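(* Let $V$ be a fixed real number. Then, as $T\to\infty$, $$\frac{1}{T}\,\mathrm{meas}\Big\{ t\in[T,2T]:\ \log|\zeta(\tfrac12+it)|\ge V\sqrt{\tfrac12\log\log T}\Big\}\ \sim\ \frac{1}{\sqrt{2\pi}}\int_V^\infty e^{-u^2/2}\,du .$$
   Context: $\zeta$ is the Riemann zeta function, and $\mathrm{meas}$ is Lebesgue measure on $\mathbb{R}$. The notation $A(T)\sim B$ means $A(T)/B\to1$ as $T\to\infty$. *)

theory Defs
  imports "HOL-Complex_Analysis.Complex_Analysis" "HOL-Library.Landau_Symbols"
begin

definition is_zeta_continuation :: "(complex \<Rightarrow> complex) \<Rightarrow> bool" where
  "is_zeta_continuation f \<longleftrightarrow>
     f holomorphic_on - {1} \<and>
     (\<forall>s. Re s > 1 \<longrightarrow> f s = (\<Sum>n. of_nat (Suc n) powr (- s)))"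

lemma dirichlet_term_norm:
  "norm (of_nat (Suc k) powr (s::complex)) = real (Suc k) powr Re s"
  by (subst norm_powr_real_powr) (auto simp del: of_nat_Suc)

lemma summable_powr_Suc:
  assumes "a < -1" shows "summable (\<lambda>k. real (Suc k) powr a)"
  using assms summable_real_powr_iff[of a] summable_Suc_iff[of "\<lambda>k. real k powr a"] by simp

lemma holomorphic_on_suminf_halfplane:
  fixes a :: "nat \<Rightarrow> complex \<Rightarrow> complex"
  assumes hol: "\<And>k. a k holomorphic_on {s. Re s > c}"
    and cont: "continuous_on UNIV C"
    and bound: "\<And>k s. Re s > c \<Longrightarrow> norm (a k s) \<le> C s * real (Suc k) powr (c - 1 - Re s)"
  shows "(\<lambda>s. \<Sum>k. a k s) holomorphic_on {s. Re s > c}"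
proof (rule holomorphic_uniform_sequence[where f = "\<lambda>n s. \<Sum>k<n. a k s"])
  show "open {s. Re s > c}" by (rule open_halfspace_Re_gt)
  show "(\<lambda>s. \<Sum>k<n. a k s) holomorphic_on {s. Re s > c}" for n
    by (intro holomorphic_intros hol)
next
  fix s assume s: "s \<in> {s. Re s > c}"
  define d where "d = (Re s - c) / 2"
  have d: "d > 0" using s by (simp add: d_def)
  have Re_ge: "Re z \<ge> c + d" if "z \<in> cball s d" for z
  proof -
    have "\<bar>Re (s - z)\<bar> \<le> d"
      using that abs_Re_le_cmod[of "s - z"] by (simp add: dist_norm)
    hence "Re s - Re z \<le> d" by simp
    thus ?thesis unfolding d_def by (simp add: field_simps)
  qed
  have "bounded (C ` cball s d)"
    by (intro compact_imp_bounded compact_continuous_image continuous_on_subset[OF cont]) auto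
  then obtain B where B: "\<And>z. z \<in> cball s d \<Longrightarrow> \<bar>C z\<bar> \<le> B"
    by (metis bounded_iff image_eqI real_norm_def)
  have "uniform_limit (cball s d) (\<lambda>n s. \<Sum>k<n. a k s) (\<lambda>s. \<Sum>k. a k s) sequentially"
  proof (rule Weierstrass_m_test)
    show "summable (\<lambda>k. B * real (Suc k) powr (-1 - d))"
      by (intro summable_mult summable_powr_Suc) (use d in auto)
    fix k z assume z: "z \<in> cball s d"
    have "norm (a k z) \<le> C z * real (Suc k) powr (c - 1 - Re z)"
      using Re_ge[OF z] d by (intro bound) auto
    also have "\<dots> \<le> B * real (Suc k) powr (-1 - d)"
      using B[OF z] Re_ge[OF z] by (intro mult_mono powr_mono) auto
    finally show "norm (a k z) \<le> B * real (Suc k) powr (-1 - d)" .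
  qed
  thus "\<exists>d>0. cball s d \<subseteq> {s. Re s > c} \<and>
          uniform_limit (cball s d) (\<lambda>n s. \<Sum>k<n. a k s) (\<lambda>s. \<Sum>k. a k s) sequentially"
    using d Re_ge by (intro exI[of _ d]) force
qed

lemma summable_dirichlet:
  assumes "Re s > 1"
  shows "summable (\<lambda>n. of_nat (Suc n) powr (- s))"
  by (rule summable_norm_cancel, subst dirichlet_term_norm, rule summable_powr_Suc)
     (use assms in auto)

lemma holomorphic_dirichlet:
  "(\<lambda>s. \<Sum>n. of_nat (Suc n) powr (- s)) holomorphic_on {s. Re s > 1}"
proof (rule holomorphic_on_suminf_halfplane[where C = "\<lambda>_. 1"])
  fix k :: nat
  show "(\<lambda>s::complex. of_nat (Suc k) powr (- s)) holomorphic_on {s. Re s > 1}"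
    by (intro holomorphic_intros)
qed (auto simp: dirichlet_term_norm simp del: of_nat_Suc)

text \<open>
  The \<open>k\<close>-th term is the remainder of the Taylor expansion of \<open>x powr (1 - s)\<close> at \<open>k + 2\<close>,
  evaluated at \<open>k + 1\<close>. Summing over \<open>k\<close> expresses \<open>\<zeta>(s)\<close> through \<open>\<zeta>(s+1), \<zeta>(s+2), \<dots>\<close>,
  which continues \<open>\<zeta>\<close> one strip at a time.
\<close>
definition zeta_rem :: "nat \<Rightarrow> nat \<Rightarrow> complex \<Rightarrow> complex" where
  "zeta_rem N k s = of_nat (Suc k) powr (1 - s) -
     (\<Sum>i\<le>N. pochhammer (s - 1) i / fact i * of_nat (Suc (Suc k)) powr (1 - s - of_nat i))"

lemma zeta_rem_bound:
  assumes s: "Re s > 1 - real N"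
  shows "norm (zeta_rem N k s) \<le>
           norm (pochhammer (s - 1) (Suc N)) / fact N * real (Suc k) powr (- real N - Re s)"
proof -
  define S where "S = closed_segment (of_nat (Suc k) :: complex) (of_nat (Suc (Suc k)))"
  define f where "f = (\<lambda>i x. (-1) ^ i * pochhammer (s - 1) i * (x::complex) powr (1 - s - of_nat i))"
  have S: "x \<in> \<real> \<and> Re x \<ge> real (Suc k)" if "x \<in> S" for x
  proof -
    from that obtain u where u: "0 \<le> u" "u \<le> 1"
      and x: "x = (1 - u) *\<^sub>R of_nat (Suc k) + u *\<^sub>R of_nat (Suc (Suc k))"
      unfolding S_def in_segment by blast
    have "x = of_real (real (Suc k) + u)"
      unfolding x by (simp add: scaleR_conv_of_real algebra_simps)
    thus ?thesis using u by (simp del: of_nat_Suc of_real_add)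
  qed
  have "norm (f 0 (of_nat (Suc k)) -
          (\<Sum>i\<le>N. f i (of_nat (Suc (Suc k))) *
             (of_nat (Suc k) - of_nat (Suc (Suc k))) ^ i / fact i))
        \<le> norm (pochhammer (s - 1) (Suc N)) * real (Suc k) powr (- real N - Re s) *
          norm (of_nat (Suc k) - of_nat (Suc (Suc k)) :: complex) ^ Suc N / fact N"
  proof (rule complex_Taylor[where S = S])
    show "convex S" by (simp add: S_def)
    show "of_nat (Suc (Suc k)) \<in> S" "of_nat (Suc k) \<in> S" by (auto simp: S_def)
    fix x assume x: "x \<in> S"
    have nz: "x \<notin> \<real>\<^sub>\<le>\<^sub>0"
      using S[OF x] by (auto simp: complex_nonpos_Reals_iff)
    show "(f i has_field_derivative f (Suc i) x) (at x within S)" for i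
      unfolding f_def using nz
      by (auto intro!: derivative_eq_intros simp: pochhammer_Suc algebra_simps)
    have "norm (f (Suc N) x) = norm (pochhammer (s - 1) (Suc N)) * Re x powr (- real N - Re s)"
    proof -
      have "norm (x powr (1 - s - of_nat (Suc N))) = Re x powr Re (1 - s - of_nat (Suc N))"
        by (rule norm_powr_real_powr) (use S[OF x] in auto)
      also have "Re (1 - s - of_nat (Suc N)) = - real N - Re s" by simp
      finally show ?thesis unfolding f_def norm_mult by (simp add: norm_power)
    qed
    also have "\<dots> \<le> norm (pochhammer (s - 1) (Suc N)) * real (Suc k) powr (- real N - Re s)"
      using S[OF x] s by (intro mult_left_mono powr_mono2') auto
    finally show "norm (f (Suc N) x) \<le> \<dots>" .
  qed
  moreover have "(\<Sum>i\<le>N. f i (of_nat (Suc (Suc k))) *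
             (of_nat (Suc k) - of_nat (Suc (Suc k))) ^ i / fact i) =
      (\<Sum>i\<le>N. pochhammer (s - 1) i / fact i * of_nat (Suc (Suc k)) powr (1 - s - of_nat i))"
  proof (rule sum.cong)
    fix i
    have "(-1) ^ i * (-1) ^ i = (1::complex)" by (simp flip: power_mult_distrib)
    thus "f i (of_nat (Suc (Suc k))) * (of_nat (Suc k) - of_nat (Suc (Suc k))) ^ i / fact i =
       pochhammer (s - 1) i / fact i * of_nat (Suc (Suc k)) powr (1 - s - of_nat i)"
      unfolding f_def by (simp add: field_simps)
  qed simp
  ultimately show ?thesis by (simp add: zeta_rem_def f_def)
qed

lemma holomorphic_zeta_rem:
  "(\<lambda>s. \<Sum>k. zeta_rem N k s) holomorphic_on {s. Re s > 1 - real N}"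
proof (rule holomorphic_on_suminf_halfplane)
  show "zeta_rem N k holomorphic_on {s. Re s > 1 - real N}" for k
    unfolding zeta_rem_def by (intro holomorphic_intros) auto
  have "(\<lambda>s::complex. pochhammer (s - 1) (Suc N)) holomorphic_on UNIV"
    by (intro holomorphic_intros)
  hence "continuous_on UNIV (\<lambda>s::complex. pochhammer (s - 1) (Suc N))"
    by (rule holomorphic_on_imp_continuous_on)
  thus "continuous_on UNIV (\<lambda>s::complex. norm (pochhammer (s - 1) (Suc N)) / fact N)"
    by (intro continuous_intros) auto
  show "norm (zeta_rem N k s) \<le> norm (pochhammer (s - 1) (Suc N)) / fact N *
          real (Suc k) powr (1 - real N - 1 - Re s)" if "Re s > 1 - real N" for k s
    using zeta_rem_bound[OF that] by simp
qed

lemma zeta_rem_sum: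
  fixes s :: complex
  defines "Z \<equiv> \<lambda>s::complex. \<Sum>n. of_nat (Suc n) powr (- s)"
  assumes s: "Re s > 2"
  shows "(\<Sum>k. zeta_rem N k s) =
     Z (s - 1) - (\<Sum>i\<le>N. pochhammer (s - 1) i / fact i * (Z (s - 1 + of_nat i) - 1))"
proof -
  have 0: "(\<lambda>k. of_nat (Suc k) powr (- z)) sums Z z" if "Re z > 1" for z
    unfolding Z_def using summable_dirichlet[OF that] by (rule summable_sums)
  have 1: "(\<lambda>k. of_nat (Suc (Suc k)) powr (- z)) sums (Z z - 1)" if "Re z > 1" for z
    using 0[OF that] by (subst sums_Suc_iff) simp
  have "(\<lambda>k. of_nat (Suc k) powr (- (s - 1)) -
     (\<Sum>i\<le>N. pochhammer (s - 1) i / fact i * of_nat (Suc (Suc k)) powr (- (s - 1 + of_nat i)))) sums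
     (Z (s - 1) - (\<Sum>i\<le>N. pochhammer (s - 1) i / fact i * (Z (s - 1 + of_nat i) - 1)))"
    by (intro sums_diff sums_sum sums_mult 0 1) (use s in auto)
  also have "(\<lambda>k. of_nat (Suc k) powr (- (s - 1)) -
     (\<Sum>i\<le>N. pochhammer (s - 1) i / fact i * of_nat (Suc (Suc k)) powr (- (s - 1 + of_nat i)))) =
     (\<lambda>k. zeta_rem N k s)"
    by (simp add: zeta_rem_def fun_eq_iff algebra_simps)
  finally show ?thesis by (simp add: sums_iff)
qed

lemma connected_halfplane: "connected {s. Re s > c}"
  by (intro convex_connected convex_halfspace_Re_gt)

lemma halfplane_identity:
  assumes f: "f holomorphic_on {s. Re s > c}" and g: "g holomorphic_on {s. Re s > c}"
    and eq: "\<And>s. Re s > d \<Longrightarrow> f s = g s" and s: "Re s > c"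
  shows "f s = g s"
proof (rule analytic_continuation_open[OF _ _ _ _ _ f g])
  show "open {s. Re s > max c d}" "open {s. Re s > c}" "connected {s. Re s > c}"
    by (rule open_halfspace_Re_gt connected_halfplane)+
  have "complex_of_real (max c d + 1) \<in> {s. Re s > max c d}"
    by (simp add: less_max_iff_disj max_def)
  thus "{s. Re s > max c d} \<noteq> {}" by blast
qed (use eq s in auto)

lemma zeta_strip_continuation:
  "\<exists>h. h holomorphic_on {s. Re s > 1 - real M} \<and>
       (\<forall>s. Re s > 1 \<longrightarrow> h s = (s - 1) * (\<Sum>n. of_nat (Suc n) powr (- s)))"
proof (induction M)
  case 0
  show ?case
    by (rule exI[of _ "\<lambda>s. (s - 1) * (\<Sum>n. of_nat (Suc n) powr (- s))"])
       (auto intro!: holomorphic_intros holomorphic_dirichlet simp del: of_nat_Suc)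
next
  case (Suc M)
  define Z where "Z = (\<lambda>s::complex. \<Sum>n. of_nat (Suc n) powr (- s))"
  from Suc.IH obtain h where h: "h holomorphic_on {s. Re s > 1 - real M}"
    and hZ: "\<And>s. Re s > 1 \<Longrightarrow> h s = (s - 1) * Z s"
    unfolding Z_def by auto
  define N where "N = Suc M"
  define H where "H = (\<lambda>s. s - (\<Sum>k. zeta_rem N k s) -
     (\<Sum>i=2..N. (pochhammer (s - 1) (i - 1) * h (s - 1 + of_nat i) - pochhammer (s - 1) i) / fact i))"
  have H: "H holomorphic_on {s. Re s > 1 - real N}"
  proof -
    have "(\<lambda>s. h (s - 1 + of_nat i)) holomorphic_on {s. Re s > 1 - real N}" if "i \<ge> 2" for i
      by (rule holomorphic_on_compose_gen[OF _ h, unfolded o_def])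
         (use that in \<open>auto intro!: holomorphic_intros simp: N_def\<close>)
    thus ?thesis unfolding H_def
      by (intro holomorphic_intros holomorphic_zeta_rem) auto
  qed
  have eq2: "H s = (s - 1) * Z s" if s: "Re s > 2" for s
  proof -
    have rem: "(\<Sum>k. zeta_rem N k s) = Z (s - 1) -
       (\<Sum>i\<le>N. pochhammer (s - 1) i / fact i * (Z (s - 1 + of_nat i) - 1))"
      unfolding Z_def by (rule zeta_rem_sum[OF s])
    have "{..N} = insert 0 (insert 1 {2..N})" by (auto simp: N_def)
    hence "(\<Sum>i\<le>N. pochhammer (s - 1) i / fact i * (Z (s - 1 + of_nat i) - 1)) =
       (Z (s - 1) - 1) + (s - 1) * (Z s - 1) +
       (\<Sum>i=2..N. pochhammer (s - 1) i / fact i * (Z (s - 1 + of_nat i) - 1))"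
      by simp
    moreover have "(\<Sum>i=2..N. pochhammer (s - 1) i / fact i * (Z (s - 1 + of_nat i) - 1)) =
      (\<Sum>i=2..N. (pochhammer (s - 1) (i - 1) * h (s - 1 + of_nat i) - pochhammer (s - 1) i) / fact i)"
    proof (rule sum.cong)
      fix i assume i: "i \<in> {2..N}"
      then obtain j where j: "i = Suc j" by (cases i) auto
      have "h (s - 1 + of_nat i) = (s - 1 + of_nat j) * Z (s - 1 + of_nat i)"
        using s i by (subst hZ) (auto simp: j)
      thus "pochhammer (s - 1) i / fact i * (Z (s - 1 + of_nat i) - 1) =
        (pochhammer (s - 1) (i - 1) * h (s - 1 + of_nat i) - pochhammer (s - 1) i) / fact i"
        by (simp add: j pochhammer_Suc diff_divide_distrib right_diff_distrib mult_ac
                 del: fact_Suc of_nat_Suc)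
    qed simp
    ultimately show ?thesis
      unfolding H_def rem by (simp add: left_diff_distrib right_diff_distrib)
  qed
  have "H s = (s - 1) * Z s" if "Re s > 1" for s
  proof (rule halfplane_identity[of H 1 "\<lambda>s. (s - 1) * Z s" 2])
    show "H holomorphic_on {s. Re s > 1}"
      by (rule holomorphic_on_subset[OF H]) (auto simp: N_def)
    show "(\<lambda>s. (s - 1) * Z s) holomorphic_on {s. Re s > 1}"
      unfolding Z_def by (intro holomorphic_intros holomorphic_dirichlet)
  qed (use eq2 that in auto)
  thus ?case using H unfolding N_def Z_def by blast
qed

lemma zeta_continuation_exists: "\<exists>f. is_zeta_continuation f"
proof -
  define Z where "Z = (\<lambda>s::complex. \<Sum>n. of_nat (Suc n) powr (- s))"
  obtain H where H: "\<And>M. H M holomorphic_on {s. Re s > 1 - real M}"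
    and HZ: "\<And>M s. Re s > 1 \<Longrightarrow> H M s = (s - 1) * Z s"
    unfolding Z_def using zeta_strip_continuation by metis
  have agree: "H M s = H M' s" if "Re s > 1 - real M" "M \<le> M'" for M M' s
  proof (rule halfplane_identity[of "H M" "1 - real M" "H M'" 1 s])
    show "H M holomorphic_on {s. Re s > 1 - real M}" by (rule H)
    show "H M' holomorphic_on {s. Re s > 1 - real M}"
      by (rule holomorphic_on_subset[OF H]) (use that in auto)
    show "H M z = H M' z" if "Re z > 1" for z using HZ[OF that] by simp
  qed (rule that)
  define m where "m = (\<lambda>s. nat \<lceil>2 - Re s\<rceil>)"
  have m: "Re s > 1 - real (m s)" for s unfolding m_def by linarith
  define h where "h = (\<lambda>s. H (m s) s)"
  have h_eq: "h s = H M s" if "Re s > 1 - real M" for M s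
    unfolding h_def using agree[OF m[of s], of M] agree[OF that, of "m s"]
    by (metis nat_le_linear)
  have "h holomorphic_on (\<Union>M. {s. Re s > 1 - real M})"
  proof (rule holomorphic_on_UN_open)
    fix M
    show "h holomorphic_on {s. Re s > 1 - real M}"
      using H[of M] by (rule holomorphic_transform) (simp add: h_eq[of M])
    show "open {s. Re s > 1 - real M}" by (rule open_halfspace_Re_gt)
  qed
  also have "(\<Union>M. {s. Re s > 1 - real M}) = UNIV" using m by blast
  finally have h: "h holomorphic_on UNIV" .
  have "is_zeta_continuation (\<lambda>s. h s / (s - 1))"
    unfolding is_zeta_continuation_def
  proof (intro conjI allI impI)
    show "(\<lambda>s. h s / (s - 1)) holomorphic_on - {1}"
      by (intro holomorphic_intros holomorphic_on_subset[OF h]) auto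
    fix s :: complex assume s: "Re s > 1"
    have "s \<noteq> 1" using s by auto
    thus "h s / (s - 1) = (\<Sum>n. of_nat (Suc n) powr (- s))"
      using h_eq[of 0 s] HZ[of s 0] s by (simp add: Z_def)
  qed
  thus ?thesis by blast
qed

lemma zeta_continuation_unique:
  assumes "is_zeta_continuation f" "is_zeta_continuation g" "s \<noteq> 1"
  shows "f s = g s"
proof (rule analytic_continuation_open[where s = "{s. Re s > 1}" and s' = "- {1}" and f = f and g = g])
  show "f holomorphic_on - {1}" "g holomorphic_on - {1}"
    using assms by (auto simp: is_zeta_continuation_def)
  show "connected (- {1::complex})" by (rule connected_punctured_universe) auto
  show "open {s. Re s > 1}" by (rule open_halfspace_Re_gt)
  have "2 \<in> {s. Re s > 1}" by simp
  thus "{s. Re s > 1} \<noteq> {}" by blast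
qed (use assms in \<open>auto simp: is_zeta_continuation_def\<close>)

text \<open>The value at the pole is set to 0.\<close>
definition zeta :: "complex \<Rightarrow> complex" where
  "zeta = (THE f. is_zeta_continuation f \<and> f 1 = 0)"

lemma zeta_unique_existence: "\<exists>!f. is_zeta_continuation f \<and> f 1 = 0"
proof (rule ex_ex1I)
  obtain f where f: "is_zeta_continuation f" using zeta_continuation_exists by blast
  have "f(1 := 0) holomorphic_on - {1}"
    by (rule holomorphic_transform[where f = f])
       (use f in \<open>auto simp: is_zeta_continuation_def\<close>)
  hence "is_zeta_continuation (f(1 := 0)) \<and> (f(1 := 0)) 1 = 0"
    using f by (auto simp: is_zeta_continuation_def)
  thus "\<exists>f. is_zeta_continuation f \<and> f 1 = 0" by blast
next
  fix f g assume "is_zeta_continuation f \<and> f 1 = 0" "is_zeta_continuation g \<and> g 1 = 0"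
  hence "f s = g s" for s using zeta_continuation_unique[of f g s] by (cases "s = 1") auto
  thus "f = g" by blast
qed

lemma is_zeta_continuation_zeta: "is_zeta_continuation zeta" and zeta_1: "zeta 1 = 0"
  using theI'[OF zeta_unique_existence] unfolding zeta_def by auto

end

theory Submission
  imports Defs "HOL-Probability.Probability" "HOL-Real_Asymp.Real_Asymp" "HOL-Number_Theory.Number_Theory"
begin

text \<open>
  Write \<open>L = ln ln T\<close> and let \<open>M(s) = \<Sum> (-1)\<^sup>k (p\<^sub>1 \<dots> p\<^sub>k)\<^sup>-\<^sup>s\<close>, the sum running over sets of \<open>k \<le> L\<^sup>2\<close>
  primes up to \<open>T\<close> to the power \<open>1/(100 L\<^sup>2)\<close>. On the critical line, \<open>\<zeta>(s) M(s) (1 - exp(-s/T)) / s\<close> is the Mellin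
  transform of a signed sum of fractional parts, whose mean square Plancherel and Brun's pure sieve
  control up to a power of \<open>L\<close>. Hence \<open>|\<zeta>M| \<le> exp(\<delta> \<surd>L)\<close> off a set of measure \<open>o(T)\<close>. Jensen's inequality for
  the half-plane \<open>Re s > 1/2\<close>, with the Poisson kernel of the point \<open>1/2 + T\<close>, where \<open>\<zeta>M\<close> is about 1, turns this
  upper bound into the lower bound \<open>|\<zeta>M| \<ge> exp(-\<delta> \<surd>L)\<close>; neither the functional equation nor information on
  the zeros is needed.

  Off a further set of measure \<open>o(T)\<close>, \<open>M\<close> is within a bounded factor of the Euler product over the same
  primes, so \<open>ln |\<zeta>(1/2 + it)|\<close> equals \<open>Re (\<Sum> p\<^sup>-\<^sup>1\<^sup>/\<^sup>2\<^sup>-\<^sup>i\<^sup>t)\<close> up to \<open>o(\<surd>L)\<close>. By unique factorisation the moments of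
  the latter up to order about \<open>L\<^sup>2\<close> are those of a sum of independent uniform phases, and Taylor expansion
  of the characteristic function together with Levy's continuity theorem gives the Gaussian limit.
\<close>

section \<open>Mertens' theorem\<close>

text \<open>Only o(sqrt L) precision in ln |zeta| is asked for, and the mean square of zeta M enters
  either through its logarithm (Jensen) or against exp(2 \<delta> sqrt L) (Chebyshev). A bound that
  is off by a power of L therefore serves as well as an asymptotic formula, and an elementary sieve
  can produce it. The order L^2 of the truncation level N balances two demands: 2^-N must absorb
  errors that are powers of ln T = exp L, while the primes removed by the cutoff cost ln (100 N) =
  O(ln L) of variance, which must be o(L). Products of at most N primes up to the cutoff stay at
  most T^(1/100), so fourth powers of the mollifier length remain negligible against sqrt T. The
  lower bound is the delicate half, since positive moments do not detect where |zeta M| is tiny. The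
  Poisson kernel of 1/2 + T gives [T, 2T] a mass bounded away from 0; a large subset with tiny |zeta
  M| would drag the mean of ln |zeta M| below its value at that point, and the positive part of the
  logarithm can compensate only by O(ln L).\<close>

lemma sum_dvd_indicator:
  assumes "h > 0"
  shows "(\<Sum>n\<in>{1..m}. if h dvd n then 1 else 0) = m div (h::nat)"
proof (induction m)
  case (Suc m)
  then show ?case using assms by (simp add: div_Suc dvd_eq_mod_eq_0)
qed simp

lemma sum_geometric_tail_le:
  fixes q :: real
  assumes "q > 1"
  shows "(\<Sum>a\<in>{1..M}. 1 / q ^ a) \<le> 1 / (q - 1)"
proof -
  have "(\<Sum>a\<in>{1..M}. 1 / q ^ a) = 1 / (q - 1) - 1 / (q ^ M * (q - 1))"
  proof (induction M)
    case (Suc M)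
    define r Q where "r = q - 1" and "Q = q ^ M"
    have "r > 0" "Q > 0" "1 + r \<noteq> 0" "q = 1 + r" using assms by (auto simp: r_def Q_def)
    then have "1 / r - 1 / (Q * r) + 1 / (q * Q) = 1 / r - 1 / (q * Q * r)"
      by (simp add: divide_simps) (simp add: algebra_simps)
    with Suc show ?case by (simp add: r_def Q_def)
  qed simp
  then show ?thesis using assms by simp
qed

section \<open>Sums over smooth numbers, and Euler's lower bound for the sum of 1/p\<close>

text \<open>Induction on \<open>S\<close>: each n splits uniquely as q^a m with q not dividing m,
  and summing over a turns the factor at q into 1 + w(q) (1/q + 1/q^2 + ...). The weight sees only
  which primes divide n; w = 1 gives Euler's bound for the harmonic sum, and weights 0, 1 and 8
  evaluate the sieve later.\<close>

lemma sum_smooth_le_prod: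
  fixes w :: "nat \<Rightarrow> real"
  assumes S: "finite S" "\<And>p. p \<in> S \<Longrightarrow> prime p" and w: "\<And>p. w p \<ge> 0"
  shows "(\<Sum>n | n \<in> {1..M} \<and> prime_factors n \<subseteq> S. (\<Prod>p\<in>prime_factors n. w p) / real n) \<le>
     (\<Prod>p\<in>S. 1 + w p / (real p - 1))"
  using S
proof (induction S rule: finite_induct)
  case empty
  have "{n. n \<in> {1..M} \<and> prime_factors n \<subseteq> {}} \<subseteq> {1}"
    by (auto simp: prime_factorization_empty_iff)
  then have "(\<Sum>n | n \<in> {1..M} \<and> prime_factors n \<subseteq> {}. (\<Prod>p\<in>prime_factors n. w p) / real n) \<le>
     (\<Sum>n\<in>{1}. (\<Prod>p\<in>prime_factors n. w p) / real n)"
    by (intro sum_mono2) (auto intro!: divide_nonneg_nonneg prod_nonneg w)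
  then show ?case by simp
next
  case (insert q S)
  have q: "prime q" using insert.prems by simp
  define f where "f = (\<lambda>n. (\<Prod>p\<in>prime_factors n. w p) / real n)"
  define X where "X = (\<lambda>S. {n. n \<in> {1..M} \<and> prime_factors n \<subseteq> S})"
  define e where "e = (\<lambda>a. if a = 0 then 1 else w q / real q ^ a)"
  define \<phi> where "\<phi> = (\<lambda>n. (multiplicity q n, n div q ^ multiplicity q n))"
  have f0: "f n \<ge> 0" for n unfolding f_def by (intro divide_nonneg_nonneg prod_nonneg) (auto intro: w)
  have e0: "e a \<ge> 0" for a unfolding e_def using w[of q] by auto
  have dec: "n = q ^ multiplicity q n * (n div q ^ multiplicity q n)" for n
    by (simp add: multiplicity_dvd)
  have inj: "inj_on \<phi> (X (insert q S))"
  proof (rule inj_onI)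
    fix n n' assume eq: "\<phi> n = \<phi> n'"
    have "n = q ^ fst (\<phi> n) * snd (\<phi> n)" for n using dec[of n] by (simp add: \<phi>_def)
    from this[of n] this[of n'] show "n = n'" unfolding eq by (rule trans[OF _ sym])
  qed
  have key: "\<phi> n \<in> {0..M} \<times> X S \<and> f n = e (fst (\<phi> n)) * f (snd (\<phi> n))" if n: "n \<in> X (insert q S)" for n
  proof -
    define a m where "a = multiplicity q n" and "m = n div q ^ a"
    have n0: "n > 0" "n \<le> M" using n by (auto simp: X_def)
    have nm: "n = q ^ a * m" unfolding m_def a_def by (rule dec)
    have m0: "m > 0" using nm n0 by (cases m) auto
    have nd: "\<not> q dvd m"
    proof
      assume "q dvd m"
      then have "q ^ Suc a dvd n" unfolding nm power_Suc by (simp add: mult.commute)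
      then have "Suc a \<le> multiplicity q n" using n0 q
        by (intro multiplicity_geI) (auto simp: prime_gt_Suc_0_nat)
      then show False by (simp add: a_def)
    qed
    \<comment> \<open>The bound on the exponent only makes the index set finite: a < 2^a <= q^a <=
      n.\<close>
    have "a \<le> M"
    proof -
      have "a < 2 ^ a" by (rule less_exp)
      also have "\<dots> \<le> q ^ a" using q by (intro power_mono) (auto simp: prime_ge_2_nat)
      also have "\<dots> \<le> q ^ a * m" using m0 by simp
      finally show ?thesis using nm n0 by simp
    qed
    have pf: "prime_factors n = (if a = 0 then {} else {q}) \<union> prime_factors m"
    proof -
      have "prime_factors n = prime_factors (q ^ a) \<union> prime_factors m"
        unfolding nm using q m0 by (intro prime_factors_product) auto
      moreover have "prime_factors (q ^ a) = (if a = 0 then {} else {q})"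
        using q by (simp add: prime_factors_power prime_prime_factors)
      ultimately show ?thesis by simp
    qed
    have qm: "q \<notin> prime_factors m" using nd by auto
    have "m \<in> X S"
    proof -
      have "1 \<le> q ^ a" using prime_gt_0_nat[OF q] by (simp add: Suc_le_eq)
      then have "1 * m \<le> q ^ a * m" by (rule mult_le_mono1)
      then have "m \<le> M" using nm n0(2) by linarith
      moreover have "prime_factors m \<subseteq> S" using n pf qm by (auto simp: X_def)
      ultimately show ?thesis using m0 by (auto simp: X_def)
    qed
    moreover have "f n = e a * f m"
      unfolding f_def e_def pf using qm by (subst nm) simp
    ultimately show ?thesis using \<open>a \<le> M\<close> by (auto simp: \<phi>_def a_def m_def)
  qed
  have finX: "finite (X S)" for S unfolding X_def by (rule finite_subset[of _ "{1..M}"]) auto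
  have "sum f (X (insert q S)) = (\<Sum>n\<in>X (insert q S). (\<lambda>(a, m). e a * f m) (\<phi> n))"
    using key by (intro sum.cong) (auto simp: case_prod_unfold)
  also have "\<dots> = (\<Sum>z\<in>\<phi> ` X (insert q S). (\<lambda>(a, m). e a * f m) z)"
    by (rule sum.reindex[OF inj, unfolded o_def, symmetric])
  also have "\<dots> \<le> (\<Sum>z\<in>{0..M} \<times> X S. (\<lambda>(a, m). e a * f m) z)"
  proof (rule sum_mono2)
    show "\<phi> ` X (insert q S) \<subseteq> {0..M} \<times> X S" using key by blast
  qed (use e0 f0 finX in auto)
  also have "\<dots> = (\<Sum>a\<in>{0..M}. e a) * sum f (X S)"
    by (simp add: sum_product sum.cartesian_product)
  also have "\<dots> \<le> (1 + w q / (real q - 1)) * (\<Prod>p\<in>S. 1 + w p / (real p - 1))"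
  proof (rule mult_mono)
    have q1: "real q > 1" using q prime_gt_1_nat by fastforce
    have "{0..M} = insert 0 {1..M}" by auto
    then have "(\<Sum>a\<in>{0..M}. e a) = 1 + w q * (\<Sum>a\<in>{1..M}. 1 / real q ^ a)"
      by (simp add: e_def sum_distrib_left)
    also have "\<dots> \<le> 1 + w q * (1 / (real q - 1))"
      using sum_geometric_tail_le[OF q1] w by (intro add_left_mono mult_left_mono) auto
    finally show "(\<Sum>a\<in>{0..M}. e a) \<le> 1 + w q / (real q - 1)" by simp
    show "sum f (X S) \<le> (\<Prod>p\<in>S. 1 + w p / (real p - 1))"
      unfolding f_def X_def using insert by auto
    show "0 \<le> 1 + w q / (real q - 1)" using q1 w[of q] by auto
  qed (auto intro!: sum_nonneg f0)
  finally show ?case using insert.hyps unfolding f_def X_def by simp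
qed

definition primes_upto :: "real \<Rightarrow> nat set" where
  "primes_upto x = {p. prime p \<and> real p \<le> x}"

lemma finite_primes_upto [simp]: "finite (primes_upto x)"
proof (rule finite_subset)
  show "primes_upto x \<subseteq> {..nat \<lfloor>x\<rfloor>}" unfolding primes_upto_def by (auto simp: le_nat_floor)
qed simp

lemma prime_primes_upto: "p \<in> primes_upto x \<Longrightarrow> prime p"
  by (simp add: primes_upto_def)

lemma primes_upto_mono: "x \<le> y \<Longrightarrow> primes_upto x \<subseteq> primes_upto y"
  by (auto simp: primes_upto_def)

lemma primes_upto_floor:
  assumes "x \<ge> 0" shows "primes_upto (real (nat \<lfloor>x\<rfloor>)) = primes_upto x"
proof (rule Set.set_eqI)
  fix p
  have "real p \<le> real (nat \<lfloor>x\<rfloor>) \<longleftrightarrow> real p \<le> x"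
    using le_nat_floor[of p x] of_nat_floor[OF assms] by linarith
  then show "p \<in> primes_upto (real (nat \<lfloor>x\<rfloor>)) \<longleftrightarrow> p \<in> primes_upto x"
    by (simp add: primes_upto_def)
qed

lemma prod_coprime_dvd:
  fixes Q :: "nat set"
  assumes "\<And>p q. p \<in> Q \<Longrightarrow> q \<in> Q \<Longrightarrow> p \<noteq> q \<Longrightarrow> coprime p q" "\<And>p. p \<in> Q \<Longrightarrow> p dvd n"
  shows "\<Prod>Q dvd n"
  using coprime_cong_prod_nat[of Q "\<lambda>p. p" n 0] assms by (simp add: cong_0_iff)

lemma primes_upto_Suc:
  "primes_upto (real (Suc n)) = (if prime (Suc n) then insert (Suc n) (primes_upto (real n)) else primes_upto (real n))"
  unfolding primes_upto_def by (auto simp: le_Suc_eq simp del: of_nat_Suc)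

definition prime_recip_sum :: "real \<Rightarrow> real" where
  "prime_recip_sum x = (\<Sum>p\<in>primes_upto x. 1 / real p)"

lemma sum_inverse_squares_le:
  assumes "finite S" "\<And>p. p \<in> S \<Longrightarrow> p \<ge> 2"
  shows "(\<Sum>p\<in>S. 1 / (real p * (real p - 1))) \<le> 1"
proof -
  obtain m where m: "S \<subseteq> {2..m}" "m \<ge> 2"
  proof -
    have "S \<subseteq> {2..Max (insert 2 S)}" using assms by auto
    then show ?thesis using that[of "Max (insert 2 S)"] assms by simp
  qed
  have "(\<Sum>p\<in>S. 1 / (real p * (real p - 1))) \<le> (\<Sum>p\<in>{2..m}. 1 / (real p * (real p - 1)))"
    using m by (intro sum_mono2) auto
  also have "\<dots> = 1 - 1 / real m"
    using m(2)
  proof (induction m rule: dec_induct)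
    case (step n)
    then have "1 / (real (Suc n) * (real (Suc n) - 1)) = 1 / real n - 1 / real (Suc n)"
      by (simp add: field_simps)
    with step show ?case by simp
  qed simp
  finally show ?thesis using order.trans by fastforce
qed

text \<open>Euler's argument: the harmonic sum up to x is at most the product of (1 - 1/p)^-1 = 1 +
  1/(p-1) over p <= x. After taking logarithms, the excess of 1/(p-1) over 1/p sums to at most
  1.\<close>

lemma prime_recip_sum_lower:
  assumes "x \<ge> 2" shows "prime_recip_sum x \<ge> ln (ln x) - 1"
proof -
  define n where "n = nat \<lfloor>x\<rfloor>"
  have nx: "real n \<le> x" "x < real n + 1" unfolding n_def using assms by linarith+
  let ?P = "primes_upto (real n)"
  have p2: "p \<in> ?P \<Longrightarrow> p \<ge> 2" for p by (auto simp: primes_upto_def prime_ge_2_nat)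
  have "ln x \<le> ln (real n + 1)" using nx assms by simp
  also have "\<dots> \<le> (\<Sum>k\<in>{1..n}. 1 / real k)"
    using ln_le_harm[of n] by (simp add: harm_def inverse_eq_divide add.commute)
  also have "\<dots> = (\<Sum>k | k \<in> {1..n} \<and> prime_factors k \<subseteq> ?P. (\<Prod>p\<in>prime_factors k. 1) / real k)"
  proof (rule sum.cong)
    show "{1..n} = {k \<in> {1..n}. prime_factors k \<subseteq> ?P}"
      unfolding primes_upto_def by (auto dest: in_prime_factors_imp_prime dvd_imp_le[OF in_prime_factors_imp_dvd])
  qed simp
  also have "\<dots> \<le> (\<Prod>p\<in>?P. 1 + 1 / (real p - 1))"
    by (rule sum_smooth_le_prod) (auto simp: primes_upto_def)
  also have "\<dots> \<le> (\<Prod>p\<in>?P. exp (1 / (real p - 1)))"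
    using p2 by (intro prod_mono) (force simp: exp_ge_add_one_self)
  also have "\<dots> = exp (\<Sum>p\<in>?P. 1 / real p + 1 / (real p * (real p - 1)))"
    unfolding exp_sum[OF finite_primes_upto] using p2 by (intro prod.cong refl arg_cong[of _ _ exp]) (force simp: field_simps)
  also have "\<dots> \<le> exp (prime_recip_sum x + 1)"
    using sum_inverse_squares_le[of ?P] p2 primes_upto_floor[of x] assms
    by (simp add: sum.distrib prime_recip_sum_def n_def)
  finally have "ln (ln x) \<le> ln (exp (prime_recip_sum x + 1))"
    using assms by (subst ln_le_cancel_iff) auto
  then show ?thesis by simp
qed

section \<open>Chebyshev's upper bound and Mertens' theorems\<close>

text \<open>Erdos' induction. For odd n = 2m+1 the primes in (m+1, 2m+1] all divide n choose m,
  which is at most 4^m because it occurs twice in a row of sum 2^n; an even n > 2 is not prime and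
  reduces to n - 1.\<close>

lemma prod_primes_upto_le: "(\<Prod>p\<in>primes_upto (real n). real p) \<le> 4 ^ n"
proof (induction n rule: less_induct)
  case (less n)
  consider "n \<le> 2" | "n > 2" "even n" | "n > 2" "odd n" by linarith
  then show ?case
  proof cases
    case 1
    have P: "primes_upto (real 0) = {}" "primes_upto (real (Suc 0)) = {}" "primes_upto (real (Suc (Suc 0))) = {2}"
      unfolding primes_upto_Suc by (auto simp: primes_upto_def prime_gt_0_nat simp flip: numeral_2_eq_2)
    have "n = 0 \<or> n = Suc 0 \<or> n = Suc (Suc 0)" using 1 by auto
    then show ?thesis using P by auto
  next
    case 2
    then obtain k where k: "n = Suc k" by (cases n) auto
    have "\<not> prime n" using 2 using prime_odd_nat[of n] by auto
    then have "primes_upto (real n) = primes_upto (real k)" unfolding k primes_upto_Suc by simp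
    then have "(\<Prod>p\<in>primes_upto (real n). real p) \<le> 4 ^ k" using less.IH[of k] k by simp
    also have "(4::real) ^ k \<le> 4 ^ n" using k by (intro power_increasing) auto
    finally show ?thesis .
  next
    case 3
    then obtain m where m: "n = 2 * m + 1" by (elim oddE)
    with 3 have "m \<ge> 1" by simp
    note 3 = m this
    define Q where "Q = {p. prime p \<and> m + 1 < p \<and> p \<le> n}"
    have finQ: "finite Q" unfolding Q_def by simp
    have un: "primes_upto (real n) = primes_upto (real (m + 1)) \<union> Q" "primes_upto (real (m + 1)) \<inter> Q = {}"
      using 3 by (auto simp: primes_upto_def Q_def)
    have "\<Prod>Q dvd n choose m"
    proof (rule prod_coprime_dvd)
      fix p assume p: "p \<in> Q"
      have "fact m * fact (m + 1) * (n choose m) = (fact n :: nat)"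
        using binomial_fact_lemma[of m n] 3 by simp
      moreover have "p dvd fact n" using p by (auto simp: Q_def prime_dvd_fact_iff)
      moreover have "\<not> p dvd fact m" "\<not> p dvd fact (m + 1)"
        using p by (auto simp: Q_def prime_dvd_fact_iff simp del: fact_Suc)
      ultimately show "p dvd n choose m"
        using p by (metis (no_types, lifting) Q_def mem_Collect_eq prime_dvd_mult_iff)
    next
      fix p q assume "p \<in> Q" "q \<in> Q" "p \<noteq> q"
      then show "coprime p q" by (intro primes_coprime) (auto simp: Q_def)
    qed
    then have "\<Prod>Q \<le> n choose m" using 3 by (intro dvd_imp_le) auto
    moreover have "2 * (n choose m) \<le> 2 * 4 ^ m"
    proof -
      have "(n choose m) + (n choose (m + 1)) \<le> (\<Sum>k\<le>n. n choose k)"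
        using 3 sum_mono2[of "{..n}" "{m, m+1}" "\<lambda>k. n choose k"] by auto
      also have "\<dots> = 2 ^ n" by (rule choose_row_sum)
      also have "(2::nat) ^ n = 2 * 4 ^ m" using 3 by (simp add: power_mult power_add)
      finally show ?thesis using binomial_symmetric[of m n] 3 by simp
    qed
    ultimately have "\<Prod>Q \<le> 4 ^ m" by simp
    then have "real (\<Prod>Q) \<le> real (4 ^ m)" by (simp only: of_nat_le_iff)
    then have Q: "(\<Prod>p\<in>Q. real p) \<le> 4 ^ m" by simp
    have "(\<Prod>p\<in>primes_upto (real n). real p) = (\<Prod>p\<in>primes_upto (real (m + 1)). real p) * (\<Prod>p\<in>Q. real p)"
      unfolding un(1) using finQ un(2) by (intro prod.union_disjoint) auto
    also have "\<dots> \<le> 4 ^ (m + 1) * 4 ^ m"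
      using Q less.IH[of "m + 1"] 3 by (intro mult_mono) (auto intro!: prod_nonneg)
    also have "\<dots> = 4 ^ n" using 3 by (simp flip: power_add add: mult_2)
    finally show ?thesis .
  qed
qed

lemma theta_le: "(\<Sum>p\<in>primes_upto (real n). ln (real p)) \<le> real n * ln 4"
proof -
  have pos: "p \<in> primes_upto (real n) \<Longrightarrow> real p > 0" for p by (auto simp: primes_upto_def prime_gt_0_nat)
  have "(\<Sum>p\<in>primes_upto (real n). ln (real p)) = ln (\<Prod>p\<in>primes_upto (real n). real p)"
    by (subst ln_prod) (auto dest: pos)
  also have "\<dots> \<le> ln (4 ^ n)"
    using prod_primes_upto_le[of n] by (subst ln_le_cancel_iff) (auto intro!: prod_pos dest: pos)
  also have "\<dots> = real n * ln 4" by (simp add: ln_realpow)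
  finally show ?thesis .
qed

text \<open>Upper half of Mertens' first theorem. The distinct primes dividing m have ln p summing
  to at most ln m, so counting multiples over m <= n bounds the sum of floor(n/p) ln p by n ln n;
  dropping the floor costs the Chebyshev sum of \<open>theta_le\<close>.\<close>

lemma sum_log_div_prime_le:
  assumes n: "n \<ge> 1"
  shows "(\<Sum>p\<in>primes_upto (real n). ln (real p) / real p) \<le> ln (real n) + ln 4"
proof -
  let ?P = "primes_upto (real n)"
  have pos: "p \<in> ?P \<Longrightarrow> p \<ge> 1" for p by (auto simp: primes_upto_def Suc_le_eq prime_gt_0_nat)
  have rad: "(\<Sum>p\<in>?P. if p dvd m then ln (real p) else 0) \<le> ln (real m)" if m: "m \<in> {1..n}" for m
  proof -
    have "(\<Sum>p\<in>?P. if p dvd m then ln (real p) else 0) = (\<Sum>p\<in>{p\<in>?P. p dvd m}. ln (real p))"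
      by (simp add: sum.inter_filter)
    also have "\<dots> = ln (real (\<Prod>{p\<in>?P. p dvd m}))"
      unfolding of_nat_prod by (subst ln_prod) (auto dest!: pos)
    also have "\<dots> \<le> ln (real m)"
    proof -
      have "\<Prod>{p\<in>?P. p dvd m} dvd m"
        by (rule prod_coprime_dvd) (auto simp: primes_upto_def intro: primes_coprime)
      then have "\<Prod>{p\<in>?P. p dvd m} \<le> m" using m by (intro dvd_imp_le) auto
      moreover have "\<Prod>{p\<in>?P. p dvd m} > 0" using pos by (intro prod_pos) fastforce
      ultimately show ?thesis by (subst ln_le_cancel_iff) (auto simp del: of_nat_prod)
    qed
    finally show ?thesis .
  qed
  have div_ge: "real n / real p - 1 \<le> real (n div p)" if "p \<in> ?P" for p
    using floor_divide_of_nat_eq[of n p, where 'a = real] by linarith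
  have "(\<Sum>p\<in>?P. (real n / real p - 1) * ln (real p)) \<le> (\<Sum>p\<in>?P. real (n div p) * ln (real p))"
    using div_ge pos by (intro sum_mono mult_right_mono) fastforce+
  also have "\<dots> = (\<Sum>p\<in>?P. \<Sum>m\<in>{1..n}. if p dvd m then ln (real p) else 0)"
  proof (rule sum.cong[OF refl])
    fix p assume p: "p \<in> ?P"
    have "(\<Sum>m\<in>{1..n}. if p dvd m then ln (real p) else 0) = (\<Sum>m\<in>{1..n}. real (if p dvd m then 1 else 0) * ln (real p))"
      by (intro sum.cong) auto
    also have "\<dots> = real (n div p) * ln (real p)"
      using sum_dvd_indicator[of p n] pos[OF p] by (simp only: sum_distrib_right[symmetric] of_nat_sum[symmetric])
    finally show "real (n div p) * ln (real p) = (\<Sum>m\<in>{1..n}. if p dvd m then ln (real p) else 0)" ..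
  qed
  also have "\<dots> = (\<Sum>m\<in>{1..n}. \<Sum>p\<in>?P. if p dvd m then ln (real p) else 0)" by (rule sum.swap)
  also have "\<dots> \<le> (\<Sum>m\<in>{1..n}. ln (real n))"
  proof (rule sum_mono)
    fix m assume m: "m \<in> {1..n}"
    then have "ln (real m) \<le> ln (real n)" by simp
    then show "(\<Sum>p\<in>?P. if p dvd m then ln (real p) else 0) \<le> ln (real n)" using rad[OF m] by linarith
  qed
  finally have 1: "(\<Sum>p\<in>?P. (real n / real p - 1) * ln (real p)) \<le> real n * ln (real n)" by simp
  have "real n * (\<Sum>p\<in>?P. ln (real p) / real p) = (\<Sum>p\<in>?P. (real n / real p - 1) * ln (real p)) + (\<Sum>p\<in>?P. ln (real p))"
    by (simp add: sum_distrib_left left_diff_distrib sum_subtractf)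
  also have "\<dots> \<le> real n * (ln (real n) + ln 4)" using 1 theta_le[of n] by (simp add: distrib_left)
  finally show ?thesis using n by simp
qed

text \<open>Discrete partial summation, with A(n) the sum of ln p / p. In the difference on the left
  a new prime n+1 contributes 1/(n+1) twice with opposite signs, so a step changes only the factor 1
  / ln n; since A(n) <= ln n + ln 4, these changes are dominated by increments of ln ln n and of -1
  / ln n.\<close>

lemma prime_recip_sum_partial_summation:
  assumes "n \<ge> 2"
  shows "prime_recip_sum (real n) - (\<Sum>p\<in>primes_upto (real n). ln (real p) / real p) / ln (real n) \<le>
    ln (ln (real n)) - ln (ln 2) + ln 4 * (1 / ln 2 - 1 / ln (real n))"
  using assms
proof (induction n rule: dec_induct)
  case base
  have "primes_upto (real 2) = {2}" unfolding primes_upto_def by (auto simp: dest: prime_ge_2_nat)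
  then show ?case by (simp add: prime_recip_sum_def)
next
  case (step n)
  define A where "A = (\<lambda>n. \<Sum>p\<in>primes_upto (real n). ln (real p) / real p)"
  have l: "0 < ln (real n)" "ln (real n) < ln (real (Suc n))" using step by auto
  have notin: "Suc n \<notin> primes_upto (real n)" by (auto simp: primes_upto_def)
  have "prime_recip_sum (real (Suc n)) - A (Suc n) / ln (real (Suc n)) = prime_recip_sum (real n) - A n / ln (real (Suc n))"
    unfolding prime_recip_sum_def A_def primes_upto_Suc using l notin
    by (auto simp: add_divide_distrib simp del: of_nat_Suc)
  also have "\<dots> = (prime_recip_sum (real n) - A n / ln (real n)) + A n * (1 / ln (real n) - 1 / ln (real (Suc n)))"
    by (simp add: right_diff_distrib)
  also have "\<dots> \<le> (ln (ln (real n)) - ln (ln 2) + ln 4 * (1 / ln 2 - 1 / ln (real n))) + (ln (real n) + ln 4) * (1 / ln (real n) - 1 / ln (real (Suc n)))"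
  proof (intro add_mono mult_right_mono)
    show "prime_recip_sum (real n) - A n / ln (real n) \<le> ln (ln (real n)) - ln (ln 2) + ln 4 * (1 / ln 2 - 1 / ln (real n))"
      using step.IH by (simp add: A_def)
    show "A n \<le> ln (real n) + ln 4" unfolding A_def using step by (intro sum_log_div_prime_le) auto
    show "0 \<le> 1 / ln (real n) - 1 / ln (real (Suc n))" using l by (simp add: frac_le del: of_nat_Suc)
  qed
  also have "\<dots> = ln (ln (real n)) + (1 - ln (real n) / ln (real (Suc n))) - ln (ln 2) + ln 4 * (1 / ln 2 - 1 / ln (real (Suc n)))"
    using l by (simp add: algebra_simps del: of_nat_Suc)
  also have "1 - ln (real n) / ln (real (Suc n)) \<le> ln (ln (real (Suc n))) - ln (ln (real n))"
  proof -
    have "ln (ln (real n) / ln (real (Suc n))) \<le> ln (real n) / ln (real (Suc n)) - 1"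
      using l by (intro ln_le_minus_one divide_pos_pos) linarith+
    then show ?thesis using l ln_div[of "ln (real n)" "ln (real (Suc n))"] step.hyps by (simp del: of_nat_Suc)
  qed
  finally show ?case unfolding A_def by simp
qed

theorem mertens_second:
  obtains C where "C \<ge> 0" "\<And>x. x \<ge> 2 \<Longrightarrow> \<bar>prime_recip_sum x - ln (ln x)\<bar> \<le> C"
proof
  \<comment> \<open>1 covers the lower bound; the modulus collects the terms left at the lower end 2
    of the partial summation.\<close>
  define C :: real where "C = 1 + \<bar>1 + ln 4 / ln 2 - ln (ln 2)\<bar>"
  show "C \<ge> (0::real)" by (simp add: C_def)
  fix x :: real assume x: "x \<ge> 2"
  define n where "n = nat \<lfloor>x\<rfloor>"
  have nx: "real n \<le> x" "n \<ge> 2" unfolding n_def using x by linarith+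
  have l: "ln (real n) > 0" using nx by simp
  have "(\<Sum>p\<in>primes_upto (real n). ln (real p) / real p) / ln (real n) \<le> (ln (real n) + ln 4) / ln (real n)"
    using sum_log_div_prime_le[of n] nx l by (intro divide_right_mono) auto
  also have "\<dots> = 1 + ln 4 / ln (real n)" using l by (simp add: add_divide_distrib)
  finally have "prime_recip_sum (real n) \<le> ln (ln (real n)) - ln (ln 2) + 1 + ln 4 / ln 2"
    using prime_recip_sum_partial_summation[OF nx(2)] by (simp add: right_diff_distrib)
  moreover have "prime_recip_sum (real n) = prime_recip_sum x"
    unfolding prime_recip_sum_def n_def using x by (subst primes_upto_floor) auto
  moreover have "ln (ln (real n)) \<le> ln (ln x)" using nx l by (simp add: order.strict_trans2)
  ultimately show "\<bar>prime_recip_sum x - ln (ln x)\<bar> \<le> C"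
    using prime_recip_sum_lower[OF x] unfolding C_def by linarith
qed

section \<open>Brun's sieve and sums of fractional parts\<close>

text \<open>Selberg's diagonalisation on the lattice of subsets: Moebius inversion writes G(A
  \<inter> A') as a sum of F(Q) over the Q contained in both sets, and summing over A and A'
  separately leaves one square for each Q.\<close>

lemma moebius_quadratic_form:
  fixes x G :: "'a set \<Rightarrow> real"
  assumes P: "finite P" and B: "B \<subseteq> Pow P"
  shows "(\<Sum>A\<in>B. \<Sum>A'\<in>B. x A * x A' * G (A \<inter> A')) =
     (\<Sum>Q\<in>Pow P. (\<Sum>R\<in>Pow Q. (-1) ^ (card Q - card R) * G R) * (\<Sum>A\<in>{A\<in>B. Q \<subseteq> A}. x A)\<^sup>2)"
proof -
  define F where "F = (\<lambda>Q. (\<Sum>R\<in>Pow Q. (-1) ^ (card Q - card R) * G R))"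
  have finB: "finite B" using P B finite_subset by auto
  have G: "G S = sum F (Pow S)" if S: "finite S" for S
  proof -
    have "G S = (\<Sum>T\<in>Pow S. (-1) ^ card T * ((-1) ^ card T * F T))"
    proof (rule inclusion_exclusion_symmetric[where f = G and g = "\<lambda>T. (-1) ^ card T * F T", OF _ S])
      fix S :: "'a set" assume S: "finite S"
      have "(-1) ^ card S * (-1::real) ^ (card S - card R) = (-1) ^ card R" if R: "R \<in> Pow S" for R
      proof -
        have "card R \<le> card S" using R S by (simp add: card_mono)
        then obtain d where d: "card S = card R + d" using le_Suc_ex by blast
        show ?thesis by (simp add: d power_add mult.assoc flip: power_mult_distrib)
      qed
      then show "(-1) ^ card S * F S = (\<Sum>T\<in>Pow S. (-1) ^ card T * G T)"
        unfolding F_def sum_distrib_left by (intro sum.cong) (simp_all flip: mult.assoc)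
    qed
    then show ?thesis by (simp flip: power_mult_distrib mult.assoc)
  qed
  have "(\<Sum>A\<in>B. \<Sum>A'\<in>B. x A * x A' * G (A \<inter> A')) =
    (\<Sum>A\<in>B. \<Sum>A'\<in>B. \<Sum>Q\<in>Pow P. if Q \<subseteq> A \<and> Q \<subseteq> A' then x A * x A' * F Q else 0)"
  proof (intro sum.cong refl)
    fix A A' assume A: "A \<in> B" "A' \<in> B"
    have "finite (A \<inter> A')" using A B P by (meson Pow_iff finite_Int finite_subset subsetD)
    have "(\<Sum>Q\<in>Pow P. if Q \<subseteq> A \<and> Q \<subseteq> A' then x A * x A' * F Q else 0) =
        (\<Sum>Q\<in>Pow P \<inter> {Q. Q \<subseteq> A \<and> Q \<subseteq> A'}. x A * x A' * F Q)"
      using P by (simp add: sum.inter_restrict)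
    also have "Pow P \<inter> {Q. Q \<subseteq> A \<and> Q \<subseteq> A'} = Pow (A \<inter> A')" using A B by auto
    finally show "x A * x A' * G (A \<inter> A') =
      (\<Sum>Q\<in>Pow P. if Q \<subseteq> A \<and> Q \<subseteq> A' then x A * x A' * F Q else 0)"
      using G[OF \<open>finite (A \<inter> A')\<close>] by (simp add: sum_distrib_left)
  qed
  also have "\<dots> = (\<Sum>Q\<in>Pow P. \<Sum>A\<in>B. \<Sum>A'\<in>B. if Q \<subseteq> A \<and> Q \<subseteq> A' then x A * x A' * F Q else 0)"
    by (subst sum.swap[of _ B "Pow P"], intro sum.cong refl sum.swap)
  also have "\<dots> = (\<Sum>Q\<in>Pow P. F Q * (\<Sum>A\<in>{A\<in>B. Q \<subseteq> A}. x A)\<^sup>2)"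
  proof (intro sum.cong refl)
    fix Q
    have 1: "(\<Sum>A\<in>{A\<in>B. Q \<subseteq> A}. f A) = (\<Sum>A\<in>B. if Q \<subseteq> A then f A else 0)" for f :: "'a set \<Rightarrow> real"
      using finB by (simp add: sum.inter_filter)
    have "(\<Sum>A\<in>{A\<in>B. Q \<subseteq> A}. x A)\<^sup>2 = (\<Sum>A\<in>B. \<Sum>A'\<in>B. (if Q \<subseteq> A then x A else 0) * (if Q \<subseteq> A' then x A' else 0))"
      unfolding 1 power2_eq_square sum_product ..
    then show "(\<Sum>A\<in>B. \<Sum>A'\<in>B. if Q \<subseteq> A \<and> Q \<subseteq> A' then x A * x A' * F Q else 0) = F Q * (\<Sum>A\<in>{A\<in>B. Q \<subseteq> A}. x A)\<^sup>2"
      by (auto simp: sum_distrib_left intro!: sum.cong)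
  qed
  finally show ?thesis unfolding F_def .
qed

text \<open>A set of primes stands for the squarefree number that it multiplies to, and the sign
  (-1)^card is its Moebius value.\<close>

definition brun :: "nat set \<Rightarrow> nat \<Rightarrow> nat set set" where
  "brun P N = {A. A \<subseteq> P \<and> card A \<le> N}"

text \<open>Over all A with Q \<subseteq> A \<subseteq> P the signed sum factors into a product. The
  omitted sets have more than N elements, so each may be weighted by 2^(card A - N) \<ge> 1
  (Rankin's trick), which turns their total into a product over P as well.\<close>

lemma brun_tail_bound:
  fixes P :: "nat set"
  assumes P: "finite P" "\<And>p. p \<in> P \<Longrightarrow> p > 0" and Q: "Q \<subseteq> P"
  shows "\<bar>\<Sum>A\<in>{A\<in>brun P N. Q \<subseteq> A}. (-1) ^ card A / real (\<Prod>A)\<bar> \<le>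
     (\<Prod>p\<in>Q. 1 / real p) * (\<bar>\<Prod>p\<in>P - Q. 1 - 1 / real p\<bar> + (\<Prod>p\<in>Q. 2) * (1/2) ^ N * (\<Prod>p\<in>P. 1 + 2 / real p))"
proof -
  have finQ: "finite Q" and finPQ: "finite (P - Q)" using P Q finite_subset by auto
  define w where "w = (\<lambda>A. (-1) ^ card A / real (\<Prod>A))"
  have w_prod: "w A = (\<Prod>p\<in>A. - 1 / real p)" for A
    by (simp add: w_def prod_uminus prod_dividef)
  define S where "S = {A. A \<subseteq> P - Q \<and> card A + card Q \<le> N}"
  define S' where "S' = {A. A \<subseteq> P - Q \<and> card A + card Q > N}"
  have Sun: "Pow (P - Q) = S \<union> S'" "S \<inter> S' = {}" by (auto simp: S_def S'_def)
  have finS: "finite S" "finite S'" using finPQ Sun(1) by (metis finite_Pow_iff finite_Un)+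
  have "sum w {A\<in>brun P N. Q \<subseteq> A} = (\<Sum>A\<in>S. w (Q \<union> A))"
  proof (rule sum.reindex_bij_witness[of _ "\<lambda>A. Q \<union> A" "\<lambda>A. A - Q"])
    fix A assume A: "A \<in> {A\<in>brun P N. Q \<subseteq> A}"
    then have "finite A" using P(1) finite_subset by (auto simp: brun_def)
    then have "card (A - Q) + card Q = card A" using A
      by (metis (no_types, lifting) card_Diff_subset card_mono finQ le_add_diff_inverse2 mem_Collect_eq)
    then show "A - Q \<in> S" using A by (auto simp: S_def brun_def)
  next
    fix A assume A: "A \<in> S"
    then show "Q \<union> A \<in> {A \<in> brun P N. Q \<subseteq> A}" using Q card_Un_le[of Q A]
      by (auto simp: S_def brun_def)
  qed (auto simp: S_def Un_absorb1)
  also have "\<dots> = (\<Sum>A\<in>S. w Q * w A)"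
  proof (intro sum.cong refl)
    fix A assume "A \<in> S"
    then have "A \<subseteq> P - Q" by (auto simp: S_def)
    then have "Q \<inter> A = {}" "finite A" using finPQ finite_subset by auto
    then show "w (Q \<union> A) = w Q * w A" unfolding w_prod using finQ by (simp add: prod.union_disjoint)
  qed
  also have "\<dots> = w Q * ((\<Prod>p\<in>P-Q. 1 - 1 / real p) - sum w S')"
  proof -
    have "(\<Prod>p\<in>P-Q. 1 - 1 / real p) = (\<Prod>p\<in>P-Q. (- 1 / real p) + 1)" by (simp add: algebra_simps)
    also have "\<dots> = sum w (Pow (P - Q))" using finPQ by (subst prod_add) (simp_all add: w_prod)
    also have "\<dots> = sum w S + sum w S'" unfolding Sun(1) using finS Sun(2) by (rule sum.union_disjoint)
    finally show ?thesis by (simp add: sum_distrib_left)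
  qed
  finally have eq: "sum w {A\<in>brun P N. Q \<subseteq> A} = w Q * ((\<Prod>p\<in>P-Q. 1 - 1 / real p) - sum w S')" .
  have "\<bar>sum w S'\<bar> \<le> (\<Sum>A\<in>S'. \<bar>w A\<bar>)" by (rule sum_abs)
  also have "\<dots> \<le> (\<Sum>A\<in>S'. (\<Prod>p\<in>Q. 2) * (1/2) ^ N * (\<Prod>p\<in>A. 2 / real p))"
  proof (rule sum_mono)
    fix A assume A: "A \<in> S'"
    have "(2::real) ^ N \<le> 2 ^ (card A + card Q)" using A by (intro power_increasing) (auto simp: S'_def)
    then have "1 \<le> (\<Prod>p\<in>Q. 2) * (1/2) ^ N * (2::real) ^ card A"
      by (simp add: power_add field_simps)
    then have "\<bar>w A\<bar> * 1 \<le> \<bar>w A\<bar> * ((\<Prod>p\<in>Q. 2) * (1/2) ^ N * (2::real) ^ card A)"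
      by (intro mult_left_mono) auto
    also have "\<dots> = (\<Prod>p\<in>Q. 2) * (1/2) ^ N * (\<Prod>p\<in>A. 2 / real p)"
      by (simp add: w_def prod_dividef abs_div abs_prod)
    finally show "\<bar>w A\<bar> \<le> (\<Prod>p\<in>Q. 2) * (1/2) ^ N * (\<Prod>p\<in>A. 2 / real p)" by simp
  qed
  also have "\<dots> \<le> (\<Prod>p\<in>Q. 2) * (1/2) ^ N * (\<Sum>A\<in>Pow P. \<Prod>p\<in>A. 2 / real p)"
    unfolding sum_distrib_left[symmetric]
    by (intro mult_left_mono sum_mono2) (use P in \<open>auto simp: S'_def intro!: prod_nonneg\<close>)
  also have "(\<Sum>A\<in>Pow P. \<Prod>p\<in>A. 2 / real p) = (\<Prod>p\<in>P. 2 / real p + 1)"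
    using P(1) by (subst prod_add) simp_all
  finally have tail: "\<bar>sum w S'\<bar> \<le> (\<Prod>p\<in>Q. 2) * (1/2) ^ N * (\<Prod>p\<in>P. 1 + 2 / real p)"
    by (simp add: add.commute)
  have "\<bar>w Q\<bar> = (\<Prod>p\<in>Q. 1 / real p)" by (simp add: w_prod abs_prod)
  moreover have "\<bar>(\<Prod>p\<in>P - Q. 1 - 1 / real p) - sum w S'\<bar> \<le>
      \<bar>\<Prod>p\<in>P - Q. 1 - 1 / real p\<bar> + (\<Prod>p\<in>Q. 2) * (1/2) ^ N * (\<Prod>p\<in>P. 1 + 2 / real p)"
    using tail by linarith
  ultimately show ?thesis
    unfolding w_def[symmetric] eq abs_mult by (auto intro!: mult_left_mono prod_nonneg)
qed

text \<open>The diagonal coefficient of Q is at most H times the product of 1 + p over Q, against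
  the square of \<open>brun_tail_bound\<close>. The local factor at p becomes (1+p)/p^2 + (1-1/p)^2
  = 1 - 1/p + 2/p^2, so the main term decays like the product of 1 - 1/p, and the truncation appears
  only in the term with 4^-N.\<close>

lemma brun_form_bound:
  fixes P :: "nat set" and G :: "nat set \<Rightarrow> real"
  assumes P: "finite P" "\<And>p. p \<in> P \<Longrightarrow> p > 0"
    and G: "\<And>R. R \<subseteq> P \<Longrightarrow> \<bar>G R\<bar> \<le> H * real (\<Prod>R)" and H: "H \<ge> 0"
  shows "(\<Sum>A\<in>brun P N. \<Sum>A'\<in>brun P N. ((-1) ^ card A / real (\<Prod>A)) * ((-1) ^ card A' / real (\<Prod>A')) * G (A \<inter> A'))
     \<le> 2 * H * ((\<Prod>p\<in>P. 1 - 1 / real p + 2 / real p ^ 2) +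
         (1/4) ^ N * ((\<Prod>p\<in>P. 1 + 2 / real p)\<^sup>2 * (\<Prod>p\<in>P. 1 + 4 * (1 + real p) / real p ^ 2)))"
proof -
  define x where "x = (\<lambda>A. (-1) ^ card A / real (\<Prod>A))"
  define E where "E = (\<Prod>p\<in>P. 1 + 2 / real p)"
  have finQ: "finite Q" if "Q \<subseteq> P" for Q using that P(1) finite_subset by blast
  have "brun P N \<subseteq> Pow P" by (auto simp: brun_def)
  then have "(\<Sum>A\<in>brun P N. \<Sum>A'\<in>brun P N. x A * x A' * G (A \<inter> A')) =
     (\<Sum>Q\<in>Pow P. (\<Sum>R\<in>Pow Q. (-1) ^ (card Q - card R) * G R) * (\<Sum>A\<in>{A\<in>brun P N. Q \<subseteq> A}. x A)\<^sup>2)"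
    by (rule moebius_quadratic_form[OF P(1)])
  also have "\<dots> \<le> (\<Sum>Q\<in>Pow P. (H * (\<Prod>p\<in>Q. 1 + real p)) *
       (2 * ((\<Prod>p\<in>Q. 1 / real p ^ 2) * (\<Prod>p\<in>P - Q. (1 - 1 / real p)\<^sup>2) +
          (1/4) ^ N * E\<^sup>2 * (\<Prod>p\<in>Q. 4 * (1 / real p ^ 2)))))"
  proof (intro sum_mono mult_mono)
    fix Q assume "Q \<in> Pow P" then have Q: "Q \<subseteq> P" by simp
    have "(\<Sum>R\<in>Pow Q. (-1) ^ (card Q - card R) * G R) \<le> (\<Sum>R\<in>Pow Q. H * real (\<Prod>R))"
    proof (rule sum_mono)
      fix R assume "R \<in> Pow Q"
      then have "\<bar>G R\<bar> \<le> H * real (\<Prod>R)" using Q by (intro G) auto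
      moreover have "(-1) ^ (card Q - card R) * G R \<le> \<bar>(-1) ^ (card Q - card R) * G R\<bar>" by (rule abs_ge_self)
      ultimately show "(-1) ^ (card Q - card R) * G R \<le> H * real (\<Prod>R)" by (simp add: abs_mult)
    qed
    also have "\<dots> = H * (\<Sum>R\<in>Pow Q. \<Prod>p\<in>R. real p)" by (simp add: sum_distrib_left)
    also have "(\<Sum>R\<in>Pow Q. \<Prod>p\<in>R. real p) = (\<Prod>p\<in>Q. real p + 1)"
      by (subst prod_add[OF finQ[OF Q]]) simp
    finally show "(\<Sum>R\<in>Pow Q. (-1) ^ (card Q - card R) * G R) \<le> H * (\<Prod>p\<in>Q. 1 + real p)"
      by (simp add: add.commute)
    have sq: "(a + b)\<^sup>2 \<le> 2 * (a\<^sup>2 + b\<^sup>2)" for a b :: real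
      using sum_squares_bound[of a b] by (simp add: power2_sum)
    have "\<bar>\<Sum>A\<in>{A\<in>brun P N. Q \<subseteq> A}. x A\<bar> \<le>
      (\<Prod>p\<in>Q. 1 / real p) * (\<bar>\<Prod>p\<in>P - Q. 1 - 1 / real p\<bar> + (\<Prod>p\<in>Q. 2) * (1/2) ^ N * E)"
      unfolding x_def E_def by (rule brun_tail_bound[OF P Q])
    then have "(\<Sum>A\<in>{A\<in>brun P N. Q \<subseteq> A}. x A)\<^sup>2 \<le>
       ((\<Prod>p\<in>Q. 1 / real p) * (\<bar>\<Prod>p\<in>P - Q. 1 - 1 / real p\<bar> + (\<Prod>p\<in>Q. 2) * (1/2) ^ N * E))\<^sup>2"
      by (subst power2_abs[symmetric]) (intro power_mono, auto)
    also have "\<dots> \<le> (\<Prod>p\<in>Q. 1 / real p)\<^sup>2 * (2 * (\<bar>\<Prod>p\<in>P - Q. 1 - 1 / real p\<bar>\<^sup>2 + ((\<Prod>p\<in>Q. 2) * (1/2) ^ N * E)\<^sup>2))"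
      unfolding power_mult_distrib[of _ "_ + _"]
      by (intro mult_left_mono sq) auto
    also have "\<dots> = 2 * ((\<Prod>p\<in>Q. 1 / real p ^ 2) * (\<Prod>p\<in>P - Q. (1 - 1 / real p)\<^sup>2) +
          (1/4) ^ N * E\<^sup>2 * (\<Prod>p\<in>Q. 4 * (1 / real p ^ 2)))"
    proof -
      have "((1/2::real) ^ N)\<^sup>2 = (1/4) ^ N" 
        using power_mult[of "1/2::real" N 2] power_mult[of "1/2::real" 2 N] by (simp add: mult.commute power_divide)
      moreover have "(2 ^ card Q)\<^sup>2 = (4::real) ^ card Q"
        using power_mult[of "2::real" "card Q" 2] power_mult[of "2::real" 2 "card Q"] by (simp add: mult.commute)
      moreover have "(\<Prod>p\<in>Q. 1 / real p)\<^sup>2 = (\<Prod>p\<in>Q. 1 / real p ^ 2)"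
        "\<bar>\<Prod>p\<in>P - Q. 1 - 1 / real p\<bar>\<^sup>2 = (\<Prod>p\<in>P - Q. (1 - 1 / real p)\<^sup>2)"
        by (simp_all add: prod_power_distrib power_divide)
      moreover have "(\<Prod>p\<in>Q. 4 * (1 / real p ^ 2)) = 4 ^ card Q * (\<Prod>p\<in>Q. 1 / real p ^ 2)"
        by (subst prod.distrib) simp
      ultimately show ?thesis by (simp add: power_mult_distrib distrib_left mult_ac)
    qed
    finally show "(\<Sum>A\<in>{A\<in>brun P N. Q \<subseteq> A}. x A)\<^sup>2 \<le> \<dots>" .
    show "0 \<le> H * (\<Prod>p\<in>Q. 1 + real p)" using H by (intro mult_nonneg_nonneg prod_nonneg) auto
    show "0 \<le> (\<Sum>A\<in>{A\<in>brun P N. Q \<subseteq> A}. x A)\<^sup>2" by simp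
  qed
  also have "\<dots> = 2 * H * ((\<Sum>Q\<in>Pow P. (\<Prod>p\<in>Q. (1 + real p) / real p ^ 2) * (\<Prod>p\<in>P - Q. (1 - 1 / real p)\<^sup>2)) +
      (1/4) ^ N * E\<^sup>2 * (\<Sum>Q\<in>Pow P. (\<Prod>p\<in>Q. 4 * (1 + real p) / real p ^ 2) * (\<Prod>p\<in>P - Q. 1)))"
    unfolding sum_distrib_left[of "(1/4) ^ N * E\<^sup>2"] sum.distrib[symmetric] sum_distrib_left[of "2 * H"]
  proof (intro sum.cong refl)
    fix Q
    have e: "(\<Prod>p\<in>Q. (1 + real p) / real p ^ 2) = (\<Prod>p\<in>Q. 1 + real p) * (\<Prod>p\<in>Q. 1 / real p ^ 2)"
      "(\<Prod>p\<in>Q. 4 * (1 + real p) / real p ^ 2) = (\<Prod>p\<in>Q. 1 + real p) * (\<Prod>p\<in>Q. 4 * (1 / real p ^ 2))"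
      unfolding prod.distrib[symmetric] by (auto intro!: prod.cong)
    show "H * (\<Prod>p\<in>Q. 1 + real p) * (2 * ((\<Prod>p\<in>Q. 1 / real p ^ 2) * (\<Prod>p\<in>P - Q. (1 - 1 / real p)\<^sup>2) +
          (1/4) ^ N * E\<^sup>2 * (\<Prod>p\<in>Q. 4 * (1 / real p ^ 2)))) =
       2 * H * ((\<Prod>p\<in>Q. (1 + real p) / real p ^ 2) * (\<Prod>p\<in>P - Q. (1 - 1 / real p)\<^sup>2) +
          (1/4) ^ N * E\<^sup>2 * ((\<Prod>p\<in>Q. 4 * (1 + real p) / real p ^ 2) * (\<Prod>p\<in>P - Q. 1)))"
      unfolding e by (simp only: prod.neutral_const mult_1_right distrib_left mult_ac)
  qed
  also have "\<dots> = 2 * H * ((\<Prod>p\<in>P. (1 + real p) / real p ^ 2 + (1 - 1 / real p)\<^sup>2) +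
      (1/4) ^ N * E\<^sup>2 * (\<Prod>p\<in>P. 4 * (1 + real p) / real p ^ 2 + 1))"
    by (simp add: prod_add[OF P(1)])
  also have "(\<Prod>p\<in>P. (1 + real p) / real p ^ 2 + (1 - 1 / real p)\<^sup>2) = (\<Prod>p\<in>P. 1 - 1 / real p + 2 / real p ^ 2)"
    by (intro prod.cong refl) (use P(2) in \<open>auto simp: field_simps power2_eq_square\<close>)
  finally show ?thesis unfolding x_def E_def by (simp add: add.commute mult.assoc)
qed

section \<open>Correlations of increments of the sawtooth function\<close>

text \<open>Hermite's identity. Raising the integer m = floor(x) by 1 moves the window of summation
  by one place, and the quotients of m + n and m by n differ by 1; so both sides grow by 1 at each
  step.\<close>

lemma sum_floor_shifts:
  assumes "n > 0"
  shows "(\<Sum>i<n. \<lfloor>(x + real i) / real n\<rfloor>) = \<lfloor>x\<rfloor>"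
proof -
  define S where "S = (\<lambda>m::int. \<Sum>i<n. (m + int i) div int n)"
  have step: "S (m + 1) = S m + 1" for m
  proof -
    obtain k where k: "n = Suc k" using assms by (cases n) auto
    have "S (m + 1) = (\<Sum>i<k. (m + int (Suc i)) div int n) + (m + 1 + int k) div int n"
      unfolding S_def by (simp add: k add_ac)
    moreover have "S m = m div int n + (\<Sum>i<k. (m + int (Suc i)) div int n)"
      unfolding S_def k sum.lessThan_Suc_shift by (simp add: k)
    moreover have "(m + 1 + int k) div int n = m div int n + 1"
      using div_add_self2[of "int n" m] by (simp add: k add_ac)
    ultimately show ?thesis by simp
  qed
  have S0: "S 0 = 0" unfolding S_def by (simp add: zdiv_int[symmetric])
  have "S m = m" for m
  proof (induction m rule: int_induct[where k = 0])
    case base show ?case by (rule S0)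
  next
    case (step1 i) then show ?case using step[of i] by simp
  next
    case (step2 i) then show ?case using step[of "i - 1"] by simp
  qed
  moreover have "\<lfloor>(x + real i) / real n\<rfloor> = (\<lfloor>x\<rfloor> + int i) div int n" for i
    using floor_divide_real_eq_div[of "int n" "x + real i"] by simp
  ultimately show ?thesis by (simp add: S_def)
qed

text \<open>The constant (n - 1)/2 cancels in differences: an increment of period g n, summed over
  its n shifts by multiples of g, is the increment of period g.\<close>

lemma sum_frac_shifts:
  assumes "n > 0"
  shows "(\<Sum>i<n. frac ((x + real i) / real n)) = frac x + (real n - 1) / 2"
proof -
  have "(\<Sum>i<n. frac ((x + real i) / real n)) = (\<Sum>i<n. (x + real i) / real n) - real_of_int (\<Sum>i<n. \<lfloor>(x + real i) / real n\<rfloor>)"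
    by (simp add: frac_def sum_subtractf)
  also have "(\<Sum>i<n. (x + real i) / real n) = (real n * x + (\<Sum>i<n. real i)) / real n"
    by (simp add: sum_divide_distrib[symmetric] sum.distrib)
  also have "(\<Sum>i<n. real i) = real n * (real n - 1) / 2"
    by (induction n) (simp_all add: field_simps)
  finally show ?thesis
    unfolding sum_floor_shifts[OF assms] by (simp only:) (use assms in \<open>simp add: frac_def field_simps\<close>)
qed

lemma sum_coprime_product:
  fixes f g :: "nat \<Rightarrow> real"
  assumes "coprime h k" "h > 0" "k > 0"
  shows "(\<Sum>j<h * k. f (j mod h) * g (j mod k)) = (\<Sum>i<h. f i) * (\<Sum>i<k. g i)"
proof -
  have "bij_betw (\<lambda>j. (j mod h, j mod k)) {..<h * k} ({..<h} \<times> {..<k})"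
  proof (rule bij_betwI')
    fix x y assume xy: "x \<in> {..<h * k}" "y \<in> {..<h * k}"
    show "((x mod h, x mod k) = (y mod h, y mod k)) = (x = y)"
    proof
      assume "(x mod h, x mod k) = (y mod h, y mod k)"
      then have "[x = y] (mod h * k)" using assms(1) by (intro coprime_cong_mult_nat) (auto simp: cong_def)
      then show "x = y" using xy by (intro cong_less_modulus_unique_nat) auto
    qed simp
  next
    fix z assume z: "z \<in> {..<h} \<times> {..<k}"
    obtain j where "j < h * k" "[j = fst z] (mod h)" "[j = snd z] (mod k)"
      using binary_chinese_remainder_unique_nat[of h k "fst z" "snd z"] assms by (auto elim: ex1E)
    then show "\<exists>j\<in>{..<h * k}. z = (j mod h, j mod k)"
      using z by (intro bexI[of _ j]) (auto simp: cong_def)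
  qed (use assms in auto)
  then have "(\<Sum>j<h * k. (\<lambda>(a, b). f a * g b) (j mod h, j mod k)) = (\<Sum>z\<in>{..<h} \<times> {..<k}. (\<lambda>(a, b). f a * g b) z)"
    by (rule sum.reindex_bij_betw)
  then show ?thesis by (simp add: sum_product sum.cartesian_product)
qed

lemma set_integrable_bounded_interval:
  fixes f :: "real \<Rightarrow> real"
  assumes "f \<in> borel_measurable borel" "\<And>x. \<bar>f x\<bar> \<le> B"
  shows "set_integrable lborel {a..<b} f"
proof -
  have "bounded {a..<b}" by (rule bounded_subset[of "{a..b}"]) auto
  then have "emeasure lborel {a..<b} < \<infinity>" by (rule emeasure_bounded_finite)
  then show ?thesis unfolding set_integrable_def
    by (intro integrableI_bounded_set_indicator[where B = B]) (use assms in auto)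
qed

lemma set_integral_shift:
  fixes f :: "real \<Rightarrow> real"
  shows "(LBINT x:{a..<b}. f (x + c)) = (LBINT x:{a+c..<b+c}. f x)"
  unfolding set_lebesgue_integral_def
  by (subst lborel_integral_real_affine[where c = 1 and t = c and f = "\<lambda>x. indicator {a+c..<b+c} x *\<^sub>R f x"])
     (auto intro!: Bochner_Integration.integral_cong simp: indicator_def add.commute)

lemma set_integral_split:
  fixes f :: "real \<Rightarrow> real"
  assumes "f \<in> borel_measurable borel" "\<And>x. \<bar>f x\<bar> \<le> B" "a \<le> b" "b \<le> c"
  shows "(LBINT x:{a..<c}. f x) = (LBINT x:{a..<b}. f x) + (LBINT x:{b..<c}. f x)"
proof -
  have "{a..<c} = {a..<b} \<union> {b..<c}" "{a..<b} \<inter> {b..<c} = {}" using assms by auto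
  then show ?thesis using set_integrable_bounded_interval[OF assms(1,2)]
    by (simp add: set_integral_Un)
qed

lemma set_integral_multiples:
  fixes f :: "real \<Rightarrow> real"
  assumes f: "f \<in> borel_measurable borel" "\<And>x. \<bar>f x\<bar> \<le> B" and g: "g \<ge> 0"
  shows "(LBINT x:{v..<v + g * real n}. f x) = (LBINT x:{v..<v+g}. \<Sum>j<n. f (x + g * real j))"
proof (induction n)
  case 0 show ?case by (simp add: set_lebesgue_integral_def)
next
  case (Suc n)
  have "(LBINT x:{v..<v + g * real (Suc n)}. f x) = (LBINT x:{v..<v + g * real n}. f x) + (LBINT x:{v + g * real n..<v + g + g * real n}. f x)"
    by (subst set_integral_split[OF f, of v "v + g * real n"]) (use g in \<open>auto simp: algebra_simps\<close>)
  also have "(LBINT x:{v + g * real n..<v + g + g * real n}. f x) = (LBINT x:{v..<v+g}. f (x + g * real n))"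
    by (rule set_integral_shift[symmetric])
  finally show ?case unfolding Suc.IH sum.lessThan_Suc
  proof (subst set_integral_add(2))
    have "\<bar>\<Sum>j<n. f (x + g * real j)\<bar> \<le> real n * B" for x
    proof -
      have "\<bar>\<Sum>j<n. f (x + g * real j)\<bar> \<le> (\<Sum>j<n. \<bar>f (x + g * real j)\<bar>)" by (rule sum_abs)
      also have "\<dots> \<le> (\<Sum>j<n. B)" by (intro sum_mono f)
      finally show ?thesis by simp
    qed
    moreover have [measurable]: "f \<in> borel_measurable borel" by fact
    ultimately show "set_integrable lborel {v..<v + g} (\<lambda>x. \<Sum>j<n. f (x + g * real j))"
      by (intro set_integrable_bounded_interval) measurable
    show "set_integrable lborel {v..<v + g} (\<lambda>x. f (x + g * real n))"
      by (rule set_integrable_bounded_interval[where B = B]) (use f in auto)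
  qed simp
qed

definition fracdiff :: "real \<Rightarrow> real \<Rightarrow> real \<Rightarrow> real" where
  "fracdiff h H u = frac (u / h) - frac ((u - H) / h)"

lemma frac_measurable [measurable]: "(frac :: real \<Rightarrow> real) \<in> borel_measurable borel"
  unfolding frac_def by measurable

lemma fracdiff_measurable [measurable]: "fracdiff h H \<in> borel_measurable borel"
  unfolding fracdiff_def by measurable

lemma abs_fracdiff_le: "\<bar>fracdiff h H u\<bar> \<le> 1"
  using frac_ge_0[of "u/h"] frac_lt_1[of "u/h"] frac_ge_0[of "(u-H)/h"] frac_lt_1[of "(u-H)/h"]
  unfolding fracdiff_def by linarith

lemma fracdiff_mod:
  assumes "g > 0" "n > 0"
  shows "fracdiff (g * real n) H (u + g * real j) =
    frac ((u / g + real (j mod n)) / real n) - frac (((u - H) / g + real (j mod n)) / real n)"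
proof -
  have "frac ((y + real j) / real n) = frac ((y + real (j mod n)) / real n)" for y
  proof -
    have "real j = real n * real (j div n) + real (j mod n)"
      by (metis mult_div_mod_eq of_nat_add of_nat_mult)
    then have "(y + real j) / real n = (y + real (j mod n)) / real n + real_of_int (int (j div n))"
      using assms(2) by (simp add: field_simps)
    then show ?thesis by (metis frac_add_of_int_right)
  qed
  moreover have "(u + g * real j) / (g * real n) = (u / g + real j) / real n"
    "(u + g * real j - H) / (g * real n) = ((u - H) / g + real j) / real n"
    using assms by (simp_all add: field_simps)
  ultimately show ?thesis unfolding fracdiff_def by simp
qed

lemma fracdiff_periodic:
  assumes "h > 0" shows "fracdiff h H (u + h * real j) = fracdiff h H u"
  using fracdiff_mod[of h 1 H u j] assms by (simp add: fracdiff_def)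

text \<open>By the Chinese remainder theorem the summands for \<open>g h\<close> and \<open>g k\<close> decouple on the fibres modulo \<open>g\<close>.\<close>
lemma integral_fracdiff_product:
  fixes h k :: nat
  assumes g: "g > 0" and hk: "coprime h k" "h > 0" "k > 0"
  shows "(LBINT u:{0..<g * real (h * k)}. fracdiff (g * real h) H u * fracdiff (g * real k) H u) =
    (LBINT u:{0..<g}. (fracdiff g H u)\<^sup>2)"
proof -
  have sum1: "(\<Sum>i<n. frac ((u / g + real i) / real n) - frac (((u - H) / g + real i) / real n)) = fracdiff g H u"
    if "n > 0" for n u
    using that by (simp add: sum_subtractf sum_frac_shifts fracdiff_def)
  have "(LBINT u:{0..<0 + g * real (h * k)}. fracdiff (g * real h) H u * fracdiff (g * real k) H u) =
    (LBINT u:{0..<0+g}. \<Sum>j<h*k. fracdiff (g * real h) H (u + g * real j) * fracdiff (g * real k) H (u + g * real j))"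
    by (rule set_integral_multiples[where B = 1])
       (use g in \<open>auto simp: abs_mult intro!: mult_le_one abs_fracdiff_le\<close>)
  also have "\<dots> = (LBINT u:{0..<0+g}. (fracdiff g H u)\<^sup>2)"
  proof -
    define a where "a = (\<lambda>n u i. frac ((u / g + real i) / real n) - frac (((u - H) / g + real i) / real n))"
    have "(\<Sum>j<h*k. fracdiff (g * real h) H (u + g * real j) * fracdiff (g * real k) H (u + g * real j)) = (fracdiff g H u)\<^sup>2" for u
    proof -
      have "(\<Sum>j<h*k. fracdiff (g * real h) H (u + g * real j) * fracdiff (g * real k) H (u + g * real j)) =
         (\<Sum>j<h*k. a h u (j mod h) * a k u (j mod k))"
        using hk g by (simp add: fracdiff_mod a_def)
      also have "\<dots> = (fracdiff g H u)\<^sup>2"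
        unfolding sum_coprime_product[OF hk] unfolding a_def using sum1 hk by (simp add: power2_eq_square)
      finally show ?thesis .
    qed
    then show ?thesis by simp
  qed
  finally show ?thesis by simp
qed

text \<open>For H < g the increment is the constant H/g on [H, g), contributing at most H^2/g \<le>
  H, and [0, H) contributes at most H because increments are bounded by 1. For H \<ge> g the trivial
  bound g suffices. What matters is uniformity in the period g.\<close>

lemma integral_fracdiff_square_bound:
  assumes g: "g > 0" and H: "H \<ge> 0"
  shows "\<bar>LBINT u:{0..<g}. (fracdiff g H u)\<^sup>2\<bar> \<le> 2 * H"
proof -
  have int: "set_integrable lborel {0..<g} (\<lambda>u. (fracdiff g H u)\<^sup>2)"
    by (rule set_integrable_bounded_interval[where B = 1])
       (auto simp: abs_square_le_1 abs_fracdiff_le)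
  have nn: "(LBINT u:{0..<g}. (fracdiff g H u)\<^sup>2) \<ge> 0"
    unfolding set_lebesgue_integral_def by (rule Bochner_Integration.integral_nonneg) auto
  have const: "(LBINT u:{a..<b}. (c::real)) = c * (b - a)" if "a \<le> b" for a b c
    using that by (simp add: set_lebesgue_integral_def)
  show ?thesis
  proof (cases "H < g")
    case False
    have "(LBINT u:{0..<g}. (fracdiff g H u)\<^sup>2) \<le> (LBINT u:{0..<g}. 1)"
      by (rule set_integral_mono[OF int]) (auto simp: abs_square_le_1 abs_fracdiff_le intro!: set_integrable_bounded_interval[where B = 1])
    also have "\<dots> = g" using g const[of 0 g 1] by simp
    finally show ?thesis using False nn by simp
  next
    case True
    have f1: "(fracdiff g H u)\<^sup>2 \<le> (H/g)\<^sup>2" if u: "u \<in> {H..<g}" for u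
    proof -
      have "frac (u / g) = u / g" "frac ((u - H)/g) = (u - H)/g" using u H g by (subst frac_eq; simp)+
      then have "fracdiff g H u = H / g" by (simp add: fracdiff_def diff_divide_distrib)
      then show ?thesis by simp
    qed
    have "(LBINT u:{0..<g}. (fracdiff g H u)\<^sup>2) = (LBINT u:{0..<H}. (fracdiff g H u)\<^sup>2) + (LBINT u:{H..<g}. (fracdiff g H u)\<^sup>2)"
      by (rule set_integral_split[where B = 1]) (use True H in \<open>auto simp: abs_square_le_1 abs_fracdiff_le\<close>)
    also have "(LBINT u:{0..<H}. (fracdiff g H u)\<^sup>2) \<le> (LBINT u:{0..<H}. 1)"
      by (rule set_integral_mono) (auto simp: abs_square_le_1 abs_fracdiff_le intro!: set_integrable_bounded_interval[where B = 1])
    also have "(LBINT u:{H..<g}. (fracdiff g H u)\<^sup>2) \<le> (LBINT u:{H..<g}. (H/g)\<^sup>2)"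
    proof (rule set_integral_mono)
      show "set_integrable lborel {H..<g} (\<lambda>u. (fracdiff g H u)\<^sup>2)"
        by (rule set_integrable_bounded_interval[where B = 1]) (auto simp: abs_square_le_1 abs_fracdiff_le)
      show "set_integrable lborel {H..<g} (\<lambda>u. (H/g)\<^sup>2)"
        by (rule set_integrable_bounded_interval[where B = "(H/g)\<^sup>2"]) auto
    qed (use f1 in auto)
    also have "(LBINT u:{0..<H}. (1::real)) + (LBINT u:{H..<g}. (H/g)\<^sup>2) = H + (H/g)\<^sup>2 * (g - H)"
      using const[of 0 H 1] const[of H g "(H/g)\<^sup>2"] True H by simp
    also have "(H/g)\<^sup>2 * (g - H) \<le> (H/g)\<^sup>2 * g" using H by (intro mult_left_mono) auto
    also have "(H/g)\<^sup>2 * g = H * (H / g)" using g by (simp add: power2_eq_square field_simps)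
    also have "H * (H / g) \<le> H * 1" using True H g by (intro mult_left_mono) auto
    finally show ?thesis using nn by simp
  qed
qed

text \<open>Whole periods contribute their exact mean; each of the two end points, measured from 0,
  costs at most two periods.\<close>

lemma integral_periodic_average:
  fixes f :: "real \<Rightarrow> real"
  assumes f: "f \<in> borel_measurable borel" "\<And>x. \<bar>f x\<bar> \<le> 1"
    and per: "\<And>x j. f (x + p * real j) = f x" and p: "p > 0" and D: "D \<ge> 0" and v: "v \<ge> 0"
  shows "\<bar>(LBINT x:{v..<v+D}. f x) - D / p * (LBINT x:{0..<p}. f x)\<bar> \<le> 4 * p"
proof -
  define I where "I = (LBINT x:{0..<p}. f x)"
  have bnd: "\<bar>LBINT x:{a..<b}. f x\<bar> \<le> b - a" if "a \<le> b" for a b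
  proof -
    have "norm (LBINT x:{a..<b}. f x) \<le> (LBINT x:{a..<b}. norm (f x))"
      by (rule set_integral_norm_bound[OF set_integrable_bounded_interval[OF f]])
    also have "\<dots> \<le> (LBINT x:{a..<b}. 1)"
      by (rule set_integral_mono) (use f in \<open>auto intro!: set_integrable_bounded_interval\<close>)
    also have "\<dots> = b - a" using that by (simp add: set_lebesgue_integral_def)
    finally show ?thesis by simp
  qed
  have fromzero: "\<bar>(LBINT x:{0..<b}. f x) - b / p * I\<bar> \<le> 2 * p" if b: "b \<ge> 0" for b
  proof -
    define n where "n = nat \<lfloor>b / p\<rfloor>"
    have "real n = of_int \<lfloor>b / p\<rfloor>" unfolding n_def using b p by simp
    then have "real n \<le> b / p" "b / p < real n + 1" by linarith+
    then have n: "p * real n \<le> b" "b < p * real n + p" using p by (simp_all add: field_simps)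
    have "(LBINT x:{0..<b}. f x) = (LBINT x:{0..<0 + p * real n}. f x) + (LBINT x:{p * real n..<b}. f x)"
      by (subst set_integral_split[OF f, of 0 "p * real n"]) (use n p in auto)
    also have "(LBINT x:{0..<0 + p * real n}. f x) = real n * I"
      unfolding I_def by (subst set_integral_multiples[OF f]) (use p in \<open>simp_all add: per\<close>)
    finally have "(LBINT x:{0..<b}. f x) - b / p * I = (LBINT x:{p * real n..<b}. f x) - (b / p - real n) * I"
      by (simp add: algebra_simps)
    moreover have "\<bar>LBINT x:{p * real n..<b}. f x\<bar> \<le> p" using bnd[of "p * real n" b] n by simp
    moreover have "\<bar>(b / p - real n) * I\<bar> \<le> 1 * p"
      unfolding abs_mult using bnd[of 0 p] p \<open>real n \<le> b / p\<close> \<open>b / p < real n + 1\<close>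
      by (intro mult_mono) (auto simp: I_def)
    ultimately show ?thesis using abs_triangle_ineq4[of "LBINT x:{p * real n..<b}. f x" "(b / p - real n) * I"] by argo
  qed
  have "(LBINT x:{0..<v+D}. f x) = (LBINT x:{0..<v}. f x) + (LBINT x:{v..<v+D}. f x)"
    by (rule set_integral_split[OF f]) (use v D in auto)
  then have "(LBINT x:{v..<v+D}. f x) - D / p * I = ((LBINT x:{0..<v+D}. f x) - (v + D) / p * I) - ((LBINT x:{0..<v}. f x) - v / p * I)"
    by (simp add: add_divide_distrib algebra_simps)
  moreover have "\<bar>a - b\<bar> \<le> 4 * p" if "\<bar>a\<bar> \<le> 2 * p" "\<bar>b\<bar> \<le> 2 * p" for a b :: real using that by linarith
  ultimately show ?thesis using fromzero[of v] fromzero[of "v + D"] v D unfolding I_def by simp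
qed

section \<open>The signed sum of fractional parts and its mean square beyond T\<close>

text \<open>One parameter \<open>y\<close> bounds both the largest product and the number of
  products, so each sum over terms or over pairs costs a power of \<open>y\<close>.\<close>

locale sieve =
  fixes P :: "nat set" and N :: nat and y :: real
  assumes finP: "finite P" and primeP: "\<And>p. p \<in> P \<Longrightarrow> prime p"
    and prod_le: "\<And>A. A \<in> brun P N \<Longrightarrow> real (\<Prod>A) \<le> y"
    and card_le: "real (card (brun P N)) \<le> y"
begin

text \<open>The second fractional part is the first one at the dilated point u exp(-\<eta>).
  Dilation multiplies a Mellin transform by exp(-\<eta> s), so the difference carries the factor 1 -
  exp(-\<eta> s), and on the arithmetic side only the integers in (u exp(-\<eta>), u] are
  seen.\<close>

definition fracsum :: "real \<Rightarrow> real \<Rightarrow> real" where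
  "fracsum \<eta> u = (\<Sum>A\<in>brun P N. (-1) ^ card A * (frac (u / real (\<Prod>A)) - frac (u * exp (-\<eta>) / real (\<Prod>A))))"

text \<open>Main term and truncation error of \<open>brun_form_bound\<close>.\<close>

definition density :: real where
  "density = (\<Prod>p\<in>P. 1 - 1 / real p + 2 / real p ^ 2) +
     (1/4) ^ N * ((\<Prod>p\<in>P. 1 + 2 / real p)\<^sup>2 * (\<Prod>p\<in>P. 1 + 4 * (1 + real p) / real p ^ 2))"

lemma finite_brun: "finite (brun P N)"
  by (rule finite_subset[of _ "Pow P"]) (auto simp: brun_def finP)

lemma brun_subset: "A \<in> brun P N \<Longrightarrow> A \<subseteq> P" and brun_finite: "A \<in> brun P N \<Longrightarrow> finite A"
  using finP finite_subset by (auto simp: brun_def)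

lemma prod_pos: "A \<subseteq> P \<Longrightarrow> \<Prod>A > 0"
  using primeP by (auto intro!: prod_pos simp: prime_gt_0_nat)

lemma y_ge_1: "y \<ge> 1"
  using prod_le[of "{}"] by (simp add: brun_def)

lemma fracsum_measurable [measurable]: "fracsum \<eta> \<in> borel_measurable borel"
  unfolding fracsum_def by measurable

lemma abs_fracsum_le: "\<bar>fracsum \<eta> u\<bar> \<le> y"
proof -
  have "\<bar>fracsum \<eta> u\<bar> \<le> (\<Sum>A\<in>brun P N. \<bar>(-1) ^ card A * (frac (u / real (\<Prod>A)) - frac (u * exp (-\<eta>) / real (\<Prod>A)))\<bar>)"
    unfolding fracsum_def by (rule sum_abs)
  also have "\<dots> \<le> (\<Sum>A\<in>brun P N. 1)"
  proof (rule sum_mono)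
    fix A
    have "\<bar>frac a - frac b\<bar> \<le> 1" for a b :: real
      using frac_ge_0[of a] frac_lt_1[of a] frac_ge_0[of b] frac_lt_1[of b] by linarith
    then show "\<bar>(-1) ^ card A * (frac (u / real (\<Prod>A)) - frac (u * exp (-\<eta>) / real (\<Prod>A)))\<bar> \<le> 1"
      by (simp add: abs_mult)
  qed
  finally show ?thesis using card_le by simp
qed

lemma coprime_prod_diff:
  assumes "A \<subseteq> P" "A' \<subseteq> P" shows "coprime (\<Prod>(A - A')) (\<Prod>(A' - A))"
  using assms primeP by (intro prod_coprime_left prod_coprime_right primes_coprime) auto

lemma prod_inter_diff:
  assumes "finite A" shows "\<Prod>(A::nat set) = \<Prod>(A \<inter> A') * \<Prod>(A - A')"
  using prod.Int_Diff[OF assms, of "\<lambda>x. x" A'] by simp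

text \<open>With a constant shift H the product of two terms is periodic, and its mean is the
  integral \<open>I\<close> at the gcd of the two products divided by their lcm; this produces the
  form of \<open>brun_form_bound\<close> with G(R) the product of R times its \<open>I\<close>.
  Passing from the mean to a block costs four periods, at most 4 y^2, for each of at most y^2
  pairs.\<close>

lemma constant_shift_block:
  assumes v: "v \<ge> 0" and D: "\<Delta> \<ge> 0" and H: "H \<ge> 0"
  shows "(LBINT u:{v..<v+\<Delta>}. (\<Sum>A\<in>brun P N. (-1) ^ card A * fracdiff (real (\<Prod>A)) H u)\<^sup>2) \<le>
     4 * \<Delta> * H * density + 4 * y ^ 4"
proof -
  define I where "I = (\<lambda>g::nat. LBINT u:{0..<real g}. (fracdiff (real g) H u)\<^sup>2)"
  define G where "G = (\<lambda>R. real (\<Prod>R) * I (\<Prod>R))"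
  define f where "f = (\<lambda>A A' u. fracdiff (real (\<Prod>A)) H u * fracdiff (real (\<Prod>A')) H u)"
  define x where "x = (\<lambda>A. (-1) ^ card A / real (\<Prod>A))"
  have f_meas: "f A A' \<in> borel_measurable borel" for A A' unfolding f_def by measurable
  have f_le: "\<bar>f A A' u\<bar> \<le> 1" for A A' u
    unfolding f_def abs_mult by (intro mult_le_one abs_fracdiff_le) auto
  have pair: "\<bar>(LBINT u:{v..<v+\<Delta>}. f A A' u) - \<Delta> * (G (A \<inter> A') / (real (\<Prod>A) * real (\<Prod>A')))\<bar> \<le> 4 * y\<^sup>2"
    if A: "A \<in> brun P N" "A' \<in> brun P N" for A A'
  proof -
    \<comment> \<open>The gcd and the two coprime cofactors: the products are g h and g k, and the
      common period is g h k.\<close>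
    define g h k where "g = \<Prod>(A \<inter> A')" and "h = \<Prod>(A - A')" and "k = \<Prod>(A' - A)"
    note sub = brun_subset[OF A(1)] brun_subset[OF A(2)]
    have pos: "g > 0" "h > 0" "k > 0" unfolding g_def h_def k_def using sub by (auto intro!: prod_pos)
    have eq: "\<Prod>A = g * h" "\<Prod>A' = g * k"
      unfolding g_def h_def k_def using prod_inter_diff[OF brun_finite[OF A(1)], of A'] prod_inter_diff[OF brun_finite[OF A(2)], of A]
      by (simp_all add: Int_commute)
    have p: "real g * real (h * k) > 0" using pos by simp
    have "\<bar>(LBINT u:{v..<v+\<Delta>}. f A A' u) - \<Delta> / (real g * real (h * k)) * (LBINT u:{0..<real g * real (h * k)}. f A A' u)\<bar>
       \<le> 4 * (real g * real (h * k))"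
    proof (rule integral_periodic_average[OF f_meas f_le _ p D v])
      fix u j
      have "fracdiff (real (\<Prod>A)) H (u + real (\<Prod>A) * real (k * j)) = fracdiff (real (\<Prod>A)) H u"
        "fracdiff (real (\<Prod>A')) H (u + real (\<Prod>A') * real (h * j)) = fracdiff (real (\<Prod>A')) H u"
        using pos by (intro fracdiff_periodic; simp add: eq)+
      then show "f A A' (u + real g * real (h * k) * real j) = f A A' u"
        unfolding f_def by (simp add: eq mult_ac)
    qed
    moreover have "(LBINT u:{0..<real g * real (h * k)}. f A A' u) = I g"
      unfolding f_def I_def eq of_nat_mult[of g h] of_nat_mult[of g k] using pos coprime_prod_diff[OF sub]
      by (intro integral_fracdiff_product) (auto simp: h_def k_def)
    moreover have "\<Delta> / (real g * real (h * k)) * I g = \<Delta> * (G (A \<inter> A') / (real (\<Prod>A) * real (\<Prod>A')))"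
      unfolding G_def eq g_def[symmetric] using pos by (simp add: field_simps)
    moreover have "real g * real (h * k) \<le> y\<^sup>2"
    proof -
      have "real g * real (h * k) \<le> real g * real (h * k) * real g" using pos by simp
      also have "\<dots> = real (\<Prod>A) * real (\<Prod>A')" by (simp add: eq)
      also have "\<dots> \<le> y * y" using prod_le A y_ge_1 by (intro mult_mono) (auto simp del: of_nat_prod)
      finally show ?thesis by (simp add: power2_eq_square)
    qed
    ultimately show ?thesis by simp
  qed
  have "(LBINT u:{v..<v+\<Delta>}. (\<Sum>A\<in>brun P N. (-1) ^ card A * fracdiff (real (\<Prod>A)) H u)\<^sup>2) =
    (LBINT u:{v..<v+\<Delta>}. \<Sum>A\<in>brun P N. \<Sum>A'\<in>brun P N. ((-1) ^ card A * (-1) ^ card A') * f A A' u)"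
    unfolding power2_eq_square sum_product f_def by (simp add: mult_ac)
  also have "\<dots> = (\<Sum>A\<in>brun P N. \<Sum>A'\<in>brun P N. ((-1) ^ card A * (-1) ^ card A') * (LBINT u:{v..<v+\<Delta>}. f A A' u))"
  proof -
    have int: "set_integrable lborel {v..<v+\<Delta>} (f A A')" for A A'
      by (rule set_integrable_bounded_interval[OF f_meas f_le])
    show ?thesis unfolding set_lebesgue_integral_def using int[unfolded set_integrable_def]
      by (simp add: sum_distrib_left mult.left_commute[of "indicator _ _"])
  qed
  also have "\<dots> \<le> (\<Sum>A\<in>brun P N. \<Sum>A'\<in>brun P N. \<Delta> * (x A * x A' * G (A \<inter> A')) + 4 * y\<^sup>2)"
  proof (intro sum_mono)
    fix A A' assume A: "A \<in> brun P N" "A' \<in> brun P N"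
    have "e * a \<le> e * b + c" if "\<bar>a - b\<bar> \<le> c" "e = 1 \<or> e = -1" for a b c e :: real
      using that by auto
    from this[OF pair[OF A], of "(-1) ^ card A * (-1) ^ card A'"]
    show "((-1) ^ card A * (-1) ^ card A') * (LBINT u:{v..<v+\<Delta>}. f A A' u) \<le> \<Delta> * (x A * x A' * G (A \<inter> A')) + 4 * y\<^sup>2"
      unfolding x_def by (simp add: mult_ac flip: power_add) (metis minus_one_power_iff)
  qed
  also have "\<dots> = \<Delta> * (\<Sum>A\<in>brun P N. \<Sum>A'\<in>brun P N. x A * x A' * G (A \<inter> A')) + 4 * y\<^sup>2 * (real (card (brun P N)))\<^sup>2"
    by (simp add: sum.distrib sum_distrib_left power2_eq_square)
  also have "\<dots> \<le> \<Delta> * (2 * (2 * H) * density) + 4 * y\<^sup>2 * y\<^sup>2"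
  proof (intro add_mono mult_left_mono D)
    show "(\<Sum>A\<in>brun P N. \<Sum>A'\<in>brun P N. x A * x A' * G (A \<inter> A')) \<le> 2 * (2 * H) * density"
      unfolding x_def density_def
    proof (rule brun_form_bound[OF finP])
      fix R assume R: "R \<subseteq> P"
      then show "\<bar>G R\<bar> \<le> 2 * H * real (\<Prod>R)"
        unfolding G_def abs_mult I_def using integral_fracdiff_square_bound[OF _ H, of "real (\<Prod>R)"] prod_pos[OF R]
        by (simp del: of_nat_prod add: mult.commute mult_left_mono)
    qed (use primeP H prime_gt_0_nat in auto)
    show "(real (card (brun P N)))\<^sup>2 \<le> y\<^sup>2" using card_le by (intro power_mono) auto
  qed auto
  finally show ?thesis by (simp add: power2_eq_square power4_eq_xxxx algebra_simps)
qed

text \<open>On the block the true shift u (1 - exp(-\<eta>)) exceeds the one frozen at u = v by at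
  most E = \<Delta> \<eta>. Monotonicity of the floor bounds the change pointwise by 2E plus a
  difference F(u - E) - F(u), whose integral collapses to a boundary term of size E; the jumps never
  have to be located.\<close>

lemma frac_shift_integral:
  fixes h v \<Delta> \<eta> :: real
  assumes h: "h \<ge> 1" and D: "\<Delta> \<ge> 0" and eta: "\<eta> \<ge> 0"
  shows "(LBINT u:{v..<v+\<Delta>}. \<bar>frac ((u - v * (1 - exp (-\<eta>))) / h) - frac (u * exp (-\<eta>) / h)\<bar>) \<le> 2 * \<Delta>\<^sup>2 * \<eta> + \<Delta> * \<eta>"
proof -
  define E where "E = \<Delta> * \<eta>"
  define H where "H = v * (1 - exp (-\<eta>))"
  define F where "F = (\<lambda>u. frac ((u - H) / h))"
  have E0: "E \<ge> 0" using D eta by (simp add: E_def)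
  have F_meas[measurable]: "F \<in> borel_measurable borel" unfolding F_def by (rule measurable_compose[OF _ frac_measurable]) measurable
  have F_bd: "0 \<le> F u" "F u \<le> 1" for u using frac_lt_1[of "(u - H)/h"] by (auto simp: F_def)
  have F_bd': "\<bar>F u\<bar> \<le> 1" for u using F_bd[of u] by simp
  have pw: "\<bar>frac ((u - H) / h) - frac (u * exp (-\<eta>) / h)\<bar> \<le> 2 * E + (F (u - E) - F u)"
    if u: "u \<in> {v..<v+\<Delta>}" for u
  proof -
    define e where "e = (u - v) * (1 - exp (-\<eta>))"
    have ex: "0 \<le> 1 - exp (-\<eta>)" "1 - exp (-\<eta>) \<le> \<eta>" using eta exp_ge_add_one_self[of "-\<eta>"] by auto
    have e: "0 \<le> e" "e \<le> E" unfolding e_def E_def using u ex eta D by (auto intro!: mult_mono)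
    have eq: "u * exp (-\<eta>) = u - H - e" unfolding e_def H_def by (simp add: algebra_simps)
    have fl: "real_of_int \<lfloor>(u - H - E) / h\<rfloor> \<le> real_of_int \<lfloor>(u - H - e) / h\<rfloor>" "real_of_int \<lfloor>(u - H - e) / h\<rfloor> \<le> real_of_int \<lfloor>(u - H) / h\<rfloor>"
      unfolding of_int_le_iff using e h by (auto intro!: floor_mono divide_right_mono)
    have eh: "a / h \<le> E" if "0 \<le> a" "a \<le> E" for a
      using divide_left_mono[of 1 h a] that h by simp
    have "E / h \<le> E" "e / h \<le> E" "0 \<le> e / h" using e h E0 eh by auto
    moreover have d: "(u - H - e)/h = (u - H)/h - e/h" "(u - E - H)/h = (u - H)/h - E/h" "(u - H - E)/h = (u - H)/h - E/h"
      by (simp_all add: diff_divide_distrib)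
    moreover have "\<bar>(x - fx) - (x - e' - fe)\<bar> \<le> 2 * E + ((x - E' - fE) - (x - fx))"
      if "fE \<le> fe" "fe \<le> fx" "e' \<le> E" "E' \<le> E" "0 \<le> e'" for x fx fe fE e' E' :: real
      using that by linarith
    ultimately show ?thesis unfolding eq F_def frac_def using fl by simp
  qed
  have int: "set_integrable lborel {a..<b} F" "set_integrable lborel {a..<b} (\<lambda>u. F (u - E))" for a b
    using F_bd' by (auto intro!: set_integrable_bounded_interval[where B = 1])
  have "(LBINT u:{v..<v+\<Delta>}. \<bar>frac ((u - H) / h) - frac (u * exp (-\<eta>) / h)\<bar>) \<le> (LBINT u:{v..<v+\<Delta>}. 2 * E + (F (u - E) - F u))"
  proof (rule set_integral_mono[OF _ _ pw])
    show "set_integrable lborel {v..<v + \<Delta>} (\<lambda>u. \<bar>frac ((u - H) / h) - frac (u * exp (-\<eta>) / h)\<bar>)"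
    proof (rule set_integrable_bounded_interval[where B = 1])
      have "\<bar>frac a - frac b\<bar> \<le> 1" for a b :: real
        using frac_ge_0[of a] frac_lt_1[of a] frac_ge_0[of b] frac_lt_1[of b] by linarith
      then show "\<bar>\<bar>frac ((u - H) / h) - frac (u * exp (-\<eta>) / h)\<bar>\<bar> \<le> 1" for u by simp
    qed measurable
    show "set_integrable lborel {v..<v + \<Delta>} (\<lambda>u. 2 * E + (F (u - E) - F u))"
      by (intro set_integral_add set_integral_diff int set_integrable_bounded_interval[where B = "\<bar>2 * E\<bar>"]) auto
  qed
  also have "\<dots> = (LBINT u:{v..<v+\<Delta>}. 2 * E) + ((LBINT u:{v..<v+\<Delta>}. F (u + (- E))) - (LBINT u:{v..<v+\<Delta>}. F u))"
    by (subst set_integral_add(2), (intro set_integral_diff int set_integrable_bounded_interval[where B = "\<bar>2 * E\<bar>"]; auto)+, subst set_integral_diff(2), auto intro!: int)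
  also have "(LBINT u:{v..<v+\<Delta>}. F (u + (- E))) = (LBINT u:{v-E..<v+\<Delta>-E}. F u)"
    unfolding set_integral_shift by simp
  also have "(LBINT u:{v-E..<v+\<Delta>-E}. F u) - (LBINT u:{v..<v+\<Delta>}. F u) \<le> E"
  proof -
    have "(LBINT u:{v-E..<v+\<Delta>-E}. F u) \<le> (LBINT u:{v-E..<v+\<Delta>}. F u)"
      unfolding set_lebesgue_integral_def
      by (rule integral_mono[OF int(1)[unfolded set_integrable_def] int(1)[unfolded set_integrable_def]]) (use F_bd E0 in \<open>auto simp: indicator_def\<close>)
    also have "\<dots> = (LBINT u:{v-E..<v}. F u) + (LBINT u:{v..<v+\<Delta>}. F u)"
      by (rule set_integral_split[where B = 1]) (use F_bd' E0 D in auto)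
    also have "(LBINT u:{v-E..<v}. F u) \<le> (LBINT u:{v-E..<v}. 1)"
      by (rule set_integral_mono[OF int(1)]) (auto intro!: F_bd set_integrable_bounded_interval[where B = 1])
    also have "\<dots> = E" using E0 by (simp add: set_lebesgue_integral_def)
    finally show ?thesis by simp
  qed
  also have "(LBINT u:{v..<v+\<Delta>}. 2 * E) = 2 * E * \<Delta>" using D by (simp add: set_lebesgue_integral_def)
  finally show ?thesis unfolding H_def E_def by (simp add: power2_eq_square mult_ac)
qed

lemma density_nonneg: "density \<ge> 0"
proof -
  have "1 - 1 / real p + 2 / real p ^ 2 \<ge> 0" if "p \<in> P" for p
  proof -
    have "1 / real p \<le> 1" using primeP[OF that] prime_gt_0_nat[of p] by (simp add: field_simps)
    moreover have "2 / real p ^ 2 \<ge> 0" by simp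
    ultimately show ?thesis by linarith
  qed
  then have "0 \<le> (\<Prod>p\<in>P. 1 - 1 / real p + 2 / real p ^ 2)" by (rule prod_nonneg)
  moreover have "0 \<le> (\<Prod>p\<in>P. 1 + 4 * (1 + real p) / real p ^ 2)" by (rule prod_nonneg) auto
  ultimately show ?thesis unfolding density_def by auto
qed

lemma fracsum_square_le: "\<bar>(fracsum \<eta> u)\<^sup>2\<bar> \<le> y\<^sup>2"
  using power_mono[OF abs_fracsum_le[of \<eta> u], of 2] by simp

lemma fracsum_block:
  assumes v: "v \<ge> 0" and D: "\<Delta> \<ge> 0" and eta: "\<eta> \<ge> 0"
  shows "(LBINT u:{v..<v+\<Delta>}. (fracsum \<eta> u)\<^sup>2) \<le>
     8 * \<Delta> * (v * \<eta>) * density + 8 * y ^ 4 + 2 * y\<^sup>2 * (2 * \<Delta>\<^sup>2 * \<eta> + \<Delta> * \<eta>)"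
proof -
  define H where "H = v * (1 - exp (-\<eta>))"
  have H: "0 \<le> H" "H \<le> v * \<eta>" unfolding H_def
    using v eta exp_ge_add_one_self[of "-\<eta>"] by (auto intro!: mult_left_mono)
  define F where "F = (\<lambda>u. \<Sum>A\<in>brun P N. (-1) ^ card A * fracdiff (real (\<Prod>A)) H u)"
  define \<delta> where "\<delta> = (\<lambda>A u. \<bar>frac ((u - H) / real (\<Prod>A)) - frac (u * exp (-\<eta>) / real (\<Prod>A))\<bar>)"
  have d1: "\<delta> A u \<le> 1" "0 \<le> \<delta> A u" for A u
  proof -
    have "\<bar>frac a - frac b\<bar> \<le> 1" for a b :: real
      using frac_ge_0[of a] frac_lt_1[of a] frac_ge_0[of b] frac_lt_1[of b] by linarith
    then show "\<delta> A u \<le> 1" "0 \<le> \<delta> A u" by (simp_all add: \<delta>_def)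
  qed
  have d_meas: "\<delta> A \<in> borel_measurable borel" for A unfolding \<delta>_def by measurable
  have F_meas: "F \<in> borel_measurable borel" unfolding F_def by measurable
  have diff: "\<bar>fracsum \<eta> u - F u\<bar> \<le> (\<Sum>A\<in>brun P N. \<delta> A u)" for u
  proof -
    have "fracsum \<eta> u - F u = (\<Sum>A\<in>brun P N. (-1) ^ card A * (frac ((u - H) / real (\<Prod>A)) - frac (u * exp (-\<eta>) / real (\<Prod>A))))"
      unfolding fracsum_def F_def fracdiff_def sum_subtractf[symmetric] by (simp add: algebra_simps)
    also have "\<bar>\<dots>\<bar> \<le> (\<Sum>A\<in>brun P N. \<delta> A u)"
      by (rule order.trans[OF sum_abs]) (simp add: abs_mult \<delta>_def)
    finally show ?thesis .
  qed
  have pw: "(fracsum \<eta> u)\<^sup>2 \<le> 2 * (F u)\<^sup>2 + 2 * y * (\<Sum>A\<in>brun P N. \<delta> A u)" for u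
  proof -
    have "(\<Sum>A\<in>brun P N. \<delta> A u) \<le> y"
      using sum_bounded_above[of "brun P N" "\<lambda>A. \<delta> A u" 1] d1 card_le by simp
    then have "(fracsum \<eta> u - F u)\<^sup>2 \<le> y * (\<Sum>A\<in>brun P N. \<delta> A u)"
      using diff[of u] mult_mono[of "\<bar>fracsum \<eta> u - F u\<bar>" y "\<bar>fracsum \<eta> u - F u\<bar>" "\<Sum>A\<in>brun P N. \<delta> A u"] y_ge_1
      by (simp add: power2_eq_square)
    moreover have "(fracsum \<eta> u)\<^sup>2 \<le> 2 * (F u)\<^sup>2 + 2 * (fracsum \<eta> u - F u)\<^sup>2"
      using zero_le_power2[of "F u - (fracsum \<eta> u - F u)"] by (simp add: power2_eq_square algebra_simps)
    ultimately show ?thesis by linarith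
  qed
  have F_bd: "\<bar>(F u)\<^sup>2\<bar> \<le> y\<^sup>2" for u
  proof -
    have "\<bar>F u\<bar> \<le> (\<Sum>A\<in>brun P N. 1)" unfolding F_def
      by (rule order.trans[OF sum_abs], rule sum_mono) (simp add: abs_mult abs_fracdiff_le del: of_nat_prod)
    then have "\<bar>F u\<bar> \<le> y" using card_le by simp
    then show ?thesis using power_mono[of "\<bar>F u\<bar>" y 2] by simp
  qed
  have iF: "set_integrable lborel {v..<v+\<Delta>} (\<lambda>u. (F u)\<^sup>2)"
    using F_meas F_bd by (intro set_integrable_bounded_interval[where B = "y\<^sup>2"]) auto
  have id: "set_integrable lborel {v..<v+\<Delta>} (\<delta> A)" for A
    using d_meas d1 by (intro set_integrable_bounded_interval[where B = 1]) auto
  have ids: "set_integrable lborel {v..<v+\<Delta>} (\<lambda>u. \<Sum>A\<in>brun P N. \<delta> A u)"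
    using id unfolding set_integrable_def by (simp add: sum_distrib_left)
  have "(LBINT u:{v..<v+\<Delta>}. (fracsum \<eta> u)\<^sup>2) \<le> (LBINT u:{v..<v+\<Delta>}. 2 * (F u)\<^sup>2 + 2 * y * (\<Sum>A\<in>brun P N. \<delta> A u))"
  proof (rule set_integral_mono[OF _ _ pw])
    show "set_integrable lborel {v..<v + \<Delta>} (\<lambda>u. (fracsum \<eta> u)\<^sup>2)"
      by (rule set_integrable_bounded_interval[OF _ fracsum_square_le]) measurable
    show "set_integrable lborel {v..<v + \<Delta>} (\<lambda>u. 2 * (F u)\<^sup>2 + 2 * y * (\<Sum>A\<in>brun P N. \<delta> A u))"
      by (intro set_integral_add set_integrable_mult_right iF ids)
  qed
  also have "\<dots> = 2 * (LBINT u:{v..<v+\<Delta>}. (F u)\<^sup>2) + 2 * y * (\<Sum>A\<in>brun P N. LBINT u:{v..<v+\<Delta>}. \<delta> A u)"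
  proof -
    have "(LBINT u:{v..<v+\<Delta>}. \<Sum>A\<in>brun P N. \<delta> A u) = (\<Sum>A\<in>brun P N. LBINT u:{v..<v+\<Delta>}. \<delta> A u)"
      using id unfolding set_integrable_def set_lebesgue_integral_def by (simp add: sum_distrib_left)
    then show ?thesis
      by (subst set_integral_add(2)) (auto intro!: set_integrable_mult_right iF ids)
  qed
  also have "\<dots> \<le> 2 * (4 * \<Delta> * (v * \<eta>) * density + 4 * y ^ 4) + 2 * y * (y * (2 * \<Delta>\<^sup>2 * \<eta> + \<Delta> * \<eta>))"
  proof (intro add_mono mult_left_mono)
    have "(LBINT u:{v..<v+\<Delta>}. (F u)\<^sup>2) \<le> 4 * \<Delta> * H * density + 4 * y ^ 4"
      unfolding F_def by (rule constant_shift_block[OF v D H(1)])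
    also have "\<dots> \<le> 4 * \<Delta> * (v * \<eta>) * density + 4 * y ^ 4"
      using H D density_nonneg by (intro add_right_mono mult_right_mono mult_left_mono) auto
    finally show "(LBINT u:{v..<v+\<Delta>}. (F u)\<^sup>2) \<le> 4 * \<Delta> * (v * \<eta>) * density + 4 * y ^ 4" .
    have "(\<Sum>A\<in>brun P N. LBINT u:{v..<v+\<Delta>}. \<delta> A u) \<le> (\<Sum>A\<in>brun P N. 2 * \<Delta>\<^sup>2 * \<eta> + \<Delta> * \<eta>)"
    proof (rule sum_mono)
      fix A assume "A \<in> brun P N"
      then have "\<Prod>A > 0" by (intro prod_pos brun_subset)
      then have "real (\<Prod>A) \<ge> 1" by linarith
      then show "(LBINT u:{v..<v+\<Delta>}. \<delta> A u) \<le> 2 * \<Delta>\<^sup>2 * \<eta> + \<Delta> * \<eta>"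
        unfolding \<delta>_def H_def using D eta by (intro frac_shift_integral) auto
    qed
    also have "\<dots> = real (card (brun P N)) * (2 * \<Delta>\<^sup>2 * \<eta> + \<Delta> * \<eta>)" by simp
    also have "\<dots> \<le> y * (2 * \<Delta>\<^sup>2 * \<eta> + \<Delta> * \<eta>)"
      using card_le D eta by (intro mult_right_mono) auto
    finally show "(\<Sum>A\<in>brun P N. LBINT u:{v..<v+\<Delta>}. \<delta> A u) \<le> y * (2 * \<Delta>\<^sup>2 * \<eta> + \<Delta> * \<eta>)" .
  qed (use y_ge_1 in auto)
  finally show ?thesis by (simp add: power2_eq_square algebra_simps)
qed

text \<open>Blocks of length \<Delta> = sqrt T with \<eta> = 1/T: short enough to keep \<Delta>^2
  \<eta> = 1 in the freezing error, long enough that y^4 divided by the length is small.\<close>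

lemma fracsum_block_nn:
  assumes T: "T \<ge> 1" and v: "v \<ge> T"
  shows "(\<integral>\<^sup>+u\<in>{v..<v + sqrt T}. ennreal ((fracsum (1/T) u)\<^sup>2 / u\<^sup>2) \<partial>lborel) \<le>
     ennreal ((8 * density / T) * (sqrt T / v) + (14 * y ^ 4 / sqrt T) * (sqrt T / v\<^sup>2))"
proof -
  have v0: "v > 0" using T v by simp
  have i: "set_integrable lborel {v..<v + sqrt T} (\<lambda>u. (fracsum (1/T) u)\<^sup>2)"
    by (rule set_integrable_bounded_interval[OF _ fracsum_square_le]) measurable
  have "(\<integral>\<^sup>+u\<in>{v..<v + sqrt T}. ennreal ((fracsum (1/T) u)\<^sup>2 / u\<^sup>2) \<partial>lborel) \<le>
    (\<integral>\<^sup>+u. ennreal ((1 / v\<^sup>2) * (indicator {v..<v + sqrt T} u *\<^sub>R (fracsum (1/T) u)\<^sup>2)) \<partial>lborel)"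
  proof (rule nn_integral_mono)
    fix u
    have "(fracsum (1/T) u)\<^sup>2 / u\<^sup>2 \<le> (fracsum (1/T) u)\<^sup>2 / v\<^sup>2" if "u \<ge> v"
      using that v0 by (intro divide_left_mono power_mono) auto
    then show "ennreal ((fracsum (1/T) u)\<^sup>2 / u\<^sup>2) * indicator {v..<v + sqrt T} u \<le>
       ennreal ((1 / v\<^sup>2) * (indicator {v..<v + sqrt T} u *\<^sub>R (fracsum (1/T) u)\<^sup>2))"
      by (auto simp: indicator_def intro!: ennreal_leI)
  qed
  also have "\<dots> = ennreal (\<integral>u. (1 / v\<^sup>2) * (indicator {v..<v + sqrt T} u *\<^sub>R (fracsum (1/T) u)\<^sup>2) \<partial>lborel)"
    using i unfolding set_integrable_def by (intro nn_integral_eq_integral integrable_mult_right) auto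
  also have "(\<integral>u. (1 / v\<^sup>2) * (indicator {v..<v + sqrt T} u *\<^sub>R (fracsum (1/T) u)\<^sup>2) \<partial>lborel) =
     (1 / v\<^sup>2) * (LBINT u:{v..<v + sqrt T}. (fracsum (1/T) u)\<^sup>2)"
    unfolding set_lebesgue_integral_def by (rule integral_mult_right_zero)
  also have "ennreal \<dots> \<le> ennreal ((1 / v\<^sup>2) * (8 * sqrt T * (v * (1/T)) * density + 14 * y ^ 4))"
  proof (intro ennreal_leI mult_left_mono)
    have "(LBINT u:{v..<v + sqrt T}. (fracsum (1/T) u)\<^sup>2) \<le> 8 * sqrt T * (v * (1/T)) * density + 8 * y ^ 4 +
       2 * y\<^sup>2 * (2 * (sqrt T)\<^sup>2 * (1/T) + sqrt T * (1/T))"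
      using T v by (intro fracsum_block) auto
    moreover have "2 * (sqrt T)\<^sup>2 * (1/T) + sqrt T * (1/T) \<le> 3"
    proof -
      have "sqrt T * 1 \<le> sqrt T * sqrt T" using T by (intro mult_left_mono) auto
      then show ?thesis using T by (simp add: field_simps)
    qed
    then have "2 * y\<^sup>2 * (2 * (sqrt T)\<^sup>2 * (1/T) + sqrt T * (1/T)) \<le> 2 * y\<^sup>2 * 3"
      by (intro mult_left_mono) auto
    moreover have "2 * y\<^sup>2 * 3 \<le> 6 * y ^ 4"
      using power_increasing[of 2 4 y] y_ge_1 by simp
    ultimately show "(LBINT u:{v..<v + sqrt T}. (fracsum (1/T) u)\<^sup>2) \<le> 8 * sqrt T * (v * (1/T)) * density + 14 * y ^ 4"
      by linarith
  qed simp_all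
  also have "(1 / v\<^sup>2) * (8 * sqrt T * (v * (1/T)) * density + 14 * y ^ 4) = (8 * density / T) * (sqrt T / v) + (14 * y ^ 4 / sqrt T) * (sqrt T / v\<^sup>2)"
    using v0 T by (simp add: field_simps power2_eq_square)
  finally show ?thesis by simp
qed

text \<open>The block bounds are dominated by increments of ln v and of -1/v. Since consecutive end
  points satisfy w \<le> 2v, each comparison loses at most a factor 2, which doubles the constants 8
  and 14.\<close>

lemma fracsum_middle:
  assumes T: "T \<ge> 1"
  shows "(\<integral>\<^sup>+u\<in>{T..<T + sqrt T * real J}. ennreal ((fracsum (1/T) u)\<^sup>2 / u\<^sup>2) \<partial>lborel) \<le>
    ennreal ((16 * density / T) * ln ((T + sqrt T * real J) / T) + (28 * y ^ 4 / sqrt T) * (1 / T - 1 / (T + sqrt T * real J)))"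
proof (induction J)
  case 0 then show ?case by simp
next
  case (Suc J)
  define v where "v = T + sqrt T * real J"
  define w where "w = v + sqrt T"
  have w_eq: "T + sqrt T * real (Suc J) = w" unfolding v_def w_def by (simp add: algebra_simps)
  have v: "v \<ge> T" unfolding v_def using T by simp
  have v0: "v > 0" using v T by simp
  have sT: "0 < sqrt T" "sqrt T \<le> v"
  proof -
    have "sqrt T * 1 \<le> sqrt T * sqrt T" using T by (intro mult_left_mono) auto
    then show "sqrt T \<le> v" "0 < sqrt T" using v T by auto
  qed
  have w: "v < w" "w \<le> 2 * v" using sT by (auto simp: w_def)
  have "ln (v / w) \<le> v / w - 1" using v0 w by (intro ln_le_minus_one) auto
  moreover have "v / w - 1 = (v - w) / w" using v0 w by (simp add: diff_divide_distrib)
  then have "v / w - 1 = - (sqrt T / w)" by (simp add: w_def)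
  moreover have "sqrt T / (2 * v) \<le> sqrt T / w" using w v0 sT by (intro divide_left_mono) auto
  moreover have "ln (w / T) = ln (v / T) - ln (v / w)" using v0 w T by (simp add: ln_div)
  ultimately have ln_step: "sqrt T / v \<le> 2 * (ln (w / T) - ln (v / T))" by simp
  have "sqrt T / (v * (2 * v)) \<le> sqrt T / (v * w)" using w v0 sT by (intro divide_left_mono mult_left_mono) auto
  moreover have "1 / v - 1 / w = (w - v) / (v * w)" using v0 w by (simp add: diff_frac_eq)
  then have "sqrt T / (v * w) = 1 / v - 1 / w" by (simp add: w_def)
  ultimately have inv_step: "sqrt T / v\<^sup>2 \<le> 2 * (1 / v - 1 / w)" by (simp add: power2_eq_square)
  have "{T..<w} = {T..<v} \<union> {v..<w}" using v w by auto
  then have "(\<integral>\<^sup>+u\<in>{T..<w}. ennreal ((fracsum (1/T) u)\<^sup>2 / u\<^sup>2) \<partial>lborel) =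
    (\<integral>\<^sup>+u\<in>{T..<v}. ennreal ((fracsum (1/T) u)\<^sup>2 / u\<^sup>2) \<partial>lborel) + (\<integral>\<^sup>+u\<in>{v..<w}. ennreal ((fracsum (1/T) u)\<^sup>2 / u\<^sup>2) \<partial>lborel)"
    by (simp only:) (rule nn_integral_disjoint_pair; auto)
  also have "\<dots> \<le> ennreal ((16 * density / T) * ln (v / T) + (28 * y ^ 4 / sqrt T) * (1 / T - 1 / v)) +
     ennreal ((8 * density / T) * (2 * (ln (w / T) - ln (v / T))) + (14 * y ^ 4 / sqrt T) * (2 * (1 / v - 1 / w)))"
  proof (rule add_mono)
    show "(\<integral>\<^sup>+u\<in>{T..<v}. ennreal ((fracsum (1/T) u)\<^sup>2 / u\<^sup>2) \<partial>lborel) \<le> ennreal ((16 * density / T) * ln (v / T) + (28 * y ^ 4 / sqrt T) * (1 / T - 1 / v))"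
      using Suc.IH by (simp add: v_def)
    have "(8 * density / T) * (sqrt T / v) + (14 * y ^ 4 / sqrt T) * (sqrt T / v\<^sup>2) \<le> (8 * density / T) * (2 * (ln (w / T) - ln (v / T))) + (14 * y ^ 4 / sqrt T) * (2 * (1 / v - 1 / w))"
      using ln_step inv_step density_nonneg T y_ge_1 by (intro add_mono mult_left_mono) auto
    then show "(\<integral>\<^sup>+u\<in>{v..<w}. ennreal ((fracsum (1/T) u)\<^sup>2 / u\<^sup>2) \<partial>lborel) \<le> ennreal ((8 * density / T) * (2 * (ln (w / T) - ln (v / T))) + (14 * y ^ 4 / sqrt T) * (2 * (1 / v - 1 / w)))"
      using fracsum_block_nn[OF T v] unfolding w_def[symmetric] by (rule order.trans[OF _ ennreal_leI, rotated])
  qed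
  also have "\<dots> = ennreal (((16 * density / T) * ln (v / T) + (28 * y ^ 4 / sqrt T) * (1 / T - 1 / v)) +
     ((8 * density / T) * (2 * (ln (w / T) - ln (v / T))) + (14 * y ^ 4 / sqrt T) * (2 * (1 / v - 1 / w))))"
  proof (rule ennreal_plus[symmetric])
    have "ln (v / T) \<ge> 0" "1 / T - 1 / v \<ge> 0" using v T by (auto simp: field_simps)
    then show "0 \<le> (16 * density / T) * ln (v / T) + (28 * y ^ 4 / sqrt T) * (1 / T - 1 / v)"
      using density_nonneg T y_ge_1 by (intro add_nonneg_nonneg mult_nonneg_nonneg) auto
    have "0 \<le> sqrt T / v" "0 \<le> sqrt T / v\<^sup>2" using v0 T by auto
    then have "0 \<le> 2 * (ln (w / T) - ln (v / T))" "0 \<le> 2 * (1 / v - 1 / w)" using ln_step inv_step by linarith+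
    then show "0 \<le> (8 * density / T) * (2 * (ln (w / T) - ln (v / T))) + (14 * y ^ 4 / sqrt T) * (2 * (1 / v - 1 / w))"
      using density_nonneg T y_ge_1 by (intro add_nonneg_nonneg mult_nonneg_nonneg) auto
  qed
  also have "((16 * density / T) * ln (v / T) + (28 * y ^ 4 / sqrt T) * (1 / T - 1 / v)) +
     ((8 * density / T) * (2 * (ln (w / T) - ln (v / T))) + (14 * y ^ 4 / sqrt T) * (2 * (1 / v - 1 / w))) =
     (16 * density / T) * ln (w / T) + (28 * y ^ 4 / sqrt T) * (1 / T - 1 / w)"
    by (simp add: right_diff_distrib)
  finally show ?case unfolding w_eq .
qed

end

section \<open>The range below T and the tail of the integral\<close>

lemma floor_eq_sum_dvd:
  assumes h: "h > 0" and u: "0 \<le> u" "u < real M + 1"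
  shows "real_of_int \<lfloor>u / real h\<rfloor> = (\<Sum>n\<in>{1..M}. if h dvd n \<and> real n \<le> u then 1 else 0)"
proof -
  define m where "m = nat \<lfloor>u\<rfloor>"
  have fl: "\<lfloor>u\<rfloor> = int m" using u by (simp add: m_def)
  have nu: "real n \<le> u \<longleftrightarrow> n \<le> m" for n
    using fl by (metis floor_of_nat le_floor_iff nat_int_comparison(3) of_int_of_nat_eq)
  have mM: "m \<le> M" using nu[of m] u by linarith
  have "\<lfloor>u / real h\<rfloor> = int (m div h)"
    using floor_divide_real_eq_div[of "int h" u] fl by (simp add: zdiv_int)
  then have "real_of_int \<lfloor>u / real h\<rfloor> = real (\<Sum>n\<in>{1..m}. if h dvd n then 1 else 0)"
    unfolding sum_dvd_indicator[OF h] by simp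
  also have "\<dots> = (\<Sum>n\<in>{1..m}. if h dvd n \<and> real n \<le> u then 1 else 0)"
    unfolding of_nat_sum by (intro sum.cong) (auto simp: nu)
  also have "\<dots> = (\<Sum>n\<in>{1..M}. if h dvd n \<and> real n \<le> u then 1 else 0)"
    by (intro sum.mono_neutral_left) (use mM nu in auto)
  finally show ?thesis .
qed

lemma inverse_square_nn_integral:
  fixes a b :: real
  assumes "0 < a" "a \<le> b"
  shows "(\<integral>\<^sup>+u\<in>{a..<b}. ennreal (1 / u\<^sup>2) \<partial>lborel) \<le> ennreal ((b - a) / a\<^sup>2)"
proof -
  have "(\<integral>\<^sup>+u\<in>{a..<b}. ennreal (1 / u\<^sup>2) \<partial>lborel) \<le> (\<integral>\<^sup>+u. ennreal (1 / a\<^sup>2) * indicator {a..<b} u \<partial>lborel)"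
    using assms by (intro nn_integral_mono) (auto simp: indicator_def intro!: ennreal_leI divide_left_mono power_mono)
  also have "\<dots> = ennreal (1 / a\<^sup>2) * ennreal (b - a)"
    using assms by (subst nn_integral_cmult_indicator) auto
  also have "\<dots> = ennreal ((b - a) / a\<^sup>2)"
    using assms by (simp flip: ennreal_mult)
  finally show ?thesis .
qed

context sieve begin

text \<open>Truncated Moebius sum over divisors: without truncation, the indicator of n having no
  prime factor in \<open>P\<close>.\<close>

definition sieved :: "nat \<Rightarrow> real" where
  "sieved n = (\<Sum>A\<in>brun P N. if \<Prod>A dvd n then (-1) ^ card A else 0)"

definition total :: real where
  "total = (\<Sum>A\<in>brun P N. (-1) ^ card A / real (\<Prod>A))"

text \<open>floor(u/h) counts the multiples of h up to u, and the sums over sets and integers are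
  exchanged. \<open>M\<close> is any bound for the integers up to u, so that one range of summation
  serves all u.\<close>

lemma fracsum_eq_sieved:
  assumes u: "0 \<le> u" "u < real M + 1" and eta: "\<eta> \<ge> 0"
  shows "fracsum \<eta> u = u * (1 - exp (-\<eta>)) * total - (\<Sum>n\<in>{1..M}. if u * exp (-\<eta>) < real n \<and> real n \<le> u then sieved n else 0)"
proof -
  define w where "w = u * exp (-\<eta>)"
  have w: "0 \<le> w" "w \<le> u" unfolding w_def using u eta by (auto intro!: mult_left_le)
  have "frac (u / real (\<Prod>A)) - frac (w / real (\<Prod>A)) =
     (u - w) / real (\<Prod>A) - (\<Sum>n\<in>{1..M}. if w < real n \<and> real n \<le> u then (if \<Prod>A dvd n then 1 else 0) else 0)"
    if A: "A \<in> brun P N" for A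
  proof -
    have pos: "\<Prod>A > 0" by (intro prod_pos brun_subset A)
    have "real_of_int \<lfloor>u / real (\<Prod>A)\<rfloor> - real_of_int \<lfloor>w / real (\<Prod>A)\<rfloor> =
      (\<Sum>n\<in>{1..M}. if w < real n \<and> real n \<le> u then (if \<Prod>A dvd n then 1 else 0) else 0)"
      using w u by (subst (1 2) floor_eq_sum_dvd[OF pos, where M = M])
        (auto simp: sum_subtractf[symmetric] simp del: of_nat_prod intro!: sum.cong)
    then show ?thesis unfolding frac_def by (simp add: diff_divide_distrib del: of_nat_prod)
  qed
  then have "fracsum \<eta> u = (\<Sum>A\<in>brun P N. (-1) ^ card A * ((u - w) / real (\<Prod>A) -
      (\<Sum>n\<in>{1..M}. if w < real n \<and> real n \<le> u then (if \<Prod>A dvd n then 1 else 0) else 0)))"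
    unfolding fracsum_def w_def[symmetric] by (intro sum.cong) (auto simp del: of_nat_prod)
  also have "\<dots> = (u - w) * total - (\<Sum>A\<in>brun P N. \<Sum>n\<in>{1..M}. if w < real n \<and> real n \<le> u then (if \<Prod>A dvd n then (-1) ^ card A else 0) else 0)"
    unfolding total_def sum_distrib_left sum_subtractf[symmetric] right_diff_distrib
    by (intro sum.cong arg_cong2[of _ _ _ _ minus]) (auto simp del: of_nat_prod)
  also have "(\<Sum>A\<in>brun P N. \<Sum>n\<in>{1..M}. if w < real n \<and> real n \<le> u then (if \<Prod>A dvd n then (-1) ^ card A else 0) else 0)
     = (\<Sum>n\<in>{1..M}. if w < real n \<and> real n \<le> u then sieved n else 0)"
    unfolding sieved_def by (subst sum.swap, intro sum.cong) (auto simp del: of_nat_prod)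
  finally show ?thesis unfolding w_def by (simp add: algebra_simps)
qed

text \<open>Below T the interval (u exp(-1/T), u] is shorter than 1 and holds at most one integer,
  so the square of the inner sum is the sum of the squares. Each n is seen by the u in [n, n
  exp(1/T)), a set of length about n/T, and contributes about 1/(nT) after division by u^2.\<close>

lemma fracsum_small:
  assumes T: "T \<ge> 1" and M: "M = nat \<lfloor>T\<rfloor>"
  shows "(\<integral>\<^sup>+u\<in>{0<..<T}. ennreal ((fracsum (1/T) u)\<^sup>2 / u\<^sup>2) \<partial>lborel) \<le>
     ennreal (2 * total\<^sup>2 / T + (4 / T) * (\<Sum>n\<in>{1..M}. (sieved n)\<^sup>2 / real n))"
proof -
  define J where "J = (\<lambda>n. {real n..<real n * exp (1/T)})"
  have TM: "T < real M + 1" unfolding M using T by linarith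
  have pw: "(fracsum (1/T) u)\<^sup>2 / u\<^sup>2 \<le> 2 * total\<^sup>2 / T\<^sup>2 + (\<Sum>n\<in>{1..M}. 2 * (sieved n)\<^sup>2 * (indicator (J n) u * (1 / u\<^sup>2)))"
    if u: "u \<in> {0<..<T}" for u
  proof -
    define w where "w = u * exp (-(1/T))"
    have ex: "1 - exp (-(1/T)) \<le> 1/T" "0 \<le> 1 - exp (-(1/T))" using exp_ge_add_one_self[of "-(1/T)"] T by auto
    have "u * (1 - exp (-(1/T))) \<le> u * (1/T)" using u ex by (intro mult_left_mono) auto
    also have "\<dots> < 1" using u T by (simp add: field_simps)
    finally have uw: "u - w < 1" by (simp add: w_def algebra_simps)
    have Jiff: "u \<in> J n \<longleftrightarrow> w < real n \<and> real n \<le> u" for n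
      unfolding J_def w_def by (auto simp: exp_minus field_simps)
    define s where "s = (\<Sum>n\<in>{1..M}. if w < real n \<and> real n \<le> u then sieved n else 0)"
    have s2: "s\<^sup>2 = (\<Sum>n\<in>{1..M}. (sieved n)\<^sup>2 * indicator (J n) u)"
    proof (cases "\<exists>n\<in>{1..M}. w < real n \<and> real n \<le> u")
      case True
      then obtain m where m: "m \<in> {1..M}" "w < real m" "real m \<le> u" by blast
      have uniq: "(w < real n \<and> real n \<le> u) \<longleftrightarrow> n = m" for n
      proof
        assume "w < real n \<and> real n \<le> u"
        then have "\<bar>real n - real m\<bar> < 1" using uw m by linarith
        then show "n = m" by linarith
      qed (use m in auto)
      show ?thesis unfolding s_def indicator_def Jiff uniq using m(1) by simp
    next
      case False
      then have "s = 0" unfolding s_def by (intro sum.neutral) auto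
      moreover have "(\<Sum>n\<in>{1..M}. (sieved n)\<^sup>2 * indicator (J n) u) = 0"
        using False unfolding indicator_def Jiff by (intro sum.neutral) auto
      ultimately show ?thesis by simp
    qed
    have "fracsum (1/T) u = u * (1 - exp (-(1/T))) * total - s"
      unfolding s_def w_def by (rule fracsum_eq_sieved) (use u TM T in auto)
    moreover have "(a - b)\<^sup>2 \<le> 2 * a\<^sup>2 + 2 * b\<^sup>2" for a b :: real
      using zero_le_power2[of "a + b"] by (simp add: power2_eq_square algebra_simps)
    ultimately have "(fracsum (1/T) u)\<^sup>2 \<le> 2 * (u * (1 - exp (-(1/T))) * total)\<^sup>2 + 2 * s\<^sup>2" by simp
    also have "(u * (1 - exp (-(1/T))) * total)\<^sup>2 \<le> (u * (1/T))\<^sup>2 * total\<^sup>2"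
      unfolding power_mult_distrib[of _ total] using ex u by (intro mult_right_mono power_mono mult_left_mono) auto
    finally have "(fracsum (1/T) u)\<^sup>2 / u\<^sup>2 \<le> (2 * ((u * (1/T))\<^sup>2 * total\<^sup>2) + 2 * s\<^sup>2) / u\<^sup>2"
      by (intro divide_right_mono) auto
    also have "\<dots> = 2 * total\<^sup>2 / T\<^sup>2 + 2 * s\<^sup>2 * (1 / u\<^sup>2)" using u T by (simp add: field_simps power2_eq_square)
    also have "2 * s\<^sup>2 * (1 / u\<^sup>2) = (\<Sum>n\<in>{1..M}. 2 * (sieved n)\<^sup>2 * (indicator (J n) u * (1 / u\<^sup>2)))"
      unfolding s2 by (simp only: sum_distrib_left sum_distrib_right mult.assoc)
    finally show ?thesis .
  qed
  have "(\<integral>\<^sup>+u\<in>{0<..<T}. ennreal ((fracsum (1/T) u)\<^sup>2 / u\<^sup>2) \<partial>lborel) \<le>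
    (\<integral>\<^sup>+u. (ennreal (2 * total\<^sup>2 / T\<^sup>2) * indicator {0<..<T} u + (\<Sum>n\<in>{1..M}. ennreal (2 * (sieved n)\<^sup>2) * (ennreal (1 / u\<^sup>2) * indicator (J n) u))) \<partial>lborel)"
  proof (rule nn_integral_mono)
    fix u
    show "ennreal ((fracsum (1/T) u)\<^sup>2 / u\<^sup>2) * indicator {0<..<T} u \<le> ennreal (2 * total\<^sup>2 / T\<^sup>2) * indicator {0<..<T} u + (\<Sum>n\<in>{1..M}. ennreal (2 * (sieved n)\<^sup>2) * (ennreal (1 / u\<^sup>2) * indicator (J n) u))"
    proof (cases "u \<in> {0<..<T}")
      case True
      have "(\<Sum>n\<in>{1..M}. ennreal (2 * (sieved n)\<^sup>2) * (ennreal (1 / u\<^sup>2) * indicator (J n) u)) =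
        ennreal (\<Sum>n\<in>{1..M}. 2 * (sieved n)\<^sup>2 * (indicator (J n) u * (1 / u\<^sup>2)))"
      proof -
        have "(\<Sum>n\<in>{1..M}. ennreal (2 * (sieved n)\<^sup>2) * (ennreal (1 / u\<^sup>2) * indicator (J n) u)) =
          (\<Sum>n\<in>{1..M}. ennreal (2 * (sieved n)\<^sup>2 * (indicator (J n) u * (1 / u\<^sup>2))))"
          by (intro sum.cong refl) (simp add: indicator_def flip: ennreal_mult)
        also have "\<dots> = ennreal (\<Sum>n\<in>{1..M}. 2 * (sieved n)\<^sup>2 * (indicator (J n) u * (1 / u\<^sup>2)))"
          by (rule sum_ennreal) auto
        finally show ?thesis .
      qed
      then show ?thesis using True ennreal_leI[OF pw[OF True]]
        by (simp add: ennreal_plus[symmetric] sum_nonneg del: ennreal_plus)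
    qed simp
  qed
  also have "\<dots> = ennreal (2 * total\<^sup>2 / T\<^sup>2) * ennreal T + (\<Sum>n\<in>{1..M}. ennreal (2 * (sieved n)\<^sup>2) * (\<integral>\<^sup>+u\<in>J n. ennreal (1 / u\<^sup>2) \<partial>lborel))"
  proof -
    have [measurable]: "J n \<in> sets borel" for n by (simp add: J_def)
    show ?thesis using T by (simp add: nn_integral_add nn_integral_sum nn_integral_cmult nn_integral_cmult_indicator)
  qed
  also have "\<dots> \<le> ennreal (2 * total\<^sup>2 / T\<^sup>2) * ennreal T + (\<Sum>n\<in>{1..M}. ennreal (2 * (sieved n)\<^sup>2) * ennreal (2 / T / real n))"
  proof (intro add_left_mono sum_mono mult_left_mono)
    fix n assume n: "n \<in> {1..M}"
    have "(\<integral>\<^sup>+u\<in>J n. ennreal (1 / u\<^sup>2) \<partial>lborel) \<le> ennreal ((real n * exp (1/T) - real n) / (real n)\<^sup>2)"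
      unfolding J_def using n T by (intro inverse_square_nn_integral) auto
    also have "\<dots> \<le> ennreal (2 / T / real n)"
    proof (rule ennreal_leI)
      have "exp (1/T) \<le> 1 + 1/T + (1/T)\<^sup>2" using T by (intro exp_bound) auto
      moreover have "(1/T)\<^sup>2 \<le> 1/T" using T by (simp add: power2_eq_square field_simps)
      ultimately have "exp (1/T) - 1 \<le> 2 / T" by simp
      then have "(exp (1/T) - 1) / real n \<le> 2 / T / real n" using n by (intro divide_right_mono) auto
      moreover have "(real n * exp (1/T) - real n) / (real n)\<^sup>2 = (exp (1/T) - 1) / real n"
        using n by (simp add: field_simps power2_eq_square)
      ultimately show "(real n * exp (1/T) - real n) / (real n)\<^sup>2 \<le> 2 / T / real n" by simp
    qed
    finally show "(\<integral>\<^sup>+u\<in>J n. ennreal (1 / u\<^sup>2) \<partial>lborel) \<le> ennreal (2 / T / real n)" .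
  qed auto
  also have "\<dots> = ennreal (2 * total\<^sup>2 / T\<^sup>2 * T + (\<Sum>n\<in>{1..M}. 2 * (sieved n)\<^sup>2 * (2 / T / real n)))"
    using T by (simp add: ennreal_mult[symmetric] sum_ennreal sum_nonneg flip: ennreal_plus)
  also have "2 * total\<^sup>2 / T\<^sup>2 * T + (\<Sum>n\<in>{1..M}. 2 * (sieved n)\<^sup>2 * (2 / T / real n)) = 2 * total\<^sup>2 / T + (4 / T) * (\<Sum>n\<in>{1..M}. (sieved n)\<^sup>2 / real n)"
    using T by (simp add: power2_eq_square sum_distrib_left field_simps)
  finally show ?thesis .
qed

lemma fracsum_large:
  assumes T: "T \<ge> 1" and w: "w \<ge> T * y\<^sup>2"
  shows "(\<integral>\<^sup>+u\<in>{w..}. ennreal ((fracsum (1/T) u)\<^sup>2 / u\<^sup>2) \<partial>lborel) \<le> ennreal (1 / T)"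
proof -
  have w0: "w > 0" using w T y_ge_1 by (intro less_le_trans[OF _ w]) auto
  have "(\<integral>\<^sup>+u\<in>{w..}. ennreal ((fracsum (1/T) u)\<^sup>2 / u\<^sup>2) \<partial>lborel) \<le> (\<integral>\<^sup>+u. ennreal (y\<^sup>2 / u\<^sup>2) * indicator {w..} u \<partial>lborel)"
    using fracsum_square_le by (intro nn_integral_mono) (auto simp: indicator_def intro!: ennreal_leI divide_right_mono)
  also have "\<dots> = ennreal (0 - (- y\<^sup>2 / w))"
  proof (rule nn_integral_FTC_atLeast)
    show "DERIV (\<lambda>u. - y\<^sup>2 / u) x :> y\<^sup>2 / x\<^sup>2" if "w \<le> x" for x
      using that w0 by (auto intro!: derivative_eq_intros simp: power2_eq_square)
    show "((\<lambda>u. - y\<^sup>2 / u) \<longlongrightarrow> 0) at_top" by real_asymp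
  qed (use w0 in auto)
  also have "0 - (- y\<^sup>2 / w) \<le> 1 / T" using w w0 T by (simp add: field_simps)
  finally show ?thesis by (simp add: ennreal_leI)
qed

text \<open>The three ranges \<open>u < T\<close>, \<open>T \<le> u < T + J \<surd>T\<close> and \<open>u \<ge> T + J \<surd>T \<ge> T y\<^sup>2\<close>.\<close>
lemma fracsum_mean_square:
  assumes T: "T \<ge> 1" and M: "M = nat \<lfloor>T\<rfloor>"
  shows "(\<integral>\<^sup>+u\<in>{0<..}. ennreal ((fracsum (1/T) u)\<^sup>2 / u\<^sup>2) \<partial>lborel) \<le>
    ennreal ((1 / T) * (1 + 2 * total\<^sup>2 + 4 * (\<Sum>n\<in>{1..M}. (sieved n)\<^sup>2 / real n) + 16 * density * ln (3 * y\<^sup>2) + 28 * y ^ 4 / sqrt T))"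
proof -
  \<comment> \<open>Enough blocks of length sqrt T to reach T y^2, where the trivial bound takes
    over. The end point stays below 3 y^2 T, which is the origin of ln (3 y^2).\<close>
  define J where "J = nat \<lceil>sqrt T * y\<^sup>2\<rceil>"
  define w where "w = T + sqrt T * real J"
  have ss: "sqrt T * sqrt T = T" using T by simp
  have y2: "y\<^sup>2 \<ge> 1" using y_ge_1 by simp
  have sT: "1 \<le> sqrt T" using T by simp
  then have "sqrt T * 1 \<le> sqrt T * sqrt T" by (intro mult_left_mono) auto
  with sT ss have sT: "1 \<le> sqrt T" "sqrt T \<le> T" by auto
  have J: "sqrt T * y\<^sup>2 \<le> real J" "real J \<le> sqrt T * y\<^sup>2 + 1"
  proof -
    have "real J = of_int \<lceil>sqrt T * y\<^sup>2\<rceil>" unfolding J_def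
    proof (rule of_nat_nat)
      have "0 \<le> sqrt T * y\<^sup>2" using T by simp
      then show "0 \<le> \<lceil>sqrt T * y\<^sup>2\<rceil>" by linarith
    qed
    then show "sqrt T * y\<^sup>2 \<le> real J" "real J \<le> sqrt T * y\<^sup>2 + 1" by linarith+
  qed
  have "sqrt T * (sqrt T * y\<^sup>2) \<le> sqrt T * real J" using J T by (intro mult_left_mono) auto
  then have w1: "w \<ge> T * y\<^sup>2" unfolding w_def using ss T by (simp flip: mult.assoc)
  have "sqrt T * real J \<le> sqrt T * (sqrt T * y\<^sup>2 + 1)" using J T by (intro mult_left_mono) auto
  also have "\<dots> = T * y\<^sup>2 + sqrt T" using ss by (simp add: distrib_left flip: mult.assoc)
  finally have Jle: "sqrt T * real J \<le> T * y\<^sup>2 + sqrt T" .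
  have "T * 1 \<le> T * y\<^sup>2" using y2 T by (intro mult_left_mono) auto
  with Jle sT have "w \<le> 3 * (T * y\<^sup>2)" unfolding w_def by linarith
  then have w2: "w \<le> 3 * y\<^sup>2 * T" by (simp add: mult_ac)
  have wT: "w \<ge> T" unfolding w_def using T by simp
  let ?f = "\<lambda>u. ennreal ((fracsum (1/T) u)\<^sup>2 / u\<^sup>2)"
  have "{0<..} = ({0<..<T} \<union> {T..<w}) \<union> {w..}" using wT T by auto
  then have "(\<integral>\<^sup>+u\<in>{0<..}. ?f u \<partial>lborel) = (\<integral>\<^sup>+u\<in>({0<..<T} \<union> {T..<w}) \<union> {w..}. ?f u \<partial>lborel)" by simp
  also have "\<dots> = (\<integral>\<^sup>+u\<in>{0<..<T} \<union> {T..<w}. ?f u \<partial>lborel) + (\<integral>\<^sup>+u\<in>{w..}. ?f u \<partial>lborel)"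
    by (rule nn_integral_disjoint_pair) (use wT in auto)
  also have "(\<integral>\<^sup>+u\<in>{0<..<T} \<union> {T..<w}. ?f u \<partial>lborel) = (\<integral>\<^sup>+u\<in>{0<..<T}. ?f u \<partial>lborel) + (\<integral>\<^sup>+u\<in>{T..<w}. ?f u \<partial>lborel)"
    by (rule nn_integral_disjoint_pair) auto
  also have "\<dots> + (\<integral>\<^sup>+u\<in>{w..}. ?f u \<partial>lborel) \<le>
      (ennreal (2 * total\<^sup>2 / T + (4 / T) * (\<Sum>n\<in>{1..M}. (sieved n)\<^sup>2 / real n)) +
       ennreal ((16 * density / T) * ln (w / T) + (28 * y ^ 4 / sqrt T) * (1 / T - 1 / w))) + ennreal (1 / T)"
    by (intro add_mono fracsum_small T M fracsum_middle[OF T, of J, folded w_def] fracsum_large w1)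
  also have "\<dots> = ennreal ((2 * total\<^sup>2 / T + (4 / T) * (\<Sum>n\<in>{1..M}. (sieved n)\<^sup>2 / real n)) +
        ((16 * density / T) * ln (w / T) + (28 * y ^ 4 / sqrt T) * (1 / T - 1 / w)) + 1 / T)"
  proof -
    have "0 \<le> 2 * total\<^sup>2 / T + (4 / T) * (\<Sum>n\<in>{1..M}. (sieved n)\<^sup>2 / real n)"
      using T by (intro add_nonneg_nonneg mult_nonneg_nonneg sum_nonneg) auto
    moreover have "0 \<le> 1 / T - 1 / w" "ln (w / T) \<ge> 0" using wT T by (auto simp: frac_le)
    then have "0 \<le> (16 * density / T) * ln (w / T) + (28 * y ^ 4 / sqrt T) * (1 / T - 1 / w)"
      using T y_ge_1 density_nonneg by (intro add_nonneg_nonneg mult_nonneg_nonneg) auto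
    ultimately show ?thesis using T by (simp add: ennreal_plus)
  qed
  also have "\<dots> \<le> ennreal ((2 * total\<^sup>2 / T + (4 / T) * (\<Sum>n\<in>{1..M}. (sieved n)\<^sup>2 / real n)) +
        ((16 * density / T) * ln (3 * y\<^sup>2) + (28 * y ^ 4 / sqrt T) * (1 / T)) + 1 / T)"
  proof (intro ennreal_leI add_mono mult_left_mono order.refl)
    show "ln (w / T) \<le> ln (3 * y\<^sup>2)" using w2 wT T by (subst ln_le_cancel_iff) (auto simp: field_simps)
  qed (use T y_ge_1 density_nonneg wT in auto)
  also have "(2 * total\<^sup>2 / T + (4 / T) * (\<Sum>n\<in>{1..M}. (sieved n)\<^sup>2 / real n)) +
        ((16 * density / T) * ln (3 * y\<^sup>2) + (28 * y ^ 4 / sqrt T) * (1 / T)) + 1 / T =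
     (1 / T) * (1 + 2 * total\<^sup>2 + 4 * (\<Sum>n\<in>{1..M}. (sieved n)\<^sup>2 / real n) + 16 * density * ln (3 * y\<^sup>2) + 28 * y ^ 4 / sqrt T)"
    using T by (simp add: algebra_simps)
  finally show ?thesis .
qed

end

section \<open>Sizes of the sieve quantities in terms of sums of 1/p\<close>

lemma sum_inverse_prime_squares_le:
  assumes "finite S" "\<And>p. p \<in> S \<Longrightarrow> prime (p::nat)"
  shows "(\<Sum>p\<in>S. 1 / real p ^ 2) \<le> 1"
proof -
  have p2: "p \<in> S \<Longrightarrow> p \<ge> 2" for p using assms by (auto simp: prime_ge_2_nat)
  have "(\<Sum>p\<in>S. 1 / real p ^ 2) \<le> (\<Sum>p\<in>S. 1 / (real p * (real p - 1)))"
  proof (rule sum_mono)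
    fix p assume "p \<in> S"
    then have "real p \<ge> 2" using p2 by fastforce
    then show "1 / real p ^ 2 \<le> 1 / (real p * (real p - 1))"
      by (intro divide_left_mono) (auto simp: power2_eq_square)
  qed
  also have "\<dots> \<le> 1" by (rule sum_inverse_squares_le[OF assms(1) p2])
  finally show ?thesis .
qed

lemma prod_le_exp_sum:
  fixes f g :: "'a \<Rightarrow> real"
  assumes "finite S" "\<And>p. p \<in> S \<Longrightarrow> 0 \<le> 1 + f p"
  shows "(\<Prod>p\<in>S. 1 + f p) \<le> exp (\<Sum>p\<in>S. f p)"
  unfolding exp_sum[OF assms(1)] using assms(2) by (intro prod_mono) (auto simp: exp_ge_add_one_self)

context sieve begin

definition recip :: real where "recip = (\<Sum>p\<in>P. 1 / real p)"

lemma P_ge2: "p \<in> P \<Longrightarrow> real p \<ge> 2"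
  using primeP prime_ge_2_nat by fastforce

lemma prod_one_plus_le: "c \<ge> 0 \<Longrightarrow> (\<Prod>p\<in>P. 1 + c / real p) \<le> exp (c * recip)"
  by (rule order.trans[OF prod_le_exp_sum[OF finP]]) (auto simp: recip_def sum_distrib_left)

text \<open>The main term exp(-\<open>recip\<close>) is of order 1 / ln x when \<open>P\<close>
  consists of all primes up to x; the truncation costs a fixed power exp(8 \<open>recip\<close>)
  against 2^-N.\<close>

lemma density_le: "density \<le> exp (2 - recip) + (1/2) ^ N * exp (8 * recip + 4)"
proof -
  have sq: "(\<Sum>p\<in>P. 1 / real p ^ 2) \<le> 1" by (rule sum_inverse_prime_squares_le[OF finP primeP])
  have "(\<Prod>p\<in>P. 1 - 1 / real p + 2 / real p ^ 2) = (\<Prod>p\<in>P. 1 + (2 / real p ^ 2 - 1 / real p))"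
    by (simp add: algebra_simps)
  also have "\<dots> \<le> exp (\<Sum>p\<in>P. 2 / real p ^ 2 - 1 / real p)"
  proof (rule prod_le_exp_sum[OF finP])
    fix p assume "p \<in> P"
    then have "1 / real p \<le> 1" using P_ge2[of p] by simp
    moreover have "2 / real p ^ 2 \<ge> 0" by simp
    ultimately show "0 \<le> 1 + (2 / real p ^ 2 - 1 / real p)" by linarith
  qed
  also have "(\<Sum>p\<in>P. 2 / real p ^ 2 - 1 / real p) = 2 * (\<Sum>p\<in>P. 1 / real p ^ 2) - recip"
    by (simp add: sum_subtractf sum_distrib_left recip_def)
  also have "exp \<dots> \<le> exp (2 - recip)" using sq by simp
  finally have 1: "(\<Prod>p\<in>P. 1 - 1 / real p + 2 / real p ^ 2) \<le> exp (2 - recip)" .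
  have "(\<Prod>p\<in>P. 1 + 4 * (1 + real p) / real p ^ 2) \<le> exp (\<Sum>p\<in>P. 4 * (1 + real p) / real p ^ 2)"
    by (rule prod_le_exp_sum[OF finP]) auto
  also have "(\<Sum>p\<in>P. 4 * (1 + real p) / real p ^ 2) = (\<Sum>p\<in>P. 4 * (1 / real p ^ 2) + 4 * (1 / real p))"
  proof (intro sum.cong refl)
    fix p assume "p \<in> P"
    then have "real p \<ge> 2" by (rule P_ge2)
    then show "4 * (1 + real p) / real p ^ 2 = 4 * (1 / real p ^ 2) + 4 * (1 / real p)"
      by (simp add: field_simps power2_eq_square)
  qed
  also have "\<dots> = 4 * (\<Sum>p\<in>P. 1 / real p ^ 2) + 4 * recip"
    by (simp only: sum.distrib sum_distrib_left[symmetric] recip_def)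
  also have "exp \<dots> \<le> exp (4 + 4 * recip)" using sq by simp
  finally have 2: "(\<Prod>p\<in>P. 1 + 4 * (1 + real p) / real p ^ 2) \<le> exp (4 + 4 * recip)" .
  have 3: "(\<Prod>p\<in>P. 1 + 2 / real p)\<^sup>2 \<le> (exp (2 * recip))\<^sup>2"
    by (intro power_mono prod_one_plus_le prod_nonneg) auto
  have "(1/4) ^ N * ((\<Prod>p\<in>P. 1 + 2 / real p)\<^sup>2 * (\<Prod>p\<in>P. 1 + 4 * (1 + real p) / real p ^ 2)) \<le>
     (1/2) ^ N * ((exp (2 * recip))\<^sup>2 * exp (4 + 4 * recip))"
  proof (rule mult_mono)
    show "(1/4) ^ N \<le> (1/2::real) ^ N" by (intro power_mono) auto
    show "(\<Prod>p\<in>P. 1 + 2 / real p)\<^sup>2 * (\<Prod>p\<in>P. 1 + 4 * (1 + real p) / real p ^ 2) \<le> (exp (2 * recip))\<^sup>2 * exp (4 + 4 * recip)"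
      by (rule mult_mono[OF 3 2]) (auto intro!: prod_nonneg)
  qed (auto intro!: prod_nonneg mult_nonneg_nonneg)
  also have "(exp (2 * recip))\<^sup>2 * exp (4 + 4 * recip) = exp (8 * recip + 4)"
    by (simp add: power2_eq_square flip: exp_add)
  finally show ?thesis unfolding density_def using 1 by simp
qed

lemma total_le: "\<bar>total\<bar> \<le> 1 + (1/2) ^ N * exp (2 * recip)"
proof -
  have "\<bar>total\<bar> \<le> \<bar>\<Prod>p\<in>P. 1 - 1 / real p\<bar> + (1/2) ^ N * (\<Prod>p\<in>P. 1 + 2 / real p)"
    using brun_tail_bound[OF finP, of "{}" N] by (simp add: total_def prime_gt_0_nat primeP)
  also have "\<bar>\<Prod>p\<in>P. 1 - 1 / real p\<bar> \<le> 1"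
    unfolding abs_prod
  proof (rule prod_le_1)
    fix p assume "p \<in> P"
    then have "0 \<le> 1 / real p" "1 / real p \<le> 1" using P_ge2[of p] by auto
    then show "0 \<le> \<bar>1 - 1 / real p\<bar> \<and> \<bar>1 - 1 / real p\<bar> \<le> 1" by linarith
  qed
  also have "(\<Prod>p\<in>P. 1 + 2 / real p) \<le> exp (2 * recip)" by (rule prod_one_plus_le) simp
  finally show ?thesis by simp
qed

text \<open>Brun's pure sieve: the truncated Moebius sum is exact unless \<open>n\<close> has more than \<open>N\<close> prime factors in \<open>P\<close>.\<close>
lemma sieved_square_le:
  assumes "n > 0"
  shows "(sieved n)\<^sup>2 \<le> (\<Prod>p\<in>prime_factors n. if p \<in> P then 0 else 1) + (1/2) ^ N * (\<Prod>p\<in>prime_factors n. 8)"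
proof -
  define Q where "Q = {p\<in>P. p dvd n}"
  have finQ: "finite Q" using finP by (simp add: Q_def)
  have Qpf: "Q \<subseteq> prime_factors n" using assms primeP by (auto simp: Q_def prime_factors_dvd)
  have dvd: "\<Prod>A dvd n \<longleftrightarrow> A \<subseteq> Q" if A: "A \<in> brun P N" for A
  proof
    assume "\<Prod>A dvd n"
    then show "A \<subseteq> Q" using brun_subset[OF A] brun_finite[OF A]
      by (auto simp: Q_def intro: dvd_trans[OF dvd_prodI])
  next
    assume "A \<subseteq> Q"
    then show "\<Prod>A dvd n" using primeP by (intro prod_coprime_dvd) (auto simp: Q_def intro!: primes_coprime)
  qed
  have eq: "sieved n = (\<Sum>A | A \<subseteq> Q \<and> card A \<le> N. (-1) ^ card A)"
  proof -
    have "sieved n = (\<Sum>A\<in>brun P N. if A \<subseteq> Q then (-1) ^ card A else 0)"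
      unfolding sieved_def using dvd by (intro sum.cong) auto
    also have "\<dots> = (\<Sum>A\<in>{A\<in>brun P N. A \<subseteq> Q}. (-1) ^ card A)"
      using finite_brun by (simp add: sum.inter_filter)
    also have "{A\<in>brun P N. A \<subseteq> Q} = {A. A \<subseteq> Q \<and> card A \<le> N}"
      by (auto simp: brun_def Q_def)
    finally show ?thesis .
  qed
  show ?thesis
  proof (cases "card Q \<le> N")
    case True
    have "card A \<le> N" if "A \<subseteq> Q" for A using card_mono[OF finQ that] True by linarith
    then have "{A. A \<subseteq> Q \<and> card A \<le> N} = Pow Q" by auto
    then have "sieved n = (\<Sum>A\<in>Pow Q. (\<Prod>p\<in>A. -1) * (\<Prod>p\<in>Q - A. 1))" unfolding eq by simp
    also have "\<dots> = (\<Prod>p\<in>Q. -1 + 1)" by (rule prod_add[OF finQ, symmetric])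
    finally have s: "sieved n = (if Q = {} then 1 else 0)" using finQ by auto
    show ?thesis
    proof (cases "Q = {}")
      case True
      then have "(\<Prod>p\<in>prime_factors n. if p \<in> P then 0 else 1) = (1::real)"
        by (intro prod.neutral) (auto simp: Q_def in_prime_factors_imp_dvd)
      then show ?thesis using s True by simp
    next
      case False
      have "0 \<le> (\<Prod>p\<in>prime_factors n. if p \<in> P then 0 else (1::real))" by (rule prod_nonneg) auto
      then show ?thesis using s False by simp
    qed
  next
    case False
    have "\<bar>sieved n\<bar> \<le> (\<Sum>A | A \<subseteq> Q \<and> card A \<le> N. \<bar>(-1) ^ card A\<bar>)" unfolding eq by (rule sum_abs)
    also have "\<dots> \<le> (\<Sum>A\<in>Pow Q. 1)" using finQ by (simp) (intro card_mono, auto)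
    also have "\<dots> = 2 ^ card Q" using finQ by (simp add: card_Pow)
    finally have "\<bar>sieved n\<bar>\<^sup>2 \<le> (2 ^ card Q)\<^sup>2" by (intro power_mono) auto
    \<comment> \<open>The trivial bound is affordable because c = card Q exceeds N: 4^c = 2^-c 8^c
      and 2^-c \<le> 2^-N.\<close>
    also have "(2 ^ card Q)\<^sup>2 = (1/2::real) ^ card Q * 8 ^ card Q"
      using power_mult[of "2::real" "card Q" 2] power_mult[of "2::real" 2 "card Q"]
      by (simp add: mult.commute flip: power_mult_distrib)
    also have "\<dots> \<le> (1/2) ^ N * 8 ^ card (prime_factors n)"
      using False by (intro mult_mono power_decreasing power_increasing card_mono Qpf) auto
    finally have "(sieved n)\<^sup>2 \<le> (1/2) ^ N * (\<Prod>p\<in>prime_factors n. 8)" by simp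
    moreover have "0 \<le> (\<Prod>p\<in>prime_factors n. if p \<in> P then 0 else (1::real))" by (rule prod_nonneg) auto
    ultimately show ?thesis by linarith
  qed
qed

text \<open>All prime factors of n \<le> T are at most T, so \<open>sum_smooth_le_prod\<close>
  applies: with weight 0 on \<open>P\<close> and 1 elsewhere for the sieved integers, with weight 8
  for the truncation error. Only the primes up to T outside \<open>P\<close> survive in the first
  product.\<close>

lemma sum_sieved_square_le:
  assumes P: "P \<subseteq> primes_upto T" and M: "M = nat \<lfloor>T\<rfloor>" and T: "T \<ge> 0"
  shows "(\<Sum>n\<in>{1..M}. (sieved n)\<^sup>2 / real n) \<le>
    exp (prime_recip_sum T - recip + 1) + (1/2) ^ N * exp (8 * prime_recip_sum T + 8)"
proof -
  let ?S = "primes_upto T"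
  have M_T: "primes_upto (real M) = ?S" unfolding M using T by (rule primes_upto_floor)
  have all: "{n. n \<in> {1..M} \<and> prime_factors n \<subseteq> ?S} = {1..M}"
    unfolding M_T[symmetric] unfolding primes_upto_def
    by (auto dest: in_prime_factors_imp_prime dvd_imp_le[OF in_prime_factors_imp_dvd])
  have sm: "(\<Sum>n\<in>{1..M}. (\<Prod>p\<in>prime_factors n. w p) / real n) \<le> exp (\<Sum>p\<in>?S. w p / real p + w p * (1 / (real p * (real p - 1))))"
    if w: "\<And>p. w p \<ge> 0" for w :: "nat \<Rightarrow> real"
  proof -
    have p2: "p \<in> ?S \<Longrightarrow> real p \<ge> 2" for p using prime_ge_2_nat by (fastforce simp: primes_upto_def)
    have "(\<Sum>n\<in>{1..M}. (\<Prod>p\<in>prime_factors n. w p) / real n) \<le> (\<Prod>p\<in>?S. 1 + w p / (real p - 1))"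
      using sum_smooth_le_prod[of ?S w M] w prime_primes_upto unfolding all by simp
    also have "\<dots> \<le> exp (\<Sum>p\<in>?S. w p / (real p - 1))"
      using w p2 by (intro prod_le_exp_sum add_nonneg_nonneg divide_nonneg_nonneg) force+
    also have "(\<Sum>p\<in>?S. w p / (real p - 1)) = (\<Sum>p\<in>?S. w p / real p + w p * (1 / (real p * (real p - 1))))"
    proof (intro sum.cong refl)
      fix p assume "p \<in> ?S"
      then have "real p \<ge> 2" by (rule p2)
      then show "w p / (real p - 1) = w p / real p + w p * (1 / (real p * (real p - 1)))"
        by (simp add: field_simps)
    qed
    finally show ?thesis .
  qed
  have tail: "(\<Sum>p\<in>?S. 1 / (real p * (real p - 1))) \<le> 1"
    by (rule sum_inverse_squares_le[OF finite_primes_upto]) (auto simp: primes_upto_def prime_ge_2_nat)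
  have nn: "1 / (real p * (real p - 1)) \<ge> 0" for p by (cases p) auto
  have "(\<Sum>n\<in>{1..M}. (\<Prod>p\<in>prime_factors n. if p \<in> P then 0 else 1) / real n) \<le>
     exp (\<Sum>p\<in>?S. (if p \<in> P then 0 else 1) / real p + (if p \<in> P then 0 else 1) * (1 / (real p * (real p - 1))))"
    by (rule sm) auto
  also have "\<dots> \<le> exp ((\<Sum>p\<in>?S. 1 / real p - (if p \<in> P then 1 / real p else 0)) + (\<Sum>p\<in>?S. 1 / (real p * (real p - 1))))"
    unfolding sum.distrib[symmetric] exp_le_cancel_iff using nn by (intro sum_mono) auto
  also have "(\<Sum>p\<in>?S. 1 / real p - (if p \<in> P then 1 / real p else 0)) = prime_recip_sum T - recip"
    unfolding sum_subtractf prime_recip_sum_def recip_def using P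
    by (simp add: sum.inter_filter[symmetric] Int_absorb1 Collect_conj_eq)
  also have "exp (prime_recip_sum T - recip + (\<Sum>p\<in>?S. 1 / (real p * (real p - 1)))) \<le> exp (prime_recip_sum T - recip + 1)"
    using tail by simp
  finally have 1: "(\<Sum>n\<in>{1..M}. (\<Prod>p\<in>prime_factors n. if p \<in> P then 0 else 1) / real n) \<le> exp (prime_recip_sum T - recip + 1)" .
  have "(\<Sum>n\<in>{1..M}. (\<Prod>p\<in>prime_factors n. 8) / real n) \<le>
     exp (\<Sum>p\<in>?S. 8 / real p + 8 * (1 / (real p * (real p - 1))))"
    by (rule sm) auto
  also have "(\<Sum>p\<in>?S. 8 / real p + 8 * (1 / (real p * (real p - 1)))) = 8 * prime_recip_sum T + 8 * (\<Sum>p\<in>?S. 1 / (real p * (real p - 1)))"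
    unfolding sum.distrib prime_recip_sum_def sum_distrib_left by simp
  also have "exp \<dots> \<le> exp (8 * prime_recip_sum T + 8)" using tail by simp
  finally have 2: "(\<Sum>n\<in>{1..M}. (\<Prod>p\<in>prime_factors n. 8) / real n) \<le> exp (8 * prime_recip_sum T + 8)" .
  have "(\<Sum>n\<in>{1..M}. (sieved n)\<^sup>2 / real n) \<le>
     (\<Sum>n\<in>{1..M}. ((\<Prod>p\<in>prime_factors n. if p \<in> P then 0 else 1) + (1/2) ^ N * (\<Prod>p\<in>prime_factors n. 8)) / real n)"
    by (intro sum_mono divide_right_mono sieved_square_le) auto
  also have "\<dots> = (\<Sum>n\<in>{1..M}. (\<Prod>p\<in>prime_factors n. if p \<in> P then 0 else 1) / real n) +
     (1/2) ^ N * (\<Sum>n\<in>{1..M}. (\<Prod>p\<in>prime_factors n. 8) / real n)"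
    by (simp add: add_divide_distrib sum.distrib sum_distrib_left)
  also have "\<dots> \<le> exp (prime_recip_sum T - recip + 1) + (1/2) ^ N * exp (8 * prime_recip_sum T + 8)"
    using 1 2 by (intro add_mono mult_left_mono) auto
  finally show ?thesis .
qed

end

text \<open>
  The mollifier has length at most \<open>T\<^sup>1\<^sup>/\<^sup>1\<^sup>0\<^sup>0\<close>, while the primes between \<open>prime_cutoff T\<close> and \<open>T\<close>
  contribute only \<open>O(ln ln ln T)\<close> to the variance. The exponent is junk (division by 0) when \<open>sieve_level T = 0\<close>.
\<close>
definition sieve_level :: "real \<Rightarrow> nat" where
  "sieve_level T = nat \<lceil>(ln (ln T))\<^sup>2\<rceil>"

definition prime_cutoff :: "real \<Rightarrow> real" where
  "prime_cutoff T = T powr (1 / (100 * real (sieve_level T)))"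

definition small_primes :: "real \<Rightarrow> nat set" where
  "small_primes T = primes_upto (prime_cutoff T)"

section \<open>Asymptotics of the cutoff, the level and the prime sums\<close>

lemma prod_brun_le:
  assumes A: "A \<in> brun (primes_upto x) N" and x: "x \<ge> 1"
  shows "real (\<Prod>A) \<le> x ^ N"
proof -
  have "real (\<Prod>A) \<le> (\<Prod>p\<in>A. x)"
    unfolding of_nat_prod using A by (intro prod_mono) (auto simp: brun_def primes_upto_def)
  also have "\<dots> \<le> x ^ N" using A x by (auto simp: brun_def intro!: power_increasing)
  finally show ?thesis .
qed

text \<open>Unique factorisation recovers a set as the set of prime factors of its product, so there
  are no more sets than possible products.\<close>

lemma card_brun_le:
  assumes x: "x \<ge> 1"
  shows "real (card (brun (primes_upto x) N)) \<le> x ^ N"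
proof -
  let ?B = "brun (primes_upto x) N"
  have pf: "prime_factors (\<Prod>A) = A" if "A \<in> ?B" for A
  proof -
    have A: "finite A" "\<And>p. p \<in> A \<Longrightarrow> prime p"
      using that finite_subset[OF _ finite_primes_upto] by (auto simp: brun_def primes_upto_def)
    have nz: "\<Prod>A \<noteq> 0" using A(1) A(2)[of 0] by auto
    show ?thesis
    proof (rule Set.set_eqI)
      fix q
      have "q \<in> prime_factors (\<Prod>A) \<longleftrightarrow> prime q \<and> (\<exists>p\<in>A. q dvd p)"
        using nz A(1) by (auto simp: prime_factors_dvd prime_dvd_prod_iff)
      also have "\<dots> \<longleftrightarrow> q \<in> A" using A(2) by (metis dvd_refl primes_dvd_imp_eq)
      finally show "q \<in> prime_factors (\<Prod>A) \<longleftrightarrow> q \<in> A" .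
    qed
  qed
  have "card ?B \<le> card {1..nat \<lfloor>x ^ N\<rfloor>}"
  proof (rule card_inj_on_le[where f = "\<lambda>A. \<Prod>A"])
    show "inj_on (\<lambda>A. \<Prod>A) ?B" by (rule inj_on_inverseI[where g = prime_factors]) (rule pf)
    show "(\<lambda>A. \<Prod>A) ` ?B \<subseteq> {1..nat \<lfloor>x ^ N\<rfloor>}"
    proof safe
      fix A assume A: "A \<in> ?B"
      have "\<Prod>A > 0" using A by (auto simp: brun_def primes_upto_def prime_gt_0_nat intro!: prod_pos)
      moreover have "\<Prod>A \<le> nat \<lfloor>x ^ N\<rfloor>" using prod_brun_le[OF A x] by (rule le_nat_floor)
      ultimately show "\<Prod>A \<in> {1..nat \<lfloor>x ^ N\<rfloor>}" by simp
    qed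
  qed simp
  also have "\<dots> = nat \<lfloor>x ^ N\<rfloor>" by simp
  finally have "real (card ?B) \<le> real (nat \<lfloor>x ^ N\<rfloor>)" by simp
  also have "\<dots> \<le> x ^ N" using x by (intro of_nat_floor) auto
  finally show ?thesis .
qed

lemma prime_cutoff_power:
  assumes "T > 1" "sieve_level T > 0"
  shows "prime_cutoff T ^ sieve_level T = T powr (1/100)"
  unfolding prime_cutoff_def using assms by (simp add: powr_realpow[symmetric] powr_powr)

lemma prime_cutoff_ge_1: "T \<ge> 1 \<Longrightarrow> prime_cutoff T \<ge> 1"
  unfolding prime_cutoff_def by (intro ge_one_powr_ge_zero) auto

lemma sieve_small_primes:
  assumes "T > 1" "sieve_level T > 0"
  shows "sieve (small_primes T) (sieve_level T) (T powr (1/100))"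
  unfolding small_primes_def prime_cutoff_power[OF assms, symmetric]
  using prime_cutoff_ge_1[of T] assms
  by unfold_locales (auto intro: prime_primes_upto prod_brun_le card_brun_le simp del: of_nat_prod)

lemma lnln_at_top: "filterlim (\<lambda>T::real. ln (ln T)) at_top at_top"
  by real_asymp

lemma sieve_level_ge: "real (sieve_level T) \<ge> (ln (ln T))\<^sup>2"
  unfolding sieve_level_def by linarith

lemma sieve_level_le: "real (sieve_level T) \<le> (ln (ln T))\<^sup>2 + 1"
proof -
  have "0 \<le> (ln (ln T))\<^sup>2" by simp
  then show ?thesis unfolding sieve_level_def by linarith
qed

lemma eventually_sieve_level_pos: "\<forall>\<^sub>F T in at_top. sieve_level T > 0"
proof -
  have "\<forall>\<^sub>F T::real in at_top. ln (ln T) > 1" using lnln_at_top by (simp add: filterlim_at_top_dense)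
  then show ?thesis
  proof eventually_elim
    case (elim T)
    then have "(ln (ln T))\<^sup>2 > 0" by simp
    then show ?case using sieve_level_ge[of T] by (cases "sieve_level T") auto
  qed
qed

text \<open>2^-N with N \<ge> L^2 beats every power exp(aL) of ln T. The truncation errors of the
  sieve and of the Euler product are absorbed this way.\<close>

lemma half_power_sieve_level:
  assumes "c > 0" "a > 0"
  shows "\<forall>\<^sub>F T in at_top. (1/2) ^ sieve_level T * exp (a * ln (ln T) + b) \<le> (c::real)"
proof -
  have "((\<lambda>L. (1/2) powr (L\<^sup>2) * exp (a * L + b)) \<longlongrightarrow> 0) at_top"
    using assms(2) by real_asymp
  then have "((\<lambda>T. (1/2) powr ((ln (ln T))\<^sup>2) * exp (a * ln (ln T) + b)) \<longlongrightarrow> 0) at_top"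
    by (rule filterlim_compose[OF _ lnln_at_top])
  then have "\<forall>\<^sub>F T in at_top. (1/2) powr ((ln (ln T))\<^sup>2) * exp (a * ln (ln T) + b) < c"
    by (rule order_tendstoD(2)) (rule assms)
  then show ?thesis
  proof eventually_elim
    case (elim T)
    have "(1/2) ^ sieve_level T = (1/2::real) powr real (sieve_level T)" by (simp add: powr_realpow)
    also have "\<dots> \<le> (1/2) powr ((ln (ln T))\<^sup>2)" by (rule powr_mono') (use sieve_level_ge in auto)
    finally have "(1/2) ^ sieve_level T * exp (a * ln (ln T) + b) \<le> (1/2) powr ((ln (ln T))\<^sup>2) * exp (a * ln (ln T) + b)"
      by (intro mult_right_mono) auto
    with elim show ?case by linarith
  qed
qed

lemma lnln_prime_cutoff:
  assumes "T > 1" "sieve_level T > 0"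
  shows "ln (ln (prime_cutoff T)) = ln (ln T) - ln (100 * real (sieve_level T))"
  unfolding prime_cutoff_def using assms by (simp add: ln_powr ln_div)

lemma prime_cutoff_at_top: "filterlim prime_cutoff at_top at_top"
proof -
  have "filterlim (\<lambda>T::real. exp (ln T / (100 * ((ln (ln T))\<^sup>2 + 1)))) at_top at_top" by real_asymp
  moreover have "\<forall>\<^sub>F T in at_top. exp (ln T / (100 * ((ln (ln T))\<^sup>2 + 1))) \<le> prime_cutoff T"
    using eventually_sieve_level_pos eventually_gt_at_top[of 1]
  proof eventually_elim
    case (elim T)
    have "ln T / (100 * ((ln (ln T))\<^sup>2 + 1)) \<le> ln T / (100 * real (sieve_level T))"
      using elim sieve_level_le[of T] by (intro divide_left_mono) (auto intro!: mult_pos_pos add_nonneg_pos)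
    then show ?case unfolding prime_cutoff_def powr_def using elim by simp
  qed
  ultimately show ?thesis by (rule filterlim_at_top_mono)
qed

lemma eventually_prime_recip_sum:
  obtains C where "C \<ge> 0"
    "\<forall>\<^sub>F T in at_top. \<bar>prime_recip_sum T - ln (ln T)\<bar> \<le> C \<and>
       \<bar>prime_recip_sum (prime_cutoff T) - (ln (ln T) - ln (100 * real (sieve_level T)))\<bar> \<le> C"
proof -
  obtain C where C: "C \<ge> 0" "\<And>x. x \<ge> 2 \<Longrightarrow> \<bar>prime_recip_sum x - ln (ln x)\<bar> \<le> C"
    using mertens_second by blast
  have "\<forall>\<^sub>F T in at_top. prime_cutoff T \<ge> 2"
    using prime_cutoff_at_top by (simp add: filterlim_at_top)
  with eventually_ge_at_top[of 2] eventually_sieve_level_pos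
  have "\<forall>\<^sub>F T in at_top. \<bar>prime_recip_sum T - ln (ln T)\<bar> \<le> C \<and>
       \<bar>prime_recip_sum (prime_cutoff T) - (ln (ln T) - ln (100 * real (sieve_level T)))\<bar> \<le> C"
    by eventually_elim (use C lnln_prime_cutoff in force)
  with C(1) show ?thesis by (rule that)
qed

text \<open>Two contributions reach the order N. The sieved integers give
  exp(\<open>prime_recip_sum T - recip\<close>), where the exponent is ln (100 N) + O(1) by Mertens;
  and \<open>density\<close> is O(N / ln T) against the factor ln (3 y^2) \<le> ln T.\<close>

theorem fracsum_mean_square_eventually:
  obtains C where "C > 0"
    "\<forall>\<^sub>F T in at_top. (\<integral>\<^sup>+u\<in>{0<..}. ennreal ((sieve.fracsum (small_primes T) (sieve_level T) (1/T) u)\<^sup>2 / u\<^sup>2) \<partial>lborel) \<le>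
       ennreal (C * real (sieve_level T) / T)"
proof -
  obtain C where C: "C \<ge> 0" and ev: "\<forall>\<^sub>F T in at_top. \<bar>prime_recip_sum T - ln (ln T)\<bar> \<le> C \<and>
       \<bar>prime_recip_sum (prime_cutoff T) - (ln (ln T) - ln (100 * real (sieve_level T)))\<bar> \<le> C"
    using eventually_prime_recip_sum by blast
  \<comment> \<open>9 = 1 + 2 * 4, with 4 bounding the square of \<open>total\<close>; 4, 16 and 28
    are the coefficients in \<open>fracsum_mean_square\<close>, and the brackets are the bounds
    \<open>s\<close> and \<open>d\<close> below divided by N.\<close>
  define K where "K = 9 + 4 * (100 * exp (2 * C + 1) + 1) + 16 * (exp (2 + C) * (100 * ln 3 + 2) + 1 + 1) + 28"
  have "\<forall>\<^sub>F T::real in at_top. ln (3 * (T powr (1/100))\<^sup>2) \<le> ln T" by real_asymp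
  moreover have "\<forall>\<^sub>F T::real in at_top. ln T \<ge> 1" by real_asymp
  moreover have "\<forall>\<^sub>F T::real in at_top. (T powr (1/100)) ^ 4 / sqrt T \<le> 1" by real_asymp
  moreover have "\<forall>\<^sub>F T::real in at_top. T > 1" "\<forall>\<^sub>F T::real in at_top. ln (ln T) \<ge> 1" by real_asymp+
  moreover note ev eventually_sieve_level_pos half_power_sieve_level[of 1 2 "2 * C", simplified] half_power_sieve_level[of 1 8 "8 * C + 8", simplified]
    half_power_sieve_level[of 1 9 "8 * C + 4", simplified]
  ultimately have "\<forall>\<^sub>F T in at_top. (\<integral>\<^sup>+u\<in>{0<..}. ennreal ((sieve.fracsum (small_primes T) (sieve_level T) (1/T) u)\<^sup>2 / u\<^sup>2) \<partial>lborel) \<le>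
       ennreal (K * real (sieve_level T) / T)"
  proof eventually_elim
    case (elim T)
    define N P y L where "N = sieve_level T" and "P = small_primes T" and "y = T powr (1/100)" and "L = ln (ln T)"
    have T: "T > 1" and N: "N > 0" using elim by (auto simp: N_def)
    have N1: "real N \<ge> 1" using N by simp
    interpret sieve P N y unfolding P_def N_def y_def by (rule sieve_small_primes) (use elim in auto)
    have recip: "recip = prime_recip_sum (prime_cutoff T)"
      unfolding recip_def unfolding prime_recip_sum_def P_def small_primes_def ..
    have sub: "P \<subseteq> primes_upto T"
    proof -
      have "prime_cutoff T \<le> T powr 1" unfolding prime_cutoff_def using T N N1
        by (intro powr_mono) (auto simp: N_def field_simps)
      then show ?thesis unfolding P_def small_primes_def using T by (intro primes_upto_mono) auto
    qed
    have lnN: "ln (100 * real N) \<ge> 0" using N1 by (intro ln_ge_zero) auto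
    have r: "recip \<le> L + C" "L - ln (100 * real N) - C \<le> recip" "prime_recip_sum T \<le> L + C"
      using elim(6) lnN unfolding recip L_def N_def by linarith+
    have h: "(1/2) ^ N * exp (2 * recip) \<le> 1" "(1/2) ^ N * exp (8 * prime_recip_sum T + 8) \<le> 1"
      "(1/2) ^ N * exp (8 * recip + 4) * exp L \<le> 1"
    proof -
      have *: "(1/2) ^ N * exp x \<le> 1" if "x \<le> x'" "(1/2) ^ N * exp x' \<le> 1" for x x' :: real
      proof -
        have "(1/2) ^ N * exp x \<le> (1/2) ^ N * exp x'" using that by (intro mult_left_mono) auto
        then show ?thesis using that by linarith
      qed
      show "(1/2) ^ N * exp (2 * recip) \<le> 1"
        by (rule *[of _ "2 * L + 2 * C"]) (use r elim(8) in \<open>auto simp: N_def L_def\<close>)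
      show "(1/2) ^ N * exp (8 * prime_recip_sum T + 8) \<le> 1"
        by (rule *[of _ "8 * L + (8 * C + 8)"]) (use r elim(9) in \<open>auto simp: N_def L_def\<close>)
      \<comment> \<open>The additional factor exp L = ln T compensates the logarithm that multiplies
        \<open>density\<close>.\<close>
      have "(1/2) ^ N * exp (8 * recip + 4 + L) \<le> 1"
        by (rule *[of _ "9 * L + (8 * C + 4)"]) (use r elim(10) in \<open>auto simp: N_def L_def\<close>)
      then show "(1/2) ^ N * exp (8 * recip + 4) * exp L \<le> 1" by (simp add: exp_add mult.assoc)
    qed
    have eL: "exp L = ln T" using T by (simp add: L_def)
    have t: "total\<^sup>2 \<le> 4" using power_mono[of "\<bar>total\<bar>" 2 2] total_le h(1) by simp
    have "(\<Sum>n\<in>{1..nat \<lfloor>T\<rfloor>}. (sieved n)\<^sup>2 / real n) \<le> exp (prime_recip_sum T - recip + 1) + 1"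
      using sum_sieved_square_le[OF sub refl] h(2) T by simp
    also have "exp (prime_recip_sum T - recip + 1) \<le> exp (ln (100 * real N) + (2 * C + 1))"
      using r by simp
    also have "\<dots> = 100 * real N * exp (2 * C + 1)" using N1 by (simp add: exp_add)
    finally have s: "(\<Sum>n\<in>{1..nat \<lfloor>T\<rfloor>}. (sieved n)\<^sup>2 / real n) \<le> (100 * exp (2 * C + 1) + 1) * real N"
      using N1 by (simp add: algebra_simps)
    have d: "density * ln (3 * y\<^sup>2) \<le> (exp (2 + C) * (100 * ln 3 + 2) + 1 + 1) * real N"
    proof -
      have ly: "ln (3 * y\<^sup>2) = ln 3 + ln T / 50" using T by (simp add: y_def ln_mult ln_realpow ln_powr)
      have ly0: "0 \<le> ln (3 * y\<^sup>2)" "ln (3 * y\<^sup>2) \<le> ln T" using ly T elim(1) by (auto simp: y_def)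
      have "density * ln (3 * y\<^sup>2) \<le> (exp (2 - recip) + (1/2) ^ N * exp (8 * recip + 4)) * ln (3 * y\<^sup>2)"
        using density_le ly0 by (intro mult_right_mono) auto
      also have "\<dots> \<le> exp (2 + C - L + ln (100 * real N)) * ln (3 * y\<^sup>2) + (1/2) ^ N * exp (8 * recip + 4) * exp L"
        unfolding distrib_right using r ly0 eL by (intro add_mono mult_mono) auto
      also have "exp (2 + C - L + ln (100 * real N)) * ln (3 * y\<^sup>2) = exp (2 + C) * (100 * real N) * (ln (3 * y\<^sup>2) / ln T)"
        using N1 T by (simp add: exp_add exp_diff eL)
      also have "ln (3 * y\<^sup>2) / ln T \<le> ln 3 + 1 / 50"
      proof -
        have "ln 3 / ln T \<le> ln 3 / 1" using elim(2) by (intro divide_left_mono) auto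
        then show ?thesis unfolding ly using elim(2) by (simp add: add_divide_distrib)
      qed
      also have "exp (2 + C) * (100 * real N) * (ln 3 + 1 / 50) = exp (2 + C) * (100 * ln 3 + 2) * real N"
        by (simp add: algebra_simps)
      finally have "density * ln (3 * y\<^sup>2) \<le> exp (2 + C) * (100 * ln 3 + 2) * real N + 1"
        using h(3) N1 by simp
      then show ?thesis using N1 by (simp add: algebra_simps)
    qed
    have "(\<integral>\<^sup>+u\<in>{0<..}. ennreal ((fracsum (1/T) u)\<^sup>2 / u\<^sup>2) \<partial>lborel) \<le>
      ennreal ((1 / T) * (1 + 2 * total\<^sup>2 + 4 * (\<Sum>n\<in>{1..nat \<lfloor>T\<rfloor>}. (sieved n)\<^sup>2 / real n) + 16 * density * ln (3 * y\<^sup>2) + 28 * y ^ 4 / sqrt T))"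
      by (rule fracsum_mean_square[OF _ refl]) (use T in simp)
    also have "\<dots> \<le> ennreal ((1 / T) * (K * real N))"
    proof (intro ennreal_leI mult_left_mono)
      have y: "y ^ 4 / sqrt T \<le> 1" using elim(3) by (simp add: y_def)
      have "1 + 2 * total\<^sup>2 + 28 * (y ^ 4 / sqrt T) \<le> 37 * real N"
        using t y N1 by linarith
      then show "1 + 2 * total\<^sup>2 + 4 * (\<Sum>n\<in>{1..nat \<lfloor>T\<rfloor>}. (sieved n)\<^sup>2 / real n) + 16 * density * ln (3 * y\<^sup>2) + 28 * y ^ 4 / sqrt T \<le> K * real N"
        using s d unfolding K_def by (simp add: algebra_simps)
    qed (use T in auto)
    finally show ?case by (simp add: N_def P_def)
  qed
  moreover have "K > 0" unfolding K_def by (intro add_pos_pos mult_pos_pos) auto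
  ultimately show ?thesis using that by blast
qed

section \<open>Jensen's inequality in a half-plane\<close>

text \<open>On the circle z cnj z = 1, so once the constant coefficients of both polynomials are
  split off, a factor z cancels against a conjugate one and both degrees drop.\<close>

lemma Re_poly_cnj_poly:
  fixes A B :: "complex poly"
  shows "\<exists>C. \<forall>z. norm z = 1 \<longrightarrow> Re (poly A z * cnj (poly B z)) = Re (poly C z)"
proof (induction A arbitrary: B)
  case 0
  show ?case by (rule exI[of _ 0]) simp
next
  case (pCons a A)
  obtain b B' where B: "B = pCons b B'" by (cases B)
  obtain C where C: "\<And>z. norm z = 1 \<Longrightarrow> Re (poly A z * cnj (poly B' z)) = Re (poly C z)"
    using pCons.IH[of B'] by blast
  show ?case
  proof (intro exI allI impI)
    fix z :: complex assume z: "norm z = 1"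
    then have "z * cnj z = 1" by (simp add: complex_norm_square[symmetric])
    then have "poly (pCons a A) z * cnj (poly B z) =
      a * cnj (poly B z) + cnj b * (z * poly A z) + poly A z * cnj (poly B' z)"
      by (simp add: B algebra_simps)
    then have "Re (poly (pCons a A) z * cnj (poly B z)) =
      Re (a * cnj (poly B z)) + Re (cnj b * (z * poly A z)) + Re (poly A z * cnj (poly B' z))" by simp
    also have "Re (a * cnj (poly B z)) = Re (cnj a * poly B z)"
      by simp
    finally show "Re (poly (pCons a A) z * cnj (poly B z)) = Re (poly (Polynomial.smult (cnj a) B + Polynomial.smult (cnj b) (pCons 0 A) + C) z)"
      using C[OF z] by (simp add: algebra_simps)
  qed
qed

text \<open>Products are the only hard case: 2 Re x Re y = Re (x y) + Re (x cnj y), and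
  \<open>Re_poly_cnj_poly\<close> removes the conjugate.\<close>

lemma real_polynomial_on_circle:
  fixes g :: "complex \<Rightarrow> real"
  assumes "real_polynomial_function g"
  shows "\<exists>Q. \<forall>z. norm z = 1 \<longrightarrow> g z = Re (poly Q z)"
  using assms
proof (induction rule: real_polynomial_function.induct)
  case (linear f)
  show ?case
  proof (intro exI allI impI)
    fix z :: complex
    have "z = Re z *\<^sub>R 1 + Im z *\<^sub>R \<i>" by (simp add: complex_eq_iff)
    then have "f z = f (Re z *\<^sub>R 1 + Im z *\<^sub>R \<i>)" by (rule arg_cong)
    also have "\<dots> = Re z * f 1 + Im z * f \<i>"
      using linear by (simp only: bounded_linear.linear linear_add linear_scale real_scaleR_def)
    finally show "f z = Re (poly [:0, of_real (f 1) - \<i> * of_real (f \<i>):] z)" by (simp add: algebra_simps)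
  qed
next
  case (const c)
  show ?case by (rule exI[of _ "[:of_real c:]"]) simp
next
  case (add f g)
  then obtain A B where "\<forall>z. norm z = 1 \<longrightarrow> f z = Re (poly A z)" "\<forall>z. norm z = 1 \<longrightarrow> g z = Re (poly B z)" by blast
  then show ?case by (intro exI[of _ "A + B"]) simp
next
  case (mult f g)
  then obtain A B where AB: "\<forall>z. norm z = 1 \<longrightarrow> f z = Re (poly A z)" "\<forall>z. norm z = 1 \<longrightarrow> g z = Re (poly B z)" by blast
  obtain C where C: "\<And>z. norm z = 1 \<Longrightarrow> Re (poly A z * cnj (poly B z)) = Re (poly C z)"
    using Re_poly_cnj_poly by blast
  have hr: "Re x * Re y = (Re (x * y) + Re (x * cnj y)) / 2" for x y by (simp add: field_simps)
  show ?case
  proof (intro exI allI impI)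
    fix z :: complex assume z: "norm z = 1"
    then have "f z * g z = Re (poly A z) * Re (poly B z)" using AB by simp
    also have "\<dots> = (Re (poly A z * poly B z) + Re (poly C z)) / 2" unfolding hr C[OF z] ..
    finally show "f z * g z = Re (poly (Polynomial.smult (1/2) (A * B + C)) z)" by simp
  qed
qed

lemma has_integral_poly_circle:
  fixes Q :: "complex poly"
  shows "((\<lambda>\<theta>. Re (poly Q (cis \<theta>))) has_integral 2 * pi * Re (poly Q 0)) {0..2*pi}"
proof -
  have "((\<lambda>\<theta>. poly Q (cis \<theta>)) has_integral of_real (2 * pi) * poly Q 0) {0..2*pi}"
  proof (induction Q)
    case (pCons a Q)
    have mon: "((\<lambda>\<theta>. cis (real (Suc k) * \<theta>)) has_integral 0) {0..2*pi}" for k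
    proof -
      have "((\<lambda>\<theta>. cis (real (Suc k) * \<theta>)) has_integral
          (cis (real (Suc k) * (2*pi)) / (\<i> * of_nat (Suc k)) - cis (real (Suc k) * 0) / (\<i> * of_nat (Suc k)))) {0..2*pi}"
      proof (rule fundamental_theorem_of_calculus)
        fix x
        have "((\<lambda>w. exp (\<i> * of_nat (Suc k) * w) / (\<i> * of_nat (Suc k))) has_field_derivative exp (\<i> * of_nat (Suc k) * of_real x)) (at (of_real x))"
          by (auto intro!: derivative_eq_intros simp del: of_nat_Suc)
        then show "((\<lambda>\<theta>. cis (real (Suc k) * \<theta>) / (\<i> * of_nat (Suc k))) has_vector_derivative cis (real (Suc k) * x)) (at x within {0..2*pi})"
          by (auto dest!: has_vector_derivative_real_field simp: cis_conv_exp mult.assoc simp del: of_nat_Suc)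
      qed simp
      moreover have "cis (real (Suc k) * (2*pi)) = 1"
        using cis_multiple_2pi[of "real (Suc k)"] by (simp add: mult_ac)
      ultimately show ?thesis by simp
    qed
    have shift: "((\<lambda>\<theta>. cis \<theta> * poly Q (cis \<theta>)) has_integral 0) {0..2*pi}" for Q
    proof -
      have "((\<lambda>\<theta>. \<Sum>i\<le>degree Q. Polynomial.coeff Q i * cis (real (Suc i) * \<theta>)) has_integral (\<Sum>i\<le>degree Q. Polynomial.coeff Q i * 0)) {0..2*pi}"
        by (intro has_integral_sum has_integral_mult_right mon) auto
      moreover have "cis \<theta> * poly Q (cis \<theta>) = (\<Sum>i\<le>degree Q. Polynomial.coeff Q i * cis (real (Suc i) * \<theta>))" for \<theta>
        unfolding poly_altdef sum_distrib_left
      proof (intro sum.cong refl)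
        fix i
        have "cis (real (Suc i) * \<theta>) = cis \<theta> * cis \<theta> ^ i" using Complex.DeMoivre[of \<theta> "Suc i"] by (simp only: power_Suc)
        then show "cis \<theta> * (Polynomial.coeff Q i * cis \<theta> ^ i) = Polynomial.coeff Q i * cis (real (Suc i) * \<theta>)" by (simp only: mult_ac)
      qed
      ultimately show ?thesis by simp
    qed
    have "((\<lambda>\<theta>. a + cis \<theta> * poly Q (cis \<theta>)) has_integral (of_real (2 * pi) * a + 0)) {0..2*pi}"
      using has_integral_const_real[of a 0 "2*pi"]
      by (intro has_integral_add shift) (simp add: scaleR_conv_of_real)
    then show ?case by simp
  qed simp
  from has_integral_Re[OF this] show ?thesis by simp
qed

text \<open>Subharmonicity without zeros: \<open>ln |F|\<close> is dominated on the circle by the real part of a polynomial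
  (Stone--Weierstrass), so the maximum principle applies to \<open>F exp(-Q)\<close>.\<close>
lemma jensen_disc:
  assumes cont: "continuous_on (cball 0 1) F" and hol: "F holomorphic_on ball 0 1"
    and eps: "\<epsilon> > 0" and F0: "F 0 \<noteq> 0"
  shows "ln (norm (F 0)) \<le> 1 / (2 * pi) * integral {0..2*pi} (\<lambda>\<theta>. ln ((norm (F (cis \<theta>)))\<^sup>2 + \<epsilon>\<^sup>2) / 2)"
proof -
  \<comment> \<open>Adding \<epsilon>^2 keeps the logarithm finite at zeros of F, so that u is
    continuous on the circle, while exp u still dominates |F|.\<close>
  define u where "u = (\<lambda>z. ln ((norm (F z))\<^sup>2 + \<epsilon>\<^sup>2) / 2)"
  have pos: "(norm (F z))\<^sup>2 + \<epsilon>\<^sup>2 > 0" for z using eps by (simp add: add_nonneg_pos)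
  have cont_u: "continuous_on (sphere 0 1) u"
  proof -
    have "(norm (F z))\<^sup>2 + \<epsilon>\<^sup>2 \<noteq> 0" for z using pos[of z] by linarith
    then show ?thesis unfolding u_def
      by (intro continuous_intros continuous_on_subset[OF cont]) auto
  qed
  have cont_uc: "continuous_on {0..2*pi} (\<lambda>\<theta>. u (cis \<theta>))"
    by (rule continuous_on_compose2[OF cont_u]) (auto intro!: continuous_intros)
  have F_le: "norm (F z) \<le> exp (u z)" for z
  proof -
    have "exp (u z) = sqrt (exp (2 * u z))"
      by (rule real_sqrt_unique[symmetric]) (simp_all add: power2_eq_square flip: exp_add)
    also have "exp (2 * u z) = (norm (F z))\<^sup>2 + \<epsilon>\<^sup>2" using pos[of z] by (simp add: u_def)
    finally show ?thesis by (simp add: real_le_rsqrt)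
  qed
  have "ln (norm (F 0)) \<le> 1 / (2 * pi) * integral {0..2*pi} (\<lambda>\<theta>. u (cis \<theta>)) + e" if e: "e > 0" for e
  proof -
    have "e / 2 > 0" using e by simp
    then obtain g where g: "real_polynomial_function g" "\<And>z. z \<in> sphere 0 1 \<Longrightarrow> \<bar>u z - g z\<bar> < e / 2"
      using Stone_Weierstrass_real_polynomial_function[OF compact_sphere cont_u] by blast
    obtain Q where Q: "\<And>z. norm z = 1 \<Longrightarrow> g z = Re (poly Q z)"
      using real_polynomial_on_circle[OF g(1)] by blast
    have ug: "u z \<le> Re (poly Q z) + e / 2" "Re (poly Q z) \<le> u z + e / 2" if "norm z = 1" for z
    proof -
      have "\<bar>u z - g z\<bar> < e / 2" using that by (intro g(2)) simp
      then show "u z \<le> Re (poly Q z) + e / 2" "Re (poly Q z) \<le> u z + e / 2" using Q[OF that] by linarith+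
    qed
    have "norm (F 0 * exp (- poly Q 0)) \<le> exp (e / 2)"
    proof (rule maximum_modulus_frontier[where S = "cball 0 1" and f = "\<lambda>z. F z * exp (- poly Q z)"])
      show "(\<lambda>z. F z * exp (- poly Q z)) holomorphic_on interior (cball 0 1)"
        using hol by (auto intro!: holomorphic_intros)
      show "continuous_on (closure (cball 0 1)) (\<lambda>z. F z * exp (- poly Q z))"
        using cont by (auto intro!: continuous_intros)
      fix z :: complex assume "z \<in> frontier (cball 0 1)"
      then have z: "norm z = 1" by (simp add: frontier_cball)
      have "norm (F z * exp (- poly Q z)) \<le> exp (u z) * exp (- Re (poly Q z))"
        unfolding norm_mult by (intro mult_mono F_le) auto
      also have "\<dots> = exp (u z - Re (poly Q z))" by (simp add: exp_diff exp_minus divide_inverse)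
      also have "\<dots> \<le> exp (e / 2)" using ug[OF z] by simp
      finally show "norm (F z * exp (- poly Q z)) \<le> exp (e / 2)" .
    qed auto
    then have "norm (F 0) \<le> exp (e / 2) * exp (Re (poly Q 0))"
      by (simp add: norm_mult norm_divide exp_minus field_simps)
    then have "ln (norm (F 0)) \<le> ln (exp (e / 2 + Re (poly Q 0)))"
      using F0 by (subst ln_le_cancel_iff) (auto simp: exp_add)
    then have le: "ln (norm (F 0)) \<le> e / 2 + Re (poly Q 0)" by simp
    have "2 * pi * Re (poly Q 0) = integral {0..2*pi} (\<lambda>\<theta>. Re (poly Q (cis \<theta>)))"
      using integral_unique[OF has_integral_poly_circle[of Q]] by simp
    also have "\<dots> \<le> integral {0..2*pi} (\<lambda>\<theta>. u (cis \<theta>) + e / 2)"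
    proof (rule integral_le)
      show "(\<lambda>\<theta>. Re (poly Q (cis \<theta>))) integrable_on {0..2*pi}" using has_integral_poly_circle by blast
      show "(\<lambda>\<theta>. u (cis \<theta>) + e / 2) integrable_on {0..2*pi}"
        by (intro integrable_continuous_real continuous_intros cont_uc)
    qed (use ug in auto)
    also have "\<dots> = integral {0..2*pi} (\<lambda>\<theta>. u (cis \<theta>)) + 2 * pi * (e / 2)"
      by (subst Henstock_Kurzweil_Integration.integral_add) (auto intro!: integrable_continuous_real cont_uc)
    finally have "Re (poly Q 0) \<le> 1 / (2 * pi) * integral {0..2*pi} (\<lambda>\<theta>. u (cis \<theta>)) + e / 2"
      by (simp add: field_simps)
    with le show ?thesis by linarith
  qed
  then have "ln (norm (F 0)) \<le> 1 / (2 * pi) * integral {0..2*pi} (\<lambda>\<theta>. u (cis \<theta>))"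
    by (rule field_le_epsilon)
  then show ?thesis by (simp add: u_def)
qed

section \<open>The Cayley map and the Poisson kernel\<close>

definition poisson :: "real \<Rightarrow> real \<Rightarrow> real" where
  "poisson a t = a / (pi * (a\<^sup>2 + t\<^sup>2))"

text \<open>Boundary value at w = it of (w - a) / (w + a), which maps the right half-plane to the
  disc, the point a to the centre and infinity to 1.\<close>

definition cayley :: "real \<Rightarrow> real \<Rightarrow> complex" where
  "cayley a t = (\<i> * of_real t - of_real a) / (\<i> * of_real t + of_real a)"

lemma cis_arctan: "cis (2 * arctan x) = (1 + \<i> * of_real x) / (1 - \<i> * of_real x)"
proof -
  have c: "cos (arctan x) \<noteq> 0" by simp
  have t: "x = sin (arctan x) / cos (arctan x)" using tan_arctan[of x] by (simp add: tan_def)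
  have "cis (arctan x) = of_real (cos (arctan x)) * (1 + \<i> * of_real x)"
    using c by (subst (3) t) (simp add: complex_eq_iff)
  moreover have "cis (- arctan x) = of_real (cos (arctan x)) * (1 - \<i> * of_real x)"
    using c by (subst (3) t) (simp add: complex_eq_iff)
  moreover have "cis (2 * arctan x) = cis (arctan x) / cis (- arctan x)" by (simp add: cis_divide)
  ultimately show ?thesis using c by simp
qed

lemma cayley_eq_cis: 
  assumes "a > 0" shows "cayley a t = cis (pi - 2 * arctan (t / a))"
proof -
  have "cis (pi - 2 * arctan (t / a)) = - inverse (cis (2 * arctan (t / a)))"
    by (simp add: cis_divide[symmetric] divide_inverse)
  also have "\<dots> = - ((1 - \<i> * of_real (t / a)) / (1 + \<i> * of_real (t / a)))" by (simp add: cis_arctan)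
  also have "\<dots> = cayley a t"
  proof -
    have "complex_of_real a * (1 - \<i> * of_real (t / a)) = of_real a - \<i> * of_real t"
         "complex_of_real a * (1 + \<i> * of_real (t / a)) = of_real a + \<i> * of_real t"
      using assms by (simp_all add: field_simps)
    then have "(1 - \<i> * of_real (t / a)) / (1 + \<i> * of_real (t / a)) = (of_real a - \<i> * of_real t) / (of_real a + \<i> * of_real t)"
      using assms by (metis mult_divide_mult_cancel_left of_real_eq_0_iff less_irrefl)
    then show ?thesis unfolding cayley_def by (simp add: minus_divide_left add.commute)
  qed
  finally show ?thesis ..
qed

text \<open>Substitution \<theta> = \<pi> - 2 arctan (t / a), under which the normalised angle
  becomes the Poisson kernel. The angles 0 and 2 \<pi>, the two ends of the line, are a null
  set.\<close>

lemma circle_mean_eq_poisson: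
  fixes \<phi> :: "complex \<Rightarrow> real"
  assumes cont: "continuous_on (sphere 0 1) \<phi>" and a: "a > 0"
  shows "integrable lborel (\<lambda>t. poisson a t * \<phi> (cayley a t))"
    and "1 / (2 * pi) * integral {0..2*pi} (\<lambda>\<theta>. \<phi> (cis \<theta>)) = (LINT t|lborel. poisson a t * \<phi> (cayley a t))"
proof -
  define g where "g = (\<lambda>t. pi - 2 * arctan (t / a))"
  have range: "range g = {0<..<2*pi}"
  proof safe
    fix t show "g t \<in> {0<..<2*pi}" unfolding g_def using arctan_bounded[of "t/a"] by auto
  next
    fix \<theta> assume th: "\<theta> \<in> {0<..<2*pi}"
    have "g (a * tan ((pi - \<theta>) / 2)) = \<theta>"
      unfolding g_def using a th by (simp add: arctan_tan field_simps)
    then show "\<theta> \<in> range g" by (metis rangeI)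
  qed
  have deriv: "(g has_real_derivative (- (2 * pi * poisson a t))) (at t within UNIV)" for t
    unfolding g_def poisson_def using a
    by (auto intro!: derivative_eq_intros simp: field_simps power2_eq_square add_nonneg_eq_0_iff)
  have inj: "inj_on g UNIV" unfolding g_def using a by (auto simp: inj_on_def arctan_eq_iff)
  have contc: "continuous_on {0..2*pi} (\<lambda>\<theta>. \<phi> (cis \<theta>))"
    by (rule continuous_on_compose2[OF cont]) (auto intro!: continuous_intros)
  have ai: "(\<lambda>\<theta>. \<phi> (cis \<theta>)) absolutely_integrable_on {0<..<2*pi}"
    using absolutely_integrable_continuous_real[OF contc]
    by (rule set_integrable_subset) auto
  have "(\<lambda>t. \<bar>- (2 * pi * poisson a t)\<bar> * \<phi> (cis (g t))) absolutely_integrable_on UNIV \<and>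
     integral UNIV (\<lambda>t. \<bar>- (2 * pi * poisson a t)\<bar> * \<phi> (cis (g t))) = integral {0<..<2*pi} (\<lambda>\<theta>. \<phi> (cis \<theta>))"
    using has_absolute_integral_change_of_variables_1'[of UNIV g "\<lambda>t. - (2 * pi * poisson a t)" "\<lambda>\<theta>. \<phi> (cis \<theta>)" "integral {0<..<2*pi} (\<lambda>\<theta>. \<phi> (cis \<theta>))"]
      deriv inj ai by (simp add: range)
  moreover have "\<bar>- (2 * pi * poisson a t)\<bar> * \<phi> (cis (g t)) = 2 * pi * (poisson a t * \<phi> (cayley a t))" for t
    using a by (simp add: cayley_eq_cis g_def poisson_def abs_mult)
  ultimately have 1: "(\<lambda>t. 2 * pi * (poisson a t * \<phi> (cayley a t))) absolutely_integrable_on UNIV"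
     and 2: "integral UNIV (\<lambda>t. 2 * pi * (poisson a t * \<phi> (cayley a t))) = integral {0<..<2*pi} (\<lambda>\<theta>. \<phi> (cis \<theta>))"
    by simp_all
  have cc: "continuous_on UNIV (\<lambda>t. poisson a t * \<phi> (cayley a t))"
    unfolding cayley_eq_cis[OF a] poisson_def using a
    by (intro continuous_intros continuous_on_compose2[OF cont]) (auto simp: add_nonneg_eq_0_iff)
  then have meas: "(\<lambda>t. poisson a t * \<phi> (cayley a t)) \<in> borel_measurable borel"
    by (rule borel_measurable_continuous_onI)
  have "integrable lebesgue (\<lambda>t. 2 * pi * (poisson a t * \<phi> (cayley a t)))"
    using 1 by (simp add: set_integrable_def)
  then have "integrable lborel (\<lambda>t. 2 * pi * (poisson a t * \<phi> (cayley a t)))"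
    using meas by (subst (asm) integrable_completion) auto
  then show int: "integrable lborel (\<lambda>t. poisson a t * \<phi> (cayley a t))"
    by simp
  have "integral UNIV (\<lambda>t. 2 * pi * (poisson a t * \<phi> (cayley a t))) = 2 * pi * (LINT t|lborel. poisson a t * \<phi> (cayley a t))"
    using integral_lborel[OF int] by simp
  then show "1 / (2 * pi) * integral {0..2*pi} (\<lambda>\<theta>. \<phi> (cis \<theta>)) = (LINT t|lborel. poisson a t * \<phi> (cayley a t))"
    using 2 by (simp add: integral_open_interval_real field_simps)
qed

lemma poisson_nonneg: "a > 0 \<Longrightarrow> poisson a t \<ge> 0"
  by (simp add: poisson_def)

lemma integrable_poisson: "a > 0 \<Longrightarrow> integrable lborel (poisson a)"
  and integral_poisson: "a > 0 \<Longrightarrow> (LINT t|lborel. poisson a t) = 1"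
  using circle_mean_eq_poisson[of "\<lambda>_. 1" a] by simp_all

lemma jensen_half_plane:
  assumes "continuous_on (cball 0 1) F" "F holomorphic_on ball 0 1" "\<epsilon> > 0" "F 0 \<noteq> 0" "a > 0"
  shows "integrable lborel (\<lambda>t. poisson a t * (ln ((norm (F (cayley a t)))\<^sup>2 + \<epsilon>\<^sup>2) / 2))"
    and "ln (norm (F 0)) \<le> (LINT t|lborel. poisson a t * (ln ((norm (F (cayley a t)))\<^sup>2 + \<epsilon>\<^sup>2) / 2))"
proof -
  have "(norm (F z))\<^sup>2 + \<epsilon>\<^sup>2 \<noteq> 0" for z using assms(3) by (simp add: add_nonneg_eq_0_iff)
  then have "continuous_on (sphere 0 1) (\<lambda>z. ln ((norm (F z))\<^sup>2 + \<epsilon>\<^sup>2) / 2)"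
    by (intro continuous_intros continuous_on_subset[OF assms(1)]) auto
  from circle_mean_eq_poisson[OF this assms(5)] jensen_disc[OF assms(1-4)]
  show "integrable lborel (\<lambda>t. poisson a t * (ln ((norm (F (cayley a t)))\<^sup>2 + \<epsilon>\<^sup>2) / 2))"
    "ln (norm (F 0)) \<le> (LINT t|lborel. poisson a t * (ln ((norm (F (cayley a t)))\<^sup>2 + \<epsilon>\<^sup>2) / 2))"
    by simp_all
qed

section \<open>The Plancherel inequality\<close>

text \<open>Rescaling of the characteristic function of the standard normal law.\<close>

lemma gaussian_fourier:
  assumes n: "n > 0"
  shows "integrable lborel (\<lambda>t. complex_of_real (exp (-((t / n)\<^sup>2) / 2)) * iexp (t * z))"
    and "(CLINT t|lborel. complex_of_real (exp (-((t / n)\<^sup>2) / 2)) * iexp (t * z)) =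
       complex_of_real (2 * pi * normal_density 0 (1 / n) z)"
proof -
  have std: "integrable lborel (\<lambda>s. complex_of_real (std_normal_density s) * iexp (s * x))" for x
    by (rule Bochner_Integration.integrable_bound[OF integrable_normal_density[of 1 0]])
       (auto simp: norm_mult normal_density_nonneg)
  have "char std_normal_distribution x = (CLINT s|lborel. complex_of_real (std_normal_density s) * iexp (s * x))" for x
    unfolding char_def by (subst integral_density) (auto simp: scaleR_conv_of_real mult.commute normal_density_nonneg)
  then have val: "(CLINT s|lborel. complex_of_real (std_normal_density s) * iexp (s * x)) = complex_of_real (exp (- x\<^sup>2 / 2))" for x
    by (simp add: char_std_normal_distribution)
  define f where "f = (\<lambda>t. complex_of_real (exp (-((t / n)\<^sup>2) / 2)) * iexp (t * z))"
  have fn: "f (0 + n * s) = complex_of_real (sqrt (2 * pi)) * (complex_of_real (std_normal_density s) * iexp (s * (n * z)))" for s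
    unfolding f_def std_normal_density_def using n by (simp add: field_simps)
  show "integrable lborel f"
  proof -
    have "integrable lborel (\<lambda>s. f (0 + n * s))" unfolding fn by (intro integrable_mult_right std)
    then show ?thesis using n lborel_integrable_real_affine_iff[of n f 0] by simp
  qed
  have "(CLINT t|lborel. f t) = \<bar>n\<bar> *\<^sub>R (CLINT s|lborel. f (0 + n * s))"
    using n by (intro lborel_integral_real_affine) auto
  also have "\<dots> = complex_of_real (n * (sqrt (2 * pi) * exp (- (n * z)\<^sup>2 / 2)))"
    unfolding fn using n val[of "n * z"] by (simp add: scaleR_conv_of_real)
  also have "n * (sqrt (2 * pi) * exp (- (n * z)\<^sup>2 / 2)) = 2 * pi * normal_density 0 (1 / n) z"
  proof -
    have 1: "sqrt (2 * pi * (1 / n)\<^sup>2) = sqrt (2 * pi) / n"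
      using n by (simp add: real_sqrt_mult real_sqrt_divide power_divide)
    have 2: "- (z - 0)\<^sup>2 / (2 * (1 / n)\<^sup>2) = - (n * z)\<^sup>2 / 2"
      using n by (simp add: power_mult_distrib power_divide)
    define r where "r = sqrt (2 * pi)"
    have rr: "r * r = 2 * pi" and r0: "r \<noteq> 0" by (simp_all add: r_def)
    have "n * (r * exp (- (n * z)\<^sup>2 / 2)) = r * r * (1 / (r / n) * exp (- (n * z)\<^sup>2 / 2))"
      using n r0 by simp
    then show ?thesis unfolding normal_density_def 1 2 r_def[symmetric] rr .
  qed
  finally show "(CLINT t|lborel. f t) = complex_of_real (2 * pi * normal_density 0 (1 / n) z)" .
qed

lemma integrable_pair_product:
  fixes f g :: "real \<Rightarrow> real"
  assumes f: "integrable lborel f" and g: "integrable lborel g"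
  shows "integrable (lborel \<Otimes>\<^sub>M lborel) (\<lambda>z. f (fst z) * g (snd z))"
proof (rule lborel_pair.Fubini_integrable)
  have [measurable]: "f \<in> borel_measurable borel" "g \<in> borel_measurable borel" using f g by auto
  show "(\<lambda>z. f (fst z) * g (snd z)) \<in> borel_measurable (lborel \<Otimes>\<^sub>M lborel)" by measurable
  show "integrable lborel (\<lambda>x. LINT y|lborel. norm (f (fst (x, y)) * g (snd (x, y))))"
    using f g by (simp add: abs_mult)
qed (use g in simp)

definition fourier :: "(real \<Rightarrow> real) \<Rightarrow> real \<Rightarrow> complex" where
  "fourier g t = (CLINT x|lborel. complex_of_real (g x) * iexp (- (t * x)))"

lemma fourier_measurable [measurable]:
  assumes [measurable]: "g \<in> borel_measurable borel"
  shows "fourier g \<in> borel_measurable borel"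
  unfolding fourier_def by measurable

text \<open>The Gaussian weight makes all integrals absolutely convergent, so Fubini turns the left
  side into the double integral of g(x) g(y) W(y - x), where W is nonnegative of mass 2 \<pi>. Then
  |g(x) g(y)| \<le> (g(x)^2 + g(y)^2) / 2 gives a bound uniform in n.\<close>

lemma gaussian_weight_plancherel:
  fixes g :: "real \<Rightarrow> real"
  assumes n: "n > 0" and g: "integrable lborel g" and g2: "integrable lborel (\<lambda>x. (g x)\<^sup>2)"
  shows "(\<integral>\<^sup>+t. ennreal (exp (-((t / n)\<^sup>2) / 2) * (norm (fourier g t))\<^sup>2) \<partial>lborel) \<le> ennreal (2 * pi * (LINT x|lborel. (g x)\<^sup>2))"
proof -
  have [measurable]: "g \<in> borel_measurable borel" using g by auto
  define w where "w = (\<lambda>t. exp (-((t / n)\<^sup>2) / 2))"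
  define W where "W = (\<lambda>z. 2 * pi * normal_density 0 (1 / n) z)"
  have w_int: "integrable lborel (\<lambda>t. complex_of_real (w t))"
    using gaussian_fourier(1)[OF n, of 0] by (simp add: w_def)
  have w_intr: "integrable lborel w" using integrable_Re[OF w_int] by simp
  have [measurable]: "w \<in> borel_measurable borel" "W \<in> borel_measurable borel" unfolding w_def W_def by measurable
  have W0: "W z \<ge> 0" for z by (simp add: W_def normal_density_nonneg)
  have cg: "integrable lborel (\<lambda>x. complex_of_real (g x))" using g by simp
  have fb: "norm (fourier g t) \<le> (LINT x|lborel. \<bar>g x\<bar>)" for t
  proof -
    have "norm (fourier g t) \<le> (LINT x|lborel. norm (complex_of_real (g x) * iexp (- (t * x))))"
      unfolding fourier_def by (rule integral_norm_bound)
    then show ?thesis by (simp add: norm_mult)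
  qed
  have int_w: "integrable lborel (\<lambda>t. w t * (norm (fourier g t))\<^sup>2)"
  proof (rule Bochner_Integration.integrable_bound)
    show "integrable lborel (\<lambda>t. w t * (LINT x|lborel. \<bar>g x\<bar>)\<^sup>2)" using w_intr by simp
    show "AE t in lborel. norm (w t * (norm (fourier g t))\<^sup>2) \<le> norm (w t * (LINT x|lborel. \<bar>g x\<bar>)\<^sup>2)"
      using fb by (auto simp: norm_mult w_def intro!: mult_left_mono power_mono)
  qed measurable
  have inner: "(CLINT t|lborel. complex_of_real (w t) * fourier g t * iexp (t * y)) = complex_of_real (LINT x|lborel. g x * W (y - x))" for y
  proof -
    have int2: "integrable (lborel \<Otimes>\<^sub>M lborel) (\<lambda>(t, x). complex_of_real (w t) * complex_of_real (g x) * iexp (t * (y - x)))"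
    proof (rule Bochner_Integration.integrable_bound)
      show "integrable (lborel \<Otimes>\<^sub>M lborel) (\<lambda>z. w (fst z) * g (snd z))"
        by (rule integrable_pair_product[OF w_intr g])
    qed (auto simp: norm_mult case_prod_unfold)
    have "(CLINT t|lborel. complex_of_real (w t) * fourier g t * iexp (t * y)) =
      (CLINT t|lborel. CLINT x|lborel. complex_of_real (w t) * complex_of_real (g x) * iexp (t * (y - x)))"
    proof (rule Bochner_Integration.integral_cong[OF refl])
      fix t
      have "complex_of_real (w t) * fourier g t * iexp (t * y) = (CLINT x|lborel. (complex_of_real (w t) * iexp (t * y)) * (complex_of_real (g x) * iexp (- (t * x))))"
        unfolding fourier_def by (subst integral_mult_right_zero) (simp add: mult_ac)
      also have "\<dots> = (CLINT x|lborel. complex_of_real (w t) * complex_of_real (g x) * iexp (t * (y - x)))"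
        by (intro Bochner_Integration.integral_cong refl) (simp add: right_diff_distrib exp_diff exp_minus divide_inverse mult_ac)
      finally show "complex_of_real (w t) * fourier g t * iexp (t * y) = (CLINT x|lborel. complex_of_real (w t) * complex_of_real (g x) * iexp (t * (y - x)))" .
    qed
    also have "\<dots> = (CLINT x|lborel. CLINT t|lborel. complex_of_real (w t) * complex_of_real (g x) * iexp (t * (y - x)))"
      by (rule lborel_pair.Fubini_integral[OF int2, symmetric])
    also have "\<dots> = (CLINT x|lborel. complex_of_real (g x * W (y - x)))"
    proof (rule Bochner_Integration.integral_cong[OF refl])
      fix x
      have "(CLINT t|lborel. complex_of_real (w t) * complex_of_real (g x) * iexp (t * (y - x))) =
        (CLINT t|lborel. complex_of_real (g x) * (complex_of_real (w t) * iexp (t * (y - x))))" by (simp add: mult_ac)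
      also have "\<dots> = complex_of_real (g x) * complex_of_real (W (y - x))"
        using gaussian_fourier(2)[OF n, of "y - x"] by (subst integral_mult_right_zero) (simp add: w_def W_def)
      finally show "(CLINT t|lborel. complex_of_real (w t) * complex_of_real (g x) * iexp (t * (y - x))) = complex_of_real (g x * W (y - x))" by simp
    qed
    also have "\<dots> = complex_of_real (LINT x|lborel. g x * W (y - x))" by (rule integral_complex_of_real)
    finally show ?thesis .
  qed
  have cf: "cnj (fourier g t) = (CLINT y|lborel. complex_of_real (g y) * iexp (t * y))" for t
    unfolding fourier_def by (subst Bochner_Integration.integral_cnj[symmetric]) (simp add: exp_cnj)
  have int3: "integrable (lborel \<Otimes>\<^sub>M lborel) (\<lambda>(t, y). complex_of_real (w t) * fourier g t * (complex_of_real (g y) * iexp (t * y)))"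
  proof (rule Bochner_Integration.integrable_bound)
    show "integrable (lborel \<Otimes>\<^sub>M lborel) (\<lambda>z. (w (fst z) * (LINT x|lborel. \<bar>g x\<bar>)) * g (snd z))"
      using w_intr by (intro integrable_pair_product g) simp
    show "AE z in lborel \<Otimes>\<^sub>M lborel. norm (case z of (t, y) \<Rightarrow> complex_of_real (w t) * fourier g t * (complex_of_real (g y) * iexp (t * y))) \<le> norm ((w (fst z) * (LINT x|lborel. \<bar>g x\<bar>)) * g (snd z))"
    proof (intro AE_I2)
      fix z :: "real \<times> real"
      obtain t y where z: "z = (t, y)" by (cases z)
      have "w t * norm (fourier g t) * \<bar>g y\<bar> \<le> w t * (LINT x|lborel. \<bar>g x\<bar>) * \<bar>g y\<bar>"
        by (intro mult_right_mono mult_left_mono fb) (auto simp: w_def)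
      then show "norm (case z of (t, y) \<Rightarrow> complex_of_real (w t) * fourier g t * (complex_of_real (g y) * iexp (t * y))) \<le> norm ((w (fst z) * (LINT x|lborel. \<bar>g x\<bar>)) * g (snd z))"
        by (simp add: z norm_mult abs_mult w_def)
    qed
  qed (auto simp: case_prod_unfold)
  have "complex_of_real (LINT t|lborel. w t * (norm (fourier g t))\<^sup>2) = (CLINT t|lborel. complex_of_real (w t) * fourier g t * cnj (fourier g t))"
    unfolding integral_complex_of_real[symmetric] by (simp only: of_real_mult complex_norm_square mult.assoc)
  also have "\<dots> = (CLINT t|lborel. CLINT y|lborel. complex_of_real (w t) * fourier g t * (complex_of_real (g y) * iexp (t * y)))"
    unfolding cf by (subst integral_mult_right_zero) simp
  also have "\<dots> = (CLINT y|lborel. CLINT t|lborel. complex_of_real (w t) * fourier g t * (complex_of_real (g y) * iexp (t * y)))"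
    by (rule lborel_pair.Fubini_integral[OF int3, symmetric])
  also have "\<dots> = (CLINT y|lborel. complex_of_real (g y * (LINT x|lborel. g x * W (y - x))))"
  proof (rule Bochner_Integration.integral_cong[OF refl])
    fix y
    have "(CLINT t|lborel. complex_of_real (w t) * fourier g t * (complex_of_real (g y) * iexp (t * y))) =
      (CLINT t|lborel. complex_of_real (g y) * (complex_of_real (w t) * fourier g t * iexp (t * y)))" by (simp add: mult_ac)
    also have "\<dots> = complex_of_real (g y) * complex_of_real (LINT x|lborel. g x * W (y - x))"
      by (subst integral_mult_right_zero) (simp only: inner)
    finally show "(CLINT t|lborel. complex_of_real (w t) * fourier g t * (complex_of_real (g y) * iexp (t * y))) = complex_of_real (g y * (LINT x|lborel. g x * W (y - x)))" by simp
  qed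
  also have "\<dots> = complex_of_real (LINT y|lborel. g y * (LINT x|lborel. g x * W (y - x)))" by (rule integral_complex_of_real)
  finally have eq: "(LINT t|lborel. w t * (norm (fourier g t))\<^sup>2) = (LINT y|lborel. g y * (LINT x|lborel. g x * W (y - x)))"
    by (simp only: of_real_eq_iff)
  have W_nn: "(\<integral>\<^sup>+z. ennreal (W z) \<partial>lborel) = ennreal (2 * pi)"
  proof -
    have "(\<integral>\<^sup>+z. ennreal (W z) \<partial>lborel) = ennreal (LINT z|lborel. W z)"
      using n by (intro nn_integral_eq_integral) (auto simp: W_def normal_density_nonneg)
    then show ?thesis using n by (simp add: W_def integral_normal_density)
  qed
  have W_sym: "W (- z) = W z" for z by (simp add: W_def normal_density_def)
  have W_shift: "(\<integral>\<^sup>+x. ennreal (W (y - x)) \<partial>lborel) = ennreal (2 * pi)" "(\<integral>\<^sup>+y. ennreal (W (y - x)) \<partial>lborel) = ennreal (2 * pi)" for x y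
  proof -
    have "(\<integral>\<^sup>+x. ennreal (W (y - x)) \<partial>lborel) = (\<integral>\<^sup>+x. ennreal (W (- y + 1 * x)) \<partial>lborel)"
      using W_sym[of "y - _"] by (simp add: algebra_simps)
    also have "\<dots> = (\<integral>\<^sup>+z. ennreal (W z) \<partial>lborel)"
      using nn_integral_real_affine[of "\<lambda>z. ennreal (W z)" 1 "- y"] by simp
    finally show "(\<integral>\<^sup>+x. ennreal (W (y - x)) \<partial>lborel) = ennreal (2 * pi)" using W_nn by simp
    show "(\<integral>\<^sup>+y. ennreal (W (y - x)) \<partial>lborel) = ennreal (2 * pi)"
      using nn_integral_real_affine[of "\<lambda>z. ennreal (W z)" 1 "- x"] W_nn by (simp add: algebra_simps)
  qed
  have sq: "(\<integral>\<^sup>+x. ennreal ((g x)\<^sup>2) \<partial>lborel) = ennreal (LINT x|lborel. (g x)\<^sup>2)"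
    by (rule nn_integral_eq_integral[OF g2]) auto
  \<comment> \<open>If an integrand here were not integrable, its Bochner integral would be 0 by
    convention and the bound trivial; so integrability need not be settled beforehand.\<close>
  have "ennreal \<bar>LINT y|lborel. g y * (LINT x|lborel. g x * W (y - x))\<bar> \<le> (\<integral>\<^sup>+y. ennreal (norm (g y * (LINT x|lborel. g x * W (y - x)))) \<partial>lborel)"
    using integral_norm_bound_ennreal[of lborel "\<lambda>y. g y * (LINT x|lborel. g x * W (y - x))"]
    by (cases "integrable lborel (\<lambda>y. g y * (LINT x|lborel. g x * W (y - x)))") (auto simp: not_integrable_integral_eq)
  also have "\<dots> \<le> (\<integral>\<^sup>+y. \<integral>\<^sup>+x. ennreal (1/2) * (ennreal ((g y)\<^sup>2) * ennreal (W (y - x)) + ennreal ((g x)\<^sup>2) * ennreal (W (y - x))) \<partial>lborel \<partial>lborel)"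
  proof (rule nn_integral_mono)
    fix y
    have "ennreal (norm (LINT x|lborel. g x * W (y - x))) \<le> (\<integral>\<^sup>+x. ennreal (norm (g x * W (y - x))) \<partial>lborel)"
      using integral_norm_bound_ennreal[of lborel "\<lambda>x. g x * W (y - x)"]
      by (cases "integrable lborel (\<lambda>x. g x * W (y - x))") (auto simp: not_integrable_integral_eq)
    then have "ennreal (norm (g y * (LINT x|lborel. g x * W (y - x)))) \<le> ennreal \<bar>g y\<bar> * (\<integral>\<^sup>+x. ennreal (norm (g x * W (y - x))) \<partial>lborel)"
      unfolding norm_mult by (subst ennreal_mult) (auto intro!: mult_left_mono)
    also have "\<dots> = (\<integral>\<^sup>+x. ennreal \<bar>g y\<bar> * ennreal (norm (g x * W (y - x))) \<partial>lborel)"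
      by (rule nn_integral_cmult[symmetric]) measurable
    also have "\<dots> \<le> (\<integral>\<^sup>+x. ennreal (1/2) * (ennreal ((g y)\<^sup>2) * ennreal (W (y - x)) + ennreal ((g x)\<^sup>2) * ennreal (W (y - x))) \<partial>lborel)"
    proof (rule nn_integral_mono)
      fix x
      have "\<bar>g y\<bar> * \<bar>g x\<bar> \<le> 1/2 * ((g y)\<^sup>2 + (g x)\<^sup>2)"
        using sum_squares_bound[of "\<bar>g y\<bar>" "\<bar>g x\<bar>"] by simp
      then have "\<bar>g y\<bar> * \<bar>g x\<bar> * W (y - x) \<le> 1/2 * ((g y)\<^sup>2 + (g x)\<^sup>2) * W (y - x)"
        using W0 by (rule mult_right_mono)
      then show "ennreal \<bar>g y\<bar> * ennreal (norm (g x * W (y - x))) \<le> ennreal (1/2) * (ennreal ((g y)\<^sup>2) * ennreal (W (y - x)) + ennreal ((g x)\<^sup>2) * ennreal (W (y - x)))"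
        using W0[of "y - x"] by (simp add: ennreal_mult[symmetric] ennreal_plus[symmetric] norm_mult abs_mult distrib_right mult.assoc del: ennreal_plus ennreal_half)
    qed
    finally show "ennreal (norm (g y * (LINT x|lborel. g x * W (y - x)))) \<le> \<dots>" .
  qed
  also have "\<dots> = ennreal (1/2) * ((\<integral>\<^sup>+y. \<integral>\<^sup>+x. ennreal ((g y)\<^sup>2) * ennreal (W (y - x)) \<partial>lborel \<partial>lborel) + (\<integral>\<^sup>+y. \<integral>\<^sup>+x. ennreal ((g x)\<^sup>2) * ennreal (W (y - x)) \<partial>lborel \<partial>lborel))"
    by (simp add: nn_integral_cmult nn_integral_add)
  also have "(\<integral>\<^sup>+y. \<integral>\<^sup>+x. ennreal ((g x)\<^sup>2) * ennreal (W (y - x)) \<partial>lborel \<partial>lborel) = (\<integral>\<^sup>+x. \<integral>\<^sup>+y. ennreal ((g x)\<^sup>2) * ennreal (W (y - x)) \<partial>lborel \<partial>lborel)"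
    by (rule lborel_pair.Fubini') measurable
  also have "(\<integral>\<^sup>+x. \<integral>\<^sup>+y. ennreal ((g x)\<^sup>2) * ennreal (W (y - x)) \<partial>lborel \<partial>lborel) = ennreal (LINT x|lborel. (g x)\<^sup>2) * ennreal (2 * pi)"
    by (simp add: nn_integral_cmult nn_integral_multc W_shift sq)
  also have "(\<integral>\<^sup>+y. \<integral>\<^sup>+x. ennreal ((g y)\<^sup>2) * ennreal (W (y - x)) \<partial>lborel \<partial>lborel) = ennreal (LINT x|lborel. (g x)\<^sup>2) * ennreal (2 * pi)"
    by (simp add: nn_integral_cmult nn_integral_multc W_shift sq)
  also have "ennreal (1/2) * (ennreal (LINT x|lborel. (g x)\<^sup>2) * ennreal (2 * pi) + ennreal (LINT x|lborel. (g x)\<^sup>2) * ennreal (2 * pi)) = ennreal (2 * pi * (LINT x|lborel. (g x)\<^sup>2))"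
    by (simp add: ennreal_mult[symmetric] ennreal_plus[symmetric] del: ennreal_plus ennreal_half)
  finally have fin: "ennreal \<bar>LINT t|lborel. w t * (norm (fourier g t))\<^sup>2\<bar> \<le> ennreal (2 * pi * (LINT x|lborel. (g x)\<^sup>2))"
    unfolding eq .
  have "(\<integral>\<^sup>+t. ennreal (w t * (norm (fourier g t))\<^sup>2) \<partial>lborel) = ennreal (LINT t|lborel. w t * (norm (fourier g t))\<^sup>2)"
    by (rule nn_integral_eq_integral[OF int_w]) (auto simp: w_def)
  also have "\<dots> \<le> ennreal \<bar>LINT t|lborel. w t * (norm (fourier g t))\<^sup>2\<bar>" by (intro ennreal_leI) auto
  also note fin
  finally show ?thesis unfolding w_def .
qed

text \<open>Monotone convergence as the Gaussian weight increases to 1.\<close>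

lemma plancherel_le:
  fixes g :: "real \<Rightarrow> real"
  assumes g: "integrable lborel g" and g2: "integrable lborel (\<lambda>x. (g x)\<^sup>2)"
  shows "(\<integral>\<^sup>+t. ennreal ((norm (fourier g t))\<^sup>2) \<partial>lborel) \<le> ennreal (2 * pi * (LINT x|lborel. (g x)\<^sup>2))"
proof -
  have [measurable]: "g \<in> borel_measurable borel" using g by auto
  define f where "f = (\<lambda>n t. ennreal (exp (-((t / real (Suc n))\<^sup>2) / 2) * (norm (fourier g t))\<^sup>2))"
  have inc: "incseq f"
    unfolding f_def by (auto simp: incseq_def le_fun_def power_divide intro!: ennreal_leI mult_right_mono divide_left_mono power_mono)
  have sup: "(SUP n. f n t) = ennreal ((norm (fourier g t))\<^sup>2)" for t
  proof (rule LIMSEQ_unique[OF LIMSEQ_SUP])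
    show "incseq (\<lambda>n. f n t)" using inc by (auto simp: incseq_def le_fun_def)
    have "(\<lambda>n. exp (-((t / real (Suc n))\<^sup>2) / 2)) \<longlonglongrightarrow> exp (- (0\<^sup>2) / 2)"
      by (intro tendsto_intros LIMSEQ_Suc[OF lim_const_over_n]) simp
    then have "(\<lambda>n. exp (-((t / real (Suc n))\<^sup>2) / 2)) \<longlonglongrightarrow> 1" by simp
    then have "(\<lambda>n. exp (-((t / real (Suc n))\<^sup>2) / 2) * (norm (fourier g t))\<^sup>2) \<longlonglongrightarrow> 1 * (norm (fourier g t))\<^sup>2"
      by (intro tendsto_mult tendsto_const)
    then show "(\<lambda>n. f n t) \<longlonglongrightarrow> ennreal ((norm (fourier g t))\<^sup>2)" unfolding f_def by (intro tendsto_ennrealI) simp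
  qed
  have "(\<integral>\<^sup>+t. ennreal ((norm (fourier g t))\<^sup>2) \<partial>lborel) = (SUP n. \<integral>\<^sup>+t. f n t \<partial>lborel)"
    unfolding sup[symmetric] by (rule nn_integral_monotone_convergence_SUP[OF inc]) (simp add: f_def)
  also have "\<dots> \<le> ennreal (2 * pi * (LINT x|lborel. (g x)\<^sup>2))"
    unfolding f_def by (intro SUP_least gaussian_weight_plancherel g g2) simp
  finally show ?thesis .
qed

section \<open>The Mellin transform of the fractional part\<close>

text \<open>With u = e^x this is the integral of frac(u) u^(-s-1) over [k+1, k+2]. In the
  logarithmic variable Mellin transforms are Fourier transforms and dilations are
  translations.\<close>

definition frac_piece :: "nat \<Rightarrow> complex \<Rightarrow> complex" where
  "frac_piece k s = integral {ln (real (Suc k))..ln (real (Suc (Suc k)))} (\<lambda>x. (of_real (exp x) - of_nat (Suc k)) * exp (- s * of_real x))"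

lemma of_nat_powr_eq_exp: "n > 0 \<Longrightarrow> of_nat n powr (s::complex) = exp (s * of_real (ln (real n)))"
  using Ln_of_real[of "real n"] by (simp add: powr_def)

lemma frac_piece_has_integral:
  fixes s :: complex
  assumes "s \<noteq> 0" "s \<noteq> 1"
  shows "((\<lambda>x. (of_real (exp x) - of_nat (Suc k)) * exp (- s * of_real x)) has_integral
     (of_nat (Suc (Suc k)) powr (1 - s) / (1 - s) + of_nat (Suc k) * of_nat (Suc (Suc k)) powr (- s) / s -
      (of_nat (Suc k) powr (1 - s) / (1 - s) + of_nat (Suc k) * of_nat (Suc k) powr (- s) / s)))
     {ln (real (Suc k))..ln (real (Suc (Suc k)))}"
proof -
  define G where "G = (\<lambda>z. exp ((1 - s) * z) / (1 - s) + of_nat (Suc k) * exp (- s * z) / s)"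
  have "((\<lambda>x. (of_real (exp x) - of_nat (Suc k)) * exp (- s * of_real x)) has_integral
      (G (of_real (ln (real (Suc (Suc k))))) - G (of_real (ln (real (Suc k)))))) {ln (real (Suc k))..ln (real (Suc (Suc k)))}"
  proof (rule fundamental_theorem_of_calculus)
    fix x :: real
    have "(G has_field_derivative exp ((1 - s) * of_real x) - of_nat (Suc k) * exp (- s * of_real x)) (at (of_real x))"
      unfolding G_def using assms by (auto intro!: derivative_eq_intros simp del: of_nat_Suc)
    moreover have "exp ((1 - s) * of_real x) - of_nat (Suc k) * exp (- s * of_real x) = (of_real (exp x) - of_nat (Suc k)) * exp (- s * of_real x)"
      by (simp add: exp_of_real algebra_simps exp_diff exp_minus divide_inverse del: of_nat_Suc)
    ultimately show "((\<lambda>x. G (of_real x)) has_vector_derivative (of_real (exp x) - of_nat (Suc k)) * exp (- s * of_real x))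
      (at x within {ln (real (Suc k))..ln (real (Suc (Suc k)))})"
      using has_vector_derivative_real_field by metis
  qed simp
  then show ?thesis unfolding G_def by (simp add: of_nat_powr_eq_exp del: of_nat_Suc)
qed

lemma frac_piece_holomorphic: "frac_piece k holomorphic_on S"
proof -
  have "frac_piece k holomorphic_on UNIV"
    unfolding frac_piece_def box_real(2)[symmetric]
  proof (rule leibniz_rule_holomorphic[where fx = "\<lambda>s x. (of_real (exp x) - of_nat (Suc k)) * (- of_real x * exp (- s * of_real x))"])
    show "(\<lambda>x. (of_real (exp x) - of_nat (Suc k)) * exp (- s * of_real x)) integrable_on cbox (ln (real (Suc k))) (ln (real (Suc (Suc k))))" for s :: complex
      by (intro integrable_continuous continuous_intros)
  qed (auto intro!: derivative_eq_intros continuous_intros simp: case_prod_unfold simp del: of_nat_Suc)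
  then show ?thesis by (rule holomorphic_on_subset) auto
qed

lemma frac_piece_bound:
  assumes "Re s > 0"
  shows "norm (frac_piece k s) \<le> real (Suc k) powr (- 1 - Re s)"
proof -
  let ?a = "ln (real (Suc k))" and ?b = "ln (real (Suc (Suc k)))"
  have ab: "?a \<le> ?b" "?b - ?a \<le> 1 / real (Suc k)"
  proof -
    have "?b - ?a = ln (1 + 1 / real (Suc k))"
      by (subst ln_div[symmetric, simplified] | simp add: field_simps ln_div)+
    also have "\<dots> \<le> 1 / real (Suc k)" by (rule ln_add_one_self_le_self) auto
    finally show "?b - ?a \<le> 1 / real (Suc k)" .
  qed simp
  have "norm (frac_piece k s) \<le> real (Suc k) powr (- Re s) * (?b - ?a)"
    unfolding frac_piece_def
  proof (rule integral_bound[OF ab(1)])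
    show "continuous_on {?a..?b} (\<lambda>x. (of_real (exp x) - of_nat (Suc k)) * exp (- s * of_real x))"
      by (intro continuous_intros)
    fix x assume x: "x \<in> {?a..?b}"
    then have "exp ?a \<le> exp x" "exp x \<le> exp ?b" by (simp_all only: exp_le_cancel_iff atLeastAtMost_iff)
    then have e: "real (Suc k) \<le> exp x" "exp x \<le> real (Suc (Suc k))" by simp_all
    have "norm (of_real (exp x) - of_nat (Suc k) :: complex) = \<bar>exp x - real (Suc k)\<bar>"
      by (metis norm_of_real of_real_diff of_real_of_nat_eq)
    also have "\<dots> \<le> 1" using e by simp
    finally have 1: "norm (of_real (exp x) - of_nat (Suc k) :: complex) \<le> 1" .
    have "norm (exp (- s * of_real x)) = exp (- Re s * x)" by simp
    also have "\<dots> \<le> exp (- Re s * ?a)" using x assms by simp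
    also have "\<dots> = real (Suc k) powr (- Re s)" by (simp add: powr_def)
    finally show "norm ((of_real (exp x) - of_nat (Suc k)) * exp (- s * of_real x)) \<le> real (Suc k) powr (- Re s)"
      unfolding norm_mult using 1 mult_mono[OF 1, of "norm (exp (- s * of_real x))" "real (Suc k) powr (- Re s)"] by simp
  qed
  also have "\<dots> \<le> real (Suc k) powr (- Re s) * (1 / real (Suc k))" using ab by (intro mult_left_mono) auto
  also have "\<dots> = real (Suc k) powr (- 1 - Re s)"
    by (simp add: powr_diff powr_minus divide_inverse del: of_nat_Suc)
  finally show ?thesis .
qed

lemma summable_frac_piece: "Re s > 0 \<Longrightarrow> summable (\<lambda>k. frac_piece k s)"
  by (rule summable_comparison_test'[of "\<lambda>k. real (Suc k) powr (- 1 - Re s)" 0])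
     (auto intro!: summable_powr_Suc frac_piece_bound simp del: of_nat_Suc)

definition frac_transform :: "complex \<Rightarrow> complex" where
  "frac_transform s = (\<Sum>k. frac_piece k s)"

lemma frac_transform_holomorphic: "frac_transform holomorphic_on {s. Re s > 0}"
  unfolding frac_transform_def
  by (rule holomorphic_on_suminf_halfplane[where C = "\<lambda>_. 1"])
     (use frac_piece_bound in \<open>auto intro: frac_piece_holomorphic simp del: of_nat_Suc\<close>)

text \<open>Each piece telescopes up to one new term (K+2)^(-s) of the zeta series. The finite
  identity holds for every s other than 0 and 1, before any question of convergence.\<close>

lemma frac_piece_partial_sum:
  fixes s :: complex
  assumes "s \<noteq> 0" "s \<noteq> 1"
  shows "s * (\<Sum>k<K. frac_piece k s) = s * (of_nat (Suc K) powr (1 - s) - 1) / (1 - s) + of_nat (Suc K) powr (1 - s) -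
     (\<Sum>n<Suc K. of_nat (Suc n) powr (- s))"
proof (induction K)
  case (Suc K)
  have m: "x powr (1 - s) = x * x powr (- s)" if "x \<noteq> 0" for x :: complex
    using that by (simp add: powr_diff powr_minus divide_inverse)
  have "s * frac_piece K s = s * (of_nat (Suc (Suc K)) powr (1 - s) - of_nat (Suc K) powr (1 - s)) / (1 - s) +
     of_nat (Suc K) * (of_nat (Suc (Suc K)) powr (- s) - of_nat (Suc K) powr (- s))"
  proof -
    have "1 - s \<noteq> 0" using assms by simp
    then have "s * (a / (1 - s) + n * c / s - (b / (1 - s) + n * d / s)) = s * (a - b) / (1 - s) + n * (c - d)" for a b c d n
      using assms by (simp add: distrib_left right_diff_distrib diff_divide_distrib)
    then show ?thesis unfolding frac_piece_def integral_unique[OF frac_piece_has_integral[OF assms]] .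
  qed
  also have "of_nat (Suc K) * (of_nat (Suc (Suc K)) powr (- s) - of_nat (Suc K) powr (- s)) =
     of_nat (Suc (Suc K)) powr (1 - s) - of_nat (Suc K) powr (1 - s) - of_nat (Suc (Suc K)) powr (- s)"
  proof -
    have nz: "of_nat (Suc n) \<noteq> (0::complex)" for n by (rule of_nat_neq_0)
    show ?thesis unfolding m[OF nz] by (simp add: algebra_simps)
  qed
  finally show ?case
    using Suc.IH by (simp add: distrib_left right_diff_distrib diff_divide_distrib del: of_nat_Suc)
qed simp

text \<open>For Re s > 1 this is the limit of \<open>frac_piece_partial_sum\<close>. Both sides are
  holomorphic on the half-plane Re s > 0 without 1, which is connected, so the identity
  extends.\<close>

lemma zeta_eq_frac_transform:
  assumes s: "Re s > 0" "s \<noteq> 1"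
  shows "zeta s = s / (s - 1) - s * frac_transform s"
proof (rule analytic_continuation_open[where f = zeta and g = "\<lambda>s. s / (s - 1) - s * frac_transform s" and s = "{s. Re s > 1}" and s' = "{s. Re s > 0} - {1}"])
  have "open {s. Re s > (0::real)}" by (rule open_halfspace_Re_gt)
  then show "open ({s. Re s > 0} - {1})" by (rule open_delete)
  show "connected ({s. Re s > 0} - {1})"
    by (rule connected_open_delete) (auto intro: open_halfspace_Re_gt connected_halfplane)
  show "open {s. Re s > 1}" by (rule open_halfspace_Re_gt)
  have "2 \<in> {s. Re s > 1}" by simp
  then show "{s. Re s > 1} \<noteq> {}" by blast
  show "zeta holomorphic_on {s. Re s > 0} - {1}"
    using is_zeta_continuation_zeta unfolding is_zeta_continuation_def by (auto intro: holomorphic_on_subset)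
  show "(\<lambda>s. s / (s - 1) - s * frac_transform s) holomorphic_on {s. Re s > 0} - {1}"
    by (intro holomorphic_intros holomorphic_on_subset[OF frac_transform_holomorphic]) auto
  fix z assume "z \<in> {s. Re s > 1}"
  then have z: "Re z > 1" "z \<noteq> 0" "z \<noteq> 1" by auto
  have zeta: "zeta z = (\<Sum>n. of_nat (Suc n) powr (- z))"
    using is_zeta_continuation_zeta z(1) unfolding is_zeta_continuation_def by blast
  have "(\<lambda>K. \<Sum>n<Suc K. of_nat (Suc n) powr (- z)) \<longlonglongrightarrow> zeta z"
    unfolding zeta using summable_LIMSEQ[OF summable_dirichlet[OF z(1)]] by (rule LIMSEQ_Suc)
  moreover have lim0: "(\<lambda>K. of_nat (Suc K) powr (1 - z)) \<longlonglongrightarrow> (0::complex)"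
  proof (rule tendsto_norm_zero_cancel)
    have "(\<lambda>K. real (Suc K) powr (1 - Re z)) \<longlonglongrightarrow> 0"
      using z(1) by real_asymp
    then show "(\<lambda>K. norm (of_nat (Suc K) powr (1 - z) :: complex)) \<longlonglongrightarrow> 0"
      by (simp only: dirichlet_term_norm) simp
  qed
  moreover have "(\<lambda>K. z * (\<Sum>k<K. frac_piece k z)) \<longlonglongrightarrow> z * frac_transform z"
    unfolding frac_transform_def using z by (intro tendsto_intros summable_LIMSEQ summable_frac_piece) auto
  ultimately have "(\<lambda>K. z * (of_nat (Suc K) powr (1 - z) - 1) / (1 - z) + of_nat (Suc K) powr (1 - z) - z * (\<Sum>k<K. frac_piece k z)) \<longlonglongrightarrow>
      z * (0 - 1) / (1 - z) + 0 - z * frac_transform z"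
    using z by (intro tendsto_intros) auto
  moreover have "z * (of_nat (Suc K) powr (1 - z) - 1) / (1 - z) + of_nat (Suc K) powr (1 - z) - z * (\<Sum>k<K. frac_piece k z) =
     (\<Sum>n<Suc K. of_nat (Suc n) powr (- z))" for K
    unfolding frac_piece_partial_sum[OF z(2,3)] by simp
  ultimately have "zeta z = z * (0 - 1) / (1 - z) + 0 - z * frac_transform z"
    using \<open>(\<lambda>K. \<Sum>n<Suc K. of_nat (Suc n) powr (- z)) \<longlonglongrightarrow> zeta z\<close> LIMSEQ_unique by fastforce
  also have "z * (0 - 1) / (1 - z) = z / (z - 1)" using z by (simp add: divide_simps algebra_simps)
  finally show "zeta z = z / (z - 1) - z * frac_transform z" by simp
qed (use s in auto)

lemma frac_transform_bound:
  obtains C where "C > 0" "\<And>s. Re s \<ge> 1/2 \<Longrightarrow> norm (frac_transform s) \<le> C"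
proof
  define C where "C = (\<Sum>k. real (Suc k) powr (- 3/2))"
  have sm: "summable (\<lambda>k. real (Suc k) powr (- 3/2))" by (rule summable_powr_Suc) simp
  show "C > 0" unfolding C_def by (rule suminf_pos[OF sm]) auto
  fix s :: complex assume s: "Re s \<ge> 1/2"
  have le: "norm (frac_piece k s) \<le> real (Suc k) powr (- 3/2)" for k
  proof -
    have "norm (frac_piece k s) \<le> real (Suc k) powr (- 1 - Re s)" using s by (intro frac_piece_bound) auto
    also have "\<dots> \<le> real (Suc k) powr (- 3/2)" using s by (intro powr_mono) auto
    finally show ?thesis .
  qed
  then show "norm (frac_transform s) \<le> C"
    unfolding frac_transform_def C_def
    by (intro norm_suminf_le sm) auto
qed

section \<open>The Mellin integral over the whole line\<close>

lemma frac_exp_integral_piece: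
  "integral {ln (real (Suc k))..ln (real (Suc (Suc k)))} (\<lambda>x. of_real (frac (exp x)) * exp (- s * of_real x)) = frac_piece k s"
  and frac_exp_integrable_piece:
  "(\<lambda>x. of_real (frac (exp x)) * exp (- s * of_real x)) integrable_on {ln (real (Suc k))..ln (real (Suc (Suc k)))}"
proof -
  let ?I = "{ln (real (Suc k))..ln (real (Suc (Suc k)))}"
  \<comment> \<open>The right end point is excluded because the fractional part jumps back to 0
    there.\<close>
  have eq: "of_real (frac (exp x)) * exp (- s * of_real x) = (of_real (exp x) - of_nat (Suc k)) * exp (- s * of_real x)"
    if "x \<in> ?I - {ln (real (Suc (Suc k)))}" for x
  proof -
    have "exp (ln (real (Suc k))) \<le> exp x" "exp x < exp (ln (real (Suc (Suc k))))"
      unfolding exp_le_cancel_iff exp_less_cancel_iff using that by auto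
    then have "real (Suc k) \<le> exp x" "exp x < real (Suc (Suc k))" by simp_all
    then have "\<lfloor>exp x\<rfloor> = int (Suc k)" by (intro floor_unique) auto
    then show ?thesis by (simp add: frac_def)
  qed
  show "integral ?I (\<lambda>x. of_real (frac (exp x)) * exp (- s * of_real x)) = frac_piece k s"
    unfolding frac_piece_def
    by (rule integral_spike[where S = "{ln (real (Suc (Suc k)))}", OF _ eq[symmetric]]) simp
  have "(\<lambda>x. (of_real (exp x) - of_nat (Suc k)) * exp (- s * of_real x)) integrable_on ?I"
    by (intro integrable_continuous_real continuous_intros)
  then show "(\<lambda>x. of_real (frac (exp x)) * exp (- s * of_real x)) integrable_on ?I"
    by (rule integrable_spike[where S = "{ln (real (Suc (Suc k)))}", OF _ _ eq]) simp
qed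

lemma frac_exp_integral_partial:
  "((\<lambda>x. of_real (frac (exp x)) * exp (- s * of_real x)) has_integral (\<Sum>k<K. frac_piece k s)) {0..ln (real (Suc K))}"
proof (induction K)
  case (Suc K)
  have "((\<lambda>x. of_real (frac (exp x)) * exp (- s * of_real x)) has_integral frac_piece K s) {ln (real (Suc K))..ln (real (Suc (Suc K)))}"
    using integrable_integral[OF frac_exp_integrable_piece[of s K]] by (simp only: frac_exp_integral_piece)
  then have "((\<lambda>x. of_real (frac (exp x)) * exp (- s * of_real x)) has_integral (\<Sum>k<K. frac_piece k s) + frac_piece K s) {0..ln (real (Suc (Suc K)))}"
    by (intro has_integral_combine[OF _ _ Suc.IH]) auto
  then show ?case by simp
qed (simp add: has_integral_refl)

lemma integrable_exp_abs:
  fixes c :: real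
  assumes c: "c > 0"
  shows "integrable lborel (\<lambda>x. exp (- c * \<bar>x\<bar>))"
proof -
  have "(\<integral>\<^sup>+x. ennreal (exp (- c * x)) * indicator {0..} x \<partial>lborel) = ennreal (0 - (- exp (- c * 0) / c))"
  proof (rule nn_integral_FTC_atLeast)
    show "DERIV (\<lambda>x. - exp (- c * x) / c) x :> exp (- c * x)" for x
      using c by (auto intro!: derivative_eq_intros)
    show "((\<lambda>x. - exp (- c * x) / c) \<longlongrightarrow> 0) at_top" using c by real_asymp
  qed auto
  moreover have "ennreal (exp (- c * x)) * indicator {0..} x = ennreal (indicator {0..} x * exp (- c * x))" for x
    by (simp add: indicator_def)
  ultimately have 1: "integrable lborel (\<lambda>x. indicator {0..} x * exp (- c * x))"
    by (intro integrableI_nn_integral_finite[where x = "0 - (- exp (- c * 0) / c)"]) (use c in auto)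
  have 2: "integrable lborel (\<lambda>x. indicator {0..} (- x) * exp (- c * (- x)))"
    using 1 lborel_integrable_real_affine_iff[of "-1" "\<lambda>x. indicator {0..} x * exp (- c * x)" 0] by simp
  show ?thesis
    by (rule Bochner_Integration.integrable_bound[OF Bochner_Integration.integrable_add[OF 1 2]])
       (auto simp: indicator_def abs_if)
qed

text \<open>For x < 0 the fractional part is e^x itself, and for x \<ge> 0 it is below 1; the weight
  exp(-\<sigma> x) thus leaves exponential decay in both directions.\<close>

lemma frac_exp_le:
  fixes \<sigma> x :: real
  assumes "0 < \<sigma>" "\<sigma> < 1"
  shows "frac (exp x) * exp (- \<sigma> * x) \<le> exp (- (min \<sigma> (1 - \<sigma>)) * \<bar>x\<bar>)"
proof (cases "x < 0")
  case True
  then have "frac (exp x) = exp x" by (subst frac_eq) auto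
  then have "frac (exp x) * exp (- \<sigma> * x) = exp (- (1 - \<sigma>) * \<bar>x\<bar>)"
    using True by (simp add: algebra_simps flip: exp_add)
  also have "\<dots> \<le> exp (- (min \<sigma> (1 - \<sigma>)) * \<bar>x\<bar>)"
    unfolding exp_le_cancel_iff by (intro mult_right_mono) auto
  finally show ?thesis .
next
  case False
  have "frac (exp x) * exp (- \<sigma> * x) \<le> 1 * exp (- \<sigma> * x)"
    using frac_lt_1[of "exp x"] by (intro mult_right_mono) auto
  also have "\<dots> \<le> exp (- (min \<sigma> (1 - \<sigma>)) * \<bar>x\<bar>)"
    using False by (auto intro!: mult_right_mono)
  finally show ?thesis .
qed

text \<open>In the strip 0 < Re s < 1 the integral may be taken over all u > 0. The part u < 1,
  where frac(u) = u, contributes 1 / (1 - s); this cancels the pole term of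
  \<open>zeta_eq_frac_transform\<close> and leaves exactly \<open>- zeta s / s\<close>.\<close>

lemma
  assumes s: "0 < Re s" "Re s < 1"
  shows integrable_frac_exp: "integrable lborel (\<lambda>x. of_real (frac (exp x)) * exp (- s * of_real x))"
    and zeta_mellin: "(CLINT x|lborel. of_real (frac (exp x)) * exp (- s * of_real x)) = - zeta s / s"
proof -
  define f where "f = (\<lambda>x. of_real (frac (exp x)) * exp (- s * of_real x))"
  have [measurable]: "f \<in> borel_measurable borel" unfolding f_def by measurable
  have c: "min (Re s) (1 - Re s) > 0" using s by simp
  have fb: "norm (f x) \<le> exp (- (min (Re s) (1 - Re s)) * \<bar>x\<bar>)" for x
    using frac_exp_le[OF s, of x] by (simp add: f_def norm_mult)
  show int: "integrable lborel f"
    by (rule Bochner_Integration.integrable_bound[OF integrable_exp_abs[OF c]]) (use fb in auto)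
  have s0: "s \<noteq> 0" "s \<noteq> 1" using s by auto
  have neg: "(f has_integral (1 / (1 - s) - exp (- (1 - s) * of_nat K) / (1 - s))) {- real K..0}" for K
  proof -
    have "((\<lambda>x. exp ((1 - s) * of_real x)) has_integral (exp ((1 - s) * of_real 0) / (1 - s) - exp ((1 - s) * of_real (- real K)) / (1 - s))) {- real K..0}"
    proof (rule fundamental_theorem_of_calculus)
      fix x :: real
      have "((\<lambda>z. exp ((1 - s) * z) / (1 - s)) has_field_derivative exp ((1 - s) * of_real x)) (at (of_real x))"
        using s0 by (auto intro!: derivative_eq_intros)
      then show "((\<lambda>x. exp ((1 - s) * of_real x) / (1 - s)) has_vector_derivative exp ((1 - s) * of_real x)) (at x within {- real K..0})"
        by (rule has_vector_derivative_real_field)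
    qed simp
    then have "((\<lambda>x. exp ((1 - s) * of_real x)) has_integral (1 / (1 - s) - exp (- (1 - s) * of_nat K) / (1 - s))) {- real K..0}"
      by (simp add: algebra_simps)
    then show ?thesis
    \<comment> \<open>At x = 0 the fractional part of e^x is 0 instead of 1; a single point is
      negligible.\<close>
    proof (rule has_integral_spike[where S = "{0}", rotated 2])
      fix x assume "x \<in> {- real K..0} - {0}"
      then have "frac (exp x) = exp x" by (subst frac_eq) auto
      then show "f x = exp ((1 - s) * of_real x)"
        unfolding f_def by (simp add: left_diff_distrib exp_diff exp_minus divide_inverse exp_of_real)
    qed simp
  qed
  define S where "S = (\<lambda>K. {- real K..ln (real (Suc K))})"
  have intS: "(LINT x:S K|lborel. f x) = (1 / (1 - s) - exp (- (1 - s) * of_nat K) / (1 - s)) + (\<Sum>k<K. frac_piece k s)" for K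
  proof -
    have "set_integrable lborel (S K) f" using int unfolding set_integrable_def S_def by (intro integrable_mult_indicator) auto
    then have "(LINT x:S K|lborel. f x) = integral (S K) f" by (rule set_borel_integral_eq_integral)
    also have "(f has_integral ((1 / (1 - s) - exp (- (1 - s) * of_nat K) / (1 - s)) + (\<Sum>k<K. frac_piece k s))) (S K)"
      unfolding S_def by (rule has_integral_combine[OF _ _ neg frac_exp_integral_partial[of s, folded f_def]]) auto
    then have "integral (S K) f = (1 / (1 - s) - exp (- (1 - s) * of_nat K) / (1 - s)) + (\<Sum>k<K. frac_piece k s)"
      by (rule integral_unique)
    finally show ?thesis .
  qed
  have "(\<lambda>K. LINT x:S K|lborel. f x) \<longlonglongrightarrow> (CLINT x|lborel. f x)"
    unfolding set_lebesgue_integral_def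
  proof (rule integral_dominated_convergence[where w = "\<lambda>x. norm (f x)"])
    show "AE x in lborel. (\<lambda>K. indicat_real (S K) x *\<^sub>R f x) \<longlonglongrightarrow> f x"
    proof (intro AE_I2 tendsto_eventually)
      fix x
      have "\<forall>\<^sub>F K in sequentially. real K \<ge> \<bar>x\<bar> \<and> ln (real (Suc K)) \<ge> x"
      proof (rule eventually_conj)
        show "\<forall>\<^sub>F K in sequentially. real K \<ge> \<bar>x\<bar>" by real_asymp
        have "filterlim (\<lambda>K. ln (real (Suc K))) at_top sequentially" by real_asymp
        then show "\<forall>\<^sub>F K in sequentially. ln (real (Suc K)) \<ge> x" by (simp add: filterlim_at_top)
      qed
      then show "\<forall>\<^sub>F K in sequentially. indicat_real (S K) x *\<^sub>R f x = f x"
        by eventually_elim (auto simp: S_def)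
    qed
  qed (use int in \<open>auto simp: S_def indicator_def\<close>)
  moreover have "(\<lambda>K. LINT x:S K|lborel. f x) \<longlonglongrightarrow> (1 / (1 - s) - 0 / (1 - s)) + frac_transform s"
    unfolding intS frac_transform_def
  proof (intro tendsto_intros summable_LIMSEQ summable_frac_piece s)
    show "(\<lambda>K. exp (- (1 - s) * of_nat K)) \<longlonglongrightarrow> 0"
    proof (rule tendsto_norm_zero_cancel)
      have "(\<lambda>K. exp (- (1 - Re s) * real K)) \<longlonglongrightarrow> 0" using s by real_asymp
      then show "(\<lambda>K. norm (exp (- (1 - s) * of_nat K))) \<longlonglongrightarrow> 0" by simp
    qed
  qed (use s0 in auto)
  ultimately have "(CLINT x|lborel. f x) = 1 / (1 - s) + frac_transform s"
    using LIMSEQ_unique by fastforce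
  also have "\<dots> = - zeta s / s"
    unfolding zeta_eq_frac_transform[OF s(1) s0(2)] using s0 by (simp add: field_simps)
  finally show "(CLINT x|lborel. f x) = - zeta s / s" .
qed

section \<open>Concentration of the mollified zeta function\<close>

lemma has_integral_exp_substitution:
  fixes F :: "real \<Rightarrow> real"
  assumes F: "F \<in> borel_measurable borel" "\<And>u. F u \<ge> 0"
    and int: "integrable lborel (\<lambda>x. exp x * F (exp x))"
  shows "ennreal (LINT x|lborel. exp x * F (exp x)) = (\<integral>\<^sup>+u\<in>{0<..}. ennreal (F u) \<partial>lborel)"
proof -
  have range: "range (exp :: real \<Rightarrow> real) = {0<..}" by (auto simp: image_iff intro: exp_ln[symmetric])
  have inj: "inj (exp :: real \<Rightarrow> real)" by (auto intro: injI)
  have ai: "(\<lambda>x. \<bar>exp x\<bar> * F (exp x)) absolutely_integrable_on UNIV"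
    using int by (simp add: set_integrable_def integrable_completion)
  have "F absolutely_integrable_on {0<..} \<and> integral {0<..} F = integral UNIV (\<lambda>x. \<bar>exp x\<bar> * F (exp x))"
    using has_absolute_integral_change_of_variables_1'[of UNIV exp exp F "integral UNIV (\<lambda>x. \<bar>exp x\<bar> * F (exp x))"] ai inj
    unfolding range[symmetric] by (auto intro!: derivative_eq_intros)
  then have FF: "F absolutely_integrable_on {0<..}" "integral {0<..} F = (LINT x|lborel. exp x * F (exp x))"
    using integral_lborel[OF int] by simp_all
  have i: "integrable lborel (\<lambda>u. indicator {0<..} u * F u)"
    using FF(1) F(1) unfolding set_integrable_def by (subst (asm) integrable_completion) auto
  have "(\<integral>\<^sup>+u\<in>{0<..}. ennreal (F u) \<partial>lborel) = (\<integral>\<^sup>+u. ennreal (indicator {0<..} u * F u) \<partial>lborel)"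
    by (intro nn_integral_cong) (auto simp: indicator_def)
  also have "\<dots> = ennreal (LINT u|lborel. indicator {0<..} u * F u)"
    by (rule nn_integral_eq_integral[OF i]) (use F in auto)
  also have "(LINT u|lborel. indicator {0<..} u * F u) = integral {0<..} F"
    using set_borel_integral_eq_integral(2)[of "{0<..}" F] i by (simp add: set_integrable_def set_lebesgue_integral_def)
  finally show ?thesis using FF(2) by simp
qed

context sieve begin

definition mollifier :: "complex \<Rightarrow> complex" where
  "mollifier s = (\<Sum>A\<in>brun P N. (-1) ^ card A * of_nat (\<Prod>A) powr (- s))"

text \<open>The factor exp(-x/2) makes the Fourier variable t run along the critical line s = 1/2 +
  it.\<close>

definition fracsum_exp :: "real \<Rightarrow> real \<Rightarrow> real" where
  "fracsum_exp \<eta> x = fracsum \<eta> (exp x) * exp (- x / 2)"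

text \<open>Translation by c multiplies the transform by exp(-s c); for c = ln h this is the factor
  h^(-s) of a mollifier term. The uniform bound 1 for the shifted function gives square
  integrability later.\<close>

lemma frac_exp_shift:
  fixes c :: real and t :: real
  assumes "c \<ge> 0"
  defines "p \<equiv> \<lambda>x. frac (exp (x - c)) * exp (- x / 2)"
  shows "integrable lborel p" "\<And>x. \<bar>p x\<bar> \<le> 1"
    and "integrable lborel (\<lambda>x. complex_of_real (p x) * iexp (- (t * x)))"
    and "(CLINT x|lborel. complex_of_real (p x) * iexp (- (t * x))) =
       exp (- (1/2 + \<i> * of_real t) * of_real c) * (- zeta (1/2 + \<i> * of_real t) / (1/2 + \<i> * of_real t))"
proof -
  define s where "s = 1/2 + \<i> * complex_of_real t"
  have s: "0 < Re s" "Re s < 1" by (auto simp: s_def)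
  define f where "f = (\<lambda>x. of_real (frac (exp x)) * exp (- s * of_real x))"
  have pf: "complex_of_real (p x) * iexp (- (t * x)) = exp (- s * of_real c) * f (- c + 1 * x)" for x
  proof -
    have "exp (- s * of_real c) * exp (- s * of_real (- c + 1 * x)) = exp (- s * of_real x)"
      by (simp add: algebra_simps flip: exp_add)
    moreover have "exp (- s * of_real x) = of_real (exp (- x / 2)) * iexp (- (t * x))"
    proof -
      have "- s * of_real x = of_real (- x / 2) + \<i> * of_real (- (t * x))" by (simp add: s_def algebra_simps)
      then show ?thesis by (simp only: exp_add exp_of_real)
    qed
    ultimately show ?thesis unfolding f_def p_def
      by (simp add: mult.assoc mult.left_commute[of "exp (- s * of_real c)"] add.commute[of "-c"])
  qed
  have fint: "integrable lborel f" unfolding f_def by (rule integrable_frac_exp[OF s])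
  show int: "integrable lborel (\<lambda>x. complex_of_real (p x) * iexp (- (t * x)))"
    unfolding pf using fint lborel_integrable_real_affine_iff[of 1 f "-c"] by simp
  have [measurable]: "p \<in> borel_measurable borel" unfolding p_def by measurable
  show "integrable lborel p"
    by (rule Bochner_Integration.integrable_bound[OF int]) (auto simp: norm_mult)
  show "\<bar>p x\<bar> \<le> 1" for x
  proof -
    have "frac (exp (x - c)) * exp (- (1/2) * (x - c)) \<le> exp (- (min (1/2) (1 - 1/2)) * \<bar>x - c\<bar>)"
      by (rule frac_exp_le) auto
    also have "\<dots> \<le> 1" by simp
    finally have "frac (exp (x - c)) * exp (- (1/2) * (x - c)) * exp (- c / 2) \<le> 1 * 1"
      using assms(1) by (intro mult_mono) auto
    moreover have "exp (- (1/2) * (x - c)) * exp (- c / 2) = exp (- x / 2)" by (simp add: field_simps flip: exp_add)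
    ultimately have "p x \<le> 1" unfolding p_def by (simp add: mult.assoc)
    moreover have "p x \<ge> 0" unfolding p_def by simp
    ultimately show ?thesis by simp
  qed
  have "(CLINT x|lborel. complex_of_real (p x) * iexp (- (t * x))) = exp (- s * of_real c) * (CLINT x|lborel. f (- c + 1 * x))"
    unfolding pf by (rule integral_mult_right_zero)
  also have "(CLINT x|lborel. f (- c + 1 * x)) = (CLINT x|lborel. f x)"
    using lborel_integral_real_affine[of 1 f "-c"] by simp
  also have "\<dots> = - zeta s / s" unfolding f_def by (rule zeta_mellin[OF s])
  finally show "(CLINT x|lborel. complex_of_real (p x) * iexp (- (t * x))) =
       exp (- (1/2 + \<i> * of_real t) * of_real c) * (- zeta (1/2 + \<i> * of_real t) / (1/2 + \<i> * of_real t))" unfolding s_def .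
qed

text \<open>Division of the argument by a product and dilation by exp(-\<eta>) are both translations
  in x, so the transform factors into \<open>- zeta s / s\<close>, the mollifier and 1 - exp(-\<eta>
  s). The function is integrable and bounded, hence square integrable.\<close>

lemma
  fixes \<eta> t :: real
  assumes eta: "\<eta> \<ge> 0"
  shows integrable_fracsum_exp: "integrable lborel (fracsum_exp \<eta>)"
    and integrable_fracsum_exp_square: "integrable lborel (\<lambda>x. (fracsum_exp \<eta> x)\<^sup>2)"
    and fourier_fracsum_exp: "fourier (fracsum_exp \<eta>) t = - (zeta (1/2 + \<i> * of_real t) * mollifier (1/2 + \<i> * of_real t) *
       ((1 - exp (- of_real \<eta> * (1/2 + \<i> * of_real t))) / (1/2 + \<i> * of_real t)))"
proof -
  define s where "s = 1/2 + \<i> * complex_of_real t"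
  define p :: "real \<Rightarrow> real \<Rightarrow> real" where "p = (\<lambda>c x. frac (exp (x - c)) * exp (- x / 2))"
  define l where "l = (\<lambda>A. ln (real (\<Prod>A)))"
  have l0: "l A \<ge> 0" "exp (l A) = real (\<Prod>A)" if "A \<in> brun P N" for A
  proof -
    have "\<Prod>A > 0" by (intro prod_pos brun_subset that)
    then have "real (\<Prod>A) \<ge> 1" by linarith
    then show "l A \<ge> 0" "exp (l A) = real (\<Prod>A)" unfolding l_def by (auto simp del: of_nat_prod)
  qed
  have eq: "fracsum_exp \<eta> x = (\<Sum>A\<in>brun P N. (-1) ^ card A * (p (l A) x - p (l A + \<eta>) x))" for x
    unfolding fracsum_exp_def fracsum_def sum_distrib_right
  proof (intro sum.cong refl)
    fix A assume A: "A \<in> brun P N"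
    have "exp x / real (\<Prod>A) = exp (x - l A)" "exp x * exp (-\<eta>) / real (\<Prod>A) = exp (x - (l A + \<eta>))"
      unfolding l0(2)[OF A, symmetric] by (simp_all add: exp_diff exp_add exp_minus field_simps)
    then show "(-1) ^ card A * (frac (exp x / real (\<Prod>A)) - frac (exp x * exp (-\<eta>) / real (\<Prod>A))) * exp (- x / 2) =
       (-1) ^ card A * (p (l A) x - p (l A + \<eta>) x)"
      unfolding p_def by (simp add: algebra_simps)
  qed
  have int_p: "integrable lborel (p c)" if "c \<ge> 0" for c unfolding p_def by (rule frac_exp_shift(1)[OF that])
  have p_le: "\<bar>p c x\<bar> \<le> 1" if "c \<ge> 0" for c x unfolding p_def by (rule frac_exp_shift(2)[OF that])
  show int: "integrable lborel (fracsum_exp \<eta>)"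
    unfolding eq using l0 eta by (intro Bochner_Integration.integrable_sum integrable_mult_right Bochner_Integration.integrable_diff int_p) auto
  have bd: "\<bar>fracsum_exp \<eta> x\<bar> \<le> 2 * y" for x
  proof -
    have "\<bar>fracsum_exp \<eta> x\<bar> \<le> (\<Sum>A\<in>brun P N. \<bar>(-1) ^ card A * (p (l A) x - p (l A + \<eta>) x)\<bar>)"
      unfolding eq by (rule sum_abs)
    also have "\<dots> \<le> (\<Sum>A\<in>brun P N. 2)"
    proof (rule sum_mono)
      fix A assume A: "A \<in> brun P N"
      have "\<bar>p (l A) x\<bar> \<le> 1" "\<bar>p (l A + \<eta>) x\<bar> \<le> 1"
        using l0[OF A] eta by (auto intro!: p_le)
      then show "\<bar>(-1) ^ card A * (p (l A) x - p (l A + \<eta>) x)\<bar> \<le> 2" by (simp add: abs_mult)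
    qed
    finally show ?thesis using card_le by simp
  qed
  have [measurable]: "fracsum_exp \<eta> \<in> borel_measurable borel" using int by auto
  show "integrable lborel (\<lambda>x. (fracsum_exp \<eta> x)\<^sup>2)"
  proof (rule Bochner_Integration.integrable_bound)
    show "integrable lborel (\<lambda>x. 2 * y * fracsum_exp \<eta> x)" using int by simp
    show "AE x in lborel. norm ((fracsum_exp \<eta> x)\<^sup>2) \<le> norm (2 * y * fracsum_exp \<eta> x)"
    proof (intro AE_I2)
      fix x
      have "\<bar>fracsum_exp \<eta> x\<bar> * \<bar>fracsum_exp \<eta> x\<bar> \<le> 2 * y * \<bar>fracsum_exp \<eta> x\<bar>"
        using bd by (intro mult_right_mono) auto
      then show "norm ((fracsum_exp \<eta> x)\<^sup>2) \<le> norm (2 * y * fracsum_exp \<eta> x)"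
        using y_ge_1 by (simp add: power2_eq_square abs_mult)
    qed
  qed measurable
  have "fourier (fracsum_exp \<eta>) t = (CLINT x|lborel. \<Sum>A\<in>brun P N. (-1) ^ card A * (complex_of_real (p (l A) x) * iexp (- (t * x)) - complex_of_real (p (l A + \<eta>) x) * iexp (- (t * x))))"
    unfolding fourier_def eq of_real_sum sum_distrib_right
    by (intro Bochner_Integration.integral_cong sum.cong refl) (simp add: algebra_simps)
  also have "\<dots> = (\<Sum>A\<in>brun P N. (-1) ^ card A * ((CLINT x|lborel. complex_of_real (p (l A) x) * iexp (- (t * x))) - (CLINT x|lborel. complex_of_real (p (l A + \<eta>) x) * iexp (- (t * x)))))"
  proof -
    have i: "integrable lborel (\<lambda>x. complex_of_real (p c x) * iexp (- (t * x)))" if "c \<ge> 0" for c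
      unfolding p_def by (rule frac_exp_shift(3)[OF that])
    have il: "integrable lborel (\<lambda>x. complex_of_real (p (l A) x) * iexp (- (t * x)))"
      "integrable lborel (\<lambda>x. complex_of_real (p (l A + \<eta>) x) * iexp (- (t * x)))" if "A \<in> brun P N" for A
      using i[OF l0(1)[OF that]] i[of "l A + \<eta>"] l0(1)[OF that] eta by simp_all
    show ?thesis
    proof (subst Bochner_Integration.integral_sum)
      show "integrable lborel (\<lambda>x. (-1) ^ card A * (complex_of_real (p (l A) x) * iexp (- (t * x)) - complex_of_real (p (l A + \<eta>) x) * iexp (- (t * x))))"
        if "A \<in> brun P N" for A
        by (intro integrable_mult_right Bochner_Integration.integrable_diff il that)
    qed (intro sum.cong refl, subst integral_mult_right_zero, subst Bochner_Integration.integral_diff, (rule il | assumption | rule refl)+)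
  qed
  also have "\<dots> = (\<Sum>A\<in>brun P N. (-1) ^ card A * (of_nat (\<Prod>A) powr (- s) * (- zeta s / s) * (1 - exp (- of_real \<eta> * s))))"
  proof (intro sum.cong refl arg_cong2[of _ _ _ _ times])
    fix A assume A: "A \<in> brun P N"
    have v: "(CLINT x|lborel. complex_of_real (p c x) * iexp (- (t * x))) = exp (- s * of_real c) * (- zeta s / s)" if "c \<ge> 0" for c
      unfolding p_def s_def by (rule frac_exp_shift(4)[OF that])
    have "\<Prod>A > 0" by (intro prod_pos brun_subset A)
    then have pw: "of_nat (\<Prod>A) powr (- s) = exp (- s * of_real (l A))"
      unfolding l_def by (rule of_nat_powr_eq_exp)
    have nn: "l A \<ge> 0" "l A + \<eta> \<ge> 0" using l0(1)[OF A] eta by auto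
    have e: "exp (- s * of_real (l A + \<eta>)) = exp (- s * of_real (l A)) * exp (- of_real \<eta> * s)"
      by (simp add: algebra_simps flip: exp_add)
    show "(CLINT x|lborel. complex_of_real (p (l A) x) * iexp (- (t * x))) - (CLINT x|lborel. complex_of_real (p (l A + \<eta>) x) * iexp (- (t * x))) =
       of_nat (\<Prod>A) powr (- s) * (- zeta s / s) * (1 - exp (- of_real \<eta> * s))"
      unfolding v[OF nn(1)] v[OF nn(2)] pw e by (simp only: right_diff_distrib mult_1_left mult_1_right mult_ac)
  qed
  also have "\<dots> = - (zeta s * mollifier s * ((1 - exp (- of_real \<eta> * s)) / s))"
    unfolding mollifier_def by (simp add: sum_distrib_left sum_distrib_right mult_ac sum_negf divide_inverse)
  finally show "fourier (fracsum_exp \<eta>) t = - (zeta (1/2 + \<i> * of_real t) * mollifier (1/2 + \<i> * of_real t) *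
       ((1 - exp (- of_real \<eta> * (1/2 + \<i> * of_real t))) / (1/2 + \<i> * of_real t)))" unfolding s_def .
qed

lemma mollified_mean_square:
  assumes eta: "\<eta> > 0"
  shows "(\<integral>\<^sup>+t. ennreal ((norm (zeta (1/2 + \<i> * of_real t) * mollifier (1/2 + \<i> * of_real t) *
        ((1 - exp (- of_real \<eta> * (1/2 + \<i> * of_real t))) / (1/2 + \<i> * of_real t))))\<^sup>2) \<partial>lborel) \<le>
     ennreal (2 * pi) * (\<integral>\<^sup>+u\<in>{0<..}. ennreal ((fracsum \<eta> u)\<^sup>2 / u\<^sup>2) \<partial>lborel)"
proof -
  have sq: "(fracsum_exp \<eta> x)\<^sup>2 = exp x * ((fracsum \<eta> (exp x))\<^sup>2 / (exp x)\<^sup>2)" for x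
  proof -
    have "(exp (- x / 2))\<^sup>2 = exp (- x)" by (simp add: power2_eq_square flip: exp_add)
    also have "\<dots> = exp x / (exp x)\<^sup>2" by (simp add: power2_eq_square exp_minus field_simps)
    finally show ?thesis unfolding fracsum_exp_def power_mult_distrib by simp
  qed
  have "(\<integral>\<^sup>+t. ennreal ((norm (fourier (fracsum_exp \<eta>) t))\<^sup>2) \<partial>lborel) \<le> ennreal (2 * pi * (LINT x|lborel. (fracsum_exp \<eta> x)\<^sup>2))"
    by (rule plancherel_le) (use eta in \<open>auto intro: integrable_fracsum_exp integrable_fracsum_exp_square\<close>)
  also have "\<dots> = ennreal (2 * pi) * ennreal (LINT x|lborel. (fracsum_exp \<eta> x)\<^sup>2)"
    by (rule ennreal_mult) auto
  also have "ennreal (LINT x|lborel. (fracsum_exp \<eta> x)\<^sup>2) = (\<integral>\<^sup>+u\<in>{0<..}. ennreal ((fracsum \<eta> u)\<^sup>2 / u\<^sup>2) \<partial>lborel)"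
    unfolding sq by (rule has_integral_exp_substitution) (use integrable_fracsum_exp_square[of \<eta>] eta in \<open>auto simp: sq\<close>)
  finally show ?thesis
    using eta by (simp add: fourier_fracsum_exp)
qed

end

section \<open>The mollified zeta function transported to the unit disc\<close>

lemma Re_moebius:
  assumes "z \<noteq> 1" shows "Re ((1 + z) / (1 - z)) = (1 - (norm z)\<^sup>2) / (norm (1 - z))\<^sup>2"
  unfolding Re_divide cmod_power2 by (simp add: power2_eq_square algebra_simps)

lemma cayley_facts:
  assumes "T > 0"
  shows "cayley T t \<noteq> 1" "norm (cayley T t) = 1"
    "(1 + cayley T t) / (1 - cayley T t) = \<i> * of_real t / of_real T"
    "norm (1 - cayley T t) \<le> 2"
proof -
  have nz: "\<i> * of_real t + of_real T \<noteq> (0::complex)" using assms by (auto simp: complex_eq_iff)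
  have 1: "1 - cayley T t = 2 * of_real T / (\<i> * of_real t + of_real T)"
    unfolding cayley_def using nz by (simp add: field_simps)
  have 2: "1 + cayley T t = 2 * \<i> * of_real t / (\<i> * of_real t + of_real T)"
    unfolding cayley_def using nz by (simp add: field_simps)
  have "1 - cayley T t \<noteq> 0" unfolding 1 using nz assms by simp
  then show "cayley T t \<noteq> 1" by simp
  show "norm (cayley T t) = 1" using cayley_eq_cis[OF assms] by simp
  then show "norm (1 - cayley T t) \<le> 2" using norm_triangle_ineq4[of 1 "cayley T t"] by simp
  show "(1 + cayley T t) / (1 - cayley T t) = \<i> * of_real t / of_real T"
    unfolding 1 2 using nz assms by simp
qed

text \<open>From n^-5 \<le> 1 / (8 n (n - 1)) for n \<ge> 2 the tail telescopes to 1/8.\<close>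

lemma zeta_near_1:
  assumes s: "Re s \<ge> 10"
  shows "norm (zeta s - 1) \<le> 1/2"
proof -
  have s1: "Re s > 1" using s by simp
  have "zeta s = (\<Sum>n. of_nat (Suc n) powr (- s))"
    using is_zeta_continuation_zeta s1 unfolding is_zeta_continuation_def by blast
  then have "zeta s - 1 = (\<Sum>n. of_nat (Suc (Suc n)) powr (- s))"
    using suminf_split_head[OF summable_dirichlet[OF s1]] by simp
  also have "norm \<dots> \<le> (\<Sum>n. 1/8 * (inverse (real (Suc n)) - inverse (real (Suc (Suc n)))))"
  proof (rule norm_suminf_le)
    have "(\<lambda>n. inverse (real (Suc n)) - inverse (real (Suc (Suc n)))) sums (inverse (real (Suc 0)) - 0)"
      by (rule telescope_sums') (rule LIMSEQ_inverse_real_of_nat)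
    then show "summable (\<lambda>n. 1/8 * (inverse (real (Suc n)) - inverse (real (Suc (Suc n)))))"
      by (intro summable_mult) (rule sums_summable)
    fix n
    let ?x = "real (Suc (Suc n))"
    have "norm (of_nat (Suc (Suc n)) powr (- s)) = ?x powr (- Re s)" by (simp only: dirichlet_term_norm) simp
    also have "\<dots> \<le> ?x powr (- 5)" using s by (intro powr_mono) auto
    also have "\<dots> = inverse (?x ^ 5)" by (simp only: powr_minus powr_numeral of_nat_0_le_iff)
    also have "\<dots> \<le> inverse (2 ^ 3 * ?x ^ 2)"
    proof (rule le_imp_inverse_le)
      have "2 ^ 3 * ?x ^ 2 \<le> ?x ^ 3 * ?x ^ 2" by (intro mult_right_mono power_mono) auto
      then show "2 ^ 3 * ?x ^ 2 \<le> ?x ^ 5" by (simp flip: power_add)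
    qed auto
    also have "\<dots> \<le> 1/8 * (inverse (real (Suc n)) - inverse ?x)"
    proof -
      have "inverse (real (Suc n)) - inverse ?x = inverse (real (Suc n) * ?x)"
        by (simp add: field_simps)
      moreover have "inverse (?x ^ 2) \<le> inverse (real (Suc n) * ?x)"
        by (intro le_imp_inverse_le) (auto simp: power2_eq_square)
      ultimately show ?thesis by simp
    qed
    finally show "norm (of_nat (Suc (Suc n)) powr (- s)) \<le> 1/8 * (inverse (real (Suc n)) - inverse ?x)" .
  qed
  also have "\<dots> = 1/8"
  proof -
    have "(\<lambda>n. inverse (real (Suc n)) - inverse (real (Suc (Suc n)))) sums (inverse (real (Suc 0)) - 0)"
      by (rule telescope_sums') (rule LIMSEQ_inverse_real_of_nat)
    then have "(\<lambda>n. 1/8 * (inverse (real (Suc n)) - inverse (real (Suc (Suc n))))) sums (1/8 * 1)"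
      by (intro sums_mult) simp
    then show ?thesis by (simp add: sums_iff)
  qed
  finally show ?thesis by simp
qed

context sieve begin

lemma mollifier_bound: "Re s \<ge> 0 \<Longrightarrow> norm (mollifier s) \<le> y"
proof -
  assume s: "Re s \<ge> 0"
  have "norm (mollifier s) \<le> (\<Sum>A\<in>brun P N. 1)"
    unfolding mollifier_def
  proof (rule order.trans[OF norm_sum], rule sum_mono)
    fix A assume "A \<in> brun P N"
    then have A: "\<Prod>A > 0" by (intro prod_pos brun_subset)
    then obtain m where m: "\<Prod>A = Suc m" by (cases "\<Prod>A") auto
    have "real (Suc m) powr (- Re s) \<le> real (Suc m) powr 0" using s by (intro powr_mono) auto
    then show "norm ((-1) ^ card A * of_nat (\<Prod>A) powr (- s)) \<le> 1"
      unfolding m norm_mult dirichlet_term_norm by (simp add: norm_power)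
  qed
  then show ?thesis using card_le by simp
qed

lemma mollifier_holomorphic: "mollifier holomorphic_on S"
proof -
  have "(\<lambda>s. (-1) ^ card A * of_nat (\<Prod>A) powr (- s)) holomorphic_on S" if "A \<in> brun P N" for A
    using prod_pos[OF brun_subset[OF that]] by (intro holomorphic_intros)
  then show ?thesis unfolding mollifier_def by (intro holomorphic_intros)
qed

text \<open>The empty set supplies the term 1, and every other product is at least 2.\<close>

lemma mollifier_near_1:
  assumes s: "Re s \<ge> 0" and y: "y * 2 powr (- Re s) \<le> 1/2"
  shows "norm (mollifier s - 1) \<le> 1/2"
proof -
  have e: "{} \<in> brun P N" by (simp add: brun_def)
  have "mollifier s - 1 = (\<Sum>A\<in>brun P N - {{}}. (-1) ^ card A * of_nat (\<Prod>A) powr (- s))"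
    unfolding mollifier_def by (subst sum.remove[OF finite_brun e]) simp
  also have "norm \<dots> \<le> (\<Sum>A\<in>brun P N - {{}}. 2 powr (- Re s))"
  proof (rule order.trans[OF norm_sum], rule sum_mono)
    fix A assume A: "A \<in> brun P N - {{}}"
    then obtain p where p: "p \<in> A" "p \<in> P" using brun_subset[of A] by auto
    have "\<Prod>A > 0" using A by (intro prod_pos brun_subset) auto
    moreover have "p dvd \<Prod>A" using p A brun_finite by (intro dvd_prodI) auto
    ultimately have "p \<le> \<Prod>A" by (intro dvd_imp_le) auto
    then have A2: "2 \<le> \<Prod>A" using primeP[OF p(2)] prime_ge_2_nat[of p] by linarith
    then obtain m where m: "\<Prod>A = Suc m" by (cases "\<Prod>A") auto
    have "real (Suc m) powr (- Re s) \<le> 2 powr (- Re s)"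
      using s A2 m by (intro powr_mono2') auto
    then show "norm ((-1) ^ card A * of_nat (\<Prod>A) powr (- s)) \<le> 2 powr (- Re s)"
      unfolding m norm_mult dirichlet_term_norm by (simp add: norm_power)
  qed
  also have "\<dots> \<le> real (card (brun P N)) * 2 powr (- Re s)"
    using finite_brun by (simp add: card_mono)
  also have "\<dots> \<le> y * 2 powr (- Re s)" using card_le by (intro mult_right_mono) auto
  finally show ?thesis using y by simp
qed

text \<open>The first factor is \<open>zeta s * ((s - 1) / s)\<close>: the pole at 1 is gone, and on
  the critical line the modulus is still |zeta s| because |s - 1| = |s|. The last factor is T times
  the one in \<open>fourier_fracsum_exp\<close> for \<eta> = 1/T; it supplies the decay that makes
  the kernel square integrable on the line.\<close>

definition zeta_kernel :: "real \<Rightarrow> complex \<Rightarrow> complex" where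
  "zeta_kernel T s = (1 - (s - 1) * frac_transform s) * mollifier s * (of_real T * (1 - exp (- s / of_real T)) / s)"

text \<open>At z = 1, the image of infinity, \<open>zeta_kernel\<close> is only known to be bounded;
  the factor 1 - z makes the function continuous on the closed disc. It is 1 at the centre, which
  corresponds to s = 1/2 + T, and at most 2 in modulus on the circle.\<close>

definition disc_kernel :: "real \<Rightarrow> complex \<Rightarrow> complex" where
  "disc_kernel T z = (if z = 1 then 0 else zeta_kernel T (1/2 + of_real T * ((1 + z) / (1 - z))) * (1 - z))"

lemma zeta_kernel_holomorphic: "zeta_kernel T holomorphic_on {s. Re s > 0}"
  unfolding zeta_kernel_def
  by (intro holomorphic_intros frac_transform_holomorphic mollifier_holomorphic) auto

text \<open>\<open>frac_transform\<close> is bounded, so the first factor grows at most linearly in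
  |s|, which the 1/|s| of the last factor compensates.\<close>

lemma zeta_kernel_bound:
  assumes T: "T > 0"
  obtains C where "C \<ge> 0" "\<And>s. Re s \<ge> 1/2 \<Longrightarrow> norm (zeta_kernel T s) \<le> C"
proof -
  obtain C where C: "C > 0" "\<And>s. Re s \<ge> 1/2 \<Longrightarrow> norm (frac_transform s) \<le> C"
    using frac_transform_bound by blast
  show ?thesis
  proof (rule that[of "(2 + 3 * C) * y * (T * 2)"])
    show "0 \<le> (2 + 3 * C) * y * (T * 2)" using C T y_ge_1 by simp
    fix s :: complex assume s: "Re s \<ge> 1/2"
    have ns: "norm s \<ge> 1/2" using s abs_Re_le_cmod[of s] by linarith
    then have s0: "s \<noteq> 0" by auto
    have "norm (1 - (s - 1) * frac_transform s) \<le> 1 + (norm s + 1) * C"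
    proof -
      have "norm (1 - (s - 1) * frac_transform s) \<le> 1 + norm (s - 1) * norm (frac_transform s)"
        using norm_triangle_ineq4[of 1 "(s - 1) * frac_transform s"] by (simp add: norm_mult)
      also have "norm (s - 1) * norm (frac_transform s) \<le> (norm s + 1) * C"
        using norm_triangle_ineq4[of s 1] C s by (intro mult_mono) auto
      finally show ?thesis by simp
    qed
    also have "\<dots> \<le> (2 + 3 * C) * norm s"
    proof -
      have "1 \<le> 2 * norm s" using ns by simp
      then have "C * 1 \<le> C * (2 * norm s)" using C by (intro mult_left_mono) auto
      then show ?thesis using \<open>1 \<le> 2 * norm s\<close> by (simp add: algebra_simps)
    qed
    finally have 1: "norm (1 - (s - 1) * frac_transform s) \<le> (2 + 3 * C) * norm s" .
    have "norm (1 - exp (- s / of_real T)) \<le> 1 + norm (exp (- s / of_real T))"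
      using norm_triangle_ineq4[of 1 "exp (- s / of_real T)"] by simp
    also have "norm (exp (- s / of_real T)) \<le> 1" using s T by (simp add: Re_divide_of_real)
    finally have 2: "norm (of_real T * (1 - exp (- s / of_real T)) / s) \<le> T * 2 / norm s"
      using T ns by (auto simp: norm_mult norm_divide intro!: divide_right_mono mult_left_mono)
    have "norm (zeta_kernel T s) \<le> ((2 + 3 * C) * norm s) * y * (T * 2 / norm s)"
      unfolding zeta_kernel_def norm_mult[of "_ * _"] norm_mult[of _ "mollifier s"]
      using 1 2 mollifier_bound[of s] s C T y_ge_1 by (intro mult_mono) auto
    also have "\<dots> = (2 + 3 * C) * y * (T * 2)" using s0 by simp
    finally show "norm (zeta_kernel T s) \<le> (2 + 3 * C) * y * (T * 2)" .
  qed
qed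

lemma disc_kernel_half_plane:
  assumes "T > 0" "norm z \<le> 1" "z \<noteq> 1"
  shows "Re (1/2 + of_real T * ((1 + z) / (1 - z))) \<ge> 1/2"
proof -
  have "(norm z)\<^sup>2 \<le> 1" using assms by (simp add: power_le_one)
  then have "Re ((1 + z) / (1 - z)) \<ge> 0" unfolding Re_moebius[OF assms(3)] by (intro divide_nonneg_nonneg) auto
  then have "T * Re ((1 + z) / (1 - z)) \<ge> 0" using assms by (intro mult_nonneg_nonneg) auto
  moreover have "Re (1/2 + of_real T * w) = 1/2 + T * Re w" for w by simp
  ultimately show ?thesis by (simp only:)
qed

lemma disc_kernel_holomorphic: "T > 0 \<Longrightarrow> disc_kernel T holomorphic_on ball 0 1"
proof -
  assume T: "T > 0"
  have "(\<lambda>z. zeta_kernel T (1/2 + of_real T * ((1 + z) / (1 - z))) * (1 - z)) holomorphic_on ball 0 1"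
  proof (intro holomorphic_intros holomorphic_on_compose_gen[OF _ zeta_kernel_holomorphic, unfolded o_def])
    show "(\<lambda>z. 1/2 + of_real T * ((1 + z) / (1 - z))) ` ball 0 1 \<subseteq> {s. 0 < Re s}"
    proof safe
      fix z :: complex assume "z \<in> ball 0 1"
      then have "norm z \<le> 1" "z \<noteq> 1" by auto
      from disc_kernel_half_plane[OF T this] show "0 < Re (1/2 + of_real T * ((1 + z) / (1 - z)))" by linarith
    qed
  qed auto
  then show ?thesis by (rule holomorphic_transform) (auto simp: disc_kernel_def)
qed

lemma disc_kernel_continuous: "T > 0 \<Longrightarrow> continuous_on (cball 0 1) (disc_kernel T)"
proof -
  assume T: "T > 0"
  obtain C where C: "C \<ge> 0" "\<And>s. Re s \<ge> 1/2 \<Longrightarrow> norm (zeta_kernel T s) \<le> C" using zeta_kernel_bound[OF T] by blast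
  let ?s = "\<lambda>z. 1/2 + of_real T * ((1 + z) / (1 - z))"
  have c1: "continuous_on (cball 0 1 - {1}) (disc_kernel T)"
  proof -
    have "continuous_on (cball 0 1 - {1}) (\<lambda>z. zeta_kernel T (?s z) * (1 - z))"
    proof (intro continuous_intros continuous_on_compose2[OF holomorphic_on_imp_continuous_on[OF zeta_kernel_holomorphic]])
      show "?s ` (cball 0 1 - {1}) \<subseteq> {s. 0 < Re s}"
      proof safe
        fix z :: complex assume "z \<in> cball 0 1" "z \<noteq> 1"
        with disc_kernel_half_plane[OF T, of z] show "0 < Re (?s z)" by simp
      qed
    qed auto
    then show ?thesis by (rule continuous_on_cong[THEN iffD1, rotated -1]) (auto simp: disc_kernel_def)
  qed
  show ?thesis unfolding continuous_on_eq_continuous_within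
  proof
    fix z :: complex assume z: "z \<in> cball 0 1"
    show "continuous (at z within cball 0 1) (disc_kernel T)"
    proof (cases "z = 1")
      case False
      have "continuous (at z within cball 0 1 - {1}) (disc_kernel T)"
        using c1 z False unfolding continuous_on_eq_continuous_within by simp
      moreover have "at z within cball 0 1 - {1} = at z within cball 0 1"
        by (rule at_within_nhd[where S = "- {1}"]) (use False in auto)
      ultimately show ?thesis by simp
    next
      case True
      have "(disc_kernel T \<longlongrightarrow> 0) (at 1 within cball 0 1)"
      proof (rule tendsto_0_le[where f = "\<lambda>z. 1 - z" and K = C])
        have "((\<lambda>z::complex. 1 - z) \<longlongrightarrow> 1 - 1) (at 1 within cball 0 1)" by (intro tendsto_intros)
        then show "((\<lambda>z::complex. 1 - z) \<longlongrightarrow> 0) (at 1 within cball 0 1)" by simp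
        show "\<forall>\<^sub>F z in at 1 within cball 0 1. norm (disc_kernel T z) \<le> norm (1 - z) * C"
          unfolding eventually_at_filter
        proof (intro always_eventually allI impI)
          fix z :: complex assume "z \<noteq> 1" "z \<in> cball 0 1"
          then have "norm (zeta_kernel T (?s z)) \<le> C" by (intro C disc_kernel_half_plane T) auto
          then have "norm (zeta_kernel T (?s z)) * norm (1 - z) \<le> C * norm (1 - z)" by (rule mult_right_mono) simp
          then show "norm (disc_kernel T z) \<le> norm (1 - z) * C"
            using \<open>z \<noteq> 1\<close> by (simp add: disc_kernel_def norm_mult mult.commute)
        qed
      qed
      then show ?thesis using True by (simp add: continuous_within disc_kernel_def)
    qed
  qed
qed

lemma zeta_kernel_critical_line:
  assumes T: "T > 0"
  shows "norm (zeta_kernel T (1/2 + \<i> * of_real t)) = T * norm (zeta (1/2 + \<i> * of_real t) * mollifier (1/2 + \<i> * of_real t) *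
        ((1 - exp (- of_real (1/T) * (1/2 + \<i> * of_real t))) / (1/2 + \<i> * of_real t)))"
proof -
  define s where "s = 1/2 + \<i> * complex_of_real t"
  have s: "Re s > 0" "s \<noteq> 1" "s \<noteq> 0" by (auto simp: s_def complex_eq_iff)
  have "1 - (s - 1) * frac_transform s = zeta s * ((s - 1) / s)"
    unfolding zeta_eq_frac_transform[OF s(1,2)] using s by (simp add: field_simps)
  moreover have "norm (s - 1) = norm s" by (simp add: s_def cmod_def)
  then have "norm ((s - 1) / s) = 1" using s by (simp add: norm_divide)
  ultimately have "norm (1 - (s - 1) * frac_transform s) = norm (zeta s)" by (simp only: norm_mult mult_1_right)
  moreover have "- s / of_real T = - of_real (1/T) * s" by simp
  ultimately show ?thesis unfolding s_def[symmetric] zeta_kernel_def using T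
    by (simp add: norm_mult norm_divide)
qed

text \<open>At s = 1/2 + T the zeta function and the mollifier are each within 1/2 of 1, the latter
  because y \<le> T is far below 2^T; the factors (s - 1)/s and (1 - exp(-x))/x are at least 1/2 and
  1/4.\<close>

lemma disc_kernel_0:
  assumes T: "T \<ge> 10" and y: "y \<le> T"
  shows "norm (disc_kernel T 0) \<ge> 1/64"
proof -
  define s where "s = 1/2 + complex_of_real T"
  have Re: "Re s = 1/2 + T" "Im s = 0" by (simp_all add: s_def)
  have s0: "s \<noteq> 0" "s \<noteq> 1" using Re T by auto
  have sr: "s = of_real (1/2 + T)" by (simp add: s_def)
  have "norm (zeta s - 1) \<le> 1/2" by (rule zeta_near_1) (use Re T in simp)
  then have z: "norm (zeta s) \<ge> 1/2" using norm_triangle_ineq2[of 1 "1 - zeta s"] by (simp add: norm_minus_commute)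
  have "norm (mollifier s - 1) \<le> 1/2"
  proof (rule mollifier_near_1)
    have "T * 2 powr (- (1/2 + T)) \<le> 1/2"
    proof -
      \<comment> \<open>2T \<le> 2^T follows from exp v \<ge> v^2 / 2 and ln 2 \<ge> 2/3, as 2 T^2 /
        9 \<ge> 2T for T \<ge> 9.\<close>
      have l: "T * (2/3) \<le> T * ln 2" using ln2_ge_two_thirds T by (intro mult_left_mono) auto
      have "9 * T \<le> T * T" using T by (intro mult_right_mono) auto
      then have "2 * T \<le> (T * (2/3))\<^sup>2 / 2" by (simp add: power2_eq_square)
      also have "\<dots> \<le> (T * ln 2)\<^sup>2 / 2" using l T by (intro divide_right_mono power_mono) auto
      also have "\<dots> \<le> exp (T * ln 2)"
      proof -
        have "0 \<le> T * ln 2" using T by simp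
        then show ?thesis using exp_lower_Taylor_quadratic[of "T * ln 2"] by linarith
      qed
      finally have "2 * T \<le> 2 powr T" by (simp add: powr_def)
      then have "T * 2 powr (- T) \<le> 1/2" by (simp add: powr_minus field_simps)
      moreover have "T * 2 powr (- (1/2 + T)) \<le> T * 2 powr (- T)" using T by (intro mult_left_mono powr_mono) auto
      ultimately show ?thesis by linarith
    qed
    moreover have "y * 2 powr (- Re s) \<le> T * 2 powr (- (1/2 + T))" using y Re T by (intro mult_mono) auto
    ultimately show "y * 2 powr (- Re s) \<le> 1/2" by linarith
  qed (use Re T in simp)
  then have m: "norm (mollifier s) \<ge> 1/2" using norm_triangle_ineq2[of 1 "1 - mollifier s"] by (simp add: norm_minus_commute)
  have "1 - (s - 1) * frac_transform s = zeta s * ((s - 1) / s)"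
    unfolding zeta_eq_frac_transform[of s, OF _ s0(2)] using s0 Re T by (subst zeta_eq_frac_transform) (auto simp: field_simps)
  moreover have "norm ((s - 1) / s) \<ge> 1/2"
  proof -
    have "(s - 1) / s = of_real ((T - 1/2) / (1/2 + T))" unfolding sr by (simp add: field_simps)
    then have "norm ((s - 1) / s) = (T - 1/2) / (1/2 + T)" using T by (simp only: norm_of_real) simp
    moreover have "(T - 1/2) / (1/2 + T) \<ge> 1/2" using T by (simp add: field_simps)
    ultimately show ?thesis by (simp only:)
  qed
  ultimately have 1: "norm (1 - (s - 1) * frac_transform s) \<ge> 1/2 * (1/2)"
    unfolding norm_mult using z by (simp only: norm_mult) (intro mult_mono, auto)
  define x where "x = (1/2 + T) / T"
  have x: "1 \<le> x" "x \<le> 2" using T by (auto simp: x_def field_simps)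
  have "of_real T * (1 - exp (- s / of_real T)) / s = of_real ((1 - exp (- x)) / x)"
  proof -
    have "- s / of_real T = of_real (- (1/2 + T) / T)" unfolding sr by (simp only: of_real_minus of_real_divide)
    also have "- (1/2 + T) / T = - x" unfolding x_def by (rule minus_divide_left[symmetric])
    finally have "of_real T * (1 - exp (- s / of_real T)) / s = of_real T * of_real (1 - exp (- x)) / of_real (1/2 + T)"
      unfolding sr by (simp only: exp_of_real of_real_diff of_real_1)
    also have "\<dots> = of_real ((1 - exp (- x)) / x)" using T unfolding x_def by simp
    finally show ?thesis .
  qed
  then have "norm (of_real T * (1 - exp (- s / of_real T)) / s) = \<bar>(1 - exp (- x)) / x\<bar>" by (simp only: norm_of_real)
  also have "\<bar>(1 - exp (- x)) / x\<bar> \<ge> 1/4"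
  proof -
    have "exp (- x) \<le> exp (- 1)" using x by simp
    also have "exp (- 1) \<le> (1/2::real)" using exp_ge_add_one_self[of "1::real"] by (simp add: exp_minus field_simps)
    finally have "(1/2) / 2 \<le> (1 - exp (- x)) / x" using x by (intro frac_le) auto
    then show ?thesis by (intro order.trans[OF _ abs_ge_self]) simp
  qed
  finally have 2: "norm (of_real T * (1 - exp (- s / of_real T)) / s) \<ge> 1/4" .
  have "norm (zeta_kernel T s) = norm (1 - (s - 1) * frac_transform s) * norm (mollifier s) * norm (of_real T * (1 - exp (- s / of_real T)) / s)"
    unfolding zeta_kernel_def by (simp only: norm_mult)
  also have "\<dots> \<ge> 1/2 * (1/2) * (1/2) * (1/4)" using 1 2 m by (intro mult_mono) auto
  finally show ?thesis by (simp add: disc_kernel_def s_def)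
qed

end

lemma continuous_zeta_line: "continuous_on UNIV (\<lambda>t. zeta (1/2 + \<i> * of_real t))"
proof -
  have "zeta holomorphic_on - {1}"
    using is_zeta_continuation_zeta by (simp add: is_zeta_continuation_def)
  then have "continuous_on (- {1}) zeta" by (rule holomorphic_on_imp_continuous_on)
  then show ?thesis
    by (rule continuous_on_compose2) (auto intro!: continuous_intros simp: complex_eq_iff)
qed

section \<open>Upper and lower tails of |zeta M| on [T, 2T]\<close>

context sieve begin

lemma mollified_zeta_measurable [measurable]:
  "(\<lambda>t. norm (zeta (1/2 + \<i> * of_real t) * mollifier (1/2 + \<i> * of_real t))) \<in> borel_measurable borel"
proof (rule borel_measurable_continuous_onI)
  have "continuous_on UNIV (\<lambda>t. mollifier (1/2 + \<i> * of_real t))"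
    by (rule continuous_on_compose2[OF holomorphic_on_imp_continuous_on[OF mollifier_holomorphic]])
       (auto intro!: continuous_intros)
  then show "continuous_on UNIV (\<lambda>t. norm (zeta (1/2 + \<i> * of_real t) * mollifier (1/2 + \<i> * of_real t)))"
    by (intro continuous_on_norm continuous_on_mult continuous_zeta_line)
qed

lemma zeta_kernel_measurable [measurable]: "(\<lambda>t. norm (zeta_kernel T (1/2 + \<i> * of_real t))) \<in> borel_measurable borel"
  by (intro borel_measurable_continuous_onI continuous_on_norm
      continuous_on_compose2[OF holomorphic_on_imp_continuous_on[OF zeta_kernel_holomorphic]])
     (auto intro!: continuous_intros)

lemma zeta_kernel_factor:
  assumes T: "T > 0"
  shows "norm (zeta_kernel T (1/2 + \<i> * of_real t)) = norm (zeta (1/2 + \<i> * of_real t) * mollifier (1/2 + \<i> * of_real t)) *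
     (T * norm (1 - exp (- of_real (1/T) * (1/2 + \<i> * of_real t))) / norm (1/2 + \<i> * complex_of_real t))"
  unfolding zeta_kernel_critical_line[OF T] by (simp add: norm_mult norm_divide)

text \<open>For t in [T, 2T] the angle t/T lies in [1, 2], away from the multiples of 2 \<pi>, so |1
  - exp(-s/T)| is at least 1/4; with |s| \<le> 5T/2 this gives 1/10. The parameter \<eta> = 1/T is
  matched to the interval in this way.\<close>

lemma kernel_factor_bounds:
  assumes T: "T \<ge> 10" and t: "t \<in> {T..2*T}"
  defines "k \<equiv> T * norm (1 - exp (- of_real (1/T) * (1/2 + \<i> * of_real t))) / norm (1/2 + \<i> * complex_of_real t)"
  shows "k \<le> 2" "k \<ge> 1/10"
proof -
  define s where "s = 1/2 + \<i> * complex_of_real t"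
  define e where "e = exp (- of_real (1/T) * s)"
  have n1: "norm s \<ge> t" using abs_Im_le_cmod[of s] by (simp add: s_def)
  have n2: "norm s \<le> 1/2 + t" using norm_triangle_ineq[of "1/2" "\<i> * complex_of_real t"] t T by (simp add: s_def norm_mult)
  have e_val: "e = of_real (exp (- (1 / (2*T)))) * cis (- (t / T))"
  proof -
    have "- of_real (1/T) * s = of_real (- (1 / (2*T))) + \<i> * of_real (- (t/T))" by (simp add: s_def algebra_simps)
    then show ?thesis unfolding e_def by (simp only: exp_add exp_of_real cis_conv_exp)
  qed
  have "norm e \<le> 1" unfolding e_val using T by (simp add: norm_mult)
  then have "norm (1 - e) \<le> 2" using norm_triangle_ineq4[of 1 e] by simp
  then have "T * norm (1 - e) \<le> 2 * norm s" using mult_mono[of T "norm s" "norm (1 - e)" 2] n1 t T by (simp add: mult.commute)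
  moreover have sp: "norm s > 0" using n1 t T by (intro less_le_trans[OF _ n1]) auto
  ultimately show "k \<le> 2" unfolding k_def s_def[symmetric] e_def[symmetric] by (simp add: field_simps)
  have c: "cos (t / T) \<le> 3/4"
  proof -
    have "pi / 4 \<le> 1" using pi_less_4 by simp
    also have "1 \<le> t / T" using t T by simp
    finally have "pi / 4 \<le> t / T" .
    moreover have "t / T \<le> 2" using t T by (simp add: field_simps)
    then have "t / T \<le> pi" using pi_ge_two by linarith
    ultimately have "cos (t / T) \<le> cos (pi / 4)" by (intro cos_monotone_0_pi_le) auto
    also have "cos (pi / 4) = sqrt 2 / 2" by (rule cos_45)
    also have "sqrt 2 \<le> 3/2" by (rule real_le_lsqrt) (auto simp: power2_eq_square)
    finally show ?thesis by simp
  qed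
  have "Re (1 - e) = 1 - exp (- (1 / (2*T))) * cos (t / T)" unfolding e_val by simp
  moreover have "exp (- (1 / (2*T))) * cos (t / T) \<le> 3/4"
  proof (cases "cos (t / T) \<ge> 0")
    case True
    have "exp (- (1 / (2*T))) \<le> 1" using T by simp
    then have "exp (- (1 / (2*T))) * cos (t / T) \<le> 1 * (3/4)" using True c by (intro mult_mono) auto
    then show ?thesis by simp
  next
    case False
    then have "exp (- (1 / (2*T))) * cos (t / T) \<le> 0" by (intro mult_nonneg_nonpos) auto
    then show ?thesis by simp
  qed
  ultimately have "norm (1 - e) \<ge> 1/4" using complex_Re_le_cmod[of "1 - e"] by linarith
  then have "T * (1/4) \<le> T * norm (1 - e)" using T by (intro mult_left_mono) auto
  moreover have "norm s \<le> 5/2 * T" using n2 t T by simp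
  ultimately have "norm s \<le> 10 * (T * norm (1 - e))" by linarith
  then show "k \<ge> 1/10" unfolding k_def s_def[symmetric] e_def[symmetric] using sp by (simp add: field_simps)
qed

text \<open>Chebyshev's inequality; 100 is the square of the 10 lost in
  \<open>kernel_factor_bounds\<close>.\<close>

lemma mollified_upper_tail:
  assumes T: "T \<ge> 10" and B: "B \<ge> 0" and K: "K > 0"
    and ms: "(\<integral>\<^sup>+t. ennreal ((norm (zeta_kernel T (1/2 + \<i> * of_real t)))\<^sup>2) \<partial>lborel) \<le> ennreal (B * T)"
  shows "measure lborel {t \<in> {T..2*T}. norm (zeta (1/2 + \<i> * of_real t) * mollifier (1/2 + \<i> * of_real t)) > K} \<le> 100 * B * T / K\<^sup>2"
proof -
  let ?S = "{t \<in> {T..2*T}. norm (zeta (1/2 + \<i> * of_real t) * mollifier (1/2 + \<i> * of_real t)) > K}"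
  have meas: "?S \<in> sets lborel" by measurable
  have fin: "emeasure lborel ?S < \<infinity>" by (rule emeasure_bounded_finite) (auto intro: bounded_subset[of "{T..2*T}"])
  have "ennreal ((K / 10)\<^sup>2) * emeasure lborel ?S = (\<integral>\<^sup>+t. ennreal ((K / 10)\<^sup>2) * indicator ?S t \<partial>lborel)"
    using meas by (simp add: nn_integral_cmult_indicator)
  also have "\<dots> \<le> (\<integral>\<^sup>+t. ennreal ((norm (zeta_kernel T (1/2 + \<i> * of_real t)))\<^sup>2) \<partial>lborel)"
  proof (rule nn_integral_mono)
    fix t
    show "ennreal ((K / 10)\<^sup>2) * indicator ?S t \<le> ennreal ((norm (zeta_kernel T (1/2 + \<i> * of_real t)))\<^sup>2)"
    proof (cases "t \<in> ?S")
      case True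
      then have "K * (1/10) \<le> norm (zeta_kernel T (1/2 + \<i> * of_real t))"
        unfolding zeta_kernel_factor[OF less_le_trans[OF _ T, of 0, simplified]] using kernel_factor_bounds(2)[OF T, of t] K
        by (intro mult_mono) auto
      then show ?thesis using True K by (auto intro!: ennreal_leI power_mono)
    qed simp
  qed
  also note ms
  finally have "ennreal ((K / 10)\<^sup>2) * ennreal (measure lborel ?S) \<le> ennreal (B * T)"
    using fin by (simp add: emeasure_eq_ennreal_measure less_top)
  then have "(K / 10)\<^sup>2 * measure lborel ?S \<le> B * T"
    using B T by (simp add: ennreal_mult[symmetric] ennreal_le_iff)
  then show ?thesis using K by (simp add: field_simps power2_eq_square)
qed

text \<open>Jensen at the centre: the Poisson mean of the regularised ln |kernel| is at least -ln
  64. Concavity of ln bounds its positive contribution by half the logarithm of a mean square, while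
  each point of S lowers the integrand by a further -ln \<epsilon> - 2. On [T, 2T] the Poisson
  kernel is at least 1 / (5 \<pi> T), so S is small once -ln \<epsilon> dominates ln B.\<close>

lemma mollified_lower_tail:
  assumes T: "T \<ge> 10" and yT: "y \<le> T" and B: "B \<ge> 0" and eps: "0 < \<epsilon>" "ln \<epsilon> + 2 \<le> 0"
    and ms: "(\<integral>\<^sup>+t. ennreal ((norm (zeta_kernel T (1/2 + \<i> * of_real t)))\<^sup>2) \<partial>lborel) \<le> ennreal (B * T)"
  shows "measure lborel {t \<in> {T..2*T}. norm (zeta (1/2 + \<i> * of_real t) * mollifier (1/2 + \<i> * of_real t)) < \<epsilon>} * (- ln \<epsilon> - 2)
     \<le> 5 * pi * T * (ln 64 + ln (2 + 2 * B) / 2)"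
proof -
  have T0: "T > 0" using T by simp
  define S where "S = {t \<in> {T..2*T}. norm (zeta (1/2 + \<i> * of_real t) * mollifier (1/2 + \<i> * of_real t)) < \<epsilon>}"
  have Smeas [measurable]: "S \<in> sets borel" unfolding S_def by measurable
  have Sfin: "emeasure lborel S < \<infinity>" by (rule emeasure_bounded_finite) (auto simp: S_def intro: bounded_subset[of "{T..2*T}"])
  define h where "h = (\<lambda>t. (norm (disc_kernel T (cayley T t)))\<^sup>2)"
  \<comment> \<open>\<open>b\<close> bounds the Poisson mean of 2 + h. The tangent of ln at
    \<open>b\<close> serves as linear majorant, so the integrated majorant is at most ln b.\<close>
  define b where "b = 2 + 2 * B"
  have b: "b \<ge> 2" using B by (simp add: b_def)
  have hk: "norm (disc_kernel T (cayley T t)) = norm (zeta_kernel T (1/2 + \<i> * of_real t)) * norm (1 - cayley T t)" for t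
  proof -
    have "1/2 + of_real T * ((1 + cayley T t) / (1 - cayley T t)) = 1/2 + \<i> * complex_of_real t"
      unfolding cayley_facts(3)[OF T0] using T0 by simp
    then show ?thesis using cayley_facts(1)[OF T0, of t] by (simp add: disc_kernel_def norm_mult)
  qed
  have hle: "norm (disc_kernel T (cayley T t)) \<le> norm (zeta_kernel T (1/2 + \<i> * of_real t)) * 2" for t
    unfolding hk using cayley_facts(4)[OF T0, of t] by (intro mult_left_mono) auto
  have pois: "poisson T t \<le> 1 / (pi * T)" "poisson T t \<ge> 0" for t
  proof -
    have "poisson T t \<le> T / (pi * T\<^sup>2)" unfolding poisson_def using T0
      by (intro divide_left_mono mult_left_mono) (auto intro!: mult_pos_pos add_pos_nonneg)
    then show "poisson T t \<le> 1 / (pi * T)" using T0 by (simp add: power2_eq_square)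
  qed (rule poisson_nonneg[OF T0])
  have jint: "integrable lborel (\<lambda>t. poisson T t * (ln (h t + \<epsilon>\<^sup>2) / 2))"
    and jle: "ln (norm (disc_kernel T 0)) \<le> (LINT t|lborel. poisson T t * (ln (h t + \<epsilon>\<^sup>2) / 2))"
  proof -
    have "disc_kernel T 0 \<noteq> 0" using disc_kernel_0[OF T yT] by auto
    from jensen_half_plane[OF disc_kernel_continuous[OF T0] disc_kernel_holomorphic[OF T0] eps(1) this T0]
    show "integrable lborel (\<lambda>t. poisson T t * (ln (h t + \<epsilon>\<^sup>2) / 2))"
      "ln (norm (disc_kernel T 0)) \<le> (LINT t|lborel. poisson T t * (ln (h t + \<epsilon>\<^sup>2) / 2))"
      by (simp_all add: h_def)
  qed
  have kint: "integrable lborel (\<lambda>t. (norm (zeta_kernel T (1/2 + \<i> * of_real t)))\<^sup>2)"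
    by (rule integrableI_bounded) (use ms in \<open>auto simp: top.not_eq_extremum intro: le_less_trans\<close>)
  have kle: "(LINT t|lborel. (norm (zeta_kernel T (1/2 + \<i> * of_real t)))\<^sup>2) \<le> B * T"
    using ms B T by (subst (asm) nn_integral_eq_integral[OF kint]) (auto simp: ennreal_le_iff)
  have cont_h: "continuous_on UNIV h"
    unfolding h_def cayley_eq_cis[OF T0] using T0
    by (intro continuous_intros continuous_on_compose2[OF disc_kernel_continuous[OF T0]]) auto
  have [measurable]: "h \<in> borel_measurable borel" by (rule borel_measurable_continuous_onI[OF cont_h])
  have [measurable]: "poisson T \<in> borel_measurable borel" unfolding poisson_def by measurable
  have ph: "poisson T t * h t \<le> 4 / (pi * T) * (norm (zeta_kernel T (1/2 + \<i> * of_real t)))\<^sup>2" for t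
  proof -
    have "h t \<le> (norm (zeta_kernel T (1/2 + \<i> * of_real t)) * 2)\<^sup>2" unfolding h_def by (intro power_mono hle) auto
    then have "poisson T t * h t \<le> 1 / (pi * T) * (norm (zeta_kernel T (1/2 + \<i> * of_real t)) * 2)\<^sup>2"
      using pois T0 by (intro mult_mono) (auto simp: h_def)
    then show ?thesis by (simp add: power_mult_distrib mult.commute)
  qed
  have pint: "integrable lborel (\<lambda>t. poisson T t * h t)"
  proof (rule Bochner_Integration.integrable_bound)
    show "integrable lborel (\<lambda>t. 4 / (pi * T) * (norm (zeta_kernel T (1/2 + \<i> * of_real t)))\<^sup>2)"
      by (rule integrable_mult_right[OF kint])
    show "AE t in lborel. norm (poisson T t * h t) \<le> norm (4 / (pi * T) * (norm (zeta_kernel T (1/2 + \<i> * of_real t)))\<^sup>2)"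
    proof (intro AE_I2)
      fix t
      have "0 \<le> poisson T t * h t" using pois(2) by (intro mult_nonneg_nonneg) (auto simp: h_def)
      then show "norm (poisson T t * h t) \<le> norm (4 / (pi * T) * (norm (zeta_kernel T (1/2 + \<i> * of_real t)))\<^sup>2)"
        using ph[of t] unfolding real_norm_def by linarith
    qed
  qed measurable
  have "(LINT t|lborel. poisson T t * h t) \<le> (LINT t|lborel. 4 / (pi * T) * (norm (zeta_kernel T (1/2 + \<i> * of_real t)))\<^sup>2)"
    by (rule integral_mono[OF pint]) (use kint ph in auto)
  also have "\<dots> \<le> 4 / (pi * T) * (B * T)"
    using kle T0 by (simp del: times_divide_eq_left)
  also have "\<dots> \<le> 2 * B" using T0 B pi_ge_two by (simp add: field_simps mult_left_mono)
  finally have hint: "(LINT t|lborel. poisson T t * h t) \<le> 2 * B" .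
  have Sint: "integrable lborel (\<lambda>t. poisson T t * indicator S t)"
    by (rule Bochner_Integration.integrable_bound[OF integrable_poisson[OF T0]]) (auto simp: indicator_def)
  have pw: "poisson T t * (ln (h t + \<epsilon>\<^sup>2) / 2) \<le> poisson T t * ((ln b - 1 + 2 / b) / 2) + (poisson T t * h t) * (1 / (2 * b)) + (poisson T t * indicator S t) * (ln \<epsilon> + 2)" for t
  proof -
    have h0: "h t \<ge> 0" by (simp add: h_def)
    \<comment> \<open>Replacing \<epsilon>^2 by 2 makes ln (2 + h) nonnegative, so that the tangent
      term is nonnegative and may be kept on S too.\<close>
    have lnb: "ln (2 + h t) \<le> ln b - 1 + (2 + h t) / b"
    proof -
      have "ln ((2 + h t) / b) \<le> (2 + h t) / b - 1" using h0 b by (intro ln_le_minus_one) auto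
      then show ?thesis using h0 b by (simp add: ln_div)
    qed
    have e1: "\<epsilon> \<le> 1" using eps by (metis ln_gt_zero linorder_not_less add_pos_pos zero_less_numeral)
    have "ln (h t + \<epsilon>\<^sup>2) / 2 \<le> (ln b - 1 + (2 + h t) / b) / 2 + indicator S t * (ln \<epsilon> + 2)"
    proof (cases "t \<in> S")
      case False
      have "h t + \<epsilon>\<^sup>2 \<le> 2 + h t" using e1 eps power_le_one[of \<epsilon> 2] by simp
      moreover have "h t + \<epsilon>\<^sup>2 > 0" using h0 eps by (simp add: add_nonneg_pos)
      ultimately have "ln (h t + \<epsilon>\<^sup>2) \<le> ln (2 + h t)" by (subst ln_le_cancel_iff) auto
      then show ?thesis using lnb False by simp
    next
      case True
      then have t: "t \<in> {T..2*T}" and le: "norm (zeta (1/2 + \<i> * of_real t) * mollifier (1/2 + \<i> * of_real t)) \<le> \<epsilon>" by (auto simp: S_def)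
      have "norm (zeta_kernel T (1/2 + \<i> * of_real t)) \<le> \<epsilon> * 2"
        unfolding zeta_kernel_factor[OF T0] using kernel_factor_bounds[OF T t] le eps T0 by (intro mult_mono) auto
      then have "norm (disc_kernel T (cayley T t)) \<le> 4 * \<epsilon>" using hle[of t] by simp
      then have "h t \<le> (4 * \<epsilon>)\<^sup>2" unfolding h_def by (intro power_mono) auto
      \<comment> \<open>17 = 4^2 + 1: the 4 is one factor 2 from \<open>kernel_factor_bounds\<close>
        and another from |1 - z| \<le> 2.\<close>
      then have "h t + \<epsilon>\<^sup>2 \<le> 17 * \<epsilon>\<^sup>2" by (simp add: power_mult_distrib)
      moreover have "h t + \<epsilon>\<^sup>2 > 0" using h0 eps by (simp add: add_nonneg_pos)
      ultimately have "ln (h t + \<epsilon>\<^sup>2) \<le> ln (17 * \<epsilon>\<^sup>2)" by (subst ln_le_cancel_iff) auto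
      also have "\<dots> = ln 17 + 2 * ln \<epsilon>" using eps by (simp add: ln_mult ln_realpow)
      also have "ln 17 \<le> (4::real)"
      proof -
        have "(17::real) \<le> 2 ^ 5" by simp
        then have "ln 17 \<le> ln (2 ^ 5 :: real)" by (subst ln_le_cancel_iff) auto
        also have "\<dots> = 5 * ln 2" by (subst ln_realpow) auto
        also have "\<dots> \<le> 4" using ln_2_less_1 ln2_le_25_over_36 by simp
        finally show ?thesis .
      qed
      finally have "ln (h t + \<epsilon>\<^sup>2) / 2 \<le> ln \<epsilon> + 2" by simp
      moreover have "0 \<le> ln b - 1 + (2 + h t) / b"
      proof -
        have "0 \<le> ln (2 + h t)" using h0 by simp
        then show ?thesis using lnb by linarith
      qed
      moreover have "u \<le> v / 2 + indicator S t * w" if "u \<le> w" "0 \<le> v" for u v w :: real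
        using True that by simp
      ultimately show ?thesis by blast
    qed
    then have "poisson T t * (ln (h t + \<epsilon>\<^sup>2) / 2) \<le> poisson T t * ((ln b - 1 + (2 + h t) / b) / 2 + indicator S t * (ln \<epsilon> + 2))"
      using pois(2) by (rule mult_left_mono)
    also have "\<dots> = poisson T t * ((ln b - 1 + 2 / b) / 2) + (poisson T t * h t) * (1 / (2 * b)) + (poisson T t * indicator S t) * (ln \<epsilon> + 2)"
      using b by (simp add: field_simps)
    finally show ?thesis .
  qed
  have "- ln 64 \<le> ln (norm (disc_kernel T 0))"
  proof -
    have "ln (1/64) \<le> ln (norm (disc_kernel T 0))" using disc_kernel_0[OF T yT] by (subst ln_le_cancel_iff) auto
    then show ?thesis by (simp add: ln_div)
  qed
  also note jle
  also have "(LINT t|lborel. poisson T t * (ln (h t + \<epsilon>\<^sup>2) / 2)) \<le> (LINT t|lborel. poisson T t * ((ln b - 1 + 2 / b) / 2) + (poisson T t * h t) * (1 / (2 * b)) + (poisson T t * indicator S t) * (ln \<epsilon> + 2))"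
    by (rule integral_mono[OF jint _ pw])
       (intro Bochner_Integration.integrable_add integrable_mult_left pint Sint integrable_poisson T0)
  also have "\<dots> = (LINT t|lborel. poisson T t) * ((ln b - 1 + 2 / b) / 2) + (LINT t|lborel. poisson T t * h t) * (1 / (2 * b)) + (LINT t|lborel. poisson T t * indicator S t) * (ln \<epsilon> + 2)"
    using pint Sint integrable_poisson[OF T0] by simp
  also have "\<dots> \<le> (ln b - 1 + 2 / b) / 2 + (2 * B) * (1 / (2 * b)) + (LINT t|lborel. poisson T t * indicator S t) * (ln \<epsilon> + 2)"
    unfolding integral_poisson[OF T0] mult_1 using hint b by (intro add_right_mono add_left_mono mult_right_mono) auto
  also have "(ln b - 1 + 2 / b) / 2 + (2 * B) * (1 / (2 * b)) = ln b / 2"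
  proof -
    have "2 / b + (2 * B) * (1 / b) = 1" using b by (simp add: b_def flip: add_divide_distrib)
    then show ?thesis by (simp add: field_simps)
  qed
  finally have main: "(LINT t|lborel. poisson T t * indicator S t) * (- ln \<epsilon> - 2) \<le> ln 64 + ln b / 2"
    by (simp add: algebra_simps)
  have "measure lborel S / (5 * pi * T) = (LINT t|lborel. indicator S t / (5 * pi * T))"
    using Sfin by simp
  also have "\<dots> \<le> (LINT t|lborel. poisson T t * indicator S t)"
  proof (rule integral_mono)
    show "integrable lborel (\<lambda>t. indicator S t / (5 * pi * T) :: real)" using Sfin by (auto intro!: integrable_real_indicator)
    show "integrable lborel (\<lambda>t. poisson T t * indicator S t)" by (rule Sint)
    fix t
    show "indicator S t / (5 * pi * T) \<le> poisson T t * indicator S t"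
    proof (cases "t \<in> S")
      case True
      then have "t \<in> {T..2*T}" by (simp add: S_def)
      then have "t\<^sup>2 \<le> (2 * T)\<^sup>2" using T0 by (intro power_mono) auto
      then have "pi * (T\<^sup>2 + t\<^sup>2) \<le> pi * (5 * T\<^sup>2)" by (intro mult_left_mono) auto
      then have "T / (pi * (5 * T\<^sup>2)) \<le> poisson T t" unfolding poisson_def using T0
        by (intro divide_left_mono) (auto intro!: mult_pos_pos add_pos_nonneg)
      moreover have "T / (pi * (5 * T\<^sup>2)) = 1 / (5 * pi * T)" using T0 by (simp add: power2_eq_square)
      ultimately show ?thesis using True by simp
    qed simp
  qed
  finally have "measure lborel S / (5 * pi * T) * (- ln \<epsilon> - 2) \<le> ln 64 + ln b / 2"
    using main eps mult_right_mono[of "measure lborel S / (5 * pi * T)" "LINT t|lborel. poisson T t * indicator S t" "- ln \<epsilon> - 2"] by linarith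
  then show ?thesis unfolding S_def[symmetric] b_def[symmetric] using T0 by (simp add: field_simps)
qed

end

text \<open>With B of order L^2 and \<epsilon> = exp(-\<delta> sqrt L) the lower tail is O(ln L /
  sqrt L) and the upper tail O(L^2 exp(-2 \<delta> sqrt L)).\<close>

theorem mollified_zeta_concentration:
  assumes d: "\<delta> > 0"
  shows "((\<lambda>T. measure lborel {t \<in> {T..2*T}. norm (zeta (1/2 + \<i> * of_real t) * sieve.mollifier (small_primes T) (sieve_level T) (1/2 + \<i> * of_real t)) < exp (- \<delta> * sqrt (ln (ln T)))} / T) \<longlongrightarrow> 0) at_top"
    and "((\<lambda>T. measure lborel {t \<in> {T..2*T}. norm (zeta (1/2 + \<i> * of_real t) * sieve.mollifier (small_primes T) (sieve_level T) (1/2 + \<i> * of_real t)) > exp (\<delta> * sqrt (ln (ln T)))} / T) \<longlongrightarrow> 0) at_top"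
proof -
  obtain C where C: "C > 0" and ev: "\<forall>\<^sub>F T in at_top. (\<integral>\<^sup>+u\<in>{0<..}. ennreal ((sieve.fracsum (small_primes T) (sieve_level T) (1/T) u)\<^sup>2 / u\<^sup>2) \<partial>lborel) \<le>
       ennreal (C * real (sieve_level T) / T)"
    using fracsum_mean_square_eventually by blast
  \<comment> \<open>2 \<pi> comes from Plancherel, C N from the sieve, and N \<le> L^2 + 1.\<close>
  define B where "B = (\<lambda>T. 2 * pi * C * ((ln (ln T))\<^sup>2 + 1))"
  let ?lo = "\<lambda>T. {t \<in> {T..2*T}. norm (zeta (1/2 + \<i> * of_real t) * sieve.mollifier (small_primes T) (sieve_level T) (1/2 + \<i> * of_real t)) < exp (- \<delta> * sqrt (ln (ln T)))}"
  let ?hi = "\<lambda>T. {t \<in> {T..2*T}. norm (zeta (1/2 + \<i> * of_real t) * sieve.mollifier (small_primes T) (sieve_level T) (1/2 + \<i> * of_real t)) > exp (\<delta> * sqrt (ln (ln T)))}"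
  have "\<forall>\<^sub>F T::real in at_top. T powr (1/100) \<le> T" by real_asymp
  moreover have "\<forall>\<^sub>F T::real in at_top. \<delta> * sqrt (ln (ln T)) > 2" using d by real_asymp
  moreover note ev eventually_sieve_level_pos eventually_ge_at_top[of 10]
  ultimately have both: "\<forall>\<^sub>F T in at_top. measure lborel (?lo T) / T \<le> 5 * pi * (ln 64 + ln (2 + 2 * B T) / 2) / (\<delta> * sqrt (ln (ln T)) - 2) \<and>
     measure lborel (?hi T) / T \<le> 100 * B T / (exp (\<delta> * sqrt (ln (ln T))))\<^sup>2"
  proof eventually_elim
    case (elim T)
    interpret sieve "small_primes T" "sieve_level T" "T powr (1/100)"
      by (rule sieve_small_primes) (use elim in auto)
    have T0: "T > 0" and T10: "T \<ge> 10" using elim by auto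
    have B0: "B T \<ge> 0" unfolding B_def using C by (intro mult_nonneg_nonneg) auto
    have "(\<integral>\<^sup>+t. ennreal ((norm (zeta_kernel T (1/2 + \<i> * of_real t)))\<^sup>2) \<partial>lborel) =
      (\<integral>\<^sup>+t. ennreal (T\<^sup>2) * ennreal ((norm (zeta (1/2 + \<i> * of_real t) * mollifier (1/2 + \<i> * of_real t) *
        ((1 - exp (- of_real (1/T) * (1/2 + \<i> * of_real t))) / (1/2 + \<i> * of_real t))))\<^sup>2) \<partial>lborel)"
      unfolding zeta_kernel_critical_line[OF T0] power_mult_distrib by (intro nn_integral_cong ennreal_mult) auto
    also have "\<dots> = ennreal (T\<^sup>2) * (\<integral>\<^sup>+t. ennreal ((norm (zeta (1/2 + \<i> * of_real t) * mollifier (1/2 + \<i> * of_real t) *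
        ((1 - exp (- of_real (1/T) * (1/2 + \<i> * of_real t))) / (1/2 + \<i> * of_real t))))\<^sup>2) \<partial>lborel)"
    proof (rule nn_integral_cmult)
      have "(\<lambda>t. ennreal ((norm (zeta_kernel T (1/2 + \<i> * of_real t)) / T)\<^sup>2)) \<in> borel_measurable lborel" by measurable
      then show "(\<lambda>t. ennreal ((norm (zeta (1/2 + \<i> * of_real t) * mollifier (1/2 + \<i> * of_real t) *
        ((1 - exp (- of_real (1/T) * (1/2 + \<i> * of_real t))) / (1/2 + \<i> * of_real t))))\<^sup>2)) \<in> borel_measurable lborel"
        unfolding zeta_kernel_critical_line[OF T0] using T0 by simp
    qed
    also have "\<dots> \<le> ennreal (T\<^sup>2) * (ennreal (2 * pi) * ennreal (C * real (sieve_level T) / T))"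
      using T0 elim(3) by (intro mult_left_mono order.trans[OF mollified_mean_square]) auto
    also have "\<dots> = ennreal (2 * pi * C * real (sieve_level T) * T)"
      using T0 C by (simp add: ennreal_mult[symmetric] power2_eq_square mult_ac)
    also have "\<dots> \<le> ennreal (B T * T)"
      unfolding B_def using T0 C sieve_level_le[of T] by (intro ennreal_leI mult_right_mono mult_left_mono) auto
    finally have ms: "(\<integral>\<^sup>+t. ennreal ((norm (zeta_kernel T (1/2 + \<i> * of_real t)))\<^sup>2) \<partial>lborel) \<le> ennreal (B T * T)" .
    have "measure lborel (?lo T) * (- ln (exp (- \<delta> * sqrt (ln (ln T)))) - 2) \<le> 5 * pi * T * (ln 64 + ln (2 + 2 * B T) / 2)"
      by (rule mollified_lower_tail[OF T10 elim(1) B0 _ _ ms]) (use elim in auto)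
    then have "measure lborel (?lo T) / T \<le> 5 * pi * (ln 64 + ln (2 + 2 * B T) / 2) / (\<delta> * sqrt (ln (ln T)) - 2)"
      using elim(2) T0 by (simp add: field_simps)
    moreover have "measure lborel (?hi T) \<le> 100 * B T * T / (exp (\<delta> * sqrt (ln (ln T))))\<^sup>2"
      by (rule mollified_upper_tail[OF T10 B0 _ ms]) simp
    then have "measure lborel (?hi T) / T \<le> 100 * B T / (exp (\<delta> * sqrt (ln (ln T))))\<^sup>2"
      using T0 by (simp add: field_simps)
    ultimately show ?case by blast
  qed
  show "((\<lambda>T. measure lborel (?lo T) / T) \<longlongrightarrow> 0) at_top"
  proof (rule tendsto_sandwich[OF _ _ tendsto_const])
    show "\<forall>\<^sub>F T in at_top. 0 \<le> measure lborel (?lo T) / T" using eventually_ge_at_top[of 0] by eventually_elim auto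
    show "\<forall>\<^sub>F T in at_top. measure lborel (?lo T) / T \<le> 5 * pi * (ln 64 + ln (2 + 2 * B T) / 2) / (\<delta> * sqrt (ln (ln T)) - 2)"
      using both by eventually_elim blast
    have "((\<lambda>L. 5 * pi * (ln 64 + ln (2 + 2 * (2 * pi * C * (L\<^sup>2 + 1))) / 2) / (\<delta> * sqrt L - 2)) \<longlongrightarrow> 0) at_top"
      using C d by real_asymp
    from filterlim_compose[OF this lnln_at_top]
    show "((\<lambda>T. 5 * pi * (ln 64 + ln (2 + 2 * B T) / 2) / (\<delta> * sqrt (ln (ln T)) - 2)) \<longlongrightarrow> 0) at_top" by (simp add: B_def)
  qed
  show "((\<lambda>T. measure lborel (?hi T) / T) \<longlongrightarrow> 0) at_top"
  proof (rule tendsto_sandwich[OF _ _ tendsto_const])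
    show "\<forall>\<^sub>F T in at_top. 0 \<le> measure lborel (?hi T) / T" using eventually_ge_at_top[of 0] by eventually_elim auto
    show "\<forall>\<^sub>F T in at_top. measure lborel (?hi T) / T \<le> 100 * B T / (exp (\<delta> * sqrt (ln (ln T))))\<^sup>2"
      using both by eventually_elim blast
    have "((\<lambda>L. 100 * (2 * pi * C * (L\<^sup>2 + 1)) / (exp (\<delta> * sqrt L))\<^sup>2) \<longlongrightarrow> 0) at_top"
      using C d by real_asymp
    from filterlim_compose[OF this lnln_at_top]
    show "((\<lambda>T. 100 * B T / (exp (\<delta> * sqrt (ln (ln T))))\<^sup>2) \<longlongrightarrow> 0) at_top" by (simp add: B_def)
  qed
qed

section \<open>The mollifier as an Euler product\<close>

lemma norm_ln_one_minus_le:
  fixes w :: complex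
  assumes "norm w < 1"
  shows "norm (ln (1 - w) + w + w\<^sup>2 / 2) \<le> norm w ^ 3 / (1 - norm w)"
proof -
  define r where "r = norm w"
  have r: "0 \<le> r" "r < 1" using assms by (auto simp: r_def)
  have "(\<lambda>n. - (w ^ n) / of_nat n) sums ln (1 - w)"
    using Ln_series'[of "- w"] assms by simp
  then have "(\<lambda>n. - (w ^ (n + 3)) / of_nat (n + 3)) sums (ln (1 - w) - (\<Sum>n<3. - (w ^ n) / of_nat n))"
    by (rule sums_split_initial_segment)
  also have "ln (1 - w) - (\<Sum>n<3. - (w ^ n) / of_nat n) = ln (1 - w) + w + w\<^sup>2 / 2"
    by (simp add: numeral_3_eq_3 power2_eq_square)
  finally have 1: "(\<lambda>n. - (w ^ (n + 3)) / of_nat (n + 3)) sums (ln (1 - w) + w + w\<^sup>2 / 2)" .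
  have 2: "(\<lambda>n. r ^ 3 * r ^ n) sums (r ^ 3 * (1 / (1 - r)))"
    using r by (intro sums_mult geometric_sums) auto
  have "norm (- (w ^ (n + 3)) / of_nat (n + 3)) \<le> r ^ 3 * r ^ n" for n
  proof -
    have "norm (- (w ^ (n + 3)) / of_nat (n + 3)) = r ^ (n + 3) / real (n + 3)"
      by (simp add: norm_divide norm_power r_def del: of_nat_add of_nat_Suc)
    also have "\<dots> \<le> r ^ (n + 3) / 1" using r by (intro divide_left_mono) auto
    finally show ?thesis by (simp add: power_add mult.commute)
  qed
  then have "norm (\<Sum>n. - (w ^ (n + 3)) / of_nat (n + 3)) \<le> (\<Sum>n. r ^ 3 * r ^ n)"
    using sums_summable[OF 2] by (rule norm_suminf_le)
  then show ?thesis using sums_unique[OF 1] sums_unique[OF 2] by (simp add: r_def)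
qed

text \<open>Order two is the right place to stop: summed over primes, the linear term is the prime
  polynomial, the quadratic one a sum with bounded mean square, and the cubic remainder converges
  absolutely.\<close>

lemma ln_norm_one_minus:
  fixes w :: complex
  assumes "(norm w)\<^sup>2 \<le> 1/2"
  shows "\<bar>ln (norm (1 - w)) + Re w + Re (w\<^sup>2) / 2\<bar> \<le> 4 * norm w ^ 3"
proof -
  have r: "norm w \<le> 3/4"
    by (rule power2_le_imp_le[OF order.trans[OF assms]]) (auto simp: power2_eq_square)
  then have "1 - w \<noteq> 0" by auto
  then have "ln (norm (1 - w)) = Re (ln (1 - w))" by simp
  then have "ln (norm (1 - w)) + Re w + Re (w\<^sup>2) / 2 = Re (ln (1 - w) + w + w\<^sup>2 / 2)" by simp
  then have "\<bar>ln (norm (1 - w)) + Re w + Re (w\<^sup>2) / 2\<bar> \<le> norm (ln (1 - w) + w + w\<^sup>2 / 2)"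
    by (metis abs_Re_le_cmod)
  also have "\<dots> \<le> norm w ^ 3 / (1 - norm w)" using r by (intro norm_ln_one_minus_le) auto
  also have "\<dots> \<le> norm w ^ 3 / (1/4)" using r by (intro divide_left_mono) auto
  finally show ?thesis by simp
qed

text \<open>One upper bound for all w, zeros of 1 - w included: the Taylor bound for small w, while
  for |w|^2 > 1/2 the cubic term outweighs everything else. It is applied on a circle of radius 2,
  where the scaled variable may exceed 1 in modulus.\<close>

lemma norm_one_minus_le_exp:
  fixes w :: complex
  shows "norm (1 - w) \<le> exp (- Re w - Re (w\<^sup>2) / 2 + 5 * norm w ^ 3)"
proof (cases "(norm w)\<^sup>2 \<le> 1/2")
  case True
  then have "norm w < 1" by (rule_tac power2_less_imp_less[OF le_less_trans]) auto
  then have "norm (1 - w) > 0" by auto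
  then have "norm (1 - w) = exp (ln (norm (1 - w)))" by simp
  also have "\<dots> \<le> exp (- Re w - Re (w\<^sup>2) / 2 + 5 * norm w ^ 3)"
    using ln_norm_one_minus[OF True] norm_ge_zero[of w] zero_le_power[of "norm w" 3] by (subst exp_le_cancel_iff) linarith
  finally show ?thesis .
next
  case False
  define r where "r = norm w"
  have r: "r \<ge> 0" "r\<^sup>2 \<ge> 1/2" using False by (auto simp: r_def)
  have r1: "r \<ge> 1/2" by (rule power2_le_imp_le) (use r in \<open>auto simp: power2_eq_square\<close>)
  have "2 * r \<le> 4 * r ^ 3"
    using mult_left_mono[OF r(2), of "4 * r"] r(1) by (simp add: power2_eq_square power3_eq_cube)
  moreover have "r\<^sup>2 / 2 \<le> r ^ 3"
    using mult_right_mono[OF r1, of "r\<^sup>2"] by (simp add: power2_eq_square power3_eq_cube)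
  moreover have "\<bar>Re w\<bar> \<le> r" "\<bar>Re (w\<^sup>2)\<bar> \<le> r\<^sup>2"
    using abs_Re_le_cmod[of w] abs_Re_le_cmod[of "w\<^sup>2"] by (auto simp: r_def norm_power)
  ultimately have *: "r \<le> - Re w - Re (w\<^sup>2) / 2 + 5 * r ^ 3" by linarith
  have "norm (1 - w) \<le> 1 + r" using norm_triangle_ineq4[of 1 w] by (simp add: r_def)
  also have "\<dots> \<le> exp r" by (rule exp_ge_add_one_self)
  also have "\<dots> \<le> exp (- Re w - Re (w\<^sup>2) / 2 + 5 * r ^ 3)" using * by simp
  finally show ?thesis by (simp add: r_def)
qed

lemma coeff_prod_linear:
  fixes x :: "'a \<Rightarrow> complex"
  assumes "finite P"
  shows "Polynomial.coeff (\<Prod>p\<in>P. [:1, - x p:]) k = (\<Sum>A\<in>{A. A \<subseteq> P \<and> card A = k}. (-1) ^ card A * (\<Prod>p\<in>A. x p))"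
proof -
  have "(\<Prod>p\<in>P. [:1, - x p:]) = (\<Prod>p\<in>P. Polynomial.monom (- x p) 1 + 1)"
    by (intro prod.cong refl) (simp add: monom_altdef one_pCons)
  also have "\<dots> = (\<Sum>A\<in>Pow P. \<Prod>p\<in>A. Polynomial.monom (- x p) 1)"
    by (subst prod_add[OF assms]) simp
  also have "\<dots> = (\<Sum>A\<in>Pow P. Polynomial.monom ((-1) ^ card A * (\<Prod>p\<in>A. x p)) (card A))"
  proof (intro sum.cong refl)
    fix A assume "A \<in> Pow P"
    then have "finite A" using assms finite_subset by auto
    then show "(\<Prod>p\<in>A. Polynomial.monom (- x p) 1) = Polynomial.monom ((-1) ^ card A * (\<Prod>p\<in>A. x p)) (card A)"
      by (induction A) (simp_all add: mult_monom monom_0 one_pCons)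
  qed
  also have "Polynomial.coeff \<dots> k = (\<Sum>A\<in>Pow P. if card A = k then (-1) ^ card A * (\<Prod>p\<in>A. x p) else 0)"
    by (simp add: coeff_sum coeff_monom)
  also have "\<dots> = (\<Sum>A\<in>{A. A \<subseteq> P \<and> card A = k}. (-1) ^ card A * (\<Prod>p\<in>A. x p))"
    using assms by (subst sum.inter_filter[symmetric]) (auto simp: Pow_def)
  finally show ?thesis .
qed

lemma norm_coeff_le:
  fixes q :: "complex poly"
  assumes "r > 0" "\<And>z. norm z = r \<Longrightarrow> norm (poly q z) \<le> B"
  shows "norm (Polynomial.coeff q k) \<le> B / r ^ k"
proof -
  have d: "(deriv ^^ k) (poly q) = poly ((pderiv ^^ k) q)"
  proof (induction k)
    case (Suc k)
    then show ?case by (auto intro!: DERIV_imp_deriv poly_DERIV)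
  qed simp
  have "poly ((pderiv ^^ k) q) 0 = fact k * Polynomial.coeff q k"
    by (simp add: poly_0_coeff_0 coeff_higher_pderiv pochhammer_fact)
  moreover have "norm ((deriv ^^ k) (poly q) 0) \<le> fact k * B / r ^ k"
    using assms by (intro Cauchy_inequality) (auto intro!: holomorphic_intros continuous_intros)
  ultimately have "fact k * norm (Polynomial.coeff q k) \<le> fact k * (B / r ^ k)" by (simp add: d norm_mult)
  then show ?thesis by (subst (asm) mult_le_cancel_left_pos) auto
qed

text \<open>The truncated sum adds the coefficients up to degree N of the polynomial z \<mapsto>
  product of 1 - z x(p). Cauchy's estimate on |z| = 2 makes the k-th coefficient at most B 2^-k, and
  the tail beyond N is geometric.\<close>

lemma truncated_product_tail:
  fixes x :: "'a \<Rightarrow> complex"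
  assumes P: "finite P"
    and B: "\<And>z. norm z = 2 \<Longrightarrow> norm (\<Prod>p\<in>P. 1 - z * x p) \<le> B"
  shows "norm ((\<Prod>p\<in>P. 1 - x p) - (\<Sum>A\<in>{A. A \<subseteq> P \<and> card A \<le> N}. (-1) ^ card A * (\<Prod>p\<in>A. x p))) \<le> B * (1/2) ^ N"
proof -
  define q where "q = (\<Prod>p\<in>P. [:1, - x p:])"
  define f where "f A = (-1) ^ card A * (\<Prod>p\<in>A. x p)" for A
  define I where "I k = {A. A \<subseteq> P \<and> card A = k}" for k
  have poly: "poly q z = (\<Prod>p\<in>P. 1 - z * x p)" for z by (simp add: q_def poly_prod)
  have cB: "norm (Polynomial.coeff q k) \<le> B * (1/2) ^ k" for k
    using norm_coeff_le[of 2 q B k] by (simp add: poly B power_one_over)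
  have "B \<ge> 0" using order.trans[OF norm_ge_zero B[of 2]] by simp
  have part: "(\<Sum>k\<in>K. Polynomial.coeff q k) = sum f {A. A \<subseteq> P \<and> card A \<in> K}" if "finite K" for K
  proof -
    have "(\<Sum>k\<in>K. Polynomial.coeff q k) = (\<Sum>k\<in>K. sum f (I k))"
      by (simp add: q_def coeff_prod_linear[OF P] f_def I_def)
    also have "\<dots> = sum f (\<Union>k\<in>K. I k)"
      using that P by (subst sum.UNION_disjoint) (auto simp: I_def)
    also have "(\<Union>k\<in>K. I k) = {A. A \<subseteq> P \<and> card A \<in> K}" by (auto simp: I_def)
    finally show ?thesis .
  qed
  define m where "m = max (card P) (max N (degree q))"
  have le: "card A \<le> m" if "A \<subseteq> P" for A using card_mono[OF P that] by (simp add: m_def)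
  have "(\<Prod>p\<in>P. 1 - x p) = poly q 1" by (simp add: poly)
  also have "\<dots> = (\<Sum>k\<in>{..m}. Polynomial.coeff q k)" unfolding poly_altdef
    by (rule sum.mono_neutral_cong_left) (auto simp: m_def coeff_eq_0)
  finally have "(\<Prod>p\<in>P. 1 - x p) - sum f {A. A \<subseteq> P \<and> card A \<le> N} = (\<Sum>k\<in>{..m}. Polynomial.coeff q k) - (\<Sum>k\<in>{..N}. Polynomial.coeff q k)"
    using part[of "{..N}"] by simp
  also have "\<dots> = (\<Sum>k\<in>{..m} - {..N}. Polynomial.coeff q k)" by (subst sum_diff) (auto simp: m_def)
  also have "{..m} - {..N} = {Suc N..<Suc m}" by auto
  also have "norm (\<Sum>k\<in>{Suc N..<Suc m}. Polynomial.coeff q k) \<le> (\<Sum>k\<in>{Suc N..<Suc m}. B * (1/2) ^ k)"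
    by (intro sum_norm_le cB)
  also have "\<dots> \<le> B * (1/2) ^ N"
  proof -
    have geo: "(\<Sum>k\<in>{Suc N..<Suc M}. (1/2) ^ k) \<le> (1/2::real) ^ N - (1/2) ^ M" if "N \<le> M" for M
      using that by (induction M rule: dec_induct) auto
    have "(\<Sum>k\<in>{Suc N..<Suc m}. (1/2) ^ k) \<le> (1/2::real) ^ N - (1/2) ^ m" by (rule geo) (simp add: m_def)
    also have "\<dots> \<le> (1/2) ^ N" by simp
    finally have "B * (\<Sum>k\<in>{Suc N..<Suc m}. (1/2) ^ k) \<le> B * (1/2) ^ N" using \<open>B \<ge> 0\<close> by (rule mult_left_mono)
    then show ?thesis unfolding sum_distrib_left .
  qed
  finally show ?thesis unfolding f_def .
qed

text \<open>The full product E satisfies |E| \<ge> exp(-a - b - 4K), and truncation costs at most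
  exp(2a + 2b + 40K) 2^-N; the hypothesis on N makes this at most |E| / 2, which moves ln |E| by at
  most ln 2. Since \<open>a\<close> bounds the modulus of the sum of the x(p), and not the sum of
  their moduli, cancellation in the prime polynomial is exploited.\<close>

lemma ln_norm_truncated_product:
  fixes x :: "'a \<Rightarrow> complex"
  defines "M \<equiv> \<lambda>P N. \<Sum>A\<in>{A. A \<subseteq> P \<and> card A \<le> N}. (-1) ^ card A * (\<Prod>p\<in>A. x p)"
  assumes P: "finite P" and x: "\<And>p. p \<in> P \<Longrightarrow> (norm (x p))\<^sup>2 \<le> 1/2"
    and a: "norm (\<Sum>p\<in>P. x p) \<le> a" and b: "(\<Sum>p\<in>P. (norm (x p))\<^sup>2) \<le> b"
    and K: "(\<Sum>p\<in>P. norm (x p) ^ 3) \<le> K"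
    and N: "(1/2) ^ N * exp (3 * a + 3 * b + 44 * K) \<le> 1/2"
  shows "M P N \<noteq> 0" 
    and "\<bar>ln (norm (M P N)) + Re (\<Sum>p\<in>P. x p) + Re (\<Sum>p\<in>P. (x p)\<^sup>2) / 2\<bar> \<le> 4 * K + 1"
proof -
  define E where "E = (\<Prod>p\<in>P. 1 - x p)"
  define P1 where "P1 = (\<Sum>p\<in>P. x p)"
  define P2 where "P2 = (\<Sum>p\<in>P. (x p)\<^sup>2)"
  have P2: "norm P2 \<le> b"
    unfolding P2_def using norm_sum[of "\<lambda>p. (x p)\<^sup>2" P] b by (simp add: norm_power)
  have P1: "norm P1 \<le> a" using a by (simp add: P1_def)
  have nz: "1 - x p \<noteq> 0" if "p \<in> P" for p using x[OF that] by auto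
  then have E0: "E \<noteq> 0" using P by (auto simp: E_def)
  have "ln (norm E) = (\<Sum>p\<in>P. ln (norm (1 - x p)))"
    unfolding E_def prod_norm[symmetric] using nz P by (subst ln_prod) auto
  then have "\<bar>ln (norm E) + Re P1 + Re P2 / 2\<bar> = \<bar>\<Sum>p\<in>P. ln (norm (1 - x p)) + Re (x p) + Re ((x p)\<^sup>2) / 2\<bar>"
    by (simp add: P1_def P2_def sum.distrib sum_divide_distrib)
  also have "\<dots> \<le> (\<Sum>p\<in>P. \<bar>ln (norm (1 - x p)) + Re (x p) + Re ((x p)\<^sup>2) / 2\<bar>)" by (rule sum_abs)
  also have "\<dots> \<le> (\<Sum>p\<in>P. 4 * norm (x p) ^ 3)" by (intro sum_mono ln_norm_one_minus x)
  also have "\<dots> \<le> 4 * K" using K by (simp flip: sum_distrib_left)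
  finally have lnE: "\<bar>ln (norm E) + Re P1 + Re P2 / 2\<bar> \<le> 4 * K" .
  \<comment> \<open>On |z| = 2 the three sums are scaled by 2, by |z|^2 / 2 = 2 and by 5 |z|^3 =
    40.\<close>
  have B: "norm (\<Prod>p\<in>P. 1 - z * x p) \<le> exp (2 * a + 2 * b + 40 * K)" if z: "norm z = 2" for z
  proof -
    have "norm (\<Prod>p\<in>P. 1 - z * x p) \<le> (\<Prod>p\<in>P. exp (- Re (z * x p) - Re ((z * x p)\<^sup>2) / 2 + 5 * norm (z * x p) ^ 3))"
      unfolding prod_norm[symmetric] by (intro prod_mono conjI norm_one_minus_le_exp) auto
    also have "\<dots> = exp (\<Sum>p\<in>P. - Re (z * x p) - Re ((z * x p)\<^sup>2) / 2 + 5 * norm (z * x p) ^ 3)"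
      using P by (simp add: exp_sum)
    also have "(\<Sum>p\<in>P. - Re (z * x p) - Re ((z * x p)\<^sup>2) / 2 + 5 * norm (z * x p) ^ 3) =
        - Re (z * P1) - Re (z\<^sup>2 * P2) / 2 + 40 * (\<Sum>p\<in>P. norm (x p) ^ 3)"
    proof -
      have "(\<Sum>p\<in>P. - Re (z * x p) - Re ((z * x p)\<^sup>2) / 2 + 5 * norm (z * x p) ^ 3) =
          - (\<Sum>p\<in>P. Re (z * x p)) - (\<Sum>p\<in>P. Re ((z * x p)\<^sup>2)) / 2 + 5 * (\<Sum>p\<in>P. norm (z * x p) ^ 3)"
        unfolding sum.distrib sum_subtractf sum_negf sum_divide_distrib sum_distrib_left ..
      moreover have "(\<Sum>p\<in>P. Re (z * x p)) = Re (z * P1)" by (simp only: P1_def sum_distrib_left Re_sum)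
      moreover have "(\<Sum>p\<in>P. Re ((z * x p)\<^sup>2)) = Re (z\<^sup>2 * P2)"
        by (simp only: P2_def sum_distrib_left Re_sum power_mult_distrib)
      moreover have "(\<Sum>p\<in>P. norm (z * x p) ^ 3) = 8 * (\<Sum>p\<in>P. norm (x p) ^ 3)"
        by (simp add: norm_mult power_mult_distrib z sum_distrib_left)
      ultimately show ?thesis by simp
    qed
    also have "\<dots> \<le> 2 * a + 2 * b + 40 * K"
    proof -
      have "- Re (z * P1) \<le> 2 * a" using abs_Re_le_cmod[of "z * P1"] P1 z by (simp add: norm_mult)
      moreover have "- Re (z\<^sup>2 * P2) \<le> 4 * b" using abs_Re_le_cmod[of "z\<^sup>2 * P2"] P2 z by (simp add: norm_mult norm_power)
      ultimately show ?thesis using K by linarith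
    qed
    finally show ?thesis by simp
  qed
  have "norm (E - M P N) \<le> exp (2 * a + 2 * b + 40 * K) * (1/2) ^ N"
    unfolding E_def M_def by (rule truncated_product_tail[OF P B])
  also have "\<dots> = ((1/2) ^ N * exp (3 * a + 3 * b + 44 * K)) * exp (- a - b - 4 * K)"
    by (simp flip: exp_add)
  also have "\<dots> \<le> 1/2 * exp (- a - b - 4 * K)" by (intro mult_right_mono N) auto
  also have "exp (- a - b - 4 * K) \<le> norm E"
  proof -
    have "- a - b - 4 * K \<le> ln (norm E)"
      using lnE abs_Re_le_cmod[of P1] abs_Re_le_cmod[of P2] P1 P2 norm_ge_zero[of P2] by linarith
    then show ?thesis using E0 by (subst (asm) ln_ge_iff) auto
  qed
  finally have d: "norm (E - M P N) \<le> norm E / 2" by simp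
  have "norm E \<le> norm (E - M P N) + norm (M P N)" using norm_triangle_ineq[of "E - M P N" "M P N"] by simp
  then have lo: "norm E / 2 \<le> norm (M P N)" using d by simp
  have hi: "norm (M P N) \<le> 2 * norm E" using norm_triangle_ineq4[of E "E - M P N"] d norm_ge_zero[of E] by (simp del: norm_ge_zero)
  show M0: "M P N \<noteq> 0" using lo E0 by auto
  have "ln (norm (M P N)) \<le> ln (2 * norm E)" using hi M0 by (subst ln_le_cancel_iff) (auto simp: E0)
  moreover have "ln (norm E / 2) \<le> ln (norm (M P N))" using lo M0 by (subst ln_le_cancel_iff) (auto simp: E0)
  ultimately have "\<bar>ln (norm (M P N)) - ln (norm E)\<bar> \<le> 1"
    using E0 ln_2_less_1 by (simp add: ln_mult ln_div)
  then show "\<bar>ln (norm (M P N)) + Re (\<Sum>p\<in>P. x p) + Re (\<Sum>p\<in>P. (x p)\<^sup>2) / 2\<bar> \<le> 4 * K + 1"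
    using lnE unfolding P1_def[symmetric] P2_def[symmetric] by linarith
qed

section \<open>Uniform averages and mean squares of Dirichlet polynomials\<close>

definition unif :: "real \<Rightarrow> real \<Rightarrow> real measure" where
  "unif a b = density lborel (\<lambda>t. ennreal (indicator {a..b} t / (b - a)))"

lemma sets_unif [simp, measurable_cong]: "sets (unif a b) = sets borel"
  and space_unif [simp]: "space (unif a b) = UNIV"
  by (auto simp: unif_def)

lemma emeasure_unif:
  assumes "a < b" "S \<in> sets borel"
  shows "emeasure (unif a b) S = ennreal (measure lborel ({a..b} \<inter> S) / (b - a))"
proof -
  have "emeasure (unif a b) S = (\<integral>\<^sup>+t. ennreal (1 / (b - a)) * indicator ({a..b} \<inter> S) t \<partial>lborel)"
    unfolding unif_def using assms by (subst emeasure_density) (auto intro!: nn_integral_cong split: split_indicator)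
  also have "\<dots> = ennreal (1 / (b - a)) * emeasure lborel ({a..b} \<inter> S)"
    using assms by (subst nn_integral_cmult_indicator) auto
  also have "emeasure lborel ({a..b} \<inter> S) = ennreal (measure lborel ({a..b} \<inter> S))"
    by (intro emeasure_eq_ennreal_measure emeasure_bounded_finite[THEN less_imp_neq, unfolded infinity_ennreal_def])
       (auto intro: bounded_subset[of "{a..b}"])
  finally show ?thesis using assms by (simp flip: ennreal_mult)
qed

lemma measure_unif:
  assumes "a < b" "S \<in> sets borel"
  shows "measure (unif a b) S = measure lborel ({a..b} \<inter> S) / (b - a)"
  using emeasure_unif[OF assms] assms(1) by (simp add: measure_def)

lemma prob_space_unif: assumes "a < b" shows "prob_space (unif a b)"
  by (rule prob_spaceI) (use assms emeasure_unif[OF assms, of UNIV] in simp)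

lemma integral_unif:
  fixes f :: "real \<Rightarrow> 'b::{banach, second_countable_topology}"
  assumes "a < b" "f \<in> borel_measurable borel"
  shows "(LINT t|unif a b. f t) = (1 / (b - a)) *\<^sub>R (LINT t|lborel. indicator {a..b} t *\<^sub>R f t)"
proof -
  have "(LINT t|unif a b. f t) = (LINT t|lborel. (indicator {a..b} t / (b - a)) *\<^sub>R f t)"
    unfolding unif_def using assms by (intro integral_density) auto
  also have "\<dots> = (1 / (b - a)) *\<^sub>R (LINT t|lborel. indicator {a..b} t *\<^sub>R f t)"
    unfolding integral_scaleR_right[symmetric] by (intro Bochner_Integration.integral_cong) auto
  finally show ?thesis .
qed

lemma cis_measurable [measurable (raw)]:
  "f \<in> borel_measurable M \<Longrightarrow> (\<lambda>x. cis (f x)) \<in> borel_measurable M"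
  by (rule borel_measurable_continuous_on[where f = cis]) (auto intro!: continuous_intros)

lemma integral_unif_cis:
  assumes "a < b" "l \<noteq> 0"
  shows "(LINT t|unif a b. cis (l * t)) = (cis (l * b) - cis (l * a)) / (\<i> * of_real (l * (b - a)))"
proof -
  have "(LINT t|unif a b. cis (l * t)) = (1 / (b - a)) *\<^sub>R (LINT t|lborel. indicator {a..b} t *\<^sub>R cis (l * t))"
    by (rule integral_unif[OF assms(1)]) measurable
  also have "(LINT t|lborel. indicator {a..b} t *\<^sub>R cis (l * t)) = cis (l * b) / (\<i> * of_real l) - cis (l * a) / (\<i> * of_real l)"
  proof (rule integral_FTC_Icc)
    show "((\<lambda>t. cis (l * t) / (\<i> * of_real l)) has_vector_derivative cis (l * x)) (at x within {a..b})" for x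
    proof -
      have "((\<lambda>z. exp (\<i> * of_real l * z) / (\<i> * of_real l)) has_field_derivative exp (\<i> * of_real l * of_real x)) (at (of_real x))"
        using assms by (auto intro!: derivative_eq_intros)
      then show ?thesis
        using has_vector_derivative_real_field by (fastforce simp: cis_conv_exp mult.assoc)
    qed
    show "continuous_on {a..b} (\<lambda>t. cis (l * t))" by (intro continuous_intros)
  qed (use assms in simp)
  finally show ?thesis using assms by (simp add: scaleR_conv_of_real field_simps)
qed

lemma norm_integral_unif_cis_le:
  assumes "a < b" "l \<noteq> 0"
  shows "norm (LINT t|unif a b. cis (l * t)) \<le> 2 / (\<bar>l\<bar> * (b - a))"
proof -
  have "norm (cis (l * b) - cis (l * a)) \<le> 2"
    using norm_triangle_ineq4[of "cis (l * b)" "cis (l * a)"] by simp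
  then show ?thesis unfolding integral_unif_cis[OF assms] using assms
    by (simp add: norm_divide norm_mult abs_mult divide_right_mono del: of_real_mult of_real_diff)
qed

lemma integrable_unif:
  fixes f :: "real \<Rightarrow> 'b::{banach, second_countable_topology}"
  assumes "a < b" "f \<in> borel_measurable borel" "\<And>t. norm (f t) \<le> B"
  shows "integrable (unif a b) f"
proof -
  interpret prob_space "unif a b" by (rule prob_space_unif) fact
  show ?thesis by (rule integrable_const_bound[where B = B]) (use assms in auto)
qed

text \<open>Expanding the square, the diagonal gives the sum of squares, and explicit integration
  bounds every off-diagonal average by 2 / (\<delta> (b - a)). For polynomials as short as the ones
  used here this crude bound suffices.\<close>

lemma trig_mean_square:
  fixes c l :: "'a \<Rightarrow> real"
  assumes ab: "a < b" and I: "finite I" and d: "\<delta> > 0"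
    and sep: "\<And>i j. i \<in> I \<Longrightarrow> j \<in> I \<Longrightarrow> i \<noteq> j \<Longrightarrow> \<delta> \<le> \<bar>l i - l j\<bar>"
  shows "(LINT t|unif a b. (norm (\<Sum>i\<in>I. of_real (c i) * cis (l i * t)))\<^sup>2) \<le> (\<Sum>i\<in>I. (c i)\<^sup>2) + 2 / (\<delta> * (b - a)) * (\<Sum>i\<in>I. \<bar>c i\<bar>)\<^sup>2"
proof -
  interpret prob_space "unif a b" by (rule prob_space_unif) fact
  have sq: "of_real ((norm (\<Sum>i\<in>I. of_real (c i) * cis (l i * t)))\<^sup>2) = (\<Sum>i\<in>I. \<Sum>j\<in>I. of_real (c i * c j) * cis ((l i - l j) * t))" for t
  proof -
    have "of_real ((norm (\<Sum>i\<in>I. of_real (c i) * cis (l i * t)))\<^sup>2) =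
        (\<Sum>i\<in>I. of_real (c i) * cis (l i * t)) * cnj (\<Sum>i\<in>I. of_real (c i) * cis (l i * t))"
      by (rule complex_norm_square)
    also have "\<dots> = (\<Sum>i\<in>I. \<Sum>j\<in>I. of_real (c i * c j) * (cis (l i * t) * cis (- (l j * t))))"
      unfolding cnj_sum sum_product by (intro sum.cong refl) (simp add: cis_cnj mult_ac)
    also have "\<dots> = (\<Sum>i\<in>I. \<Sum>j\<in>I. of_real (c i * c j) * cis ((l i - l j) * t))"
      by (simp add: cis_mult algebra_simps)
    finally show ?thesis .
  qed
  have int: "integrable (unif a b) (\<lambda>t. cis (x * t))" for x by (rule integrable_unif[OF ab, of _ 1]) (auto intro!: cis_measurable)
  have diag: "norm (LINT t|unif a b. cis ((l i - l j) * t)) \<le> (if i = j then 1 else 0) + 2 / (\<delta> * (b - a))" if "i \<in> I" "j \<in> I" for i j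
  proof (cases "i = j")
    case True
    then show ?thesis using prob_space d ab by simp
  next
    case False
    have "norm (LINT t|unif a b. cis ((l i - l j) * t)) \<le> 2 / (\<bar>l i - l j\<bar> * (b - a))"
      by (rule norm_integral_unif_cis_le[OF ab]) (use sep[OF that False] d in auto)
    also have "\<dots> \<le> 2 / (\<delta> * (b - a))"
      using sep[OF that False] d ab by (intro divide_left_mono mult_right_mono mult_pos_pos) auto
    finally show ?thesis using False by simp
  qed
  have "of_real (LINT t|unif a b. (norm (\<Sum>i\<in>I. of_real (c i) * cis (l i * t)))\<^sup>2) =
     (LINT t|unif a b. (\<Sum>i\<in>I. \<Sum>j\<in>I. of_real (c i * c j) * cis ((l i - l j) * t)))"
    unfolding sq[symmetric] integral_complex_of_real ..
  also have "\<dots> = (\<Sum>i\<in>I. \<Sum>j\<in>I. of_real (c i * c j) * (LINT t|unif a b. cis ((l i - l j) * t)))"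
    by (simp add: int)
  finally have "(LINT t|unif a b. (norm (\<Sum>i\<in>I. of_real (c i) * cis (l i * t)))\<^sup>2) =
     Re (\<Sum>i\<in>I. \<Sum>j\<in>I. of_real (c i * c j) * (LINT t|unif a b. cis ((l i - l j) * t)))"
    by (metis Re_complex_of_real)
  also have "\<dots> \<le> norm (\<Sum>i\<in>I. \<Sum>j\<in>I. of_real (c i * c j) * (LINT t|unif a b. cis ((l i - l j) * t)))"
    by (rule complex_Re_le_cmod)
  also have "\<dots> \<le> (\<Sum>i\<in>I. \<Sum>j\<in>I. \<bar>c i\<bar> * \<bar>c j\<bar> * ((if i = j then 1 else 0) + 2 / (\<delta> * (b - a))))"
    unfolding norm_mult norm_of_real abs_mult by (intro sum_norm_le, unfold norm_mult norm_of_real abs_mult, intro mult_left_mono diag) simp_all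
  also have "\<dots> = (\<Sum>i\<in>I. (c i)\<^sup>2) + 2 / (\<delta> * (b - a)) * (\<Sum>i\<in>I. \<bar>c i\<bar>)\<^sup>2"
  proof -
    have "(\<Sum>j\<in>I. \<bar>c i\<bar> * \<bar>c j\<bar> * (if i = j then 1 else 0)) = (c i)\<^sup>2" if "i \<in> I" for i
      using that I by (simp add: power2_eq_square if_distrib cong: if_cong)
    then have "(\<Sum>i\<in>I. \<Sum>j\<in>I. \<bar>c i\<bar> * \<bar>c j\<bar> * (if i = j then 1 else 0)) = (\<Sum>i\<in>I. (c i)\<^sup>2)" by simp
    moreover have "(\<Sum>i\<in>I. \<bar>c i\<bar>)\<^sup>2 = (\<Sum>i\<in>I. \<Sum>j\<in>I. \<bar>c i\<bar> * \<bar>c j\<bar>)" by (simp add: power2_eq_square sum_product)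
    ultimately show ?thesis
      unfolding distrib_left sum.distrib by (simp add: sum_distrib_left sum_divide_distrib mult_ac)
  qed
  finally show ?thesis .
qed

text \<open>Distinct integers differ by at least 1, and up to x the slope of ln is at least
  1/x.\<close>

lemma ln_diff_ge_inverse:
  fixes m n :: nat
  assumes "0 < m" "0 < n" "m \<noteq> n" "real m \<le> x" "real n \<le> x"
  shows "1 / x \<le> \<bar>ln (real m) - ln (real n)\<bar>"
proof -
  have *: "1 / x \<le> ln (real n) - ln (real m)" if "m < n" "0 < m" "real n \<le> x" for m n :: nat
  proof -
    have "1 / x \<le> 1 / real n" using that by (intro divide_left_mono) auto
    also have "\<dots> \<le> 1 - real m / real n" using that by (simp add: field_simps)
    also have "\<dots> \<le> - ln (real m / real n)" using ln_le_minus_one[of "real m / real n"] that by simp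
    also have "\<dots> = ln (real n) - ln (real m)" using that by (simp add: ln_div)
    finally show ?thesis .
  qed
  show ?thesis using *[of m n] *[of n m] assms by (cases "m < n") auto
qed

lemma powr_minus_half_square: "x > 0 \<Longrightarrow> ((x::real) powr (-1/2))\<^sup>2 = 1 / x"
  unfolding power2_eq_square by (subst powr_add[symmetric]) (simp add: powr_minus_divide)

lemma of_nat_powr_critical_line:
  assumes "p > 0"
  shows "of_nat p powr (- (1/2 + \<i> * of_real t)) = of_real (real p powr (-1/2)) * cis (- ln (real p) * t)"
    and "(of_nat p powr (- (1/2 + \<i> * complex_of_real t)))\<^sup>2 = of_real (1 / real p) * cis ((- 2 * ln (real p)) * t)"
proof -
  show 1: "of_nat p powr (- (1/2 + \<i> * of_real t)) = of_real (real p powr (-1/2)) * cis (- ln (real p) * t)"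
    using assms by (simp add: powr_def cis_conv_exp exp_of_real[symmetric] ring_distribs mult_ac flip: exp_add)
  show "(of_nat p powr (- (1/2 + \<i> * complex_of_real t)))\<^sup>2 = of_real (1 / real p) * cis ((- 2 * ln (real p)) * t)"
  proof -
    have "(real p powr (-1/2))\<^sup>2 = 1 / real p"
      using assms by (intro powr_minus_half_square) simp
    moreover have "(cis (- ln (real p) * t))\<^sup>2 = cis ((- 2 * ln (real p)) * t)" by (simp add: power2_eq_square cis_mult mult_ac)
    ultimately show ?thesis unfolding 1 power_mult_distrib by (metis of_real_power)
  qed
qed

definition prime_poly :: "real \<Rightarrow> real \<Rightarrow> complex" where
  "prime_poly X t = (\<Sum>p\<in>primes_upto X. of_real (real p powr (-1/2)) * cis (- ln (real p) * t))"

lemma prime_poly_measurable [measurable]: "prime_poly X \<in> borel_measurable borel"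
  unfolding prime_poly_def by measurable

lemma sum_powr_half_le:
  assumes "X \<ge> 1" shows "(\<Sum>p\<in>primes_upto X. \<bar>real p powr (-1/2)\<bar>) \<le> X"
proof -
  have "(\<Sum>p\<in>primes_upto X. \<bar>real p powr (-1/2)\<bar>) \<le> (\<Sum>p\<in>primes_upto X. 1)"
  proof (intro sum_mono)
    fix p assume "p \<in> primes_upto X"
    then have "real p \<ge> 1" using prime_ge_1_nat by (auto simp: primes_upto_def)
    then have "real p powr (-1/2) \<le> real p powr 0" by (intro powr_mono) auto
    then show "\<bar>real p powr (-1/2)\<bar> \<le> 1" using \<open>real p \<ge> 1\<close> by simp
  qed
  also have "\<dots> = real (card (primes_upto X))" by simp
  also have "\<dots> \<le> real (card {1..nat \<lfloor>X\<rfloor>})"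
    by (intro of_nat_mono card_mono) (use prime_ge_1_nat in \<open>auto simp: primes_upto_def le_nat_floor\<close>)
  also have "\<dots> \<le> X" using assms by simp
  finally show ?thesis .
qed

lemma prime_poly_mean_square:
  assumes "a < b" "X \<ge> 1"
  shows "(LINT t|unif a b. (norm (prime_poly X t))\<^sup>2) \<le> prime_recip_sum X + 2 * X ^ 3 / (b - a)"
proof -
  have "(LINT t|unif a b. (norm (prime_poly X t))\<^sup>2) \<le>
      (\<Sum>p\<in>primes_upto X. (real p powr (-1/2))\<^sup>2) + 2 / (1 / X * (b - a)) * (\<Sum>p\<in>primes_upto X. \<bar>real p powr (-1/2)\<bar>)\<^sup>2"
    unfolding prime_poly_def
  proof (rule trig_mean_square)
    fix p q assume pq: "p \<in> primes_upto X" "q \<in> primes_upto X" "p \<noteq> q"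
    have "1 / X \<le> \<bar>ln (real p) - ln (real q)\<bar>"
      using pq prime_gt_0_nat by (intro ln_diff_ge_inverse) (auto simp: primes_upto_def)
    then show "1 / X \<le> \<bar>- ln (real p) - - ln (real q)\<bar>" by simp
  qed (use assms in auto)
  also have "(\<Sum>p\<in>primes_upto X. (real p powr (-1/2))\<^sup>2) = prime_recip_sum X"
    unfolding prime_recip_sum_def
    by (intro sum.cong refl) (use prime_gt_0_nat in \<open>auto simp only: primes_upto_def mem_Collect_eq of_nat_0_less_iff intro!: powr_minus_half_square\<close>)
  also have "2 / (1 / X * (b - a)) * (\<Sum>p\<in>primes_upto X. \<bar>real p powr (-1/2)\<bar>)\<^sup>2 \<le> 2 / (1 / X * (b - a)) * X\<^sup>2"
    using assms sum_powr_half_le[of X] by (intro mult_left_mono power_mono) (auto intro!: sum_nonneg)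
  also have "2 / (1 / X * (b - a)) * X\<^sup>2 = 2 * X ^ 3 / (b - a)" using assms by (simp add: power2_eq_square power3_eq_cube)
  finally show ?thesis by simp
qed

text \<open>The diagonal is a convergent sum of 1/p^2. With a bounded mean square, the squares of
  primes are negligible on the scale sqrt L.\<close>

lemma prime_square_poly_mean_square:
  assumes "a < b" "X \<ge> 1"
  shows "(LINT t|unif a b. (norm (\<Sum>p\<in>primes_upto X. of_real (1 / real p) * cis ((- 2 * ln (real p)) * t)))\<^sup>2) \<le> 1 + 2 * X ^ 3 / (b - a)"
proof -
  have "(LINT t|unif a b. (norm (\<Sum>p\<in>primes_upto X. of_real (1 / real p) * cis ((- 2 * ln (real p)) * t)))\<^sup>2) \<le>
      (\<Sum>p\<in>primes_upto X. (1 / real p)\<^sup>2) + 2 / (1 / X * (b - a)) * (\<Sum>p\<in>primes_upto X. \<bar>1 / real p\<bar>)\<^sup>2"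
  proof (rule trig_mean_square)
    fix p q assume pq: "p \<in> primes_upto X" "q \<in> primes_upto X" "p \<noteq> q"
    have "1 / X \<le> \<bar>ln (real p) - ln (real q)\<bar>"
      using pq prime_gt_0_nat by (intro ln_diff_ge_inverse) (auto simp: primes_upto_def)
    then show "1 / X \<le> \<bar>- 2 * ln (real p) - - 2 * ln (real q)\<bar>" by simp
  qed (use assms in auto)
  also have "\<dots> \<le> 1 + 2 / (1 / X * (b - a)) * X\<^sup>2"
  proof (rule add_mono[OF _ mult_left_mono[OF power_mono]])
    show "(\<Sum>p\<in>primes_upto X. (1 / real p)\<^sup>2) \<le> 1"
      unfolding power_divide power_one by (rule sum_inverse_prime_squares_le[OF finite_primes_upto]) (auto simp: primes_upto_def)
    have "(\<Sum>p\<in>primes_upto X. \<bar>1 / real p\<bar>) \<le> (\<Sum>p\<in>primes_upto X. \<bar>real p powr (-1/2)\<bar>)"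
    proof (intro sum_mono)
      fix p assume "p \<in> primes_upto X"
      then have p: "real p \<ge> 1" using prime_ge_1_nat by (auto simp: primes_upto_def)
      then have "real p powr (-1) \<le> real p powr (-1/2)" by (intro powr_mono) auto
      moreover have "real p powr (-1) = 1 / real p" using p by (simp add: powr_minus_divide)
      ultimately show "\<bar>1 / real p\<bar> \<le> \<bar>real p powr (-1/2)\<bar>" by simp
    qed
    also note sum_powr_half_le[OF assms(2)]
    finally show "(\<Sum>p\<in>primes_upto X. \<bar>1 / real p\<bar>) \<le> X" .
    show "0 \<le> 2 / (1 / X * (b - a))" using assms by simp
    show "0 \<le> (\<Sum>p\<in>primes_upto X. \<bar>1 / real p\<bar>)" by (intro sum_nonneg) simp
  qed
  also have "2 / (1 / X * (b - a)) * X\<^sup>2 = 2 * X ^ 3 / (b - a)" using assms by (simp add: power2_eq_square power3_eq_cube)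
  finally show ?thesis .
qed

section \<open>The mollifier compared with the prime polynomial\<close>

lemma powr_prod_nat:
  fixes s :: complex
  assumes "finite A"
  shows "of_nat (\<Prod>A) powr s = (\<Prod>p\<in>A. of_nat p powr s)"
  using assms
proof (induction A)
  case (insert p A)
  have "of_nat (\<Prod>(insert p A)) powr s = (of_nat p * of_nat (\<Prod>A)) powr s" using insert by simp
  also have "\<dots> = of_nat p powr s * of_nat (\<Prod>A) powr s" by (rule powr_times_real) (simp_all only: Reals_of_nat complex.sel of_nat_0_le_iff complex_Re_of_nat)
  finally show ?case using insert by simp
qed simp

lemma (in sieve) mollifier_eq_prod:
  "mollifier s = (\<Sum>A\<in>{A. A \<subseteq> P \<and> card A \<le> N}. (-1) ^ card A * (\<Prod>p\<in>A. of_nat p powr (- s)))"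
  unfolding mollifier_def brun_def
  by (intro sum.cong refl arg_cong2[of _ _ _ _ times] powr_prod_nat) (use finP finite_subset in auto)

definition prime_square_poly :: "real \<Rightarrow> real \<Rightarrow> complex" where
  "prime_square_poly X t = (\<Sum>p\<in>primes_upto X. of_real (1 / real p) * cis ((- 2 * ln (real p)) * t))"

lemma prime_square_poly_measurable [measurable]: "prime_square_poly X \<in> borel_measurable borel"
  unfolding prime_square_poly_def by measurable

abbreviation mollifier_at :: "real \<Rightarrow> real \<Rightarrow> complex" where
  "mollifier_at T t \<equiv> sieve.mollifier (small_primes T) (sieve_level T) (1/2 + \<i> * of_real t)"

abbreviation prime_poly_at :: "real \<Rightarrow> real \<Rightarrow> complex" where
  "prime_poly_at T t \<equiv> prime_poly (prime_cutoff T) t"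

lemma eventually_prime_recip_sum_le:
  obtains C where "C \<ge> 0" "\<forall>\<^sub>F T in at_top. prime_recip_sum (prime_cutoff T) \<le> ln (ln T) + C"
proof -
  obtain C where C: "C \<ge> 0" "\<forall>\<^sub>F T in at_top. \<bar>prime_recip_sum T - ln (ln T)\<bar> \<le> C \<and>
       \<bar>prime_recip_sum (prime_cutoff T) - (ln (ln T) - ln (100 * real (sieve_level T)))\<bar> \<le> C"
    using eventually_prime_recip_sum by blast
  from C(2) eventually_sieve_level_pos have "\<forall>\<^sub>F T in at_top. prime_recip_sum (prime_cutoff T) \<le> ln (ln T) + C"
  proof eventually_elim
    case (elim T)
    have "ln (100 * real (sieve_level T)) \<ge> 0" using elim(2) by (intro ln_ge_zero) linarith
    then show ?case using elim(1) by linarith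
  qed
  with C(1) show ?thesis by (rule that)
qed

lemma prime_cutoff_cube_le:
  assumes "T > 1" "sieve_level T > 0"
  shows "prime_cutoff T ^ 3 \<le> T"
proof -
  have "prime_cutoff T \<le> T powr (1/100)"
    unfolding prime_cutoff_def using assms by (intro powr_mono) (auto simp: field_simps)
  then have "prime_cutoff T ^ 3 \<le> (T powr (1/100)) ^ 3"
    using prime_cutoff_ge_1[of T] assms by (intro power_mono) auto
  also have "\<dots> = T powr (3/100)" using assms by (simp add: powr_powr flip: powr_numeral)
  also have "\<dots> \<le> T powr 1" using assms by (intro powr_mono) auto
  finally show ?thesis using assms by simp
qed

text \<open>\<open>ln_norm_truncated_product\<close> with x(p) = p^(-s), a = L, b = L + C and K the
  convergent sum of n^(-3/2). Its condition becomes 2^-N exp(6L + O(1)) \<le> 1/2, which the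
  quadratic level meets.\<close>

lemma ln_mollifier_approx:
  obtains K where "\<forall>\<^sub>F T in at_top. \<forall>t. norm (prime_poly_at T t) \<le> ln (ln T) \<longrightarrow>
      mollifier_at T t \<noteq> 0 \<and>
      \<bar>ln (norm (mollifier_at T t)) + Re (prime_poly_at T t) + Re (prime_square_poly (prime_cutoff T) t) / 2\<bar> \<le> K"
proof -
  obtain C where C: "C \<ge> 0" and recip: "\<forall>\<^sub>F T in at_top. prime_recip_sum (prime_cutoff T) \<le> ln (ln T) + C"
    using eventually_prime_recip_sum_le by blast
  define K where "K = (\<Sum>n. real n powr (-3/2))"
  have K: "(\<Sum>p\<in>S. real p powr (-3/2)) \<le> K" if "finite S" for S :: "nat set"
    unfolding K_def using that by (intro sum_le_suminf) (auto simp: summable_real_powr_iff)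
  have small: "\<forall>\<^sub>F T in at_top. (1/2) ^ sieve_level T * exp (6 * ln (ln T) + (3 * C + 44 * K)) \<le> 1/2"
    by (rule half_power_sieve_level) auto
  have "\<forall>\<^sub>F T in at_top. \<forall>t. norm (prime_poly_at T t) \<le> ln (ln T) \<longrightarrow>
      mollifier_at T t \<noteq> 0 \<and>
      \<bar>ln (norm (mollifier_at T t)) + Re (prime_poly_at T t) + Re (prime_square_poly (prime_cutoff T) t) / 2\<bar> \<le> 4 * K + 1"
    using recip small eventually_sieve_level_pos eventually_gt_at_top[of 1]
  proof eventually_elim
    case (elim T)
    interpret sieve "small_primes T" "sieve_level T" "T powr (1/100)"
      by (rule sieve_small_primes) (use elim in auto)
    show ?case
    proof (intro allI impI)
      fix t assume a: "norm (prime_poly_at T t) \<le> ln (ln T)"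
      define x where "x p = of_nat p powr (- (1/2 + \<i> * complex_of_real t))" for p :: nat
      have pos: "p > 0" "p \<ge> 2" if "p \<in> small_primes T" for p using that prime_gt_0_nat prime_ge_2_nat primeP by auto
      have x: "x p = of_real (real p powr (-1/2)) * cis (- ln (real p) * t)" "(x p)\<^sup>2 = of_real (1 / real p) * cis ((- 2 * ln (real p)) * t)"
        if "p \<in> small_primes T" for p
        unfolding x_def using pos[OF that] of_nat_powr_critical_line[of p t] by auto
      have nx: "norm (x p) = real p powr (-1/2)" if "p \<in> small_primes T" for p
        by (simp add: x(1)[OF that] norm_mult)
      have nx2: "(norm (x p))\<^sup>2 = 1 / real p" if "p \<in> small_primes T" for p
        using nx[OF that] powr_minus_half_square[of "real p"] pos[OF that] by simp
      have nx3: "norm (x p) ^ 3 = real p powr (-3/2)" if "p \<in> small_primes T" for p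
        using pos[OF that] unfolding nx[OF that] by (subst powr_realpow[symmetric]) (auto simp: powr_powr)
      have P1: "(\<Sum>p\<in>small_primes T. x p) = prime_poly_at T t"
        unfolding prime_poly_def small_primes_def[symmetric] by (intro sum.cong refl x(1))
      have P2: "(\<Sum>p\<in>small_primes T. (x p)\<^sup>2) = prime_square_poly (prime_cutoff T) t"
        unfolding prime_square_poly_def small_primes_def[symmetric] by (intro sum.cong refl x(2))
      have M: "mollifier_at T t = (\<Sum>A\<in>{A. A \<subseteq> small_primes T \<and> card A \<le> sieve_level T}. (-1) ^ card A * (\<Prod>p\<in>A. x p))"
        unfolding mollifier_eq_prod x_def ..
      have "(norm (x p))\<^sup>2 \<le> 1/2" if "p \<in> small_primes T" for p
        unfolding nx2[OF that] using pos(2)[OF that] by (intro divide_left_mono) auto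
      moreover have "norm (\<Sum>p\<in>small_primes T. x p) \<le> ln (ln T)" using a by (simp add: P1)
      moreover have "(\<Sum>p\<in>small_primes T. (norm (x p))\<^sup>2) \<le> ln (ln T) + C"
        using elim(1) by (simp add: nx2 prime_recip_sum_def small_primes_def)
      moreover have "(\<Sum>p\<in>small_primes T. norm (x p) ^ 3) \<le> K" using K[OF finP] by (simp add: nx3)
      moreover have "(1/2) ^ sieve_level T * exp (3 * ln (ln T) + 3 * (ln (ln T) + C) + 44 * K) \<le> 1/2"
        using elim(2) by (simp add: algebra_simps)
      ultimately show "mollifier_at T t \<noteq> 0 \<and>
          \<bar>ln (norm (mollifier_at T t)) + Re (prime_poly_at T t) + Re (prime_square_poly (prime_cutoff T) t) / 2\<bar> \<le> 4 * K + 1"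
        unfolding M P1[symmetric] P2[symmetric]
        using ln_norm_truncated_product[OF finP, of x "ln (ln T)" "ln (ln T) + C" K "sieve_level T"] by blast
    qed
  qed
  then show ?thesis by (rule that)
qed

lemma chebyshev_unif:
  assumes ab: "a < b" and f: "f \<in> borel_measurable borel" and B: "\<And>t. norm (f t) \<le> B"
    and c: "c > 0" and I: "(LINT t|unif a b. (norm (f t :: complex))\<^sup>2) \<le> I"
  shows "measure (unif a b) {t. norm (f t) \<ge> c} \<le> I / c\<^sup>2"
proof -
  have "integrable (unif a b) (\<lambda>t. (norm (f t))\<^sup>2)"
    by (rule integrable_unif[OF ab, where B = "B\<^sup>2"]) (use f in \<open>auto simp: B power_mono\<close>)
  then have "measure (unif a b) {t \<in> space (unif a b). (norm (f t))\<^sup>2 \<ge> c\<^sup>2} \<le> (LINT t|unif a b. (norm (f t))\<^sup>2) / c\<^sup>2"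
    using c by (intro integral_Markov_inequality_measure[where A = "{}"]) auto
  also have "\<dots> \<le> I / c\<^sup>2" using I c by (intro divide_right_mono) auto
  also have "{t \<in> space (unif a b). (norm (f t))\<^sup>2 \<ge> c\<^sup>2} = {t. norm (f t) \<ge> c}"
    using c by (auto simp: power2_le_iff_abs_le intro: power2_le_imp_le)
  finally show ?thesis .
qed

lemma norm_prime_poly_le:
  "norm (prime_poly X t) \<le> (\<Sum>p\<in>primes_upto X. real p powr (-1/2))"
  "norm (prime_square_poly X t) \<le> (\<Sum>p\<in>primes_upto X. 1 / real p)"
  unfolding prime_poly_def prime_square_poly_def by (auto intro!: sum_norm_le simp: norm_mult norm_divide)

text \<open>Two Chebyshev sets are discarded: |prime polynomial| \<ge> L, of measure O(1/L) since
  the mean square is at most L + O(1), and |sum over prime squares| \<ge> \<delta> sqrt L, of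
  measure O(1/L) since that mean square is bounded. The typical size sqrt L lies far below the
  threshold L of \<open>ln_mollifier_approx\<close>.\<close>

theorem mollifier_prime_poly:
  assumes d: "\<delta> > 0"
  shows "((\<lambda>T. measure (unif T (2*T)) {t. \<not> (mollifier_at T t \<noteq> 0 \<and>
      \<bar>ln (norm (mollifier_at T t)) + Re (prime_poly_at T t)\<bar> \<le> \<delta> * sqrt (ln (ln T)))}) \<longlongrightarrow> 0) at_top"
    (is "((\<lambda>T. measure (unif T (2*T)) (?S T)) \<longlongrightarrow> 0) at_top")
proof -
  obtain C where C: "C \<ge> 0" and recip: "\<forall>\<^sub>F T in at_top. prime_recip_sum (prime_cutoff T) \<le> ln (ln T) + C"
    using eventually_prime_recip_sum_le by blast
  obtain K where K: "\<forall>\<^sub>F T in at_top. \<forall>t. norm (prime_poly_at T t) \<le> ln (ln T) \<longrightarrow>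
      mollifier_at T t \<noteq> 0 \<and>
      \<bar>ln (norm (mollifier_at T t)) + Re (prime_poly_at T t) + Re (prime_square_poly (prime_cutoff T) t) / 2\<bar> \<le> K"
    using ln_mollifier_approx by blast
  have "\<forall>\<^sub>F T::real in at_top. ln (ln T) > 0" by real_asymp
  \<comment> \<open>Half of the tolerance pays for the constant K; the other half pays for the prime
    squares, which enter with the factor 1/2.\<close>
  moreover have "\<forall>\<^sub>F T::real in at_top. K \<le> \<delta> * sqrt (ln (ln T)) / 2" using d by real_asymp
  moreover note recip K eventually_sieve_level_pos eventually_gt_at_top[of 1]
  ultimately have bound: "\<forall>\<^sub>F T in at_top. measure (unif T (2*T)) (?S T) \<le>
      (ln (ln T) + C + 2) / (ln (ln T))\<^sup>2 + 3 / (\<delta> * sqrt (ln (ln T)))\<^sup>2"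
  proof eventually_elim
    case (elim T)
    have T: "T < 2 * T" and X: "prime_cutoff T \<ge> 1" using elim prime_cutoff_ge_1[of T] by auto
    have err: "2 * prime_cutoff T ^ 3 / (2 * T - T) \<le> 2"
      using prime_cutoff_cube_le[of T] elim by (simp add: field_simps)
    interpret prob_space "unif T (2*T)" by (rule prob_space_unif[OF T])
    let ?A = "{t. norm (prime_poly_at T t) \<ge> ln (ln T)}"
    let ?B = "{t. norm (prime_square_poly (prime_cutoff T) t) \<ge> \<delta> * sqrt (ln (ln T))}"
    have "?S T \<subseteq> ?A \<union> ?B"
    proof
      fix t assume t: "t \<in> ?S T"
      show "t \<in> ?A \<union> ?B"
      proof (rule ccontr)
        assume "t \<notin> ?A \<union> ?B"
        then have n: "norm (prime_poly_at T t) \<le> ln (ln T)" "norm (prime_square_poly (prime_cutoff T) t) \<le> \<delta> * sqrt (ln (ln T))" by auto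
        have "\<bar>Re (prime_square_poly (prime_cutoff T) t)\<bar> \<le> \<delta> * sqrt (ln (ln T))"
          using abs_Re_le_cmod n(2) order.trans by blast
        moreover have "mollifier_at T t \<noteq> 0 \<and> \<bar>ln (norm (mollifier_at T t)) + Re (prime_poly_at T t) + Re (prime_square_poly (prime_cutoff T) t) / 2\<bar> \<le> K"
          using elim(4) n(1) by blast
        ultimately show False using t elim(2) by (auto simp: abs_le_iff)
      qed
    qed
    moreover have sets: "?A \<in> events" "?B \<in> events" unfolding sets_unif by measurable
    ultimately have "measure (unif T (2*T)) (?S T) \<le> measure (unif T (2*T)) (?A \<union> ?B)" by (intro finite_measure_mono) auto
    also have "\<dots> \<le> measure (unif T (2*T)) ?A + measure (unif T (2*T)) ?B" using sets by (intro measure_Un_le)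
    also have "measure (unif T (2*T)) ?A \<le> (ln (ln T) + C + 2) / (ln (ln T))\<^sup>2"
      by (rule chebyshev_unif[OF T _ norm_prime_poly_le(1)])
         (use elim err in \<open>auto intro!: order.trans[OF prime_poly_mean_square[OF T X]]\<close>)
    also have "measure (unif T (2*T)) ?B \<le> 3 / (\<delta> * sqrt (ln (ln T)))\<^sup>2"
      by (rule chebyshev_unif[OF T _ norm_prime_poly_le(2)])
         (use elim err d in \<open>auto intro!: order.trans[OF prime_square_poly_mean_square[OF T X, folded prime_square_poly_def]]\<close>)
    finally show ?case by simp
  qed
  show ?thesis
  proof (rule tendsto_sandwich[OF _ bound tendsto_const])
    have "((\<lambda>L. (L + C + 2) / L\<^sup>2 + 3 / (\<delta> * sqrt L)\<^sup>2) \<longlongrightarrow> 0) at_top" using d by real_asymp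
    from filterlim_compose[OF this lnln_at_top]
    show "((\<lambda>T. (ln (ln T) + C + 2) / (ln (ln T))\<^sup>2 + 3 / (\<delta> * sqrt (ln (ln T)))\<^sup>2) \<longlongrightarrow> 0) at_top" .
  qed simp
qed

section \<open>The prime polynomial is asymptotically Gaussian\<close>

lemma cis_sum: "cis (sum f A) = (\<Prod>x\<in>A. cis (f x))"
  by (induction A rule: infinite_finite_induct) (auto simp: cis_mult[symmetric])

text \<open>The form is ln A - ln B, where A and B collect the primes with positive and with
  negative coefficients. Unique factorisation gives A \<noteq> B, and both are integers at most X^k,
  so \<open>ln_diff_ge_inverse\<close> applies.\<close>

lemma log_linear_form_ge:
  fixes m :: "nat \<Rightarrow> int"
  assumes P: "finite P" "\<And>p. p \<in> P \<Longrightarrow> prime p" "\<And>p. p \<in> P \<Longrightarrow> real p \<le> X" and X: "X \<ge> 1"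
    and m: "(\<Sum>p\<in>P. \<bar>m p\<bar>) \<le> int k" and nz: "q \<in> P" "m q \<noteq> 0"
  shows "1 / X ^ k \<le> \<bar>\<Sum>p\<in>P. of_int (m p) * ln (real p)\<bar>"
proof -
  define A where "A = (\<Prod>p\<in>P. p ^ nat (m p))"
  define B where "B = (\<Prod>p\<in>P. p ^ nat (- m p))"
  have p0: "p > 0" if "p \<in> P" for p using P(2)[OF that] prime_gt_0_nat by blast
  have pos: "A > 0" "B > 0" using p0 P(1) by (auto simp: A_def B_def intro!: prod_pos)
  have le: "real (\<Prod>p\<in>P. p ^ nat (s * m p)) \<le> X ^ k" if "\<bar>s\<bar> = 1" for s
  proof -
    have "real (\<Prod>p\<in>P. p ^ nat (s * m p)) \<le> (\<Prod>p\<in>P. X ^ nat (s * m p))"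
      unfolding of_nat_prod of_nat_power using P(3) by (intro prod_mono conjI power_mono) auto
    also have "\<dots> = X ^ (\<Sum>p\<in>P. nat (s * m p))" by (simp add: power_sum)
    also have "\<dots> \<le> X ^ k"
    proof (rule power_increasing[OF _ X])
      have "(\<Sum>p\<in>P. nat (s * m p)) \<le> (\<Sum>p\<in>P. nat \<bar>m p\<bar>)"
        using that by (intro sum_mono nat_mono) (auto simp: abs_if split: if_splits)
      moreover have "int (\<Sum>p\<in>P. nat \<bar>m p\<bar>) \<le> int k" using m by simp
      ultimately show "(\<Sum>p\<in>P. nat (s * m p)) \<le> k" by linarith
    qed
    finally show ?thesis .
  qed
  have "A \<noteq> B"
  proof
    assume "A = B"
    then have "multiplicity q A = multiplicity q B" by simp
    \<comment> \<open>One of the two sides is always 0, so equality forces m q = 0.\<close>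
    then have "nat (m q) = nat (- m q)"
      unfolding A_def B_def using P nz by (simp add: multiplicity_prod_prime_powers)
    then show False using nz by linarith
  qed
  then have "1 / X ^ k \<le> \<bar>ln (real A) - ln (real B)\<bar>"
    using pos le[of 1] le[of "-1"] by (intro ln_diff_ge_inverse) (auto simp: A_def B_def)
  also have "ln (real A) - ln (real B) = (\<Sum>p\<in>P. of_int (m p) * ln (real p))"
  proof -
    have ln: "ln (real (\<Prod>p\<in>P. p ^ f p)) = (\<Sum>p\<in>P. real (f p) * ln (real p))" for f :: "nat \<Rightarrow> nat"
      unfolding of_nat_prod using P(1) p0 by (subst ln_prod) (auto simp: ln_realpow)
    have "ln (real A) - ln (real B) = (\<Sum>p\<in>P. (real (nat (m p)) - real (nat (- m p))) * ln (real p))"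
      unfolding A_def B_def ln by (simp add: sum_subtractf left_diff_distrib)
    also have "\<dots> = (\<Sum>p\<in>P. of_int (m p) * ln (real p))"
      by (intro sum.cong refl arg_cong2[of _ _ _ _ times]) auto
    finally show ?thesis .
  qed
  finally show ?thesis .
qed

text \<open>The model for the angles t ln p modulo 2 \<pi>: independent uniform phases, one for each
  prime.\<close>

definition torus :: "nat set \<Rightarrow> (nat \<Rightarrow> real) measure" where
  "torus P = PiM P (\<lambda>_. unif 0 (2 * pi))"

lemma prob_space_torus: "prob_space (torus P)"
  unfolding torus_def by (intro prob_space_PiM prob_space_unif) simp

lemma torus_component_measurable: "p \<in> P \<Longrightarrow> (\<lambda>\<theta>. \<theta> p) \<in> borel_measurable (torus P)"
  unfolding torus_def using measurable_component_singleton[of p P "\<lambda>_. unif 0 (2 * pi)"]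
  by (simp add: measurable_cong_sets[OF refl sets_unif])

lemma integrable_torus:
  fixes f :: "(nat \<Rightarrow> real) \<Rightarrow> 'b::{banach, second_countable_topology}"
  assumes "f \<in> borel_measurable (torus P)" "\<And>\<theta>. norm (f \<theta>) \<le> B"
  shows "integrable (torus P) f"
proof -
  interpret prob_space "torus P" by (rule prob_space_torus)
  show ?thesis by (rule integrable_const_bound[where B = B]) (use assms in auto)
qed

lemma integral_torus_prod:
  fixes f :: "nat \<Rightarrow> real \<Rightarrow> 'b::{real_normed_field, banach, second_countable_topology}"
  assumes "finite P" "\<And>p. p \<in> P \<Longrightarrow> integrable (unif 0 (2 * pi)) (f p)"
  shows "(LINT \<theta>|torus P. (\<Prod>p\<in>P. f p (\<theta> p))) = (\<Prod>p\<in>P. LINT x|unif 0 (2 * pi). f p x)"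
proof -
  interpret product_sigma_finite "\<lambda>_::nat. unif 0 (2 * pi)"
    unfolding product_sigma_finite_def by (intro allI prob_space_imp_sigma_finite prob_space_unif) simp
  show ?thesis unfolding torus_def by (rule product_integral_prod[OF assms])
qed

lemma integral_circle_cis: "(LINT x|unif 0 (2 * pi). cis (of_int m * x)) = (if m = 0 then 1 else 0)"
proof (cases "m = 0")
  case True
  interpret prob_space "unif 0 (2 * pi)" by (rule prob_space_unif) simp
  show ?thesis using True prob_space by simp
next
  case False
  have "cis (of_int m * (2 * pi)) = 1" using cis_multiple_2pi[of "of_int m"] by (simp add: mult.commute)
  then show ?thesis using False by (subst integral_unif_cis) auto
qed

text \<open>Each cosine is split into two exponentials: f chooses a prime and a sign for each of the
  k factors, and the inner sum is the net frequency at p.\<close>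

lemma cosine_sum_power:
  fixes c \<phi> :: "nat \<Rightarrow> real" and k :: nat
  assumes P: "finite P"
  defines "J \<equiv> PiE {..<k} (\<lambda>_. P \<times> {1, -1::int})"
  shows "of_real ((\<Sum>p\<in>P. c p * cos (\<phi> p)) ^ k) =
     (\<Sum>f\<in>J. of_real (\<Prod>i<k. c (fst (f i)) / 2) * cis (\<Sum>p\<in>P. of_int (\<Sum>i\<in>{i. i < k \<and> fst (f i) = p}. snd (f i)) * \<phi> p))"
proof -
  define w where "w j = of_real (c (fst j) / 2) * cis (of_int (snd j) * \<phi> (fst j))" for j :: "nat \<times> int"
  have w: "(\<Sum>j\<in>P \<times> {1, -1}. w j) = of_real (\<Sum>p\<in>P. c p * cos (\<phi> p))"
  proof -
    have "(\<Sum>j\<in>P \<times> {1, -1}. w j) = (\<Sum>p\<in>P. \<Sum>s\<in>{1, -1}. w (p, s))"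
      using sum.cartesian_product[of "\<lambda>p s. w (p, s)" "{1, -1}" P] by simp
    also have "\<dots> = (\<Sum>p\<in>P. of_real (c p * cos (\<phi> p)))"
      by (intro sum.cong refl) (simp add: w_def complex_eq_iff)
    finally show ?thesis by simp
  qed
  have "of_real ((\<Sum>p\<in>P. c p * cos (\<phi> p)) ^ k) = (\<Prod>i<k. \<Sum>j\<in>P \<times> {1, -1}. w j)"
    unfolding w by simp
  also have "\<dots> = (\<Sum>f\<in>J. \<Prod>i<k. w (f i))"
    unfolding J_def using P by (intro prod_sum_PiE) auto
  also have "\<dots> = (\<Sum>f\<in>J. of_real (\<Prod>i<k. c (fst (f i)) / 2) * cis (\<Sum>p\<in>P. of_int (\<Sum>i\<in>{i. i < k \<and> fst (f i) = p}. snd (f i)) * \<phi> p))"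
  proof (intro sum.cong refl)
    fix f assume f: "f \<in> J"
    have "(\<Sum>i<k. of_int (snd (f i)) * \<phi> (fst (f i))) =
        (\<Sum>p\<in>P. \<Sum>i\<in>{i\<in>{..<k}. fst (f i) = p}. of_int (snd (f i)) * \<phi> (fst (f i)))"
      using f P by (intro sum.group[symmetric]) (auto simp: J_def PiE_def Pi_def)
    also have "\<dots> = (\<Sum>p\<in>P. of_int (\<Sum>i\<in>{i. i < k \<and> fst (f i) = p}. snd (f i)) * \<phi> p)"
      by (intro sum.cong refl) (simp add: sum_distrib_right)
    finally have "(\<Prod>i<k. cis (of_int (snd (f i)) * \<phi> (fst (f i)))) =
        cis (\<Sum>p\<in>P. of_int (\<Sum>i\<in>{i. i < k \<and> fst (f i) = p}. snd (f i)) * \<phi> p)"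
      by (simp flip: cis_sum)
    then show "(\<Prod>i<k. w (f i)) = of_real (\<Prod>i<k. c (fst (f i)) / 2) * cis (\<Sum>p\<in>P. of_int (\<Sum>i\<in>{i. i < k \<and> fst (f i) = p}. snd (f i)) * \<phi> p)"
      unfolding w_def prod.distrib by simp
  qed
  finally show ?thesis .
qed

text \<open>Term by term in \<open>cosine_sum_power\<close>. If all net frequencies vanish, both
  averages equal 1. Otherwise the torus average is exactly 0, and the average over t is at most 2
  X^k / (b - a), since the frequency is at least X^-k by \<open>log_linear_form_ge\<close>.\<close>

lemma moment_comparison:
  assumes ab: "a < b" and P: "finite P" "\<And>p. p \<in> P \<Longrightarrow> prime p" "\<And>p. p \<in> P \<Longrightarrow> real p \<le> X" and X: "X \<ge> 1"
  shows "\<bar>(LINT t|unif a b. (\<Sum>p\<in>P. c p * cos (ln (real p) * t)) ^ k) - (LINT \<theta>|torus P. (\<Sum>p\<in>P. c p * cos (\<theta> p)) ^ k)\<bar>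
     \<le> (\<Sum>p\<in>P. \<bar>c p\<bar>) ^ k * (2 * X ^ k / (b - a))"
proof -
  define J where "J = PiE {..<k} (\<lambda>_. P \<times> {1, -1::int})"
  define g where "g f = (\<Prod>i<k. c (fst (f i)) / 2)" for f :: "nat \<Rightarrow> nat \<times> int"
  define m where "m f p = (\<Sum>i\<in>{i. i < k \<and> fst (f i) = p}. snd (f i))" for f :: "nat \<Rightarrow> nat \<times> int" and p
  define \<Lambda> where "\<Lambda> f = (\<Sum>p\<in>P. of_int (m f p) * ln (real p))" for f
  note expand = cosine_sum_power[OF P(1), of c _ k, folded m_def g_def J_def]
  have "finite J" unfolding J_def using P(1) by (intro finite_PiE) auto
  have intC: "integrable (unif a b) (\<lambda>t. cis (x * t))" for x
    by (rule integrable_unif[OF ab, of _ 1]) (auto intro!: cis_measurable)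
  have intT: "integrable (torus P) (\<lambda>\<theta>. cis (\<Sum>p\<in>P. of_int (m f p) * \<theta> p))" for f
    by (rule integrable_torus[of _ _ 1]) (auto intro!: cis_measurable borel_measurable_sum borel_measurable_times torus_component_measurable)
  have "of_real (LINT t|unif a b. (\<Sum>p\<in>P. c p * cos (ln (real p) * t)) ^ k) =
      (LINT t|unif a b. (\<Sum>f\<in>J. of_real (g f) * cis (\<Lambda> f * t)))"
    unfolding integral_complex_of_real[symmetric] expand \<Lambda>_def by (simp add: sum_distrib_right mult.assoc)
  also have "\<dots> = (\<Sum>f\<in>J. of_real (g f) * (LINT t|unif a b. cis (\<Lambda> f * t)))"
    using intC by simp
  finally have 1: "of_real (LINT t|unif a b. (\<Sum>p\<in>P. c p * cos (ln (real p) * t)) ^ k) =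
      (\<Sum>f\<in>J. of_real (g f) * (LINT t|unif a b. cis (\<Lambda> f * t)))" .
  have "of_real (LINT \<theta>|torus P. (\<Sum>p\<in>P. c p * cos (\<theta> p)) ^ k) =
      (LINT \<theta>|torus P. (\<Sum>f\<in>J. of_real (g f) * cis (\<Sum>p\<in>P. of_int (m f p) * \<theta> p)))"
    unfolding integral_complex_of_real[symmetric] expand ..
  also have "\<dots> = (\<Sum>f\<in>J. of_real (g f) * (LINT \<theta>|torus P. cis (\<Sum>p\<in>P. of_int (m f p) * \<theta> p)))"
    using intT by simp
  finally have 2: "of_real (LINT \<theta>|torus P. (\<Sum>p\<in>P. c p * cos (\<theta> p)) ^ k) =
      (\<Sum>f\<in>J. of_real (g f) * (LINT \<theta>|torus P. cis (\<Sum>p\<in>P. of_int (m f p) * \<theta> p)))" .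
  have diff: "norm ((LINT t|unif a b. cis (\<Lambda> f * t)) - (LINT \<theta>|torus P. cis (\<Sum>p\<in>P. of_int (m f p) * \<theta> p))) \<le> 2 * X ^ k / (b - a)"
    if f: "f \<in> J" for f
  proof -
    have torus: "(LINT \<theta>|torus P. cis (\<Sum>p\<in>P. of_int (m f p) * \<theta> p)) = (\<Prod>p\<in>P. if m f p = 0 then 1 else 0)"
    proof -
      have "(LINT \<theta>|torus P. (\<Prod>p\<in>P. cis (of_int (m f p) * \<theta> p))) = (\<Prod>p\<in>P. LINT x|unif 0 (2 * pi). cis (of_int (m f p) * x))"
        by (rule integral_torus_prod[OF P(1)]) (auto intro!: integrable_unif[of _ _ _ 1] cis_measurable)
      then show ?thesis by (simp add: cis_sum integral_circle_cis)
    qed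
    show ?thesis
    proof (cases "\<exists>q\<in>P. m f q \<noteq> 0")
      case False
      interpret prob_space "unif a b" by (rule prob_space_unif[OF ab])
      have "\<Lambda> f = 0" using False by (simp add: \<Lambda>_def)
      then show ?thesis unfolding torus using False X ab prob_space by simp
    next
      case True
      then obtain q where q: "q \<in> P" "m f q \<noteq> 0" by blast
      have "(\<Sum>p\<in>P. \<bar>m f p\<bar>) \<le> (\<Sum>p\<in>P. \<Sum>i\<in>{i\<in>{..<k}. fst (f i) = p}. \<bar>snd (f i)\<bar>)"
        unfolding m_def by (intro sum_mono) (use sum_abs in auto)
      also have "\<dots> = (\<Sum>i<k. \<bar>snd (f i)\<bar>)"
        using f P(1) by (intro sum.group) (auto simp: J_def PiE_def Pi_def)
      also have "\<dots> = (\<Sum>i<k. 1)" using f by (intro sum.cong refl) (auto simp: J_def PiE_def Pi_def)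
      finally have mk: "(\<Sum>p\<in>P. \<bar>m f p\<bar>) \<le> int k" by simp
      have L: "1 / X ^ k \<le> \<bar>\<Lambda> f\<bar>" unfolding \<Lambda>_def by (rule log_linear_form_ge[OF P X mk q])
      have X0: "X ^ k > 0" using X by simp
      have "\<Lambda> f \<noteq> 0" using L X0 by (auto simp: divide_le_0_iff)
      then have "norm (LINT t|unif a b. cis (\<Lambda> f * t)) \<le> 2 / (\<bar>\<Lambda> f\<bar> * (b - a))"
        by (rule norm_integral_unif_cis_le[OF ab])
      also have "\<dots> \<le> 2 / (1 / X ^ k * (b - a))"
        using L X0 ab by (intro divide_left_mono mult_right_mono mult_pos_pos) (auto intro: less_le_trans)
      moreover have "(\<Prod>p\<in>P. if m f p = 0 then 1 else 0) = (0::complex)" using q P(1) by (intro prod_zero) auto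
      ultimately show ?thesis unfolding torus by simp
    qed
  qed
  have "of_real \<bar>(LINT t|unif a b. (\<Sum>p\<in>P. c p * cos (ln (real p) * t)) ^ k) - (LINT \<theta>|torus P. (\<Sum>p\<in>P. c p * cos (\<theta> p)) ^ k)\<bar> =
      norm (of_real (LINT t|unif a b. (\<Sum>p\<in>P. c p * cos (ln (real p) * t)) ^ k) - complex_of_real (LINT \<theta>|torus P. (\<Sum>p\<in>P. c p * cos (\<theta> p)) ^ k))"
    by (simp flip: of_real_diff)
  also have "\<dots> = norm (\<Sum>f\<in>J. of_real (g f) * ((LINT t|unif a b. cis (\<Lambda> f * t)) - (LINT \<theta>|torus P. cis (\<Sum>p\<in>P. of_int (m f p) * \<theta> p))))"
    unfolding 1 2 by (simp add: right_diff_distrib sum_subtractf)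
  also have "\<dots> \<le> (\<Sum>f\<in>J. \<bar>g f\<bar> * (2 * X ^ k / (b - a)))"
    by (intro sum_norm_le, unfold norm_mult norm_of_real, intro mult_left_mono diff) simp_all
  also have "\<dots> = (\<Sum>f\<in>J. \<Prod>i<k. \<bar>c (fst (f i))\<bar> / 2) * (2 * X ^ k / (b - a))"
    unfolding sum_distrib_right g_def abs_prod by simp
  also have "(\<Sum>f\<in>J. \<Prod>i<k. \<bar>c (fst (f i))\<bar> / 2) = (\<Prod>i<k. \<Sum>j\<in>P \<times> {1, -1::int}. \<bar>c (fst j)\<bar> / 2)"
    unfolding J_def using P(1) by (intro prod_sum_PiE[symmetric]) auto
  also have "(\<Sum>j\<in>P \<times> {1, -1::int}. \<bar>c (fst j)\<bar> / 2) = (\<Sum>p\<in>P. \<bar>c p\<bar>)"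
    by (simp add: sum.cartesian_product[of "\<lambda>p s. \<bar>c p\<bar> / 2" "{1, -1::int}" P, unfolded case_prod_unfold, symmetric])
  finally show ?thesis by simp
qed

section \<open>Moment bounds on the torus\<close>

lemma power_even_le_exp:
  fixes x :: real
  shows "x ^ (2 * n) / fact (2 * n) \<le> exp x + exp (- x)"
proof -
  have *: "y ^ m / fact m \<le> exp y" if "y \<ge> 0" for y :: real and m
  proof -
    obtain t where "exp y = (\<Sum>i<Suc m. y ^ i / fact i) + exp t / fact (Suc m) * y ^ Suc m"
      using Maclaurin_exp_le[of y "Suc m"] by blast
    moreover have "exp t / fact (Suc m) * y ^ Suc m \<ge> 0" using that by (intro mult_nonneg_nonneg) auto
    moreover have "(\<Sum>i<m. y ^ i / fact i) \<ge> 0" using that by (intro sum_nonneg) auto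
    ultimately show ?thesis by simp
  qed
  have "x ^ (2 * n) / fact (2 * n) = \<bar>x\<bar> ^ (2 * n) / fact (2 * n)" by (simp add: power_mult)
  also have "\<dots> \<le> exp \<bar>x\<bar>" by (rule *) simp
  also have "\<dots> \<le> exp x + exp (- x)" by (simp add: abs_if)
  finally show ?thesis .
qed

lemma integrable_circle:
  fixes f :: "real \<Rightarrow> 'b::{banach, second_countable_topology}"
  assumes "f \<in> borel_measurable borel" "\<And>t. norm (f t) \<le> B"
  shows "integrable (unif 0 (2 * pi)) f"
  by (rule integrable_unif[OF _ assms]) simp

lemma integral_circle_cos: "(LINT x|unif 0 (2 * pi). cos x) = 0"
  and integral_circle_cos_square: "(LINT x|unif 0 (2 * pi). (cos x)\<^sup>2) = 1/2"
proof -
  interpret prob_space "unif 0 (2 * pi)" by (rule prob_space_unif) simp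
  have int: "integrable (unif 0 (2 * pi)) (\<lambda>x. cis (of_int m * x))" for m
    by (rule integrable_circle[of _ 1]) (auto intro!: cis_measurable)
  have Re: "(LINT x|unif 0 (2 * pi). cos (of_int m * x)) = (if m = 0 then 1 else 0)" for m
    using arg_cong[OF integral_circle_cis[of m], of Re] unfolding integral_Re[OF int, symmetric] by simp
  show "(LINT x|unif 0 (2 * pi). cos x) = 0" using Re[of 1] by simp
  have "(\<lambda>x::real. (cos x)\<^sup>2) = (\<lambda>x. 1/2 + cos (of_int 2 * x) / 2)"
    by (simp add: cos_double_cos fun_eq_iff diff_divide_distrib)
  moreover have "integrable (unif 0 (2 * pi)) (\<lambda>x. cos (2 * x))"
    by (rule integrable_circle[of _ 1]) auto
  ultimately show "(LINT x|unif 0 (2 * pi). (cos x)\<^sup>2) = 1/2"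
    using Re[of 2] prob_space by simp
qed

lemma exp_mult_cos_le: "exp (l * cos x) \<le> exp \<bar>l::real\<bar>"
proof -
  have "l * cos x \<le> \<bar>l\<bar> * \<bar>cos x\<bar>" using abs_ge_self[of "l * cos x"] by (simp add: abs_mult)
  also have "\<dots> \<le> \<bar>l\<bar>" by (rule mult_left_le) auto
  finally show ?thesis by simp
qed

text \<open>Hoeffding's lemma for a mean-zero variable in an interval of length 2, with exponent 2^2
  l^2 / 8. The sign of l is moved into the variable so that the parameter |l| is positive.\<close>

lemma integral_circle_exp_cos: "(LINT x|unif 0 (2 * pi). exp (l * cos x)) \<le> exp (l\<^sup>2 / 2)"
proof (cases "l = 0")
  case True
  interpret prob_space "unif 0 (2 * pi)" by (rule prob_space_unif) simp
  show ?thesis using True prob_space by simp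
next
  case False
  interpret prob_space "unif 0 (2 * pi)" by (rule prob_space_unif) simp
  interpret interval_bounded_random_variable "unif 0 (2 * pi)" "\<lambda>x. sgn l * cos x" "-1" 1
  proof unfold_locales
    show "random_variable borel (\<lambda>x. sgn l * cos x)" by measurable
    have "sgn l * cos x \<in> {-1..1}" for x
      using cos_le_one[of x] cos_ge_minus_one[of x] by (cases "l > 0") (auto simp: sgn_if)
    then show "AE x in unif 0 (2 * pi). sgn l * cos x \<in> {-1..1}" by simp
  qed
  have int: "integrable (unif 0 (2 * pi)) (\<lambda>x. exp (l * cos x))"
    by (rule integrable_circle[of _ "exp \<bar>l\<bar>"]) (use exp_mult_cos_le in auto)
  have "ennreal (LINT x|unif 0 (2 * pi). exp (l * cos x)) = (\<integral>\<^sup>+x. ennreal (exp (l * cos x)) \<partial>unif 0 (2 * pi))"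
    using int by (intro nn_integral_eq_integral[symmetric]) auto
  also have "\<dots> = (\<integral>\<^sup>+x. ennreal (exp (\<bar>l\<bar> * (sgn l * cos x))) \<partial>unif 0 (2 * pi))"
    by (simp add: abs_mult_sgn flip: mult.assoc)
  also have "\<dots> \<le> ennreal (exp (\<bar>l\<bar>\<^sup>2 * (1 - (-1))\<^sup>2 / 8))"
    by (rule Hoeffdings_lemma_nn_integral_0) (use False integral_circle_cos in auto)
  finally show ?thesis by simp
qed

definition cosine_sum :: "nat set \<Rightarrow> (nat \<Rightarrow> real) \<Rightarrow> (nat \<Rightarrow> real) \<Rightarrow> real" where
  "cosine_sum P c \<phi> = (\<Sum>p\<in>P. c p * cos (\<phi> p))"

lemma abs_cosine_sum_le: "\<bar>cosine_sum P c \<phi>\<bar> \<le> (\<Sum>p\<in>P. \<bar>c p\<bar>)"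
  unfolding cosine_sum_def by (intro order.trans[OF sum_abs] sum_mono) (simp add: abs_mult mult_left_le)

lemma cosine_sum_measurable [measurable]:
  "cosine_sum P c \<in> borel_measurable (torus P)"
  "(\<lambda>t. cosine_sum P c (\<lambda>p. ln (real p) * t)) \<in> borel_measurable borel"
proof -
  have cos: "cos \<in> borel_measurable (borel :: real measure)"
    by (intro borel_measurable_continuous_onI continuous_intros)
  show "cosine_sum P c \<in> borel_measurable (torus P)" unfolding cosine_sum_def[abs_def]
    by (intro borel_measurable_sum borel_measurable_times borel_measurable_const measurable_compose[OF torus_component_measurable cos])
  show "(\<lambda>t. cosine_sum P c (\<lambda>p. ln (real p) * t)) \<in> borel_measurable borel"
    unfolding cosine_sum_def[abs_def] by (intro borel_measurable_continuous_onI continuous_intros)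
qed

lemma torus_exp_moment:
  assumes P: "finite P"
  shows "(LINT \<theta>|torus P. exp (l * cosine_sum P c \<theta>)) \<le> exp (l\<^sup>2 / 2 * (\<Sum>p\<in>P. (c p)\<^sup>2))"
proof -
  have "(LINT \<theta>|torus P. exp (l * cosine_sum P c \<theta>)) = (LINT \<theta>|torus P. (\<Prod>p\<in>P. exp (l * c p * cos (\<theta> p))))"
    using P by (simp add: cosine_sum_def sum_distrib_left exp_sum mult.assoc)
  also have "\<dots> = (\<Prod>p\<in>P. LINT x|unif 0 (2 * pi). exp (l * c p * cos x))"
    using exp_mult_cos_le[of "l * c _"]
    by (intro integral_torus_prod[OF P] integrable_circle[of _ "exp \<bar>l * c _\<bar>"]) auto
  also have "\<dots> \<le> (\<Prod>p\<in>P. exp ((l * c p)\<^sup>2 / 2))"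
    by (intro prod_mono conjI integral_circle_exp_cos integral_nonneg_AE) auto
  also have "\<dots> = exp (l\<^sup>2 / 2 * (\<Sum>p\<in>P. (c p)\<^sup>2))"
    using P by (simp add: exp_sum[symmetric] sum_distrib_left power_mult_distrib)
  finally show ?thesis .
qed

text \<open>One exponential moment controls all even ones through x^(2n) / (2n)! \<le> exp x +
  exp(-x). The parameter l is left free and becomes 2u in \<open>char_comparison\<close>.\<close>

lemma torus_even_moment:
  assumes P: "finite P"
  shows "l ^ (2 * n) / fact (2 * n) * (LINT \<theta>|torus P. cosine_sum P c \<theta> ^ (2 * n)) \<le> 2 * exp (l\<^sup>2 / 2 * (\<Sum>p\<in>P. (c p)\<^sup>2))"
proof -
  define B where "B = (\<Sum>p\<in>P. \<bar>c p\<bar>)"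
  have "(l * cosine_sum P c \<theta>) \<le> \<bar>l\<bar> * B" for l \<theta>
    using abs_ge_self[of "l * cosine_sum P c \<theta>"] mult_left_mono[OF abs_cosine_sum_le[of P c \<theta>] abs_ge_zero[of l]]
    by (simp add: abs_mult B_def)
  then have int: "integrable (torus P) (\<lambda>\<theta>. exp (l * cosine_sum P c \<theta>))" for l
    by (intro integrable_torus[of _ _ "exp (\<bar>l\<bar> * B)"]) auto
  have "l ^ (2 * n) / fact (2 * n) * (LINT \<theta>|torus P. cosine_sum P c \<theta> ^ (2 * n)) =
     (LINT \<theta>|torus P. (l * cosine_sum P c \<theta>) ^ (2 * n) / fact (2 * n))"
    by (simp add: power_mult_distrib)
  also have "\<dots> \<le> (LINT \<theta>|torus P. exp (l * cosine_sum P c \<theta>) + exp (- l * cosine_sum P c \<theta>))"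
  proof (rule integral_mono)
    show "integrable (torus P) (\<lambda>\<theta>. (l * cosine_sum P c \<theta>) ^ (2 * n) / fact (2 * n))"
    proof (rule integrable_torus)
      fix \<theta>
      have "\<bar>l * cosine_sum P c \<theta>\<bar> \<le> \<bar>l\<bar> * B" by (simp add: abs_mult B_def mult_left_mono abs_cosine_sum_le)
      then have "\<bar>l * cosine_sum P c \<theta>\<bar> ^ (2 * n) / fact (2 * n) \<le> (\<bar>l\<bar> * B) ^ (2 * n) / fact (2 * n)"
        by (intro divide_right_mono power_mono) auto
      then show "norm ((l * cosine_sum P c \<theta>) ^ (2 * n) / fact (2 * n)) \<le> (\<bar>l\<bar> * B) ^ (2 * n) / fact (2 * n)"
        by (simp only: real_norm_def abs_divide power_abs fact_ge_zero abs_of_nonneg)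
    qed measurable
    show "(l * cosine_sum P c \<theta>) ^ (2 * n) / fact (2 * n) \<le> exp (l * cosine_sum P c \<theta>) + exp (- l * cosine_sum P c \<theta>)" for \<theta>
      using power_even_le_exp[of "l * cosine_sum P c \<theta>" n] by simp
  qed (intro Bochner_Integration.integrable_add int)
  also have "\<dots> = (LINT \<theta>|torus P. exp (l * cosine_sum P c \<theta>)) + (LINT \<theta>|torus P. exp (- l * cosine_sum P c \<theta>))"
    by (intro Bochner_Integration.integral_add int)
  also have "\<dots> \<le> 2 * exp (l\<^sup>2 / 2 * (\<Sum>p\<in>P. (c p)\<^sup>2))"
    using torus_exp_moment[OF P, of l c] torus_exp_moment[OF P, of "-l" c] by simp
  finally show ?thesis .
qed

section \<open>Characteristic functions of cosine sums\<close>

text \<open>The degree is even, so the absolute moment in the remainder is an ordinary moment and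
  can itself be compared with the torus.\<close>

lemma char_taylor:
  assumes M: "prob_space M" and f: "f \<in> borel_measurable M" "\<And>x. \<bar>f x\<bar> \<le> B"
  shows "norm (char (distr M borel f) u - (\<Sum>k\<le>2*n. (\<i> * u) ^ k / fact k * (LINT x|M. f x ^ k))) \<le>
    2 * (u ^ (2*n) / fact (2*n) * (LINT x|M. f x ^ (2*n)))"
proof -
  interpret prob_space M by fact
  interpret D: real_distribution "distr M borel f" using f(1) by (rule real_distribution_distr)
  have int: "integrable M (\<lambda>x. f x ^ k)" for k
    by (rule integrable_const_bound[where B = "B ^ k"]) (use f in \<open>auto simp: power_abs intro!: power_mono\<close>)
  have "norm (char (distr M borel f) u - (\<Sum>k\<le>2*n. (\<i> * u) ^ k / fact k * D.expectation (\<lambda>x. x ^ k))) \<le>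
    2 * \<bar>u\<bar> ^ (2*n) / fact (2*n) * D.expectation (\<lambda>x. \<bar>x\<bar> ^ (2*n))"
    by (rule D.char_approx1) (use int f in \<open>simp add: integrable_distr_eq\<close>)
  also have "(\<lambda>k. D.expectation (\<lambda>x. x ^ k)) = (\<lambda>k. LINT x|M. f x ^ k)"
    using f by (simp add: integral_distr)
  also have "D.expectation (\<lambda>x. \<bar>x\<bar> ^ (2*n)) = (LINT x|M. f x ^ (2*n))"
    using f by (subst integral_distr) (auto simp: power_mult)
  finally show ?thesis by (simp add: power_mult)
qed

text \<open>Taylor polynomials of degree 2n are compared moment by moment, and the remainder for the
  average over t is reduced to the torus moment as well. The choice l = 2u in
  \<open>torus_even_moment\<close> yields the factor 4^-n. In X^(4n) one half of the exponent comes
  from the coefficients and one half from the smallest frequency, each with k \<le> 2n.\<close>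

lemma char_comparison:
  assumes ab: "a < b" and P: "finite P" "\<And>p. p \<in> P \<Longrightarrow> prime p" "\<And>p. p \<in> P \<Longrightarrow> real p \<le> X" and X: "X \<ge> 1"
    and c: "(\<Sum>p\<in>P. \<bar>c p\<bar>) \<le> X"
  shows "norm (char (distr (unif a b) borel (\<lambda>t. cosine_sum P c (\<lambda>p. ln (real p) * t))) u - char (distr (torus P) borel (cosine_sum P c)) u)
    \<le> 6 * exp \<bar>u\<bar> * X ^ (4 * n) / (b - a) + 8 * (1/4) ^ n * exp (2 * u\<^sup>2 * (\<Sum>p\<in>P. (c p)\<^sup>2))"
proof -
  define D where "D = 2 * X ^ (4 * n) / (b - a)"
  have D0: "D \<ge> 0" using X ab by (simp add: D_def)
  define E where "E k = (LINT \<theta>|torus P. cosine_sum P c \<theta> ^ k)" for k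
  define F where "F k = (LINT t|unif a b. cosine_sum P c (\<lambda>p. ln (real p) * t) ^ k)" for k
  have EF: "\<bar>F k - E k\<bar> \<le> D" if "k \<le> 2 * n" for k
  proof -
    have "\<bar>F k - E k\<bar> \<le> (\<Sum>p\<in>P. \<bar>c p\<bar>) ^ k * (2 * X ^ k / (b - a))"
      unfolding E_def F_def cosine_sum_def by (rule moment_comparison[OF ab P X])
    also have "\<dots> \<le> X ^ k * (2 * X ^ k / (b - a))"
      using c ab X by (intro mult_right_mono power_mono) (auto intro!: sum_nonneg)
    also have "\<dots> = 2 * X ^ (2 * k) / (b - a)" unfolding mult_2[of k] power_add by simp
    also have "\<dots> \<le> D" unfolding D_def using X ab that by (intro divide_right_mono mult_left_mono power_increasing) simp_all
    finally show ?thesis .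
  qed
  define R where "R = \<bar>u\<bar> ^ (2*n) / fact (2*n)"
  have R: "R = u ^ (2*n) / fact (2*n)" by (simp add: R_def power_mult)
  have exp_ge: "(\<Sum>k\<le>m. \<bar>u\<bar> ^ k / fact k) \<le> exp \<bar>u\<bar>" for m
  proof -
    obtain t where "exp \<bar>u\<bar> = (\<Sum>i<Suc m. \<bar>u\<bar> ^ i / fact i) + exp t / fact (Suc m) * \<bar>u\<bar> ^ Suc m"
      using Maclaurin_exp_le[of "\<bar>u\<bar>" "Suc m"] by blast
    moreover have "exp t / fact (Suc m) * \<bar>u\<bar> ^ Suc m \<ge> 0" by (intro mult_nonneg_nonneg) auto
    ultimately show ?thesis by (simp add: lessThan_Suc_atMost)
  qed
  have "R \<le> (\<Sum>k\<le>2*n. \<bar>u\<bar> ^ k / fact k)" unfolding R_def by (rule member_le_sum) auto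
  with exp_ge have RE: "R \<le> exp \<bar>u\<bar>" using order.trans by blast
  have R0: "R \<ge> 0" by (simp add: R_def)
  have RE2: "R * E (2*n) \<le> (1/4) ^ n * (2 * exp (2 * u\<^sup>2 * (\<Sum>p\<in>P. (c p)\<^sup>2)))"
  proof -
    have "(2 * u) ^ (2*n) / fact (2*n) * E (2*n) \<le> 2 * exp ((2*u)\<^sup>2 / 2 * (\<Sum>p\<in>P. (c p)\<^sup>2))"
      unfolding E_def by (rule torus_even_moment[OF P(1)])
    then have "4 ^ n * (R * E (2*n)) \<le> 2 * exp (2 * u\<^sup>2 * (\<Sum>p\<in>P. (c p)\<^sup>2))"
      by (simp add: R power_mult_distrib power_mult)
    then show ?thesis by (simp add: field_simps power_one_over)
  qed
  have "norm (char (distr (unif a b) borel (\<lambda>t. cosine_sum P c (\<lambda>p. ln (real p) * t))) u - (\<Sum>k\<le>2*n. (\<i> * u) ^ k / fact k * F k)) \<le> 2 * (R * F (2*n))"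
    unfolding F_def R by (rule char_taylor[OF prob_space_unif[OF ab] _ abs_cosine_sum_le])
      (use cosine_sum_measurable(2)[of P c] in \<open>simp add: measurable_cong_sets[OF sets_unif refl]\<close>)
  moreover have "norm (char (distr (torus P) borel (cosine_sum P c)) u - (\<Sum>k\<le>2*n. (\<i> * u) ^ k / fact k * E k)) \<le> 2 * (R * E (2*n))"
    unfolding E_def R by (rule char_taylor[OF prob_space_torus _ abs_cosine_sum_le]) measurable
  moreover have "norm ((\<Sum>k\<le>2*n. (\<i> * u) ^ k / fact k * F k) - (\<Sum>k\<le>2*n. (\<i> * u) ^ k / fact k * complex_of_real (E k))) \<le> exp \<bar>u\<bar> * D"
  proof -
    have "(\<Sum>k\<le>2*n. (\<i> * u) ^ k / fact k * F k) - (\<Sum>k\<le>2*n. (\<i> * u) ^ k / fact k * complex_of_real (E k)) =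
       (\<Sum>k\<le>2*n. (\<i> * u) ^ k / fact k * of_real (F k - E k))" by (simp add: sum_subtractf right_diff_distrib)
    also have "norm \<dots> \<le> (\<Sum>k\<le>2*n. \<bar>u\<bar> ^ k / fact k * D)"
    proof (rule sum_norm_le)
      fix k assume "k \<in> {..2*n}"
      then have "\<bar>F k - E k\<bar> \<le> D" using EF by simp
      then have "\<bar>u\<bar> ^ k / fact k * \<bar>F k - E k\<bar> \<le> \<bar>u\<bar> ^ k / fact k * D" by (intro mult_left_mono) auto
      then show "norm ((\<i> * u) ^ k / fact k * of_real (F k - E k)) \<le> \<bar>u\<bar> ^ k / fact k * D"
        by (simp add: norm_mult norm_divide norm_power del: of_real_diff)
    qed
    also have "\<dots> = (\<Sum>k\<le>2*n. \<bar>u\<bar> ^ k / fact k) * D" by (simp add: sum_distrib_right)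
    also have "\<dots> \<le> exp \<bar>u\<bar> * D" using exp_ge D0 by (rule mult_right_mono)
    finally show ?thesis .
  qed
  moreover have "norm (z - w) \<le> norm (z - z') + norm (w - w') + norm (z' - w')" for z w z' w' :: complex
  proof -
    have "norm (z - w) = norm ((z - z') + (z' - w') - (w - w'))" by simp
    also have "\<dots> \<le> norm ((z - z') + (z' - w')) + norm (w - w')" by (rule norm_triangle_ineq4)
    also have "norm ((z - z') + (z' - w')) \<le> norm (z - z') + norm (z' - w')" by (rule norm_triangle_ineq)
    finally show ?thesis by simp
  qed
  ultimately have "norm (char (distr (unif a b) borel (\<lambda>t. cosine_sum P c (\<lambda>p. ln (real p) * t))) u - char (distr (torus P) borel (cosine_sum P c)) u)
     \<le> 2 * (R * F (2*n)) + 2 * (R * E (2*n)) + exp \<bar>u\<bar> * D"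
    by (meson add_mono order.trans)
  also have "R * F (2*n) \<le> R * E (2*n) + exp \<bar>u\<bar> * D"
  proof -
    have "R * F (2*n) \<le> R * (E (2*n) + D)" using EF[of "2*n"] R0 by (intro mult_left_mono) auto
    moreover have "R * D \<le> exp \<bar>u\<bar> * D" using RE D0 by (rule mult_right_mono)
    ultimately show ?thesis by (simp add: distrib_left)
  qed
  finally have "norm (char (distr (unif a b) borel (\<lambda>t. cosine_sum P c (\<lambda>p. ln (real p) * t))) u - char (distr (torus P) borel (cosine_sum P c)) u)
     \<le> 4 * (R * E (2*n)) + 3 * (exp \<bar>u\<bar> * D)" by (simp add: algebra_simps)
  also have "\<dots> \<le> 4 * ((1/4) ^ n * (2 * exp (2 * u\<^sup>2 * (\<Sum>p\<in>P. (c p)\<^sup>2)))) + 3 * (exp \<bar>u\<bar> * D)" using RE2 by simp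
  also have "\<dots> = 6 * exp \<bar>u\<bar> * X ^ (4 * n) / (b - a) + 8 * (1/4) ^ n * exp (2 * u\<^sup>2 * (\<Sum>p\<in>P. (c p)\<^sup>2))"
    by (simp add: D_def)
  finally show ?thesis .
qed

lemma exp_minus_approx:
  fixes x :: real
  assumes "x \<ge> 0" shows "\<bar>exp (- x) - (1 - x)\<bar> \<le> x\<^sup>2 / 2"
proof (cases "x = 0")
  case False
  then have x: "x > 0" using assms by simp
  have "\<exists>s. - x < s \<and> s < 0 \<and> exp (- x) = (\<Sum>m<2. exp 0 / fact m * (- x) ^ m) + exp s / fact 2 * (- x) ^ 2"
    using x by (intro Maclaurin_minus[where diff = "\<lambda>_. exp"]) auto
  then obtain s where s: "s < 0" "exp (- x) - (1 - x) = exp s * (x\<^sup>2 / 2)"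
    by (auto simp: numeral_2_eq_2)
  have "exp s * (x\<^sup>2 / 2) \<le> 1 * (x\<^sup>2 / 2)" using s(1) by (intro mult_right_mono) auto
  then show ?thesis unfolding s(2) by (simp add: abs_mult)
qed simp

text \<open>Mean 0 and variance 1/2 give 1 - u^2/4 up to |u|^3 / 6, and passing to exp(-u^2/4) costs
  u^4 / 32.\<close>

lemma char_cosine:
  assumes u: "\<bar>u\<bar> \<le> 1"
  shows "norm (char (distr (unif 0 (2 * pi)) borel cos) u - of_real (exp (- (u\<^sup>2 / 4)))) \<le> \<bar>u\<bar> ^ 3"
proof -
  interpret prob_space "unif 0 (2 * pi)" by (rule prob_space_unif) simp
  have "norm (char (distr (unif 0 (2 * pi)) borel cos) u - (1 - u^2 * (1/2) / 2)) \<le>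
      (u^2 / 6) * expectation (\<lambda>x. min (6 * (cos x)^2) (\<bar>u\<bar> * \<bar>cos x\<bar>^3))"
    by (rule char_approx3') (auto simp: integral_circle_cos integral_circle_cos_square power_le_one abs_square_le_1 intro!: integrable_circle[of _ 1])
  also have "\<dots> \<le> (u^2 / 6) * expectation (\<lambda>x. \<bar>u\<bar>)"
    by (intro mult_left_mono integral_mono integrable_circle[of _ "\<bar>u\<bar>"])
       (auto simp: min_le_iff_disj power_le_one mult_left_le)
  also have "expectation (\<lambda>x. \<bar>u\<bar>) = \<bar>u\<bar>" using prob_space by simp
  finally have 1: "norm (char (distr (unif 0 (2 * pi)) borel cos) u - (1 - u^2 / 4)) \<le> u\<^sup>2 / 6 * \<bar>u\<bar>" by simp
  have "norm (complex_of_real (1 - u\<^sup>2 / 4) - of_real (exp (- (u\<^sup>2 / 4)))) = \<bar>exp (- (u\<^sup>2 / 4)) - (1 - u\<^sup>2 / 4)\<bar>"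
    unfolding of_real_diff[symmetric] norm_of_real by (rule abs_minus_commute)
  also have "\<dots> \<le> (u\<^sup>2 / 4)\<^sup>2 / 2" by (rule exp_minus_approx) simp
  also have "\<dots> = \<bar>u\<bar> ^ 4 / 32" by (simp add: power_divide)
  also have "\<dots> \<le> \<bar>u\<bar> ^ 3 / 32" using u by (intro divide_right_mono power_decreasing) auto
  finally have 2: "norm (complex_of_real (1 - u\<^sup>2 / 4) - of_real (exp (- (u\<^sup>2 / 4)))) \<le> \<bar>u\<bar> ^ 3 / 32" .
  have "u\<^sup>2 / 6 * \<bar>u\<bar> = \<bar>u\<bar> ^ 3 / 6" by (simp add: power3_eq_cube power2_eq_square)
  moreover have "norm (char (distr (unif 0 (2 * pi)) borel cos) u - of_real (exp (- (u\<^sup>2 / 4)))) \<le> u\<^sup>2 / 6 * \<bar>u\<bar> + \<bar>u\<bar> ^ 3 / 32"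
    by (rule norm_diff_triangle_le[OF 1]) (use 2 in simp)
  moreover have "0 \<le> \<bar>u\<bar> ^ 3" by simp
  ultimately show ?thesis by linarith
qed

text \<open>Independence gives a product of factors, and products of numbers in the unit disc differ
  by at most the sum of the differences of their factors. For c(p) = p^(-1/2) the cubic sum stays
  bounded while u tends to 0, which is the central limit theorem for the model.\<close>

lemma char_cosine_sum:
  assumes P: "finite P" and u: "\<And>p. p \<in> P \<Longrightarrow> \<bar>u * c p\<bar> \<le> 1"
  shows "norm (char (distr (torus P) borel (cosine_sum P c)) u - of_real (exp (- (u\<^sup>2 / 4 * (\<Sum>p\<in>P. (c p)\<^sup>2)))))
    \<le> \<bar>u\<bar> ^ 3 * (\<Sum>p\<in>P. \<bar>c p\<bar> ^ 3)"
proof -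
  define J where "J x = char (distr (unif 0 (2 * pi)) borel cos) x" for x
  interpret C: prob_space "unif 0 (2 * pi)" by (rule prob_space_unif) simp
  interpret D: real_distribution "distr (unif 0 (2 * pi)) borel cos" by (rule C.real_distribution_distr) simp
  have J: "J x = (CLINT y|unif 0 (2 * pi). iexp (x * cos y))" for x
    unfolding J_def char_def by (subst integral_distr) auto
  have "char (distr (torus P) borel (cosine_sum P c)) u = (CLINT \<theta>|torus P. iexp (u * cosine_sum P c \<theta>))"
    unfolding char_def by (subst integral_distr) auto
  also have "\<dots> = (CLINT \<theta>|torus P. (\<Prod>p\<in>P. iexp (u * c p * cos (\<theta> p))))"
    using P by (simp add: cosine_sum_def sum_distrib_left exp_sum mult.assoc)
  also have "\<dots> = (\<Prod>p\<in>P. J (u * c p))"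
    unfolding J by (rule integral_torus_prod[OF P], rule integrable_circle[of _ 1]) auto
  finally have "char (distr (torus P) borel (cosine_sum P c)) u = (\<Prod>p\<in>P. J (u * c p))" .
  moreover have "complex_of_real (exp (- (u\<^sup>2 / 4 * (\<Sum>p\<in>P. (c p)\<^sup>2)))) = (\<Prod>p\<in>P. of_real (exp (- ((u * c p)\<^sup>2 / 4))))"
    using P by (simp add: exp_sum[symmetric] sum_distrib_left sum_negf power_mult_distrib flip: of_real_prod)
  moreover have "norm ((\<Prod>p\<in>P. J (u * c p)) - (\<Prod>p\<in>P. of_real (exp (- ((u * c p)\<^sup>2 / 4))))) \<le>
      (\<Sum>p\<in>P. norm (J (u * c p) - of_real (exp (- ((u * c p)\<^sup>2 / 4)))))"
    by (rule norm_prod_diff) (auto simp: J_def D.cmod_char_le_1 simp del: of_real_exp)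
  moreover have "\<dots> \<le> (\<Sum>p\<in>P. \<bar>u\<bar> ^ 3 * \<bar>c p\<bar> ^ 3)"
    unfolding J_def power_mult_distrib[symmetric] abs_mult[symmetric] by (intro sum_mono char_cosine u)
  ultimately show ?thesis by (simp add: sum_distrib_left)
qed

section \<open>The normalised prime polynomial\<close>

lemma Re_prime_poly:
  "Re (prime_poly X t) = cosine_sum (primes_upto X) (\<lambda>p. real p powr (-1/2)) (\<lambda>p. ln (real p) * t)"
  unfolding prime_poly_def cosine_sum_def Re_sum by simp

text \<open>By Mertens the sum is L - ln (100 N) + O(1), and N = O(L^2) makes the loss O(ln
  L).\<close>

lemma prime_recip_sum_ratio:
  "((\<lambda>T. prime_recip_sum (prime_cutoff T) / ln (ln T)) \<longlongrightarrow> 1) at_top"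
proof -
  obtain C where C: "C \<ge> 0" and ev: "\<forall>\<^sub>F T in at_top. \<bar>prime_recip_sum T - ln (ln T)\<bar> \<le> C \<and>
       \<bar>prime_recip_sum (prime_cutoff T) - (ln (ln T) - ln (100 * real (sieve_level T)))\<bar> \<le> C"
    using eventually_prime_recip_sum by blast
  have L: "\<forall>\<^sub>F T::real in at_top. ln (ln T) > 0" by real_asymp
  have "\<forall>\<^sub>F T in at_top. norm (prime_recip_sum (prime_cutoff T) / ln (ln T) - 1) \<le>
      (C + ln (100 * ((ln (ln T))\<^sup>2 + 1))) / ln (ln T)"
    using ev L eventually_sieve_level_pos
  proof eventually_elim
    case (elim T)
    define a where "a = ln (100 * real (sieve_level T))"
    have "a \<ge> 0" unfolding a_def using elim(3) by (intro ln_ge_zero) linarith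
    moreover have "a \<le> ln (100 * ((ln (ln T))\<^sup>2 + 1))"
      unfolding a_def using elim(3) sieve_level_le[of T] by (subst ln_le_cancel_iff) (auto intro: add_nonneg_pos)
    ultimately have "\<bar>prime_recip_sum (prime_cutoff T) - ln (ln T)\<bar> \<le> C + ln (100 * ((ln (ln T))\<^sup>2 + 1))"
      using elim(1) unfolding a_def by linarith
    moreover have "prime_recip_sum (prime_cutoff T) / ln (ln T) - 1 = (prime_recip_sum (prime_cutoff T) - ln (ln T)) / ln (ln T)"
      using elim(2) by (simp add: diff_divide_distrib)
    ultimately show ?case using elim(2) by (simp add: abs_divide divide_right_mono)
  qed
  moreover have "((\<lambda>T. (C + ln (100 * ((ln (ln T))\<^sup>2 + 1))) / ln (ln T)) \<longlongrightarrow> 0) at_top" by real_asymp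
  ultimately have "((\<lambda>T. prime_recip_sum (prime_cutoff T) / ln (ln T) - 1) \<longlongrightarrow> 0) at_top"
    by (rule Lim_null_comparison)
  then show ?thesis by (simp add: LIM_zero_iff)
qed

text \<open>In the model the variance of the real part is half the sum of 1/p, hence asymptotic to
  L/2.\<close>

definition normalized_prime_poly :: "real \<Rightarrow> real \<Rightarrow> real" where
  "normalized_prime_poly T t = Re (prime_poly_at T t) / sqrt (1/2 * ln (ln T))"

lemma normalized_prime_poly_measurable [measurable]: "normalized_prime_poly T \<in> borel_measurable borel"
  unfolding normalized_prime_poly_def by measurable

text \<open>\<open>char_comparison\<close> at u = l / sqrt(L/2) with n = N: then X^(4N) = T^(4/100)
  is negligible against T, and 4^-N multiplies a bounded exponential. The model is Gaussian with
  exponent u^2/4 times the sum of 1/p, which tends to l^2 / 2.\<close>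

theorem char_normalized_prime_poly:
  "((\<lambda>T. char (distr (unif T (2*T)) borel (normalized_prime_poly T)) l) \<longlongrightarrow> of_real (exp (- (l\<^sup>2) / 2))) at_top"
proof -
  define u where "u T = l / sqrt (1/2 * ln (ln T))" for T
  define \<sigma>2 where "\<sigma>2 T = prime_recip_sum (prime_cutoff T)" for T
  define c where "c = (\<lambda>p. real p powr (-1/2))"
  define K where "K = (\<Sum>n. real n powr (-3/2))"
  have K: "(\<Sum>p\<in>S. real p powr (-3/2)) \<le> K" if "finite S" for S :: "nat set"
    unfolding K_def using that by (intro sum_le_suminf) (auto simp: summable_real_powr_iff)
  define err where "err T = (6 * exp 1 * (T powr (1/100)) ^ 4 / T + 8 * ((1/4) powr ((ln (ln T))\<^sup>2) * exp (8 * l\<^sup>2))) + \<bar>u T\<bar> ^ 3 * K" for T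
  have L: "\<forall>\<^sub>F T::real in at_top. ln (ln T) > 0" by real_asymp
  have u0: "(u \<longlongrightarrow> 0) at_top" unfolding u_def by real_asymp
  have u1: "\<forall>\<^sub>F T in at_top. \<bar>u T\<bar> \<le> 1"
  proof -
    from u0 have "((\<lambda>T. \<bar>u T\<bar>) \<longlongrightarrow> 0) at_top" by (rule tendsto_rabs_zero)
    then have "\<forall>\<^sub>F T in at_top. \<bar>u T\<bar> < 1" by (rule order_tendstoD) simp
    then show ?thesis by eventually_elim simp
  qed
  have ratio: "\<forall>\<^sub>F T in at_top. \<sigma>2 T / ln (ln T) < 2"
    unfolding \<sigma>2_def by (rule order_tendstoD(2)[OF prime_recip_sum_ratio]) simp
  have "\<forall>\<^sub>F T in at_top. norm (char (distr (unif T (2*T)) borel (normalized_prime_poly T)) l - of_real (exp (- ((u T)\<^sup>2 / 4 * \<sigma>2 T)))) \<le> err T"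
    using L u1 ratio eventually_sieve_level_pos eventually_gt_at_top[of 1]
  proof eventually_elim
    case (elim T)
    define P where "P = primes_upto (prime_cutoff T)"
    define X where "X = prime_cutoff T"
    have X: "X \<ge> 1" unfolding X_def using prime_cutoff_ge_1 elim by simp
    have p: "prime p" "real p \<le> X" "real p \<ge> 1" if "p \<in> P" for p
      using that prime_ge_1_nat by (auto simp: P_def X_def primes_upto_def)
    have c1: "c p \<le> 1" "c p \<ge> 0" if "p \<in> P" for p
      using powr_mono[of "-1/2" 0 "real p"] p(3)[OF that] by (auto simp: c_def)
    have c2: "(\<Sum>p\<in>P. (c p)\<^sup>2) = \<sigma>2 T"
      unfolding \<sigma>2_def prime_recip_sum_def P_def[symmetric] c_def
      by (intro sum.cong refl powr_minus_half_square) (use p(3) in fastforce)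
    have c3: "(\<Sum>p\<in>P. \<bar>c p\<bar> ^ 3) \<le> K"
    proof -
      have "\<bar>c p\<bar> ^ 3 = real p powr (-3/2)" if "p \<in> P" for p
        using p(3)[OF that] by (simp add: c_def powr_powr flip: powr_realpow)
      then show ?thesis using K[of P] by (simp add: P_def)
    qed
    have "char (distr (unif T (2*T)) borel (normalized_prime_poly T)) l =
        char (distr (unif T (2*T)) borel (\<lambda>t. cosine_sum P c (\<lambda>p. ln (real p) * t))) (u T)"
      unfolding char_def by (subst (1 2) integral_distr)
        (auto simp: measurable_cong_sets[OF sets_unif refl] normalized_prime_poly_def Re_prime_poly u_def P_def c_def)
    moreover have "norm (char (distr (unif T (2*T)) borel (\<lambda>t. cosine_sum P c (\<lambda>p. ln (real p) * t))) (u T) - char (distr (torus P) borel (cosine_sum P c)) (u T))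
      \<le> 6 * exp \<bar>u T\<bar> * X ^ (4 * sieve_level T) / (2*T - T) + 8 * (1/4) ^ sieve_level T * exp (2 * (u T)\<^sup>2 * (\<Sum>p\<in>P. (c p)\<^sup>2))"
      by (rule char_comparison[OF _ _ p(1,2) X]) (use elim sum_powr_half_le[OF X] in \<open>auto simp: P_def c_def X_def\<close>)
    moreover have "\<dots> \<le> 6 * exp 1 * (T powr (1/100)) ^ 4 / T + 8 * ((1/4) powr ((ln (ln T))\<^sup>2) * exp (8 * l\<^sup>2))"
    proof (rule add_mono)
      have "X ^ (4 * sieve_level T) = (T powr (1/100)) ^ 4"
        using prime_cutoff_power[of T] elim by (simp add: X_def mult.commute[of 4] power_mult)
      then show "6 * exp \<bar>u T\<bar> * X ^ (4 * sieve_level T) / (2*T - T) \<le> 6 * exp 1 * (T powr (1/100)) ^ 4 / T"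
        using elim by (auto intro!: divide_right_mono mult_right_mono)
      have "(1/4::real) ^ sieve_level T = (1/4) powr real (sieve_level T)" by (simp add: powr_realpow)
      also have "\<dots> \<le> (1/4) powr ((ln (ln T))\<^sup>2)" using sieve_level_ge[of T] by (intro powr_mono') auto
      finally have 1: "(1/4::real) ^ sieve_level T \<le> (1/4) powr ((ln (ln T))\<^sup>2)" .
      \<comment> \<open>The origin of 8 l^2: here u^2 = 2 l^2 / L, and the sum of 1/p is eventually
        below 2L.\<close>
      have "(u T)\<^sup>2 = 2 * l\<^sup>2 / ln (ln T)" using elim(1) by (simp add: u_def power_divide)
      then have "2 * (u T)\<^sup>2 * \<sigma>2 T = 4 * l\<^sup>2 * (\<sigma>2 T / ln (ln T))" by simp
      also have "\<dots> \<le> 4 * l\<^sup>2 * 2" using elim(3) by (intro mult_left_mono) auto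
      finally have 2: "exp (2 * (u T)\<^sup>2 * (\<Sum>p\<in>P. (c p)\<^sup>2)) \<le> exp (8 * l\<^sup>2)" by (simp add: c2)
      show "8 * (1/4) ^ sieve_level T * exp (2 * (u T)\<^sup>2 * (\<Sum>p\<in>P. (c p)\<^sup>2)) \<le> 8 * ((1/4) powr ((ln (ln T))\<^sup>2) * exp (8 * l\<^sup>2))"
        using mult_mono[OF 1 2] by simp
    qed
    moreover have "norm (char (distr (torus P) borel (cosine_sum P c)) (u T) - of_real (exp (- ((u T)\<^sup>2 / 4 * \<sigma>2 T)))) \<le> \<bar>u T\<bar> ^ 3 * K"
    proof -
      have "\<bar>u T * c p\<bar> \<le> 1" if "p \<in> P" for p
        using elim(2) c1[OF that] mult_mono[of "\<bar>u T\<bar>" 1 "c p" 1] by (simp add: abs_mult)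
      then have "norm (char (distr (torus P) borel (cosine_sum P c)) (u T) - of_real (exp (- ((u T)\<^sup>2 / 4 * \<sigma>2 T)))) \<le>
          \<bar>u T\<bar> ^ 3 * (\<Sum>p\<in>P. \<bar>c p\<bar> ^ 3)"
        unfolding c2[symmetric] by (intro char_cosine_sum) (auto simp: P_def)
      also have "\<dots> \<le> \<bar>u T\<bar> ^ 3 * K" using c3 by (intro mult_left_mono) auto
      finally show ?thesis .
    qed
    moreover have "norm (a - z) \<le> e' + e''" if "a = b" "norm (b - m) \<le> e" "e \<le> e'" "norm (m - z) \<le> e''" for a b m z :: complex and e e' e''
      using that norm_triangle_ineq[of "b - m" "m - z"] by simp
    ultimately show ?case unfolding err_def by blast
  qed
  moreover have "(err \<longlongrightarrow> 0) at_top"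
  proof -
    have "((\<lambda>T. 6 * exp 1 * (T powr (1/100)) ^ 4 / T) \<longlongrightarrow> (0::real)) at_top" by real_asymp
    moreover have "((\<lambda>L. 8 * ((1/4) powr (L\<^sup>2) * exp (8 * l\<^sup>2))) \<longlongrightarrow> (0::real)) at_top" by real_asymp
    from filterlim_compose[OF this lnln_at_top]
    have "((\<lambda>T. 8 * ((1/4) powr ((ln (ln T))\<^sup>2) * exp (8 * l\<^sup>2))) \<longlongrightarrow> (0::real)) at_top" .
    moreover have "((\<lambda>T. \<bar>u T\<bar> ^ 3 * K) \<longlongrightarrow> \<bar>0\<bar> ^ 3 * K) at_top" by (intro tendsto_intros u0)
    then have "((\<lambda>T. \<bar>u T\<bar> ^ 3 * K) \<longlongrightarrow> 0) at_top" by simp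
    ultimately show ?thesis unfolding err_def by (auto intro!: tendsto_add_zero)
  qed
  ultimately have lim: "((\<lambda>T. char (distr (unif T (2*T)) borel (normalized_prime_poly T)) l - of_real (exp (- ((u T)\<^sup>2 / 4 * \<sigma>2 T)))) \<longlongrightarrow> 0) at_top"
    by (rule Lim_null_comparison)
  have "((\<lambda>T. complex_of_real (exp (- ((u T)\<^sup>2 / 4 * \<sigma>2 T)))) \<longlongrightarrow> of_real (exp (- (l\<^sup>2) / 2))) at_top"
  proof -
    have "((\<lambda>T. exp (- (l\<^sup>2 / 2 * (\<sigma>2 T / ln (ln T))))) \<longlongrightarrow> exp (- (l\<^sup>2 / 2 * 1))) at_top"
      unfolding \<sigma>2_def by (intro tendsto_intros prime_recip_sum_ratio)
    moreover have "\<forall>\<^sub>F T in at_top. exp (- (l\<^sup>2 / 2 * (\<sigma>2 T / ln (ln T)))) = exp (- ((u T)\<^sup>2 / 4 * \<sigma>2 T))"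
      using L by eventually_elim (simp add: u_def power_divide)
    ultimately have "((\<lambda>T. exp (- ((u T)\<^sup>2 / 4 * \<sigma>2 T))) \<longlongrightarrow> exp (- (l\<^sup>2 / 2 * 1))) at_top"
      by (rule Lim_transform_eventually)
    then show ?thesis by (intro tendsto_of_real) simp
  qed
  from tendsto_add[OF lim this] show ?thesis by simp
qed

section \<open>Distribution of the logarithm of zeta\<close>

lemma std_normal_measure:
  "A \<in> sets borel \<Longrightarrow> measure std_normal_distribution A = (LBINT x:A. std_normal_density x)"
proof -
  assume A: "A \<in> sets borel"
  interpret real_distribution std_normal_distribution by (rule real_dist_normal_dist)
  have "measure std_normal_distribution A = (LINT x|std_normal_distribution. indicator A x)" using A by simp
  also have "\<dots> = (LINT x|lborel. std_normal_density x *\<^sub>R indicator A x)"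
    using A by (subst integral_density) auto
  also have "\<dots> = (LBINT x:A. std_normal_density x)"
    unfolding set_lebesgue_integral_def by (intro Bochner_Integration.integral_cong) auto
  finally show ?thesis .
qed

lemma isCont_cdf_std_normal: "isCont (cdf std_normal_distribution) x"
proof -
  interpret real_distribution std_normal_distribution by (rule real_dist_normal_dist)
  have "emeasure std_normal_distribution {x} = 0"
    by (subst emeasure_density) (auto simp: nn_integral_0_iff_AE intro!: AE_I[of _ _ "{x}"] split: split_indicator)
  then show ?thesis by (simp add: isCont_cdf measure_def)
qed

text \<open>Positivity reduces the asymptotic equivalence to convergence to a nonzero constant. The
  closed half-line and the complement of {..V} differ by a point of measure 0.\<close>

lemma std_normal_tail_pos: "1 / sqrt (2 * pi) * (LBINT u:{V..}. exp (- (u ^ 2) / 2)) > 0"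
  and cdf_std_normal: "1 - cdf std_normal_distribution V = 1 / sqrt (2 * pi) * (LBINT u:{V..}. exp (- (u ^ 2) / 2))"
proof -
  interpret real_distribution std_normal_distribution by (rule real_dist_normal_dist)
  have tail: "measure std_normal_distribution {V..} = 1 / sqrt (2 * pi) * (LBINT u:{V..}. exp (- (u ^ 2) / 2))"
    by (rule trans[OF std_normal_measure[OF atLeast_borel]]) (simp only: std_normal_density_def set_integral_mult_right)
  have "emeasure std_normal_distribution {V} = 0"
    by (subst emeasure_density) (auto simp: nn_integral_0_iff_AE intro!: AE_I[of _ _ "{V}"] split: split_indicator)
  then have 0: "measure std_normal_distribution {V} = 0" by (simp add: measure_def)
  have "{V..} = {V} \<union> (space std_normal_distribution - {..V})" by auto
  then have "measure std_normal_distribution {V..} \<le> measure std_normal_distribution {V} + measure std_normal_distribution (space std_normal_distribution - {..V})"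
    using measure_Un_le[of "{V}" std_normal_distribution "space std_normal_distribution - {..V}"] by auto
  moreover have "measure std_normal_distribution (space std_normal_distribution - {..V}) \<le> measure std_normal_distribution {V..}"
    by (intro finite_measure_mono) auto
  moreover have "measure std_normal_distribution (space std_normal_distribution - {..V}) = 1 - cdf std_normal_distribution V"
    unfolding cdf_def by (rule prob_compl) auto
  ultimately show "1 - cdf std_normal_distribution V = 1 / sqrt (2 * pi) * (LBINT u:{V..}. exp (- (u ^ 2) / 2))"
    using 0 tail by linarith
  have "measure std_normal_distribution {V..} \<noteq> 0"
  proof
    assume "measure std_normal_distribution {V..} = 0"
    then have "emeasure std_normal_distribution {V..} = 0" by (simp add: emeasure_eq_measure)
    then have "AE x in lborel. ennreal (std_normal_density x) * indicator {V..} x = 0"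
      by (subst (asm) emeasure_density) (auto simp: nn_integral_0_iff_AE)
    then have "AE x in lborel. x \<notin> {V..}"
      by eventually_elim (auto simp: std_normal_density_def split: split_indicator_asm)
    then have "emeasure lborel {V..} = 0" by (subst (asm) AE_iff_measurable[OF _ refl]) (auto simp: atLeast_def)
    moreover have "emeasure lborel {V..V+1} \<le> emeasure lborel {V..}" by (intro emeasure_mono) auto
    ultimately show False by simp
  qed
  then show "1 / sqrt (2 * pi) * (LBINT u:{V..}. exp (- (u ^ 2) / 2)) > 0"
    unfolding tail[symmetric] by (simp add: zero_less_measure_iff)
qed

text \<open>Levy's theorem concerns sequences of laws, so the limit is tested along an arbitrary
  sequence tending to infinity. Every point is a continuity point of the normal distribution
  function.\<close>

theorem normalized_prime_poly_limit:
  "((\<lambda>T. measure (unif T (2*T)) {t. normalized_prime_poly T t \<le> x}) \<longlongrightarrow> cdf std_normal_distribution x) at_top"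
proof (rule tendsto_at_topI_sequentially)
  fix X :: "nat \<Rightarrow> real" assume X: "filterlim X at_top sequentially"
  \<comment> \<open>Keeping S n at least 1 makes [S n, 2 S n] nondegenerate, so that every member of
    the sequence is a probability law; eventually S and X agree.\<close>
  define S where "S n = max 1 (X n)" for n
  have ev: "\<forall>\<^sub>F n in sequentially. S n = X n"
    using X by (auto simp: filterlim_at_top S_def max_def elim!: allE[of _ 1] eventually_mono)
  have S: "filterlim S at_top sequentially"
    using filterlim_cong[OF refl refl ev] X by simp
  have S2: "S n < 2 * S n" for n
  proof -
    have "S n \<ge> 1" by (simp add: S_def)
    then show ?thesis by simp
  qed
  define M where "M n = distr (unif (S n) (2 * S n)) borel (normalized_prime_poly (S n))" for n
  have meas: "normalized_prime_poly T \<in> borel_measurable (unif (S n) (2 * S n))" for T n by measurable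
  have M: "real_distribution (M n)" for n
    unfolding M_def using meas by (rule prob_space.real_distribution_distr[OF prob_space_unif[OF S2]])
  have "weak_conv_m M std_normal_distribution"
  proof (rule levy_continuity[OF M real_dist_normal_dist])
    fix t
    show "(\<lambda>n. char (M n) t) \<longlonglongrightarrow> char std_normal_distribution t"
      unfolding M_def char_std_normal_distribution
      using filterlim_compose[OF char_normalized_prime_poly S] by simp
  qed
  then have "(\<lambda>n. cdf (M n) x) \<longlonglongrightarrow> cdf std_normal_distribution x"
    unfolding weak_conv_m_def weak_conv_def using isCont_cdf_std_normal by blast
  moreover have "cdf (M n) x = measure (unif (S n) (2 * S n)) {t. normalized_prime_poly (S n) t \<le> x}" for n
    unfolding cdf_def M_def by (subst measure_distr[OF meas]) (auto simp: vimage_def)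
  ultimately have "(\<lambda>n. measure (unif (S n) (2 * S n)) {t. normalized_prime_poly (S n) t \<le> x}) \<longlonglongrightarrow> cdf std_normal_distribution x"
    by simp
  then show "(\<lambda>n. measure (unif (X n) (2 * X n)) {t. normalized_prime_poly (X n) t \<le> x}) \<longlonglongrightarrow> cdf std_normal_distribution x"
    by (rule Lim_transform_eventually) (use ev in eventually_elim, simp)
qed

section \<open>Transfer from the prime polynomial to the logarithm of zeta\<close>

text \<open>Zeros of zeta are declared exceptional explicitly, since the convention ln 0 = 0 could
  otherwise let them pass.\<close>

definition exceptional :: "real \<Rightarrow> real \<Rightarrow> real set" where
  "exceptional \<delta> T = {t. \<not> (zeta (1/2 + \<i> * of_real t) \<noteq> 0 \<and>
     \<bar>ln (norm (zeta (1/2 + \<i> * of_real t))) / sqrt (1/2 * ln (ln T)) - normalized_prime_poly T t\<bar> \<le> \<delta>)}"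

lemma zeta_line_measurable [measurable]: "(\<lambda>t. zeta (1/2 + \<i> * of_real t)) \<in> borel_measurable borel"
  by (intro borel_measurable_continuous_onI continuous_zeta_line)

lemma exceptional_sets: "exceptional \<delta> T \<in> sets borel"
  unfolding exceptional_def by measurable

text \<open>ln |zeta| = ln |zeta M| - ln |M|: the first term is small by
  \<open>mollified_zeta_concentration\<close>, and \<open>mollifier_prime_poly\<close> identifies
  -ln |M| with the prime polynomial.\<close>

theorem exceptional_measure:
  assumes d: "\<delta> > 0"
  shows "((\<lambda>T. measure (unif T (2*T)) (exceptional \<delta> T)) \<longlongrightarrow> 0) at_top"
proof -
  \<comment> \<open>Two errors of e sqrt L must add up to \<delta> sqrt(L/2), the tolerance before
    normalisation.\<close>
  define e where "e = \<delta> / (2 * sqrt 2)"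
  have e: "e > 0" using d by (simp add: e_def)
  define Q where "Q T t = norm (zeta (1/2 + \<i> * of_real t) * mollifier_at T t)" for T t
  define B1 where "B1 T = {t. Q T t < exp (- e * sqrt (ln (ln T)))}" for T
  define B2 where "B2 T = {t. Q T t > exp (e * sqrt (ln (ln T)))}" for T
  define B3 where "B3 T = {t. \<not> (mollifier_at T t \<noteq> 0 \<and>
      \<bar>ln (norm (mollifier_at T t)) + Re (prime_poly_at T t)\<bar> \<le> e * sqrt (ln (ln T)))}" for T
  have L: "\<forall>\<^sub>F T::real in at_top. ln (ln T) > 0" by real_asymp
  have sets: "\<forall>\<^sub>F T in at_top. B1 T \<in> sets borel \<and> B2 T \<in> sets borel \<and> B3 T \<in> sets borel"
    using eventually_sieve_level_pos eventually_gt_at_top[of 1]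
  proof eventually_elim
    case (elim T)
    interpret sieve "small_primes T" "sieve_level T" "T powr (1/100)"
      by (rule sieve_small_primes) (use elim in auto)
    have [measurable]: "mollifier_at T \<in> borel_measurable borel"
      by (intro borel_measurable_continuous_onI continuous_on_compose2[OF holomorphic_on_imp_continuous_on[OF mollifier_holomorphic]])
         (auto intro!: continuous_intros)
    show ?case unfolding B1_def B2_def B3_def Q_def by measurable
  qed
  have lim: "((\<lambda>T. measure (unif T (2*T)) (B1 T) + measure (unif T (2*T)) (B2 T) + measure (unif T (2*T)) (B3 T)) \<longlongrightarrow> 0 + 0 + 0) at_top"
  proof (intro tendsto_add)
    show "((\<lambda>T. measure (unif T (2*T)) (B3 T)) \<longlongrightarrow> 0) at_top"
      unfolding B3_def by (rule mollifier_prime_poly[OF e])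
    have eq: "\<forall>\<^sub>F T in at_top. measure lborel {t \<in> {T..2*T}. t \<in> B T} / T = measure (unif T (2*T)) (B T)"
      if "\<forall>\<^sub>F T in at_top. B T \<in> sets borel" for B
      using that eventually_gt_at_top[of 0] by eventually_elim (simp add: measure_unif Int_def)
    show "((\<lambda>T. measure (unif T (2*T)) (B1 T)) \<longlongrightarrow> 0) at_top"
    proof (rule Lim_transform_eventually[OF _ eq])
      show "((\<lambda>T. measure lborel {t \<in> {T..2*T}. t \<in> B1 T} / T) \<longlongrightarrow> 0) at_top"
        using mollified_zeta_concentration(1)[OF e] by (simp add: B1_def Q_def)
      show "\<forall>\<^sub>F T in at_top. B1 T \<in> sets borel" using sets by eventually_elim simp
    qed
    show "((\<lambda>T. measure (unif T (2*T)) (B2 T)) \<longlongrightarrow> 0) at_top"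
    proof (rule Lim_transform_eventually[OF _ eq])
      show "((\<lambda>T. measure lborel {t \<in> {T..2*T}. t \<in> B2 T} / T) \<longlongrightarrow> 0) at_top"
        using mollified_zeta_concentration(2)[OF e] by (simp add: B2_def Q_def)
      show "\<forall>\<^sub>F T in at_top. B2 T \<in> sets borel" using sets by eventually_elim simp
    qed
  qed
  have le: "\<forall>\<^sub>F T in at_top. measure (unif T (2*T)) (exceptional \<delta> T) \<le>
      measure (unif T (2*T)) (B1 T) + measure (unif T (2*T)) (B2 T) + measure (unif T (2*T)) (B3 T)"
    using sets L eventually_gt_at_top[of 0]
  proof eventually_elim
    case (elim T)
    interpret prob_space "unif T (2*T)" by (rule prob_space_unif) (use elim in simp)
    define s where "s = sqrt (1/2 * ln (ln T))"
    have s: "s > 0" "2 * (e * sqrt (ln (ln T))) = \<delta> * s"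
      using elim by (auto simp: s_def e_def real_sqrt_divide)
    have "exceptional \<delta> T \<subseteq> B1 T \<union> B2 T \<union> B3 T"
    proof
      fix t assume t: "t \<in> exceptional \<delta> T"
      show "t \<in> B1 T \<union> B2 T \<union> B3 T"
      proof (rule ccontr)
        assume n: "t \<notin> B1 T \<union> B2 T \<union> B3 T"
        define z m w where "z = zeta (1/2 + \<i> * of_real t)" and "m = mollifier_at T t" and "w = Re (prime_poly_at T t)"
        have Q: "exp (- e * sqrt (ln (ln T))) \<le> norm z * norm m" "norm z * norm m \<le> exp (e * sqrt (ln (ln T)))"
          using n by (auto simp: B1_def B2_def Q_def z_def m_def norm_mult)
        have m: "m \<noteq> 0" "\<bar>ln (norm m) + w\<bar> \<le> e * sqrt (ln (ln T))"
          using n by (auto simp: B3_def m_def w_def)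
        have pos: "norm z * norm m > 0" by (rule less_le_trans[OF _ Q(1)]) simp
        then have z: "z \<noteq> 0" by auto
        have "ln (norm z * norm m) \<le> e * sqrt (ln (ln T))" using ln_mono[OF Q(2) pos] by simp
        moreover have "- e * sqrt (ln (ln T)) \<le> ln (norm z * norm m)" using Q(1) pos by (simp add: ln_ge_iff)
        moreover have "ln (norm z * norm m) = ln (norm z) + ln (norm m)" using z m(1) by (simp add: ln_mult)
        ultimately have "\<bar>ln (norm z) - w\<bar> \<le> \<delta> * s" using m(2) s(2) by linarith
        then have "\<bar>ln (norm z) / s - w / s\<bar> \<le> \<delta>"
          using s(1) by (simp add: abs_divide pos_divide_le_eq flip: diff_divide_distrib)
        then show False using t z by (simp add: exceptional_def normalized_prime_poly_def z_def w_def s_def)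
      qed
    qed
    then have "measure (unif T (2*T)) (exceptional \<delta> T) \<le> measure (unif T (2*T)) (B1 T \<union> B2 T \<union> B3 T)"
      using elim by (intro finite_measure_mono) auto
    also have "\<dots> \<le> measure (unif T (2*T)) (B1 T \<union> B2 T) + measure (unif T (2*T)) (B3 T)"
      using elim by (intro measure_Un_le) auto
    also have "measure (unif T (2*T)) (B1 T \<union> B2 T) \<le> measure (unif T (2*T)) (B1 T) + measure (unif T (2*T)) (B2 T)"
      using elim by (intro measure_Un_le) auto
    finally show ?case by simp
  qed
  show ?thesis
    by (rule tendsto_sandwich[OF _ le tendsto_const]) (use lim in auto)
qed

text \<open>Up to the exceptional set the event lies between those of the normalised polynomial
  exceeding V + \<delta> and V - \<delta>. The error is shared in thirds between convergence at
  these two points, continuity of the normal distribution function at V, and the exceptional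
  set.\<close>

theorem log_zeta_limit:
  "((\<lambda>T. measure (unif T (2*T)) {t. zeta (1/2 + \<i> * of_real t) \<noteq> 0 \<and> ln (norm (zeta (1/2 + \<i> * of_real t))) \<ge> V * sqrt (1/2 * ln (ln T))})
     \<longlongrightarrow> 1 - cdf std_normal_distribution V) at_top"
proof (rule tendstoI)
  fix \<epsilon> :: real assume eps: "\<epsilon> > 0"
  define \<Phi> where "\<Phi> = cdf std_normal_distribution"
  define Y where "Y = normalized_prime_poly"
  define G where "G T = {t. zeta (1/2 + \<i> * of_real t) \<noteq> 0 \<and> ln (norm (zeta (1/2 + \<i> * of_real t))) \<ge> V * sqrt (1/2 * ln (ln T))}" for T
  obtain \<delta> where d: "\<delta> > 0" "\<And>x. \<bar>x - V\<bar> \<le> \<delta> \<Longrightarrow> \<bar>\<Phi> x - \<Phi> V\<bar> < \<epsilon> / 3"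
  proof -
    have "\<epsilon> / 3 > 0" using eps by simp
    then obtain d where "d > 0" "\<And>x. \<bar>x - V\<bar> < d \<Longrightarrow> \<bar>\<Phi> x - \<Phi> V\<bar> < \<epsilon> / 3"
      using isCont_cdf_std_normal[of V] unfolding continuous_at_eps_delta \<Phi>_def[symmetric] dist_real_def by metis
    then show ?thesis using that[of "d / 2"] by auto
  qed
  have lim: "\<forall>\<^sub>F T in at_top. \<bar>measure (unif T (2*T)) {t. Y T t \<le> x} - \<Phi> x\<bar> < \<epsilon> / 3" for x
    using tendstoD[OF normalized_prime_poly_limit[of x], of "\<epsilon> / 3"] eps by (simp add: \<Phi>_def Y_def dist_real_def)
  \<comment> \<open>Half of \<delta> leaves room for the strict inequality at V - \<delta>.\<close>
  have bad: "\<forall>\<^sub>F T in at_top. measure (unif T (2*T)) (exceptional (\<delta>/2) T) < \<epsilon> / 3"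
    using order_tendstoD(2)[OF exceptional_measure[of "\<delta>/2"], of "\<epsilon> / 3"] d eps by simp
  have L: "\<forall>\<^sub>F T::real in at_top. ln (ln T) > 0" by real_asymp
  show "\<forall>\<^sub>F T in at_top. dist (measure (unif T (2*T)) {t. zeta (1/2 + \<i> * of_real t) \<noteq> 0 \<and> ln (norm (zeta (1/2 + \<i> * of_real t))) \<ge> V * sqrt (1/2 * ln (ln T))})
     (1 - cdf std_normal_distribution V) < \<epsilon>"
    using lim[of "V + \<delta>"] lim[of "V - \<delta>"] bad L eventually_gt_at_top[of 0]
  proof eventually_elim
    case (elim T)
    interpret prob_space "unif T (2*T)" by (rule prob_space_unif) (use elim in simp)
    define m where "m A = measure (unif T (2*T)) A" for A
    define E where "E = exceptional (\<delta>/2) T"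
    have sq: "sqrt (1/2 * ln (ln T)) > 0" using elim by simp
    have key: "zeta (1/2 + \<i> * of_real t) \<noteq> 0" "\<bar>ln (norm (zeta (1/2 + \<i> * of_real t))) / sqrt (1/2 * ln (ln T)) - Y T t\<bar> \<le> \<delta>/2"
      if "t \<notin> E" for t using that by (auto simp: E_def exceptional_def Y_def)
    have iff: "ln (norm (zeta (1/2 + \<i> * of_real t))) \<ge> V * sqrt (1/2 * ln (ln T)) \<longleftrightarrow>
       V \<le> ln (norm (zeta (1/2 + \<i> * of_real t))) / sqrt (1/2 * ln (ln T))" for t
      using sq by (simp only: pos_le_divide_eq)
    have up: "G T \<subseteq> {t. \<not> Y T t \<le> V - \<delta>} \<union> E"
    proof
      fix t assume t: "t \<in> G T"
      show "t \<in> {t. \<not> Y T t \<le> V - \<delta>} \<union> E"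
      proof (cases "t \<in> E")
        case False
        have "V \<le> ln (norm (zeta (1/2 + \<i> * of_real t))) / sqrt (1/2 * ln (ln T))"
          using t iff[of t] by (simp only: G_def mem_Collect_eq)
        then have "\<not> Y T t \<le> V - \<delta>" using key(2)[OF False] d(1) by linarith
        then show ?thesis by simp
      qed simp
    qed
    have low: "{t. \<not> Y T t \<le> V + \<delta>} \<subseteq> G T \<union> E"
    proof
      fix t assume t: "t \<in> {t. \<not> Y T t \<le> V + \<delta>}"
      show "t \<in> G T \<union> E"
      proof (cases "t \<in> E")
        case False
        have "V \<le> ln (norm (zeta (1/2 + \<i> * of_real t))) / sqrt (1/2 * ln (ln T))"
          using key(2)[OF False] t d(1) unfolding mem_Collect_eq by linarith
        then show ?thesis using key(1)[OF False] iff[of t] by (simp only: G_def mem_Collect_eq Un_iff simp_thms)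
      qed simp
    qed
    have sets: "E \<in> events" "G T \<in> events" "{t. Y T t \<le> x} \<in> events" "{t. \<not> Y T t \<le> x} \<in> events" for x
      unfolding sets_unif E_def G_def Y_def by (rule exceptional_sets) measurable
    have compl: "m {t. \<not> Y T t \<le> x} = 1 - m {t. Y T t \<le> x}" for x
      using prob_compl[OF sets(3)[of x]] unfolding m_def by (simp add: set_diff_eq)
    have "m (G T) \<le> m ({t. \<not> Y T t \<le> V - \<delta>} \<union> E)"
      unfolding m_def using sets by (intro finite_measure_mono up) auto
    also have "\<dots> \<le> m {t. \<not> Y T t \<le> V - \<delta>} + m E" unfolding m_def using sets by (intro measure_Un_le)
    finally have 1: "m (G T) \<le> 1 - m {t. Y T t \<le> V - \<delta>} + m E" by (simp add: compl)
    have "m {t. \<not> Y T t \<le> V + \<delta>} \<le> m (G T \<union> E)"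
      unfolding m_def using sets by (intro finite_measure_mono low) auto
    also have "\<dots> \<le> m (G T) + m E" unfolding m_def using sets by (intro measure_Un_le)
    finally have 2: "1 - m {t. Y T t \<le> V + \<delta>} \<le> m (G T) + m E" by (simp add: compl)
    have "\<bar>\<Phi> (V + \<delta>) - \<Phi> V\<bar> < \<epsilon> / 3" "\<bar>\<Phi> (V - \<delta>) - \<Phi> V\<bar> < \<epsilon> / 3" using d by auto
    with 1 2 elim(1-3) have "\<bar>m (G T) - (1 - \<Phi> V)\<bar> < \<epsilon>"
      unfolding m_def[symmetric] E_def[symmetric] by linarith
    then show ?case by (simp add: m_def G_def \<Phi>_def dist_real_def)
  qed
qed

text \<open>The condition that zeta is nonzero expresses ln 0 = -infinity: with the default value ln
  0 = 0, zeros would count for large T whenever V \<le> 0.\<close>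

theorem theorem1:
  fixes V :: real
  shows "(\<lambda>T::real. 1 / T * measure lebesgue {t \<in> {T..2 * T}.
            zeta (1 / 2 + \<i> * of_real t) \<noteq> 0 \<and>
            ln (norm (zeta (1 / 2 + \<i> * of_real t))) \<ge> V * sqrt (1 / 2 * ln (ln T))})
         \<sim>[at_top] (\<lambda>_. 1 / sqrt (2 * pi) * (LBINT u:{V..}. exp (- (u ^ 2) / 2)))"
proof (rule tendsto_imp_asymp_equiv_const)
  show "1 / sqrt (2 * pi) * (LBINT u:{V..}. exp (- (u ^ 2) / 2)) \<noteq> 0"
    using std_normal_tail_pos[of V] by (rule less_imp_neq[THEN not_sym])
  define G where "G T = {t. zeta (1/2 + \<i> * of_real t) \<noteq> 0 \<and> ln (norm (zeta (1/2 + \<i> * of_real t))) \<ge> V * sqrt (1/2 * ln (ln T))}" for T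
  have G: "G T \<in> sets borel" for T unfolding G_def by measurable
  have "((\<lambda>T. measure (unif T (2*T)) (G T)) \<longlongrightarrow> 1 / sqrt (2 * pi) * (LBINT u:{V..}. exp (- (u ^ 2) / 2))) at_top"
    unfolding G_def cdf_std_normal[symmetric] by (rule log_zeta_limit)
  moreover have "\<forall>\<^sub>F T in at_top. measure (unif T (2*T)) (G T) = 1 / T * measure lebesgue {t \<in> {T..2 * T}.
            zeta (1 / 2 + \<i> * of_real t) \<noteq> 0 \<and>
            ln (norm (zeta (1 / 2 + \<i> * of_real t))) \<ge> V * sqrt (1 / 2 * ln (ln T))}"
    using eventually_gt_at_top[of 0]
  proof eventually_elim
    case (elim T)
    have eq: "{t \<in> {T..2 * T}. zeta (1 / 2 + \<i> * of_real t) \<noteq> 0 \<and>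
            ln (norm (zeta (1 / 2 + \<i> * of_real t))) \<ge> V * sqrt (1 / 2 * ln (ln T))} = {T..2*T} \<inter> G T"
      by (auto simp: G_def)
    have "measure lebesgue ({T..2*T} \<inter> G T) = measure lborel ({T..2*T} \<inter> G T)"
      using G[of T] by (intro measure_completion) auto
    then show ?case unfolding eq using elim G[of T] by (simp add: measure_unif)
  qed
  ultimately show "((\<lambda>T. 1 / T * measure lebesgue {t \<in> {T..2 * T}.
            zeta (1 / 2 + \<i> * of_real t) \<noteq> 0 \<and>
            ln (norm (zeta (1 / 2 + \<i> * of_real t))) \<ge> V * sqrt (1 / 2 * ln (ln T))}) \<longlongrightarrow>
      1 / sqrt (2 * pi) * (LBINT u:{V..}. exp (- (u ^ 2) / 2))) at_top"
    by (rule Lim_transform_eventually)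
qed

end
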